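(* With $\mathcal L_L$ the self-adjoint model operator on $[0,R]$ attached to a Lagrangian $L$ given by matrices $\mathcal A,\mathcal B$, and $F(\mu)=\det\begin{pmatrix}\mathcal A&\mathcal B\\ J_+(\mu)&J_-(\mu)\end{pmatrix}$, one has $$2x\,\mathrm{Tr}(\mathcal L_L+x^2)^{-1}=\frac{d}{dx}\log F(ix)$$ for all complex $x\in\mathbb C$ for which either (and hence both) sides make sense.
   Context: Model operator. Let $q_0,q_1\ge0$ be integers, $q=q_0+q_1$, $\lambda_{q_0+1}\le\dots\le\lambda_{q_0+q_1}$ real numbers in $(-\frac14,\frac34)$, $\nu_j=\sqrt{\lambda_{q_0+j}+\frac14}$, $R>0$, and $A=\mathrm{diag}(-\frac14,\dots,-\frac14,\lambda_{q_0+1},\dots,\lambda_{q_0+q_1})$ ($-\frac14$ repeated $q_0$ times). Let $\mathcal L=-\frac{d^2}{dr^2}+\frac1{r^2}A$ over $[0,R]$, with the Dirichlet condition at $r=R$. Its maximal domain $\mathfrak D_{\max}$ consists of the $\phi$ with $\phi(R)=0$ of the form $$\phi=\sum_{\ell=1}^{q_0}\{c_\ell r^{1/2}e_\ell+c_{q+\ell}r^{1/2}\log r\,e_\ell\}+\sum_{\ell=1}^{q_1}\tfrac1{\sqrt{2\nu_\ell}}\{c_{q_0+\ell}r^{\nu_\ell+1/2}e_{q_0+\ell}+c_{q+q_0+\ell}r^{-\nu_\ell+1/2}e_{q_0+\ell}\}+\widetilde\phi,$$ with $e_\ell$ the standard basis of $\mathbb C^q$, constants $c_j=c_j(\phi)$,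 $\widetilde\phi$ continuously differentiable on $[0,R]$, $\widetilde\phi=\mathcal O(r^{3/2})$, $\widetilde\phi'=\mathcal O(r^{1/2})$ near $r=0$, $\mathcal L\widetilde\phi\in L^2([0,R],\mathbb C^q)$. Put $\vec\phi=(c_1,\dots,c_{2q})^t$. Let $\mathcal A,\mathcal B$ be $q\times q$ matrices with $(\mathcal A\ \mathcal B)$ of rank $q$ and $\mathcal A'\mathcal B^*$ self-adjoint, $\mathcal A'$ being $\mathcal A$ with its first $q_0$ columns multiplied by $-1$; $L=\{\vec c\in\mathbb C^{2q}:(\mathcal A\ \mathcal B)\vec c=0\}$ is the corresponding Lagrangian. $\mathcal L_L$ is $\mathcal L$ with domain $\{\phi\in\mathfrak D_{\max}:(\mathcal A\ \mathcal B)\vec\phi=0\}$; it is self-adjoint on $L^2([0,R],\mathbb C^q)$. The matrices $J_\pm(\mu)$. Let $J_v$ and $Y_0$ be the Bessel functions of the first and second kind, $\gamma$ the Euler–Mascheroni constant, and $\widetilde J_0(\mu R):=\frac\pi2Y_0(\mu R)-(\log\mu-\log2+\gamma)J_0(\mu R)$. $J_+(\mu)$ is the $q\times q$ diagonal matrix with entries $J_0(\mu R)$ ($q_0$ times), then $2^{\nu_j}\Gamma(1+\nu_j)\mu^{-\nu_j}J_{\nu_j}(\mu R)$, $j=1,\dots,q_1$; $J_-(\mu)$ is the diagonal matrix with entries $\widetilde J_0(\mu R)$ ($q_0$ times), then $2^{-\nu_j}\Gamma(1-\nu_j)\mu^{\nu_j}J_{-\nu_j}(\mu R)$, $j=1,\dots,q_1$.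 All entries are even entire functions of $\mu$. *)

theory Defs
  imports
    "HOL-Complex_Analysis.Complex_Analysis"
    "Jordan_Normal_Form.Matrix"
    "Jordan_Normal_Form.Determinant"
    "Jordan_Normal_Form.Schur_Decomposition"
    "Jordan_Normal_Form.DL_Rank"
begin

unbundle no vec_syntax
hide_const (open) Finite_Cartesian_Product.vec Finite_Cartesian_Product.mat Determinants.det
  Finite_Cartesian_Product.row Finite_Cartesian_Product.column

section \<open>The Hilbert space of square-integrable functions from [0,R] to C^q\<close>

text \<open>
  A function from [0,R] to C^q is represented by its components, \<open>f j r\<close> being the j-th component
  (\<open>j < q\<close>, counted from 0) at the point r; other values of f are irrelevant.  Elements of the
  Hilbert space are such functions up to \<open>L2_eq\<close>, equality almost everywhere.
\<close>

type_synonym vfun = "nat \<Rightarrow> real \<Rightarrow> complex"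

definition L2 :: "nat \<Rightarrow> real \<Rightarrow> vfun set" where
  "L2 q R = {f. \<forall>j<q. f j \<in> borel_measurable (lebesgue_on {0..R}) \<and>
                      integrable (lebesgue_on {0..R}) (\<lambda>r. (cmod (f j r))\<^sup>2)}"

definition L2_eq :: "nat \<Rightarrow> real \<Rightarrow> vfun \<Rightarrow> vfun \<Rightarrow> bool" where
  "L2_eq q R f g \<longleftrightarrow> (\<forall>j<q. AE r in lebesgue_on {0..R}. f j r = g j r)"

definition L2_inner :: "nat \<Rightarrow> real \<Rightarrow> vfun \<Rightarrow> vfun \<Rightarrow> complex" where
  "L2_inner q R f g = (\<Sum>j<q. LINT r|lebesgue_on {0..R}. f j r * cnj (g j r))"

definition L2_norm :: "nat \<Rightarrow> real \<Rightarrow> vfun \<Rightarrow> real" where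
  "L2_norm q R f = sqrt (\<Sum>j<q. LINT r|lebesgue_on {0..R}. (cmod (f j r))\<^sup>2)"

text \<open>
  Linearity is only required up to almost-everywhere equality; together with the norm bound it
  implies that \<open>T\<close> respects \<open>L2_eq\<close>.
\<close>

definition bounded_op :: "nat \<Rightarrow> real \<Rightarrow> (vfun \<Rightarrow> vfun) \<Rightarrow> bool" where
  "bounded_op q R T \<longleftrightarrow>
     (\<forall>f\<in>L2 q R. T f \<in> L2 q R) \<and>
     (\<forall>f\<in>L2 q R. \<forall>g\<in>L2 q R. \<forall>a b.
        L2_eq q R (T (\<lambda>j r. a * f j r + b * g j r)) (\<lambda>j r. a * T f j r + b * T g j r)) \<and>
     (\<exists>C. \<forall>f\<in>L2 q R. L2_norm q R (T f) \<le> C * L2_norm q R f)"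

definition orthonormal_basis :: "nat \<Rightarrow> real \<Rightarrow> nat set \<Rightarrow> (nat \<Rightarrow> vfun) \<Rightarrow> bool" where
  "orthonormal_basis q R I e \<longleftrightarrow>
     (\<forall>n\<in>I. e n \<in> L2 q R) \<and>
     (\<forall>m\<in>I. \<forall>n\<in>I. L2_inner q R (e m) (e n) = (if m = n then 1 else 0)) \<and>
     (\<forall>f\<in>L2 q R. (\<forall>n\<in>I. L2_inner q R f (e n) = 0) \<longrightarrow> L2_eq q R f (\<lambda>_ _. 0))"

text \<open>
  \<open>P = |T|\<close>: P is positive and \<open>P\<^sup>2 = T\<^sup>*T\<close>.  On a complex Hilbert space positivity includes
  self-adjointness.
\<close>

definition is_abs_op :: "nat \<Rightarrow> real \<Rightarrow> (vfun \<Rightarrow> vfun) \<Rightarrow> (vfun \<Rightarrow> vfun) \<Rightarrow> bool" where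
  "is_abs_op q R T P \<longleftrightarrow>
     bounded_op q R P \<and>
     (\<forall>f\<in>L2 q R. L2_inner q R (P f) f \<in> \<real>\<^sub>\<ge>\<^sub>0) \<and>
     (\<forall>f\<in>L2 q R. \<forall>g\<in>L2 q R. L2_inner q R (P f) (P g) = L2_inner q R (T f) (T g))"

definition trace_class :: "nat \<Rightarrow> real \<Rightarrow> (vfun \<Rightarrow> vfun) \<Rightarrow> bool" where
  "trace_class q R T \<longleftrightarrow>
     bounded_op q R T \<and>
     (\<exists>P. is_abs_op q R T P \<and>
       (\<forall>I e. orthonormal_basis q R I e \<longrightarrow> (\<lambda>n. L2_inner q R (P (e n)) (e n)) summable_on I))"

definition op_trace :: "nat \<Rightarrow> real \<Rightarrow> (vfun \<Rightarrow> vfun) \<Rightarrow> complex" where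
  "op_trace q R T =
     (THE t. \<forall>I e. orthonormal_basis q R I e \<longrightarrow>
        ((\<lambda>n. L2_inner q R (T (e n)) (e n)) has_sum t) I)"

text \<open>
  \<open>G\<close> is the graph of an (unbounded) operator S, and \<open>T = (S + w)\<^sup>-\<^sup>1\<close>, everywhere defined and bounded:
  \<open>u = T f\<close> if and only if u is in the domain of S and \<open>S u = f - w u\<close>.
\<close>

definition is_shifted_inverse ::
    "nat \<Rightarrow> real \<Rightarrow> (vfun \<times> vfun) set \<Rightarrow> complex \<Rightarrow> (vfun \<Rightarrow> vfun) \<Rightarrow> bool" where
  "is_shifted_inverse q R G w T \<longleftrightarrow>
     bounded_op q R T \<and>
     (\<forall>f\<in>L2 q R. \<forall>u\<in>L2 q R. L2_eq q R u (T f) \<longleftrightarrow> (u, \<lambda>j r. f j r - w * u j r) \<in> G)"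

section \<open>The model operator\<close>

text \<open>
  All indices are counted from 0: the components \<open>j < q0\<close> carry the entries -1/4 of the diagonal
  matrix A, and for \<open>q0 \<le> j < q0 + q1\<close> the entry is \<open>lam j\<close>.
\<close>

definition diag_entry :: "nat \<Rightarrow> (nat \<Rightarrow> real) \<Rightarrow> nat \<Rightarrow> real" where
  "diag_entry q0 lam j = (if j < q0 then - 1/4 else lam j)"

definition nu :: "(nat \<Rightarrow> real) \<Rightarrow> nat \<Rightarrow> real" where
  "nu lam j = sqrt (lam j + 1/4)"

text \<open>
  \<open>h\<close> is the second derivative of \<open>u\<close> on (0,R), where the first derivative is only required to be
  locally absolutely continuous.
\<close>

definition has_second_derivative :: "real \<Rightarrow> (real \<Rightarrow> complex) \<Rightarrow> (real \<Rightarrow> complex) \<Rightarrow> bool" where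
  "has_second_derivative R u h \<longleftrightarrow>
     (\<exists>u'. (\<forall>r\<in>{0<..<R}. (u has_vector_derivative u' r) (at r)) \<and>
           (\<forall>a b. 0 < a \<and> a \<le> b \<and> b < R \<longrightarrow>
              integrable (lebesgue_on {a..b}) h \<and> u' b - u' a = (LINT s|lebesgue_on {a..b}. h s)))"

text \<open>\<open>g = -\<phi>'' + A \<phi> / r\<^sup>2\<close>\<close>

definition model_expr :: "nat \<Rightarrow> nat \<Rightarrow> (nat \<Rightarrow> real) \<Rightarrow> real \<Rightarrow> vfun \<Rightarrow> vfun \<Rightarrow> bool" where
  "model_expr q0 q1 lam R \<phi> g \<longleftrightarrow>
     (\<forall>j<q0+q1. \<exists>h. has_second_derivative R (\<phi> j) h \<and>
        (AE r in lebesgue_on {0..R}.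
           g j r = - h r + complex_of_real (diag_entry q0 lam j / r\<^sup>2) * \<phi> j r))"

text \<open>
  \<open>\<phi>\<close> lies in the maximal domain and has coefficient vector \<open>c = (c_1, ..., c_{2q})\<close>.  The value of
  \<open>\<phi>\<close> at r = 0, where the singular terms are undefined, is irrelevant.
\<close>

definition max_domain_coeffs ::
    "nat \<Rightarrow> nat \<Rightarrow> (nat \<Rightarrow> real) \<Rightarrow> real \<Rightarrow> vfun \<Rightarrow> complex vec \<Rightarrow> bool" where
  "max_domain_coeffs q0 q1 lam R \<phi> c \<longleftrightarrow>
     c \<in> carrier_vec (2 * (q0 + q1)) \<and>
     (\<forall>j<q0+q1. \<phi> j R = 0) \<and>
     (\<exists>\<psi> d\<psi>.
        (\<forall>j<q0. \<forall>r\<in>{0<..R}.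
           \<phi> j r = c $ j * complex_of_real (r powr (1/2))
                 + c $ (q0 + q1 + j) * complex_of_real (r powr (1/2) * ln r) + \<psi> j r) \<and>
        (\<forall>j\<in>{q0..<q0+q1}. \<forall>r\<in>{0<..R}.
           \<phi> j r = complex_of_real (1 / sqrt (2 * nu lam j)) *
                    (c $ j * complex_of_real (r powr (nu lam j + 1/2))
                     + c $ (q0 + q1 + j) * complex_of_real (r powr (- nu lam j + 1/2))) + \<psi> j r) \<and>
        (\<forall>j<q0+q1.
           (\<forall>r\<in>{0..R}. (\<psi> j has_vector_derivative d\<psi> j r) (at r within {0..R})) \<and>
           continuous_on {0..R} (d\<psi> j) \<and>
           \<psi> j \<in> O[at_right 0](\<lambda>r. complex_of_real (r powr (3/2))) \<and>
           d\<psi> j \<in> O[at_right 0](\<lambda>r. complex_of_real (r powr (1/2)))) \<and>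
        (\<exists>g\<in>L2 (q0 + q1) R. model_expr q0 q1 lam R \<psi> g))"

definition beside :: "nat \<Rightarrow> complex mat \<Rightarrow> complex mat \<Rightarrow> complex mat" where
  "beside q A B = mat q (2 * q) (\<lambda>(i, j). if j < q then A $$ (i, j) else B $$ (i, j - q))"

definition negate_first_cols :: "nat \<Rightarrow> complex mat \<Rightarrow> complex mat" where
  "negate_first_cols q0 A =
     mat (dim_row A) (dim_col A) (\<lambda>(i, j). if j < q0 then - (A $$ (i, j)) else A $$ (i, j))"

text \<open>The graph of \<open>\<L>_L\<close>, closed under almost-everywhere equality in both components.\<close>

definition model_graph ::
    "nat \<Rightarrow> nat \<Rightarrow> (nat \<Rightarrow> real) \<Rightarrow> real \<Rightarrow> complex mat \<Rightarrow> complex mat \<Rightarrow> (vfun \<times> vfun) set" where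
  "model_graph q0 q1 lam R A B =
     {(u, g). u \<in> L2 (q0 + q1) R \<and> g \<in> L2 (q0 + q1) R \<and>
        (\<exists>\<phi> c. max_domain_coeffs q0 q1 lam R \<phi> c \<and>
           beside (q0 + q1) A B *\<^sub>v c = 0\<^sub>v (q0 + q1) \<and>
           L2_eq (q0 + q1) R u \<phi> \<and> model_expr q0 q1 lam R \<phi> g)}"

section \<open>Bessel functions and the determinant\<close>

text \<open>
  Principal branches.  The case distinction is needed because \<open>0 powr 0 = 0\<close>.
\<close>

definition bessel_J :: "real \<Rightarrow> complex \<Rightarrow> complex" where
  "bessel_J v z = (if v = 0 then 1 else (z / 2) powr complex_of_real v) *
     (\<Sum>k. (-1) ^ k / fact k * rGamma (complex_of_real (v + real k + 1)) * (z / 2) ^ (2 * k))"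

text \<open>Neumann's expansion of the Bessel function of the second kind of order 0.\<close>

definition bessel_Y0 :: "complex \<Rightarrow> complex" where
  "bessel_Y0 z = complex_of_real (2 / pi) *
     ((Ln (z / 2) + euler_mascheroni) * bessel_J 0 z
      - (\<Sum>k. (-1) ^ k * harm k / (fact k)\<^sup>2 * (z / 2) ^ (2 * k)))"

definition bessel_J0_tilde :: "real \<Rightarrow> complex \<Rightarrow> complex" where
  "bessel_J0_tilde R \<mu> = complex_of_real (pi / 2) * bessel_Y0 (\<mu> * complex_of_real R)
     - (Ln \<mu> - complex_of_real (ln 2) + euler_mascheroni) * bessel_J 0 (\<mu> * complex_of_real R)"

text \<open>
  The entries given by the formulas are entire functions of \<open>\<mu>\<close> once the removable singularity at
  \<open>\<mu> = 0\<close> is filled in; the branch cuts of the factors cancel.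
\<close>

definition J_plus_entry :: "nat \<Rightarrow> (nat \<Rightarrow> real) \<Rightarrow> real \<Rightarrow> nat \<Rightarrow> complex \<Rightarrow> complex" where
  "J_plus_entry q0 lam R j = remove_sings (\<lambda>\<mu>.
     if j < q0 then bessel_J 0 (\<mu> * complex_of_real R)
     else complex_of_real (2 powr nu lam j * Gamma (1 + nu lam j)) *
          \<mu> powr complex_of_real (- nu lam j) * bessel_J (nu lam j) (\<mu> * complex_of_real R))"

definition J_minus_entry :: "nat \<Rightarrow> (nat \<Rightarrow> real) \<Rightarrow> real \<Rightarrow> nat \<Rightarrow> complex \<Rightarrow> complex" where
  "J_minus_entry q0 lam R j = remove_sings (\<lambda>\<mu>.
     if j < q0 then bessel_J0_tilde R \<mu>
     else complex_of_real (2 powr (- nu lam j) * Gamma (1 - nu lam j)) *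
          \<mu> powr complex_of_real (nu lam j) * bessel_J (- nu lam j) (\<mu> * complex_of_real R))"

definition F_det ::
    "nat \<Rightarrow> nat \<Rightarrow> (nat \<Rightarrow> real) \<Rightarrow> real \<Rightarrow> complex mat \<Rightarrow> complex mat \<Rightarrow> complex \<Rightarrow> complex" where
  "F_det q0 q1 lam R A B \<mu> =
     det (four_block_mat A B
            (mat_diag (q0 + q1) (\<lambda>j. J_plus_entry q0 lam R j \<mu>))
            (mat_diag (q0 + q1) (\<lambda>j. J_minus_entry q0 lam R j \<mu>)))"

text \<open>
  \<open>d/dx log f(x)\<close> exists and equals D: some holomorphic logarithm of f near x has derivative D at x.
  Local logarithms differ by locally constant functions, so the choice does not matter.
\<close>

definition has_log_derivative :: "(complex \<Rightarrow> complex) \<Rightarrow> complex \<Rightarrow> complex \<Rightarrow> bool" where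
  "has_log_derivative f D x \<longleftrightarrow>
     (\<exists>U l. open U \<and> x \<in> U \<and> l holomorphic_on U \<and> (\<forall>z\<in>U. exp (l z) = f z) \<and>
            (l has_field_derivative D) (at x))"

end

(*
  In each component the equation (L + x^2) u = f is solved by variation of constants: with w = x^2,
  u = c P_w + c' M_w + V_w f, where P_w, M_w are the two Frobenius solutions of the homogeneous equation
  and V_w is the Volterra resolvent operator. The Dirichlet condition together with the Lagrangian
  condition is a linear system for the coefficients c, whose matrix N(w) is the matrix of F (the
  boundary values P_w(R), M_w(R) are Bessel functions). Hence the resolvent exists if and only if
  det N(w) is nonzero. V_w factors through Hilbert-Schmidt operators with triangular kernels, so it is
  nuclear with trace 0. The rest of the resolvent has finite rank, and since d/dw P_w(R) = - (V_w P_w)(R)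
  its trace is tr(N^{-1} dN/dw) = d/dw log det N.
*)
theory Submission imports Defs "HOL-Library.Diagonal_Subsequence"
begin

section \<open>Semi-Hilbert spaces\<close>

text \<open>Operators act on representatives of functions modulo null functions, so the operator
  theory is developed in a degenerate inner product space. Trace class requires an absolute value,
  and the trace is a number common to all orthonormal bases, so some basis must exist. Both come
  from the eigenvectors of \<open>T' T\<close>: the resolvent is injective, hence these eigenvectors
  already form a basis, and the finite trace norm makes it countable. The bound 3/4 on the
  eigenvalues means \<open>v < 1\<close>. Then the singular solution is square integrable, and the
  regular solution, of order \<open>r powr (1/2 + v)\<close>, is excluded from the remainders of
  order \<open>r powr (3/2)\<close>. The remainder conditions of the maximal domain therefore single
  out exactly the Volterra solution. The obstacle in the estimates is the logarithm at
  \<open>v = 0\<close>. A weight exponent \<open>\<theta>\<close> strictly between \<open>v\<close>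
  and 1 absorbs it, so that one kernel bound serves all \<open>v\<close>. The derivative in the
  spectral parameter costs no extra analysis: the difference quotient of a Frobenius solution is
  itself a resolvent expression.\<close>

lemma quadratic_nonneg_imp_zero:
  fixes c :: complex and b :: real
  assumes "\<And>t::complex. 0 \<le> 2 * Re (cnj t * c) + (cmod t)\<^sup>2 * b"
  shows "c = 0"
proof (rule ccontr)
  assume c: "c \<noteq> 0"
  \<comment> \<open>The test value is \<open>t = - s c\<close>. The quadratic becomes
    \<open>s |c|^2 (s b - 2)\<close>, and this \<open>s\<close> makes the bracket negative for
    either sign of \<open>b\<close>.\<close>
  define s where "s = 1 / (\<bar>b\<bar> + 1)"
  have s: "s > 0" "s * b < 2"
    by (auto simp: s_def field_simps)
  have "Re (cnj c * c) = (cmod c)\<^sup>2"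
    by (metis complex_norm_square mult.commute Re_complex_of_real)
  moreover have "Re (cnj (- of_real s * c) * c) = - s * Re (cnj c * c)"
    by (simp add: algebra_simps)
  ultimately have "Re (cnj (- of_real s * c) * c) = - s * (cmod c)\<^sup>2"
    by simp
  with assms[of "- of_real s * c"] have "0 \<le> - 2 * s * (cmod c)\<^sup>2 + s\<^sup>2 * (cmod c)\<^sup>2 * b"
    by (simp add: norm_mult power_mult_distrib)
  also have "\<dots> = s * (cmod c)\<^sup>2 * (s * b - 2)"
    by (simp add: algebra_simps power2_eq_square)
  also have "\<dots> < 0"
    using s c by (intro mult_pos_neg) auto
  finally show False by simp
qed

text \<open>Initial segments of \<open>I\<close> are cofinal among its finite subsets, so theorems
  about sequences become available for unordered sums.\<close>

lemma has_sum_imp_partial_sums: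
  fixes a :: "nat \<Rightarrow> complex"
  assumes "(a has_sum t) I"
  shows "(\<lambda>N. \<Sum>n\<in>I \<inter> {..<N}. a n) \<longlonglongrightarrow> t"
proof -
  have "filterlim (\<lambda>N. I \<inter> {..<N}) (finite_subsets_at_top I) sequentially"
    unfolding filterlim_finite_subsets_at_top
  proof (intro allI impI)
    fix X assume X: "finite X \<and> X \<subseteq> I"
    then obtain N where "X \<subseteq> {..<N}"
      using finite_nat_iff_bounded by blast
    then show "\<forall>\<^sub>F n in sequentially. finite (I \<inter> {..<n}) \<and> X \<subseteq> I \<inter> {..<n} \<and> I \<inter> {..<n} \<subseteq> I"
      using X by (intro eventually_sequentiallyI[of N]) force
  qed
  from filterlim_compose[OF assms[unfolded has_sum_def] this] show ?thesis .
qed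

text \<open>The bound gives absolute, hence unconditional, summability; the ordered limit only
  identifies the value.\<close>

lemma has_sum_of_partial_sums:
  fixes a :: "nat \<Rightarrow> complex"
  assumes bd: "\<And>F. finite F \<Longrightarrow> F \<subseteq> I \<Longrightarrow> (\<Sum>n\<in>F. cmod (a n)) \<le> C"
    and lim: "(\<lambda>N. \<Sum>n\<in>I \<inter> {..<N}. a n) \<longlonglongrightarrow> t"
  shows "(a has_sum t) I"
proof -
  have "(\<lambda>n. cmod (a n)) summable_on I"
    by (rule nonneg_bdd_above_summable_on) (use bd in \<open>auto intro!: bdd_aboveI[of _ C]\<close>)
  then have "a summable_on I"
    by (rule abs_summable_summable)
  then have hs: "(a has_sum infsum a I) I" by simp
  from has_sum_imp_partial_sums[OF hs] lim have "infsum a I = t"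
    using LIMSEQ_unique by blast
  with hs show ?thesis by simp
qed

text \<open>The form may be degenerate: functions that agree almost everywhere stay distinct
  elements. No vector space laws are assumed for \<open>add\<close> and \<open>scl\<close>;
  identities between vectors are tested only through \<open>ip\<close>.\<close>

locale semi_inner =
  fixes S :: "'a set" and add :: "'a \<Rightarrow> 'a \<Rightarrow> 'a" and scl :: "complex \<Rightarrow> 'a \<Rightarrow> 'a"
    and ip :: "'a \<Rightarrow> 'a \<Rightarrow> complex"
  assumes S_nonempty: "S \<noteq> {}"
    and add_S [simp, intro]: "x \<in> S \<Longrightarrow> y \<in> S \<Longrightarrow> add x y \<in> S"
    and scl_S [simp, intro]: "x \<in> S \<Longrightarrow> scl c x \<in> S"
    and ip_add_left [simp]: "x \<in> S \<Longrightarrow> y \<in> S \<Longrightarrow> z \<in> S \<Longrightarrow> ip (add x y) z = ip x z + ip y z"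
    and ip_scl_left [simp]: "x \<in> S \<Longrightarrow> z \<in> S \<Longrightarrow> ip (scl c x) z = c * ip x z"
    and ip_cnj: "x \<in> S \<Longrightarrow> y \<in> S \<Longrightarrow> ip y x = cnj (ip x y)"
    and ip_ge0: "x \<in> S \<Longrightarrow> 0 \<le> Re (ip x x)"
begin

definition sub :: "'a \<Rightarrow> 'a \<Rightarrow> 'a" where "sub x y = add x (scl (-1) y)"
definition nrm2 :: "'a \<Rightarrow> real" where "nrm2 x = Re (ip x x)"
definition nrm :: "'a \<Rightarrow> real" where "nrm x = sqrt (nrm2 x)"
definition zero :: 'a where "zero = scl 0 (SOME x. x \<in> S)"
definition lim_to :: "(nat \<Rightarrow> 'a) \<Rightarrow> 'a \<Rightarrow> bool" where
  "lim_to X y \<longleftrightarrow> (\<lambda>n. nrm2 (sub (X n) y)) \<longlonglongrightarrow> 0"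

lemma zero_S [simp, intro]: "zero \<in> S"
  unfolding zero_def using S_nonempty by (intro scl_S) (simp add: some_in_eq)

lemma sub_S [simp, intro]: "x \<in> S \<Longrightarrow> y \<in> S \<Longrightarrow> sub x y \<in> S"
  by (simp add: sub_def)

lemma ip_sub_left [simp]: "x \<in> S \<Longrightarrow> y \<in> S \<Longrightarrow> z \<in> S \<Longrightarrow> ip (sub x y) z = ip x z - ip y z"
  by (simp add: sub_def)

lemma ip_zero_left [simp]: "z \<in> S \<Longrightarrow> ip zero z = 0"
  unfolding zero_def using S_nonempty by (simp add: some_in_eq)

lemma ip_add_right [simp]: "x \<in> S \<Longrightarrow> y \<in> S \<Longrightarrow> z \<in> S \<Longrightarrow> ip z (add x y) = ip z x + ip z y"
  by (subst (1 2 3) ip_cnj) auto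

lemma ip_scl_right [simp]: "x \<in> S \<Longrightarrow> z \<in> S \<Longrightarrow> ip z (scl c x) = cnj c * ip z x"
  by (subst (1 2) ip_cnj) auto

lemma ip_sub_right [simp]: "x \<in> S \<Longrightarrow> y \<in> S \<Longrightarrow> z \<in> S \<Longrightarrow> ip z (sub x y) = ip z x - ip z y"
  by (simp add: sub_def)

lemma ip_zero_right [simp]: "z \<in> S \<Longrightarrow> ip z zero = 0"
  by (subst ip_cnj) auto

lemma nrm2_nonneg [simp]: "x \<in> S \<Longrightarrow> 0 \<le> nrm2 x"
  by (simp add: nrm2_def ip_ge0)

lemma nrm_nonneg [simp]: "x \<in> S \<Longrightarrow> 0 \<le> nrm x"
  by (simp add: nrm_def)

lemma nrm_sq: "x \<in> S \<Longrightarrow> (nrm x)\<^sup>2 = nrm2 x"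
  by (simp add: nrm_def)

lemma ip_self:
  assumes "x \<in> S" shows "ip x x = of_real (nrm2 x)"
proof -
  have "Im (ip x x) = - Im (ip x x)"
    by (subst (1) ip_cnj[OF assms assms]) simp
  then show ?thesis by (simp add: nrm2_def complex_eq_iff)
qed

lemma nrm2_scl [simp]:
  assumes "x \<in> S" shows "nrm2 (scl c x) = (cmod c)\<^sup>2 * nrm2 x"
proof -
  have "ip (scl c x) (scl c x) = of_real ((cmod c)\<^sup>2) * ip x x"
    unfolding complex_norm_square using assms by simp
  then show ?thesis by (simp add: nrm2_def del: of_real_power)
qed

lemma nrm_scl [simp]: "x \<in> S \<Longrightarrow> nrm (scl c x) = cmod c * nrm x"
  by (simp add: nrm_def real_sqrt_mult)

lemma nrm2_add: "x \<in> S \<Longrightarrow> y \<in> S \<Longrightarrow> nrm2 (add x y) = nrm2 x + 2 * Re (ip x y) + nrm2 y"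
  using ip_cnj[of x y] by (simp add: nrm2_def)

lemma nrm2_sub: "x \<in> S \<Longrightarrow> y \<in> S \<Longrightarrow> nrm2 (sub x y) = nrm2 x - 2 * Re (ip x y) + nrm2 y"
  using ip_cnj[of x y] by (simp add: nrm2_def)

lemma Cauchy_Schwarz_sq:
  assumes "x \<in> S" "y \<in> S"
  shows "(cmod (ip x y))\<^sup>2 \<le> nrm2 x * nrm2 y"
proof -
  let ?c = "ip x y"
  \<comment> \<open>Expands the squared norm of \<open>x - s * ip x y * y\<close>. For
    \<open>nrm2 y > 0\<close> the optimal choice is \<open>s = 1 / nrm2 y\<close>.\<close>
  have key: "0 \<le> nrm2 x - 2 * s * (cmod ?c)\<^sup>2 + s\<^sup>2 * (cmod ?c)\<^sup>2 * nrm2 y" for s :: real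
  proof -
    have "0 \<le> nrm2 (add x (scl (- of_real s * ?c) y))"
      using assms by simp
    also have "\<dots> = nrm2 x + 2 * Re (- of_real s * (cnj ?c * ?c)) + s\<^sup>2 * (cmod ?c)\<^sup>2 * nrm2 y"
      using assms by (subst nrm2_add) (auto simp: norm_mult power_mult_distrib algebra_simps)
    also have "cnj ?c * ?c = of_real ((cmod ?c)\<^sup>2)"
      by (metis complex_norm_square mult.commute)
    finally show ?thesis by (simp add: mult_ac)
  qed
  show ?thesis
  proof (cases "nrm2 y = 0")
    case True
    have "?c = 0"
    proof (rule ccontr)
      assume "?c \<noteq> 0"
      then show False
        \<comment> \<open>With \<open>nrm2 y = 0\<close> the right-hand side of \<open>key\<close>
          is affine in \<open>s\<close>, and this \<open>s\<close> gives it the value -1.\<close>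
        using key[of "(nrm2 x + 1) / (2 * (cmod ?c)\<^sup>2)"] True by (simp add: field_simps)
    qed
    then show ?thesis using assms by simp
  next
    case False
    with assms have pos: "nrm2 y > 0" by (simp add: order_less_le)
    with key[of "1 / nrm2 y"] show ?thesis
      by (simp add: field_simps power2_eq_square)
  qed
qed

lemma Cauchy_Schwarz: "x \<in> S \<Longrightarrow> y \<in> S \<Longrightarrow> cmod (ip x y) \<le> nrm x * nrm y"
  using Cauchy_Schwarz_sq[of x y] unfolding nrm_def
  by (metis real_le_rsqrt real_sqrt_mult)

lemma ip_null_left: "x \<in> S \<Longrightarrow> y \<in> S \<Longrightarrow> nrm2 x = 0 \<Longrightarrow> ip x y = 0"
  using Cauchy_Schwarz_sq[of x y] by simp

lemma null_iff_orthogonal: "x \<in> S \<Longrightarrow> nrm2 x = 0 \<longleftrightarrow> (\<forall>z\<in>S. ip x z = 0)"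
  by (metis ip_null_left ip_self of_real_eq_0_iff)

lemma nrm2_sub_eq_0_iff:
  "x \<in> S \<Longrightarrow> y \<in> S \<Longrightarrow> nrm2 (sub x y) = 0 \<longleftrightarrow> (\<forall>z\<in>S. ip x z = ip y z)"
  by (subst null_iff_orthogonal) auto

lemma nrm_sub_commute: "x \<in> S \<Longrightarrow> y \<in> S \<Longrightarrow> nrm2 (sub x y) = nrm2 (sub y x)"
  using ip_cnj[of x y] by (simp add: nrm2_sub)

lemma nrm2_sub_triangle:
  assumes "x \<in> S" "y \<in> S" "z \<in> S"
  shows "nrm2 (sub x z) \<le> 2 * nrm2 (sub x y) + 2 * nrm2 (sub y z)"
proof -
  have "0 \<le> nrm2 (sub (sub x y) (sub y z))"
    using assms by simp
  moreover have "nrm2 (sub x z) + nrm2 (sub (sub x y) (sub y z)) = 2 * nrm2 (sub x y) + 2 * nrm2 (sub y z)"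
    using assms by (simp add: nrm2_def)
  ultimately show ?thesis by linarith
qed

lemma lim_to_ip_left:
  assumes "\<And>n. X n \<in> S" "y \<in> S" "z \<in> S" "lim_to X y"
  shows "(\<lambda>n. ip (X n) z) \<longlonglongrightarrow> ip y z"
proof -
  have *: "(\<lambda>n. sqrt (nrm2 (sub (X n) y)) * nrm z) \<longlonglongrightarrow> sqrt 0 * nrm z"
    using assms(4) unfolding lim_to_def by (intro tendsto_intros)
  have "(\<lambda>n. ip (X n) z - ip y z) \<longlonglongrightarrow> 0"
  proof (rule Lim_null_comparison[rotated, where g = "\<lambda>n. sqrt (nrm2 (sub (X n) y)) * nrm z"])
    show "(\<lambda>n. sqrt (nrm2 (sub (X n) y)) * nrm z) \<longlonglongrightarrow> 0" using * by simp
  next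
    show "\<forall>\<^sub>F n in sequentially. cmod (ip (X n) z - ip y z) \<le> sqrt (nrm2 (sub (X n) y)) * nrm z"
      using Cauchy_Schwarz[of "sub (X _) y" z] assms by (intro always_eventually allI) (simp add: nrm_def)
  qed
  then show ?thesis by (simp add: LIM_zero_iff)
qed

lemma lim_to_nrm2:
  assumes "\<And>n. X n \<in> S" "y \<in> S" "lim_to X y"
  shows "(\<lambda>n. nrm2 (X n)) \<longlonglongrightarrow> nrm2 y"
proof -
  have "(\<lambda>n. nrm2 (sub (X n) y) + 2 * Re (ip (X n) y) - nrm2 y) \<longlonglongrightarrow> 0 + 2 * Re (ip y y) - nrm2 y"
    using assms(3) lim_to_ip_left[OF assms(1,2,2,3)] unfolding lim_to_def by (intro tendsto_intros)
  moreover have "nrm2 (sub (X n) y) + 2 * Re (ip (X n) y) - nrm2 y = nrm2 (X n)" for n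
    using assms by (simp add: nrm2_sub)
  ultimately show ?thesis by (simp add: nrm2_def)
qed

section \<open>Orthonormal families and Bessel's inequality\<close>

definition orthonormal :: "nat set \<Rightarrow> (nat \<Rightarrow> 'a) \<Rightarrow> bool" where
  "orthonormal I e \<longleftrightarrow> (\<forall>n\<in>I. e n \<in> S) \<and> (\<forall>m\<in>I. \<forall>n\<in>I. ip (e m) (e n) = (if m = n then 1 else 0))"

definition onb :: "nat set \<Rightarrow> (nat \<Rightarrow> 'a) \<Rightarrow> bool" where
  "onb I e \<longleftrightarrow> orthonormal I e \<and> (\<forall>f\<in>S. (\<forall>n\<in>I. ip f (e n) = 0) \<longrightarrow> nrm2 f = 0)"

lemma orthonormal_mono: "orthonormal I e \<Longrightarrow> J \<subseteq> I \<Longrightarrow> orthonormal J e"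
  unfolding orthonormal_def by blast

text \<open>Index sets are arbitrary sets of naturals, so finite and infinite bases are treated
  alike; cutting at \<open>N\<close> turns a sum over \<open>I\<close> into a sequence.\<close>

primrec psum :: "(nat \<Rightarrow> complex) \<Rightarrow> (nat \<Rightarrow> 'a) \<Rightarrow> nat set \<Rightarrow> nat \<Rightarrow> 'a" where
  "psum c e I 0 = zero"
| "psum c e I (Suc n) = (if n \<in> I then add (psum c e I n) (scl (c n) (e n)) else psum c e I n)"

lemma psum_S [simp]: "orthonormal I e \<Longrightarrow> psum c e I N \<in> S"
  by (induction N) (auto simp: orthonormal_def)

lemma ip_psum_left:
  assumes "orthonormal I e" "z \<in> S"
  shows "ip (psum c e I N) z = (\<Sum>n\<in>I \<inter> {..<N}. c n * ip (e n) z)"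
proof (induction N)
  case (Suc N)
  have [simp]: "psum c e I N \<in> S" using assms by simp
  have *: "I \<inter> {..<Suc N} = (if N \<in> I then insert N (I \<inter> {..<N}) else I \<inter> {..<N})"
    by (auto simp: less_Suc_eq)
  show ?case using Suc assms by (auto simp: * orthonormal_def)
qed (use assms in simp)

lemma ip_psum_basis:
  assumes "orthonormal I e" "m \<in> I"
  shows "ip (psum c e I N) (e m) = (if m < N then c m else 0)"
proof -
  have "ip (psum c e I N) (e m) = (\<Sum>n\<in>I \<inter> {..<N}. c n * ip (e n) (e m))"
    using assms by (intro ip_psum_left) (auto simp: orthonormal_def)
  also have "\<dots> = (\<Sum>n\<in>I \<inter> {..<N}. if n = m then c m else 0)"
    using assms by (intro sum.cong) (auto simp: orthonormal_def)
  also have "\<dots> = (if m < N then c m else 0)"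
    using assms by (subst sum.delta) auto
  finally show ?thesis .
qed

lemma ip_psum_psum:
  assumes "orthonormal I e" "M \<le> N"
  shows "ip (psum c e I M) (psum d e I N) = (\<Sum>n\<in>I \<inter> {..<M}. c n * cnj (d n))"
proof -
  have "e n \<in> S" if "n \<in> I" for n
    using assms that by (auto simp: orthonormal_def)
  then have "ip (e n) (psum d e I N) = cnj (d n)" if "n \<in> I \<inter> {..<M}" for n
    using that assms by (subst ip_cnj) (auto simp: ip_psum_basis)
  then show ?thesis
    using assms by (subst ip_psum_left) auto
qed

lemma nrm2_psum_diff:
  assumes "orthonormal I e" "M \<le> N"
  shows "nrm2 (sub (psum c e I N) (psum c e I M)) 
    = (\<Sum>n\<in>I \<inter> {..<N}. (cmod (c n))\<^sup>2) - (\<Sum>n\<in>I \<inter> {..<M}. (cmod (c n))\<^sup>2)"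
proof -
  have *: "ip (psum c e I M) (psum c e I N) = (\<Sum>n\<in>I \<inter> {..<M}. (cmod (c n))\<^sup>2)" if "M \<le> N" for M N
    using assms(1) that by (subst ip_psum_psum) (auto simp flip: complex_norm_square)
  have "ip (psum c e I N) (psum c e I M) = cnj (ip (psum c e I M) (psum c e I N))"
    using assms by (subst ip_cnj) auto
  then show ?thesis
    using assms by (simp add: nrm2_sub) (simp add: nrm2_def *)
qed

lemma bessel:
  assumes "orthonormal I e" "finite I" "x \<in> S"
  shows "(\<Sum>n\<in>I. (cmod (ip x (e n)))\<^sup>2) \<le> nrm2 x"
proof -
  obtain N where N: "I \<subseteq> {..<N}"
    using assms(2) finite_nat_iff_bounded by blast
  define c where "c n = ip x (e n)" for n
  let ?p = "psum c e I N"
  have IN: "I \<inter> {..<N} = I" using N by blast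
  have eS: "e n \<in> S" if "n \<in> I" for n
    using assms that by (auto simp: orthonormal_def)
  have "c n * ip (e n) x = of_real ((cmod (c n))\<^sup>2)" if "n \<in> I" for n
    using ip_cnj[OF assms(3) eS[OF that]] by (simp add: c_def complex_norm_square del: of_real_power)
  then have "ip ?p x = (\<Sum>n\<in>I. (cmod (c n))\<^sup>2)"
    using assms by (subst ip_psum_left) (auto simp: IN)
  then have 1: "Re (ip x ?p) = (\<Sum>n\<in>I. (cmod (c n))\<^sup>2)"
    using assms by (subst ip_cnj) auto
  have 2: "nrm2 ?p = (\<Sum>n\<in>I. (cmod (c n))\<^sup>2)"
    using assms unfolding nrm2_def
    by (subst ip_psum_psum) (simp_all add: IN complex_norm_square[symmetric] del: of_real_power flip: of_real_sum)
  have "0 \<le> nrm2 (sub x ?p)" using assms by simp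
  also have "\<dots> = nrm2 x - (\<Sum>n\<in>I. (cmod (c n))\<^sup>2)"
    using assms 1 2 by (simp add: nrm2_sub)
  finally show ?thesis by (simp add: c_def)
qed

lemma bessel2:
  assumes "orthonormal I e" "orthonormal I f" "finite I" "x \<in> S" "y \<in> S"
  shows "(\<Sum>n\<in>I. cmod (ip x (e n)) * cmod (ip y (f n))) \<le> nrm x * nrm y"
proof -
  have "(\<Sum>n\<in>I. cmod (ip x (e n)) * cmod (ip y (f n))) 
      \<le> L2_set (\<lambda>n. cmod (ip x (e n))) I * L2_set (\<lambda>n. cmod (ip y (f n))) I"
    using L2_set_mult_ineq[of "\<lambda>n. cmod (ip x (e n))" "\<lambda>n. cmod (ip y (f n))" I] by (simp only: abs_norm_cancel)
  also have "\<dots> \<le> nrm x * nrm y"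
    using mult_mono[OF real_sqrt_le_mono[OF bessel[OF assms(1,3,4)]] real_sqrt_le_mono[OF bessel[OF assms(2,3,5)]]] assms(4)
    by (simp add: L2_set_def nrm_def sum_nonneg)
  finally show ?thesis .
qed

end

text \<open>Limits are unique only up to null vectors, so completeness asks for some limit.\<close>

locale semi_hilbert = semi_inner +
  assumes complete: "\<And>X. (\<And>n::nat. X n \<in> S) \<Longrightarrow>
      (\<And>\<epsilon>. \<epsilon> > 0 \<Longrightarrow> \<exists>N. \<forall>m\<ge>N. \<forall>n\<ge>N. nrm2 (sub (X m) (X n)) < \<epsilon>) \<Longrightarrow> \<exists>y\<in>S. lim_to X y"
begin

text \<open>A minimising sequence is Cauchy by the parallelogram law. The closedness hypothesis
  concerns every limit of a sequence in \<open>Y\<close>, so \<open>Y\<close> also contains all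
  vectors at distance 0 from it.\<close>

lemma projection:
  assumes Y: "Y \<subseteq> S" "Y \<noteq> {}" and add: "\<And>x y. x \<in> Y \<Longrightarrow> y \<in> Y \<Longrightarrow> add x y \<in> Y"
    and scl: "\<And>c x. x \<in> Y \<Longrightarrow> scl c x \<in> Y"
    and closed: "\<And>X y. (\<And>n. X n \<in> Y) \<Longrightarrow> y \<in> S \<Longrightarrow> lim_to X y \<Longrightarrow> y \<in> Y"
    and g: "g \<in> S"
  shows "\<exists>y\<in>Y. \<forall>z\<in>Y. ip (sub g y) z = 0"
proof -
  define d where "d = (INF y\<in>Y. nrm2 (sub g y))"
  have YS: "y \<in> S" if "y \<in> Y" for y using Y that by blast
  have bdd: "bdd_below ((\<lambda>y. nrm2 (sub g y)) ` Y)"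
    by (rule bdd_belowI[of _ 0]) (use YS g in auto)
  have d_le: "d \<le> nrm2 (sub g y)" if "y \<in> Y" for y
    unfolding d_def by (rule cINF_lower[OF bdd that])
  have "\<exists>y\<in>Y. nrm2 (sub g y) < d + 1 / real (Suc n)" for n
  proof -
    have "(INF y\<in>Y. nrm2 (sub g y)) < d + 1 / real (Suc n)"
      by (simp add: d_def[symmetric])
    then show ?thesis using cINF_less_iff[OF Y(2) bdd] by blast
  qed
  then obtain X where X: "\<And>n. X n \<in> Y" "\<And>n. nrm2 (sub g (X n)) < d + 1 / real (Suc n)"
    by metis
  have XS: "X n \<in> S" for n using X(1) YS by blast
  \<comment> \<open>The midpoint \<open>?h\<close> lies in \<open>Y\<close>, so its squared distance
    from \<open>g\<close> is at least \<open>d\<close>.\<close>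
  have par: "nrm2 (sub (X m) (X n)) \<le> 2 / real (Suc m) + 2 / real (Suc n)" for m n
  proof -
    let ?h = "scl (1/2) (add (X m) (X n))"
    have "nrm2 (sub (X m) (X n)) = 2 * nrm2 (sub g (X m)) + 2 * nrm2 (sub g (X n)) - 4 * nrm2 (sub g ?h)"
      using g XS by (simp add: nrm2_def algebra_simps)
    moreover have "d \<le> nrm2 (sub g ?h)"
      using X(1) add scl by (intro d_le) auto
    ultimately show ?thesis using X(2)[of m] X(2)[of n] by simp
  qed
  obtain y where y: "y \<in> S" "lim_to X y"
  proof -
    have "\<exists>y\<in>S. lim_to X y"
    proof (rule complete[OF XS])
      fix \<epsilon> :: real assume "\<epsilon> > 0"
      then obtain N where N: "1 / real (Suc N) < \<epsilon> / 4"
        using nat_approx_posE[of "\<epsilon> / 4"] by (metis zero_less_divide_iff zero_less_numeral)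
      have "1 / real (Suc m) \<le> 1 / real (Suc N)" if "m \<ge> N" for m
        using that by (simp add: field_simps)
      then have "nrm2 (sub (X m) (X n)) < \<epsilon>" if "m \<ge> N" "n \<ge> N" for m n
      proof -
        have "1 / real (Suc m) < \<epsilon> / 4" "1 / real (Suc n) < \<epsilon> / 4"
          using that N \<open>\<And>m. m \<ge> N \<Longrightarrow> 1 / real (Suc m) \<le> 1 / real (Suc N)\<close> le_less_trans by blast+
        moreover have "2 / real (Suc m) + 2 / real (Suc n) = 2 * (1 / real (Suc m)) + 2 * (1 / real (Suc n))"
          by simp
        ultimately show ?thesis using par[of m n] by linarith
      qed
      then show "\<exists>N. \<forall>m\<ge>N. \<forall>n\<ge>N. nrm2 (sub (X m) (X n)) < \<epsilon>" by blast
    qed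
    then show ?thesis using that by blast
  qed
  have yY: "y \<in> Y" using closed[OF X(1) y] .
  have "(\<lambda>n. nrm2 (sub g (X n))) \<longlonglongrightarrow> nrm2 (sub g y)"
  proof (rule lim_to_nrm2)
    have "nrm2 (sub (sub g (X n)) (sub g y)) = nrm2 (sub (X n) y)" for n
      using g XS y(1) by (simp add: nrm2_def)
    then show "lim_to (\<lambda>n. sub g (X n)) (sub g y)"
      using y(2) by (simp add: lim_to_def)
  qed (use g XS y in auto)
  moreover have "(\<lambda>n. d + 1 / real (Suc n)) \<longlonglongrightarrow> d + 0"
    by (intro tendsto_intros LIMSEQ_Suc lim_1_over_n)
  ultimately have "nrm2 (sub g y) \<le> d + 0"
    by (rule LIMSEQ_le) (use X(2) less_imp_le in blast)
  then have min: "nrm2 (sub g y) \<le> nrm2 (sub g z)" if "z \<in> Y" for z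
    using d_le[OF that] by simp
  show ?thesis
  proof (intro bexI[OF _ yY] ballI)
    fix z assume z: "z \<in> Y"
    \<comment> \<open>First variation: replacing \<open>y\<close> by \<open>y - t z\<close> cannot
      decrease the distance to \<open>g\<close>.\<close>
    show "ip (sub g y) z = 0"
    proof (rule quadratic_nonneg_imp_zero)
      fix t
      have "sub g (add y (scl (- t) z)) \<in> S" using g y z YS by auto
      have "nrm2 (sub g (add y (scl (- t) z))) = nrm2 (add (sub g y) (scl t z))"
        using g y(1) YS[OF z] by (simp add: nrm2_def algebra_simps)
      also have "\<dots> = nrm2 (sub g y) + 2 * Re (cnj t * ip (sub g y) z) + (cmod t)\<^sup>2 * nrm2 z"
        using g y(1) YS[OF z] by (subst nrm2_add) auto
      finally show "0 \<le> 2 * Re (cnj t * ip (sub g y) z) + (cmod t)\<^sup>2 * nrm2 z"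
        using min[OF add[OF yY scl[OF z]], of "- t"] by simp
    qed
  qed
qed

text \<open>The diagonal argument runs over the members \<open>X k\<close> of the sequence itself
  instead of over a dense set. The test vectors for which the subsequence converges form a closed
  subspace \<open>Y\<close>, and the component of \<open>g\<close> orthogonal to \<open>Y\<close> is
  orthogonal to every \<open>X k\<close>.\<close>

lemma weak_compactness:
  assumes X: "\<And>n. X n \<in> S" and bd: "\<And>n. nrm (X n) \<le> B"
  shows "\<exists>r::nat \<Rightarrow> nat. strict_mono r \<and> (\<forall>g\<in>S. convergent (\<lambda>n. ip (X (r n)) g))"
proof -
  have bdip: "cmod (ip (X n) g) \<le> B * nrm g" if "g \<in> S" for n g
    using Cauchy_Schwarz[OF X that, of n] mult_right_mono[OF bd[of n], of "nrm g"] that by fastforce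
  interpret subseqs "\<lambda>k s. convergent (\<lambda>i. ip (X (s i)) (X k))"
  proof
    fix k and s :: "nat \<Rightarrow> nat" assume "strict_mono s"
    have "bounded (range (\<lambda>i. ip (X (s i)) (X k)))"
      using bdip[OF X[of k]] by (intro boundedI) auto
    then obtain l r where "strict_mono r" "((\<lambda>i. ip (X (s i)) (X k)) \<circ> r) \<longlonglongrightarrow> l"
      using bounded_imp_convergent_subsequence by blast
    then show "\<exists>r'. strict_mono r' \<and> convergent (\<lambda>i. ip (X ((s \<circ> r') i)) (X k))"
      by (auto simp: convergent_def o_def)
  qed
  define r where "r = diagseq"
  have r: "strict_mono r" unfolding r_def by (rule subseq_diagseq)
  have conv_X: "convergent (\<lambda>i. ip (X (r i)) (X k))" for k
  proof -
    have "convergent (\<lambda>i. ip (X ((diagseq \<circ> ((+) (Suc k))) i)) (X k))"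
    proof (rule diagseq_holds)
      fix n and s t :: "nat \<Rightarrow> nat"
      assume "strict_mono t" "convergent (\<lambda>i. ip (X (s i)) (X n))"
      then show "convergent (\<lambda>i. ip (X ((s \<circ> t) i)) (X n))"
        using convergent_subseq_convergent[of "\<lambda>i. ip (X (s i)) (X n)" t] by (simp add: o_def)
    qed
    then have "convergent (\<lambda>i. ip (X (r (i + Suc k))) (X k))"
      by (simp add: r_def o_def add.commute)
    then show ?thesis
      using convergent_ignore_initial_segment[of "\<lambda>i. ip (X (r i)) (X k)" "Suc k"] by simp
  qed
  define Y where "Y = {g \<in> S. convergent (\<lambda>n. ip (X (r n)) g)}"
  have "g \<in> Y" if g: "g \<in> S" for g
  proof -
    have "\<exists>y\<in>Y. \<forall>z\<in>Y. ip (sub g y) z = 0"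
    proof (rule projection)
      show "Y \<subseteq> S" by (auto simp: Y_def)
      show "Y \<noteq> {}" using conv_X[of 0] X[of 0] by (auto simp: Y_def)
      show "add x y \<in> Y" if "x \<in> Y" "y \<in> Y" for x y
        using that X by (auto simp: Y_def intro: convergent_add)
      show "scl c x \<in> Y" if "x \<in> Y" for c x
        using that X by (auto simp: Y_def intro!: convergent_mult convergent_const)
      show "y \<in> Y" if Z: "\<And>n. Z n \<in> Y" and y: "y \<in> S" and lim: "lim_to Z y" for Z y
      proof -
        have ZS: "Z n \<in> S" for n using Z by (auto simp: Y_def)
        have "Cauchy (\<lambda>n. ip (X (r n)) y)"
        proof (rule metric_CauchyI)
          fix e :: real assume "e > 0"
          \<comment> \<open>Chosen so that \<open>nrm2 < \<delta>\<close> gives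
            \<open>(|B| + 1) * nrm < e / 4\<close>; the added 1 avoids a division by 0.\<close>
          define \<delta> where "\<delta> = (e / (4 * (\<bar>B\<bar> + 1)))\<^sup>2"
          have "\<delta> > 0" using \<open>e > 0\<close> by (auto simp: \<delta>_def)
          then obtain k where "nrm2 (sub (Z k) y) < \<delta>"
            using order_tendstoD(2)[OF lim[unfolded lim_to_def]] by (auto simp: eventually_sequentially)
          then have "nrm (sub (Z k) y) < sqrt \<delta>" unfolding nrm_def by simp
          moreover have "sqrt \<delta> = e / (4 * (\<bar>B\<bar> + 1))"
            using \<open>e > 0\<close> by (simp add: \<delta>_def)
          ultimately have k: "(\<bar>B\<bar> + 1) * nrm (sub (Z k) y) < e / 4"
            by (simp add: field_simps)
          have diff: "cmod (ip (X n) y - ip (X n) (Z k)) < e / 4" for n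
          proof -
            have "cmod (ip (X n) y - ip (X n) (Z k)) = cmod (ip (X n) (sub (Z k) y))"
              using X ZS y by (simp add: norm_minus_commute)
            also have "\<dots> \<le> B * nrm (sub (Z k) y)"
              using bdip ZS y by auto
            also have "\<dots> \<le> (\<bar>B\<bar> + 1) * nrm (sub (Z k) y)"
              using ZS y by (intro mult_right_mono) auto
            finally show ?thesis using k by simp
          qed
          have "Cauchy (\<lambda>n. ip (X (r n)) (Z k))"
            using Z[of k] by (auto simp: Y_def intro: convergent_Cauchy)
          then obtain M where M: "\<And>m n. m \<ge> M \<Longrightarrow> n \<ge> M \<Longrightarrow> dist (ip (X (r m)) (Z k)) (ip (X (r n)) (Z k)) < e / 2"
            using metric_CauchyD[of "\<lambda>n. ip (X (r n)) (Z k)" "e / 2"] \<open>e > 0\<close> by fastforce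
          show "\<exists>M. \<forall>m\<ge>M. \<forall>n\<ge>M. dist (ip (X (r m)) y) (ip (X (r n)) y) < e"
          proof (intro exI[of _ M] allI impI)
            fix m n assume "m \<ge> M" "n \<ge> M"
            have "dist (ip (X (r m)) y) (ip (X (r n)) y) 
              \<le> dist (ip (X (r m)) y) (ip (X (r m)) (Z k)) + dist (ip (X (r m)) (Z k)) (ip (X (r n)) (Z k))
                + dist (ip (X (r n)) (Z k)) (ip (X (r n)) y)"
              using dist_triangle[of "ip (X (r m)) y" "ip (X (r n)) y" "ip (X (r m)) (Z k)"]
                dist_triangle[of "ip (X (r m)) (Z k)" "ip (X (r n)) y" "ip (X (r n)) (Z k)"] by linarith
            then show "dist (ip (X (r m)) y) (ip (X (r n)) y) < e"
              using diff[of "r m"] diff[of "r n"] M[OF \<open>m \<ge> M\<close> \<open>n \<ge> M\<close>]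
              by (simp add: dist_norm norm_minus_commute)
          qed
        qed
        then show ?thesis using y by (simp add: Y_def Cauchy_convergent_iff)
      qed
    qed (rule g)
    then obtain y where y: "y \<in> Y" "\<And>z. z \<in> Y \<Longrightarrow> ip (sub g y) z = 0" by auto
    have yS: "y \<in> S" using y(1) by (simp add: Y_def)
    have "ip (sub g y) (X k) = 0" for k
      using y(2)[of "X k"] conv_X X by (simp add: Y_def)
    then have "ip (X k) (sub g y) = 0" for k
      using g yS X by (subst ip_cnj) auto
    then have "ip (X k) g = ip (X k) y" for k
      using g yS X by simp
    then show ?thesis using y(1) g by (simp add: Y_def)
  qed
  then show ?thesis using r by (intro exI[of _ r]) (simp add: Y_def)
qed

text \<open>The partial sums of the squared coefficients increase and are bounded, hence Cauchy; by
  \<open>nrm2_psum_diff\<close> the vectors \<open>psum\<close> are then Cauchy as well.\<close>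

lemma riesz_fischer:
  assumes e: "orthonormal I e" and bd: "\<And>F. finite F \<Longrightarrow> F \<subseteq> I \<Longrightarrow> (\<Sum>n\<in>F. (cmod (c n))\<^sup>2) \<le> B"
  obtains y where "y \<in> S" "\<And>n. n \<in> I \<Longrightarrow> ip y (e n) = c n"
    "\<And>z. z \<in> S \<Longrightarrow> (\<lambda>N. \<Sum>n\<in>I \<inter> {..<N}. c n * ip (e n) z) \<longlonglongrightarrow> ip y z"
proof -
  define a where "a N = (\<Sum>n\<in>I \<inter> {..<N}. (cmod (c n))\<^sup>2)" for N
  have inc: "incseq a" unfolding a_def by (auto simp: incseq_def intro!: sum_mono2)
  have "convergent a"
    by (rule incseq_convergent[OF inc, of B]) (auto simp: a_def intro: bd convergentI)
  then have Ca: "Cauchy a" by (rule convergent_Cauchy)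
  have "\<exists>y\<in>S. lim_to (psum c e I) y"
  proof (rule complete)
    fix \<epsilon> :: real assume "\<epsilon> > 0"
    then obtain N where N: "\<And>m n. m \<ge> N \<Longrightarrow> n \<ge> N \<Longrightarrow> dist (a m) (a n) < \<epsilon>"
      using metric_CauchyD[OF Ca] by blast
    have "nrm2 (sub (psum c e I m) (psum c e I n)) \<le> dist (a m) (a n)" for m n
    proof (cases "n \<le> m")
      case True
      then show ?thesis using nrm2_psum_diff[OF e True, of c] by (simp add: a_def dist_real_def)
    next
      case False
      then show ?thesis
        using nrm2_psum_diff[OF e, of m n c] e by (subst nrm_sub_commute) (auto simp: a_def dist_real_def)
    qed
    then show "\<exists>N. \<forall>m\<ge>N. \<forall>n\<ge>N. nrm2 (sub (psum c e I m) (psum c e I n)) < \<epsilon>"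
      using N le_less_trans by blast
  qed (use e in auto)
  then obtain y where y: "y \<in> S" "lim_to (psum c e I) y" by blast
  have lim: "(\<lambda>N. \<Sum>n\<in>I \<inter> {..<N}. c n * ip (e n) z) \<longlonglongrightarrow> ip y z" if "z \<in> S" for z
    using lim_to_ip_left[OF psum_S[OF e] y(1) that y(2)] by (simp add: ip_psum_left[OF e that])
  have "ip y (e n) = c n" if "n \<in> I" for n
  proof (rule LIMSEQ_unique)
    show "(\<lambda>N. ip (psum c e I N) (e n)) \<longlonglongrightarrow> ip y (e n)"
      using e that by (intro lim_to_ip_left[OF psum_S[OF e] y(1) _ y(2)]) (auto simp: orthonormal_def)
    have "\<forall>\<^sub>F N in sequentially. ip (psum c e I N) (e n) = c n"
      using eventually_gt_at_top[of n] by eventually_elim (simp add: ip_psum_basis[OF e that])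
    then show "(\<lambda>N. ip (psum c e I N) (e n)) \<longlonglongrightarrow> c n"
      by (rule tendsto_eventually)
  qed
  with y lim show ?thesis using that by blast
qed

text \<open>Parseval's identity in polarised form. Riesz-Fischer yields a vector with the same
  coefficients as \<open>x\<close>, and by totality of the basis it differs from \<open>x\<close> by
  a null vector.\<close>

lemma onb_expansion:
  assumes e: "onb I e" and x: "x \<in> S" and z: "z \<in> S"
  shows "((\<lambda>n. ip x (e n) * cnj (ip z (e n))) has_sum ip x z) I"
proof (rule has_sum_of_partial_sums)
  have on: "orthonormal I e" using e by (simp add: onb_def)
  have eS: "e n \<in> S" if "n \<in> I" for n using on that by (simp add: orthonormal_def)
  show "(\<Sum>n\<in>F. cmod (ip x (e n) * cnj (ip z (e n)))) \<le> nrm x * nrm z" if "finite F" "F \<subseteq> I" for F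
    using bessel2[OF orthonormal_mono[OF on that(2)] orthonormal_mono[OF on that(2)] that(1) x z]
    by (simp add: norm_mult)
  obtain y where y: "y \<in> S" "\<And>n. n \<in> I \<Longrightarrow> ip y (e n) = ip x (e n)"
    "\<And>z. z \<in> S \<Longrightarrow> (\<lambda>N. \<Sum>n\<in>I \<inter> {..<N}. ip x (e n) * ip (e n) z) \<longlonglongrightarrow> ip y z"
    using riesz_fischer[OF on, of "\<lambda>n. ip x (e n)" "nrm2 x"] bessel[OF orthonormal_mono[OF on] _ x] by blast
  have "nrm2 (sub x y) = 0"
    using e y(1,2) x eS unfolding onb_def by simp
  then have "ip x z = ip y z"
    using nrm2_sub_eq_0_iff[OF x y(1)] z by blast
  moreover have "(\<Sum>n\<in>I \<inter> {..<N}. ip x (e n) * ip (e n) z) = (\<Sum>n\<in>I \<inter> {..<N}. ip x (e n) * cnj (ip z (e n)))" for N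
    using eS z by (intro sum.cong) (auto simp: ip_cnj[of z])
  ultimately show "(\<lambda>N. \<Sum>n\<in>I \<inter> {..<N}. ip x (e n) * cnj (ip z (e n))) \<longlonglongrightarrow> ip x z"
    using y(3)[OF z] by simp
qed

end

section \<open>Operators with bounded nuclear sums\<close>

text \<open>Bases are indexed by sets of naturals, so a countable set of vectors has to be
  relabelled.\<close>

lemma countable_nat_indexing:
  assumes "countable E"
  obtains I :: "nat set" and e where "bij_betw e I E"
  using bij_betw_inv_into[OF inj_on_imp_bij_betw[OF inj_on_to_nat_on[OF assms]]] that by blast

lemma has_sum_finite_sum:
  fixes f :: "'i \<Rightarrow> 'a \<Rightarrow> 'b :: {topological_comm_monoid_add}"
  assumes "finite J" "\<And>j. j \<in> J \<Longrightarrow> (f j has_sum s j) A"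
  shows "((\<lambda>x. \<Sum>j\<in>J. f j x) has_sum (\<Sum>j\<in>J. s j)) A"
  using assms by (induction J) (auto intro: has_sum_add)

context semi_hilbert
begin

text \<open>Compactness in sequential form. No weak limit has to be known in advance, only
  convergence of the numbers \<open>ip (X n) z\<close>.\<close>

definition weak_to_strong :: "('a \<Rightarrow> 'a) \<Rightarrow> bool" where
  "weak_to_strong T \<longleftrightarrow> (\<forall>X B. (\<forall>n::nat. X n \<in> S \<and> nrm (X n) \<le> B) \<longrightarrow> (\<forall>z\<in>S. convergent (\<lambda>n. ip (X n) z)) \<longrightarrow>
     (\<exists>y\<in>S. lim_to (\<lambda>n. T (X n)) y))"

text \<open>Possession of an adjoint is the form in which linearity up to null vectors is assumed;
  see \<open>adjoint_pair_add\<close> and \<open>adjoint_pair_scl\<close>.\<close>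

definition adjoint_pair :: "('a \<Rightarrow> 'a) \<Rightarrow> ('a \<Rightarrow> 'a) \<Rightarrow> bool" where
  "adjoint_pair T T' \<longleftrightarrow> (\<forall>x\<in>S. T x \<in> S \<and> T' x \<in> S) \<and> (\<forall>x\<in>S. \<forall>y\<in>S. ip (T x) y = ip x (T' y))"

text \<open>Trace norm at most \<open>C\<close>. The two families are independent of each other, so
  that \<open>e n\<close> can be paired with the normalised \<open>T (e n)\<close>, which sums the
  singular values.\<close>

definition nuclear_bound :: "('a \<Rightarrow> 'a) \<Rightarrow> real \<Rightarrow> bool" where
  "nuclear_bound T C \<longleftrightarrow> (\<forall>F e f. finite F \<longrightarrow> orthonormal F e \<longrightarrow> orthonormal F f \<longrightarrow>
     (\<Sum>n\<in>F. cmod (ip (T (e n)) (f n))) \<le> C)"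

text \<open>The trace is carried along as the parameter \<open>t\<close>: independence of the basis
  is obtained for each construction separately.\<close>

definition nuclear :: "('a \<Rightarrow> 'a) \<Rightarrow> complex \<Rightarrow> bool" where
  "nuclear T t \<longleftrightarrow> (\<exists>T'. adjoint_pair T T') \<and> weak_to_strong T \<and> (\<exists>C. nuclear_bound T C) \<and>
     (\<forall>I e. onb I e \<longrightarrow> ((\<lambda>n. ip (T (e n)) (e n)) has_sum t) I)"

lemma adjoint_pair_S: "adjoint_pair T T' \<Longrightarrow> x \<in> S \<Longrightarrow> T x \<in> S" "adjoint_pair T T' \<Longrightarrow> x \<in> S \<Longrightarrow> T' x \<in> S"
  by (auto simp: adjoint_pair_def)

lemma adjoint_pair_add:
  assumes "adjoint_pair T T'" "x \<in> S" "y \<in> S" "z \<in> S"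
  shows "ip (T (add x y)) z = ip (T x) z + ip (T y) z"
  using assms unfolding adjoint_pair_def by (metis add_S ip_add_left)

lemma adjoint_pair_scl:
  assumes "adjoint_pair T T'" "x \<in> S" "z \<in> S"
  shows "ip (T (scl c x)) z = c * ip (T x) z"
  using assms unfolding adjoint_pair_def by (metis scl_S ip_scl_left)

lemma adjoint_pair_sub:
  assumes "adjoint_pair T T'" "x \<in> S" "y \<in> S" "z \<in> S"
  shows "ip (T (sub x y)) z = ip (sub (T x) (T y)) z"
  using assms by (simp add: sub_def adjoint_pair_add adjoint_pair_scl adjoint_pair_S)

lemma nrm2_cong: 
  assumes "x \<in> S" "y \<in> S" "\<And>z. z \<in> S \<Longrightarrow> ip x z = ip y z"
  shows "nrm2 x = nrm2 y"
proof -
  have "Re (ip x x) = Re (ip y x)" "Re (ip x y) = Re (ip y y)"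
    using assms by simp_all
  moreover have "Re (ip y x) = Re (ip x y)"
    by (subst ip_cnj[OF assms(1,2)]) simp
  ultimately show ?thesis by (simp add: nrm2_def)
qed

text \<open>Families of length one, namely the normalised \<open>x\<close> and the normalised
  \<open>T x\<close>, already bound the operator norm by \<open>C\<close>.\<close>

lemma nuclear_bound_bounded:
  assumes T: "adjoint_pair T T'" and C: "nuclear_bound T C" and x: "x \<in> S"
  shows "nrm2 (T x) \<le> C\<^sup>2 * nrm2 x"
proof (cases "nrm2 (T x) = 0")
  case True
  then show ?thesis using x by simp
next
  case False
  have Tx: "T x \<in> S" using T x by (rule adjoint_pair_S)
  have "nrm2 x \<noteq> 0"
  proof
    assume "nrm2 x = 0"
    then have "ip (T x) (T x) = 0"
      using T x Tx ip_null_left unfolding adjoint_pair_def by metis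
    then show False using False by (simp add: nrm2_def)
  qed
  then have px: "nrm x > 0" and pT: "nrm (T x) > 0"
    using False x Tx by (auto simp: nrm_def order_less_le)
  define e where "e = scl (of_real (1 / nrm x)) x"
  define f where "f = scl (of_real (1 / nrm (T x))) (T x)"
  have eS: "e \<in> S" "f \<in> S" using x Tx by (auto simp: e_def f_def)
  have "nrm2 e = 1" "nrm2 f = 1"
    using x Tx False \<open>nrm2 x \<noteq> 0\<close> by (simp_all add: e_def f_def norm_divide power_divide nrm_sq)
  then have "ip e e = 1" "ip f f = 1"
    using eS by (simp_all add: ip_self)
  then have "orthonormal {0} (\<lambda>_. e)" "orthonormal {0} (\<lambda>_. f)"
    using eS by (auto simp: orthonormal_def)
  then have "cmod (ip (T e) f) \<le> C"
    using C[unfolded nuclear_bound_def, rule_format, of "{0}" "\<lambda>_. e" "\<lambda>_. f"] by simp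
  moreover have "ip (T e) f = of_real (nrm (T x) / nrm x)"
  proof -
    have "ip (T e) f = of_real (1 / nrm x) * ip (T x) f"
      unfolding e_def using T x eS(2) by (rule adjoint_pair_scl)
    also have "ip (T x) f = of_real (1 / nrm (T x) * (nrm (T x))\<^sup>2)"
      using Tx by (simp add: f_def ip_self nrm_sq)
    finally show ?thesis using pT by (simp add: power2_eq_square)
  qed
  ultimately have "\<bar>nrm (T x) / nrm x\<bar> \<le> C" by (simp only: norm_of_real)
  then have "nrm (T x) / nrm x \<le> C" by linarith
  then have "nrm (T x) \<le> C * nrm x" using px by (simp add: field_simps)
  then have "(nrm (T x))\<^sup>2 \<le> (C * nrm x)\<^sup>2"
    using Tx by (intro power_mono) auto
  then show ?thesis using x Tx by (simp add: nrm_sq power_mult_distrib)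
qed

text \<open>Spectral theorem for the compact positive operator \<open>T' T\<close>. Zorn's lemma
  gives a maximal orthonormal set of eigenvectors. If a non-null vector were orthogonal to it,
  maximising \<open>nrm2 (T x)\<close> over unit vectors of the orthogonal complement would produce
  one more eigenvector. Injectivity excludes the singular value 0.\<close>

lemma singular_basis:
  assumes T: "adjoint_pair T T'" and ws: "weak_to_strong T" and C: "nuclear_bound T C"
    and inj: "\<And>x. x \<in> S \<Longrightarrow> nrm2 (T x) = 0 \<Longrightarrow> nrm2 x = 0"
  shows "\<exists>I e s. onb I e \<and> (\<forall>n\<in>I. s n > (0::real)) \<and>
    (\<forall>n\<in>I. \<forall>z\<in>S. ip (T (e n)) (T z) = of_real ((s n)\<^sup>2) * ip (e n) z)"
proof -
  have TS [simp]: "T x \<in> S" "T' x \<in> S" if "x \<in> S" for x using adjoint_pair_S[OF T that] by auto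
  have bd: "nrm2 (T x) \<le> C\<^sup>2 * nrm2 x" if "x \<in> S" for x using nuclear_bound_bounded[OF T C that] .
  \<comment> \<open>The last condition is the eigenvalue equation \<open>T' T x = \<mu> x\<close> in
    weak form; for a unit vector it forces \<open>\<mu> = nrm2 (T x)\<close>.\<close>
  define \<E> where "\<E> = {E. E \<subseteq> S \<and> (\<forall>x\<in>E. nrm2 x = 1) \<and> (\<forall>x\<in>E. \<forall>y\<in>E. x \<noteq> y \<longrightarrow> ip x y = 0) \<and>
      (\<forall>x\<in>E. \<exists>\<mu>::real. \<forall>z\<in>S. ip (T x) (T z) = of_real \<mu> * ip x z)}"
  have "\<exists>M\<in>\<E>. \<forall>X\<in>\<E>. M \<subseteq> X \<longrightarrow> X = M"
  proof (rule subset_Zorn')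
    fix \<C> assume ch: "subset.chain \<E> \<C>"
    then have sub: "\<And>E. E \<in> \<C> \<Longrightarrow> E \<in> \<E>" by (auto simp: subset.chain_def)
    have "ip x y = 0" if xy: "x \<in> \<Union>\<C>" "y \<in> \<Union>\<C>" "x \<noteq> y" for x y
    proof -
      obtain E1 E2 where E: "E1 \<in> \<C>" "x \<in> E1" "E2 \<in> \<C>" "y \<in> E2" using xy by blast
      then have "E1 \<subseteq> E2 \<or> E2 \<subseteq> E1" using ch by (auto simp: subset.chain_def)
      then obtain E3 where "E3 \<in> \<C>" "x \<in> E3" "y \<in> E3" using E by blast
      then show ?thesis using sub[of E3] xy(3) by (auto simp: \<E>_def)
    qed
    moreover have "x \<in> S \<and> nrm2 x = 1 \<and> (\<exists>\<mu>::real. \<forall>z\<in>S. ip (T x) (T z) = of_real \<mu> * ip x z)" if "x \<in> \<Union>\<C>" for x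
    proof -
      obtain G where "G \<in> \<E>" "x \<in> G" using sub \<open>x \<in> \<Union>\<C>\<close> by blast
      then have "G \<subseteq> S" "\<forall>x\<in>G. nrm2 x = 1"
        "\<forall>x\<in>G. \<exists>\<mu>::real. \<forall>z\<in>S. ip (T x) (T z) = of_real \<mu> * ip x z"
        by (simp_all add: \<E>_def)
      with \<open>x \<in> G\<close> show ?thesis by auto
    qed
    ultimately show "\<Union>\<C> \<in> \<E>"
      unfolding \<E>_def mem_Collect_eq by (intro conjI subsetI ballI impI) metis+
  qed
  then obtain E where E: "E \<in> \<E>" and max: "\<And>X. X \<in> \<E> \<Longrightarrow> E \<subseteq> X \<Longrightarrow> X = E" by blast
  have ES: "x \<in> S" if "x \<in> E" for x using E that by (auto simp: \<E>_def)
  have E1: "nrm2 x = 1" if "x \<in> E" for x using E that by (auto simp: \<E>_def)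
  have E0: "ip x y = 0" if "x \<in> E" "y \<in> E" "x \<noteq> y" for x y using E that by (auto simp: \<E>_def)
  define s where "s x = nrm (T x)" for x
  have s_pos: "s x > 0" if "x \<in> E" for x
    using inj[OF ES[OF that]] E1[OF that] ES[OF that] by (force simp: s_def nrm_def order_less_le)
  have eig: "ip (T x) (T z) = of_real ((s x)\<^sup>2) * ip x z" if xz: "x \<in> E" "z \<in> S" for x z
  proof -
    obtain \<mu> :: real where \<mu>: "\<And>z. z \<in> S \<Longrightarrow> ip (T x) (T z) = of_real \<mu> * ip x z"
    proof -
      have "\<exists>\<mu>::real. \<forall>z\<in>S. ip (T x) (T z) = of_real \<mu> * ip x z"
        using E xz(1) by (simp add: \<E>_def)
      with that show ?thesis by auto
    qed
    have "of_real (nrm2 (T x)) = (of_real \<mu> * of_real (nrm2 x) :: complex)"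
      using \<mu>[of x] ES[OF xz(1)] by (simp add: ip_self)
    then have "\<mu> = (s x)\<^sup>2"
      using E1[OF xz(1)] ES[OF xz(1)] by (simp add: s_def nrm_sq)
    then show ?thesis using \<mu> xz by simp
  qed
  have total: "nrm2 f = 0" if f: "f \<in> S" "\<And>x. x \<in> E \<Longrightarrow> ip f x = 0" for f
  proof (rule ccontr)
    assume nf: "nrm2 f \<noteq> 0"
    define X where "X = {x \<in> S. \<forall>e\<in>E. ip x e = 0}"
    have XS: "x \<in> S" if "x \<in> X" for x using that by (auto simp: X_def)
    have X_add: "add x y \<in> X" if "x \<in> X" "y \<in> X" for x y using that ES by (auto simp: X_def)
    have X_scl: "scl c x \<in> X" if "x \<in> X" for x c using that ES by (auto simp: X_def)
    have X_closed: "y \<in> X" if "\<And>n. Z n \<in> X" "y \<in> S" "lim_to Z y" for Z y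
    proof -
      have "ip y e = 0" if "e \<in> E" for e
      proof -
        have "(\<lambda>n. ip (Z n) e) \<longlonglongrightarrow> ip y e"
          using that \<open>\<And>n. Z n \<in> X\<close> XS ES \<open>y \<in> S\<close> \<open>lim_to Z y\<close> by (intro lim_to_ip_left) auto
        moreover have "ip (Z n) e = 0" for n using that \<open>\<And>n. Z n \<in> X\<close> by (auto simp: X_def)
        ultimately show ?thesis by (simp add: LIMSEQ_const_iff)
      qed
      then show ?thesis using that by (simp add: X_def)
    qed
    have fX: "f \<in> X" using f by (simp add: X_def)
    define U where "U = {x \<in> X. nrm2 x = 1}"
    \<comment> \<open>The candidate for the largest eigenvalue on the complement
      \<open>X\<close>.\<close>
    define lmax where "lmax = (SUP x\<in>U. nrm2 (T x))"
    have normalise: "scl (of_real (1 / nrm x)) x \<in> U" if "x \<in> X" "nrm2 x \<noteq> 0" for x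
      using that XS X_scl by (auto simp: U_def nrm_sq power_divide norm_divide)
    have bddU: "bdd_above ((\<lambda>x. nrm2 (T x)) ` U)"
    proof (rule bdd_aboveI2)
      fix x assume "x \<in> U"
      then show "nrm2 (T x) \<le> C\<^sup>2" using bd[of x] XS[of x] by (simp add: U_def)
    qed
    have lelmax: "nrm2 (T x) \<le> lmax * nrm2 x" if x: "x \<in> X" for x
    proof (cases "nrm2 x = 0")
      case True
      then show ?thesis using bd[OF XS[OF x]] by simp
    next
      case False
      let ?c = "of_real (1 / nrm x)"
      have "nrm2 (T (scl ?c x)) \<le> lmax"
        unfolding lmax_def using normalise[OF x False] bddU by (intro cSUP_upper) auto
      moreover have "nrm2 (T (scl ?c x)) = nrm2 (scl ?c (T x))"
        using XS[OF x] T by (intro nrm2_cong) (auto simp: adjoint_pair_scl simp del: of_real_divide)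
      ultimately have "(cmod ?c)\<^sup>2 * nrm2 (T x) \<le> lmax"
        using XS[OF x] by (simp only: nrm2_scl TS)
      then have "((cmod ?c)\<^sup>2 * nrm2 (T x)) * nrm2 x \<le> lmax * nrm2 x"
        using XS[OF x] by (intro mult_right_mono) auto
      moreover have "(cmod ?c)\<^sup>2 * nrm2 x = 1"
        using XS[OF x] False by (simp add: nrm_sq power_divide norm_divide)
      ultimately show ?thesis
        by (metis mult.assoc mult.commute mult_1)
    qed
    have "0 < nrm2 (T f)" using inj[OF f(1)] nf f(1) by (force simp: order_less_le)
    then have "0 < lmax * nrm2 f" using lelmax[OF fX] by linarith
    moreover have "0 < nrm2 f" using f(1) nf by (simp add: order_less_le)
    ultimately have lmaxpos: "lmax > 0" by (simp add: zero_less_mult_iff)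
    have "\<exists>x\<in>U. lmax - 1 / real (Suc n) < nrm2 (T x)" for n
      using less_cSUP_iff[OF _ bddU, of "lmax - 1 / real (Suc n)"] normalise[OF fX nf] by (auto simp: lmax_def)
    then obtain x0 where x0: "\<And>n. x0 n \<in> U" "\<And>n. lmax - 1 / real (Suc n) < nrm2 (T (x0 n))"
      by metis
    have x0S: "x0 n \<in> S" "nrm (x0 n) \<le> 1" for n using x0(1)[of n] XS by (auto simp: U_def nrm_def)
    obtain r :: "nat \<Rightarrow> nat" where r: "strict_mono r" "\<And>g. g \<in> S \<Longrightarrow> convergent (\<lambda>n. ip (x0 (r n)) g)"
      using weak_compactness[of x0 1, OF x0S] by auto
    define x where "x n = x0 (r n)" for n
    have xU: "x n \<in> X" "x n \<in> S" "nrm2 (x n) = 1" for n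
      using x0(1)[of "r n"] XS by (auto simp: x_def U_def)
    have xT: "lmax - 1 / real (Suc n) < nrm2 (T (x n))" for n
    proof -
      have "1 / real (Suc (r n)) \<le> 1 / real (Suc n)"
        using seq_suble[OF r(1), of n] by (simp add: field_simps)
      then show ?thesis using x0(2)[of "r n"] by (simp add: x_def)
    qed
    obtain y where y: "y \<in> S" "lim_to (\<lambda>n. T (x n)) y"
      using ws r(2) x0S unfolding weak_to_strong_def x_def by meson
    define \<delta> where "\<delta> n = (2 * (1 / real (Suc n)) + 2 * nrm2 (sub (T (x n)) y)) / lmax" for n
    \<comment> \<open>The parallelogram law is used for the images and for the vectors, linked by
      \<open>lelmax\<close> at \<open>x m + x n\<close>. Since the images converge strongly, the
      maximising sequence itself becomes Cauchy.\<close>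
    have est: "nrm2 (sub (x m) (x n)) \<le> \<delta> m + \<delta> n" for m n
    proof -
      have "nrm2 (T (add (x m) (x n))) = nrm2 (add (T (x m)) (T (x n)))"
        using xU T by (intro nrm2_cong) (auto simp: adjoint_pair_add)
      also have "\<dots> = 2 * nrm2 (T (x m)) + 2 * nrm2 (T (x n)) - nrm2 (sub (T (x m)) (T (x n)))"
        using xU by (simp add: nrm2_def)
      finally have "2 * nrm2 (T (x m)) + 2 * nrm2 (T (x n)) - nrm2 (sub (T (x m)) (T (x n))) \<le> lmax * nrm2 (add (x m) (x n))"
        using lelmax[OF X_add[OF xU(1) xU(1)], of m n] by simp
      moreover have "nrm2 (sub (T (x m)) (T (x n))) \<le> 2 * nrm2 (sub (T (x m)) y) + 2 * nrm2 (sub (T (x n)) y)"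
        using nrm2_sub_triangle[of "T (x m)" y "T (x n)"] y(1) xU nrm_sub_commute[of y "T (x n)"] by simp
      moreover have "nrm2 (add (x m) (x n)) = 4 - nrm2 (sub (x m) (x n))"
        using xU by (simp add: nrm2_add nrm2_sub)
      ultimately have "lmax * nrm2 (sub (x m) (x n)) \<le> 2 * (1 / real (Suc m)) + 2 * (1 / real (Suc n))
          + 2 * nrm2 (sub (T (x m)) y) + 2 * nrm2 (sub (T (x n)) y)"
        using xT[of m] xT[of n] by (simp only: right_diff_distrib)
      then have "nrm2 (sub (x m) (x n)) \<le> (2 * (1 / real (Suc m)) + 2 * (1 / real (Suc n))
          + 2 * nrm2 (sub (T (x m)) y) + 2 * nrm2 (sub (T (x n)) y)) / lmax"
        using lmaxpos by (subst pos_le_divide_eq) (simp_all only: mult.commute)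
      also have "\<dots> = \<delta> m + \<delta> n"
        unfolding \<delta>_def by (simp only: add_divide_distrib)
      finally show ?thesis .
    qed
    have \<delta>0: "\<delta> \<longlonglongrightarrow> 0"
    proof -
      have "(\<lambda>n. (2 * (1 / real (Suc n)) + 2 * nrm2 (sub (T (x n)) y)) / lmax) \<longlonglongrightarrow> (2 * 0 + 2 * 0) / lmax"
        using y(2) lmaxpos unfolding lim_to_def by (intro tendsto_intros LIMSEQ_Suc lim_1_over_n) auto
      then show ?thesis by (simp add: \<delta>_def[abs_def])
    qed
    have "\<exists>u\<in>S. lim_to x u"
    proof (rule complete[OF xU(2)])
      fix \<epsilon> :: real assume "\<epsilon> > 0"
      then have "\<forall>\<^sub>F n in sequentially. \<delta> n < \<epsilon> / 2"
        using \<delta>0 by (intro order_tendstoD) auto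
      then obtain N where "\<And>n. n \<ge> N \<Longrightarrow> \<delta> n < \<epsilon> / 2" by (auto simp: eventually_sequentially)
      then show "\<exists>N. \<forall>m\<ge>N. \<forall>n\<ge>N. nrm2 (sub (x m) (x n)) < \<epsilon>"
      proof (intro exI[of _ N] allI impI)
        fix m n assume "m \<ge> N" "n \<ge> N"
        then have "\<delta> m < \<epsilon> / 2" "\<delta> n < \<epsilon> / 2"
          using \<open>\<And>n. n \<ge> N \<Longrightarrow> \<delta> n < \<epsilon> / 2\<close> by auto
        then show "nrm2 (sub (x m) (x n)) < \<epsilon>" using est[of m n] by linarith
      qed
    qed
    then obtain u where u: "u \<in> S" "lim_to x u" by blast
    have uX: "u \<in> X" by (rule X_closed[OF xU(1) u])
    have u1: "nrm2 u = 1"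
      using lim_to_nrm2[OF xU(2) u] xU(3) by (simp add: LIMSEQ_const_iff)
    have "lim_to (\<lambda>n. T (x n)) (T u)"
      unfolding lim_to_def
    proof (rule tendsto_sandwich[of "\<lambda>_. 0" _ _ "\<lambda>n. C\<^sup>2 * nrm2 (sub (x n) u)"])
      show "\<forall>\<^sub>F n in sequentially. nrm2 (sub (T (x n)) (T u)) \<le> C\<^sup>2 * nrm2 (sub (x n) u)"
      proof (intro always_eventually allI)
        fix n
        have "nrm2 (sub (T (x n)) (T u)) = nrm2 (T (sub (x n) u))"
          by (rule nrm2_cong) (use T xU u in \<open>simp_all add: adjoint_pair_sub\<close>)
        then show "nrm2 (sub (T (x n)) (T u)) \<le> C\<^sup>2 * nrm2 (sub (x n) u)"
          using bd[of "sub (x n) u"] xU u by simp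
      qed
      show "(\<lambda>n. C\<^sup>2 * nrm2 (sub (x n) u)) \<longlonglongrightarrow> 0"
        using tendsto_mult_left[OF u(2)[unfolded lim_to_def], of "C\<^sup>2"] by simp
    qed (use xU u in auto)
    then have lim1: "(\<lambda>n. nrm2 (T (x n))) \<longlonglongrightarrow> nrm2 (T u)"
      using xU u by (intro lim_to_nrm2) auto
    have lim2: "(\<lambda>n. lmax - 1 / real (Suc n)) \<longlonglongrightarrow> lmax - 0"
      by (intro tendsto_intros LIMSEQ_Suc lim_1_over_n)
    have "lmax - 0 \<le> nrm2 (T u)"
    proof (rule LIMSEQ_le[OF lim2 lim1])
      show "\<exists>N. \<forall>n\<ge>N. lmax - 1 / real (Suc n) \<le> nrm2 (T (x n))"
        by (intro exI[of _ 0] allI impI less_imp_le xT)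
    qed
    with lelmax[OF uX] u1 have Tu: "nrm2 (T u) = lmax" by simp
    \<comment> \<open>First variation at the maximiser:
      \<open>lmax * nrm2 (u + t z) - nrm2 (T (u + t z))\<close> is nonnegative and vanishes at
      \<open>t = 0\<close>.\<close>
    have eigX: "ip (T u) (T z) = of_real lmax * ip u z" if z: "z \<in> X" for z
    proof -
      have "of_real lmax * ip u z - ip (T u) (T z) = 0"
      proof (rule quadratic_nonneg_imp_zero)
        fix t :: complex
        have "nrm2 (T (add u (scl t z))) = nrm2 (add (T u) (scl t (T z)))"
          using u(1) XS[OF z] T by (intro nrm2_cong) (auto simp: adjoint_pair_add adjoint_pair_scl)
        also have "\<dots> = lmax + 2 * Re (cnj t * ip (T u) (T z)) + (cmod t)\<^sup>2 * nrm2 (T z)"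
          using u(1) XS[OF z] Tu by (subst nrm2_add) auto
        finally have "lmax + 2 * Re (cnj t * ip (T u) (T z)) + (cmod t)\<^sup>2 * nrm2 (T z) \<le> lmax * nrm2 (add u (scl t z))"
          using lelmax[OF X_add[OF uX X_scl[OF z]], of t] by simp
        also have "nrm2 (add u (scl t z)) = 1 + 2 * Re (cnj t * ip u z) + (cmod t)\<^sup>2 * nrm2 z"
          using u(1) XS[OF z] u1 by (subst nrm2_add) auto
        finally show "0 \<le> 2 * Re (cnj t * (of_real lmax * ip u z - ip (T u) (T z))) + (cmod t)\<^sup>2 * (lmax * nrm2 z - nrm2 (T z))"
          by (simp add: algebra_simps)
      qed
      then show ?thesis by simp
    qed
    \<comment> \<open>\<open>T' (T u)\<close> is orthogonal to \<open>E\<close>, because members of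
      \<open>E\<close> are eigenvectors, and so lies in \<open>X\<close>. Replacing \<open>z\<close>
      by its projection to \<open>X\<close> therefore changes neither side.\<close>
    have eigS: "ip (T u) (T z) = of_real lmax * ip u z" if z: "z \<in> S" for z
    proof -
      have "\<exists>w\<in>X. \<forall>v\<in>X. ip (sub z w) v = 0"
      proof (rule projection)
        show "X \<subseteq> S" "X \<noteq> {}" using XS fX by auto
        show "y \<in> X" if "\<And>n. Z n \<in> X" "y \<in> S" "lim_to Z y" for Z y
          by (rule X_closed[OF that])
        show "add x y \<in> X" if "x \<in> X" "y \<in> X" for x y by (rule X_add[OF that])
        show "scl c x \<in> X" if "x \<in> X" for c x by (rule X_scl[OF that])
      qed (rule z)
      then obtain w where w: "w \<in> X" "\<And>v. v \<in> X \<Longrightarrow> ip (sub z w) v = 0" by auto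
      have wS: "w \<in> S" using XS[OF w(1)] .
      have "T' (T u) \<in> X"
      proof -
        have "ip (T' (T u)) e = 0" if e: "e \<in> E" for e
        proof -
          have "ip e (T' (T u)) = ip (T e) (T u)"
            using T ES[OF e] u(1) TS(1)[OF u(1)] unfolding adjoint_pair_def by simp
          also have "\<dots> = of_real ((s e)\<^sup>2) * ip e u" by (rule eig[OF e u(1)])
          also have "ip e u = 0"
            using uX e ip_cnj[of u e] ES[OF e] u(1) by (simp add: X_def)
          finally show ?thesis using ip_cnj[of e "T' (T u)"] ES[OF e] u(1) by simp
        qed
        then show ?thesis using u(1) by (simp add: X_def)
      qed
      then have "ip (sub z w) (T' (T u)) = 0" by (rule w(2))
      then have "ip (T (sub z w)) (T u) = 0"
        using T z wS u(1) unfolding adjoint_pair_def by simp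
      then have "ip (T z) (T u) = ip (T w) (T u)"
        using T z wS u(1) by (simp add: adjoint_pair_sub)
      then have 1: "ip (T u) (T z) = ip (T u) (T w)"
        using z wS u(1) ip_cnj[of "T z" "T u"] ip_cnj[of "T w" "T u"] by simp
      have "ip (sub z w) u = 0" by (rule w(2)[OF uX])
      then have "ip z u = ip w u" using z wS u(1) by simp
      then have "ip u z = ip u w"
        using z wS u(1) ip_cnj[of z u] ip_cnj[of w u] by simp
      then show ?thesis using 1 eigX[OF w(1)] by simp
    qed
    have "insert u E \<in> \<E>"
    proof -
      have "ip u e = 0" "ip e u = 0" if "e \<in> E" for e
        using uX that ip_cnj[of u e] ES[OF that] u(1) by (auto simp: X_def)
      moreover have "E \<subseteq> S" "\<forall>x\<in>E. nrm2 x = 1" "\<forall>x\<in>E. \<forall>y\<in>E. x \<noteq> y \<longrightarrow> ip x y = 0"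
        "\<forall>x\<in>E. \<exists>\<mu>::real. \<forall>z\<in>S. ip (T x) (T z) = of_real \<mu> * ip x z"
        using E by (simp_all add: \<E>_def)
      moreover have "\<exists>\<mu>::real. \<forall>z\<in>S. ip (T u) (T z) = of_real \<mu> * ip u z"
        using eigS by blast
      ultimately show ?thesis
        using u(1) u1 by (simp add: \<E>_def)
    qed
    then have "u \<in> E" using max[of "insert u E"] by blast
    then have "ip u u = 0" using uX by (simp add: X_def)
    then show False using u1 by (simp add: nrm2_def)
  qed
  \<comment> \<open>The vectors \<open>T (e n)\<close> are mutually orthogonal with norms
    \<open>s (e n)\<close>; pairing \<open>e n\<close> with the normalised image in
    \<open>nuclear_bound\<close> sums the singular values. This bound is what makes \<open>E\<close>
    countable.\<close>
  have fin_bd: "sum s F \<le> C" if F: "finite F" "F \<subseteq> E" for F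
  proof -
    obtain J :: "nat set" and e where bij: "bij_betw e J F"
      using countable_nat_indexing countable_finite[OF F(1)] by blast
    have finJ: "finite J" using bij F(1) bij_betw_finite by blast
    have eE: "e n \<in> E" if "n \<in> J" for n using bij that F(2) by (auto simp: bij_betw_def)
    have einj: "e m = e n \<longleftrightarrow> m = n" if "m \<in> J" "n \<in> J" for m n
      using bij that by (auto simp: bij_betw_def inj_on_def)
    have oe: "orthonormal J e"
      unfolding orthonormal_def using eE ES einj E0 by (auto simp: ip_self E1)
    define f where "f n = scl (of_real (1 / s (e n))) (T (e n))" for n
    have Te: "ip (T (e m)) (T (e n)) = (if m = n then of_real ((s (e m))\<^sup>2) else 0)" if "m \<in> J" "n \<in> J" for m n
      using eig[OF eE[OF that(1)] ES[OF eE[OF that(2)]]] oe that by (auto simp: orthonormal_def)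
    have eS: "e n \<in> S" "s (e n) \<noteq> 0" if "n \<in> J" for n
      using eE[OF that] ES s_pos[OF eE[OF that]] by auto
    have "ip (f m) (f n) = (if m = n then 1 else 0)" if "m \<in> J" "n \<in> J" for m n
    proof -
      have "ip (f m) (f n) = of_real (1 / s (e m)) * (of_real (1 / s (e n)) * ip (T (e m)) (T (e n)))"
        unfolding f_def using eS[OF that(1)] eS[OF that(2)] by simp
      then show ?thesis using Te[OF that] eS(2)[OF that(1)] eS(2)[OF that(2)]
        by (cases "m = n") (simp_all add: power2_eq_square)
    qed
    then have "orthonormal J f"
      using eS by (simp add: orthonormal_def f_def)
    then have "(\<Sum>n\<in>J. cmod (ip (T (e n)) (f n))) \<le> C"
      using C oe finJ unfolding nuclear_bound_def by blast
    moreover have "cmod (ip (T (e n)) (f n)) = s (e n)" if "n \<in> J" for n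
    proof -
      have "ip (T (e n)) (f n) = of_real (s (e n))"
        using Te[OF that that] eE[OF that] ES s_pos[OF eE[OF that]] by (simp add: f_def power2_eq_square)
      then show ?thesis using s_pos[OF eE[OF that]] by simp
    qed
    ultimately have "(\<Sum>n\<in>J. s (e n)) \<le> C" by simp
    then show ?thesis using sum.reindex_bij_betw[OF bij, of s] by simp
  qed
  have "s summable_on E"
  proof (rule nonneg_bdd_above_summable_on)
    show "0 \<le> s x" if "x \<in> E" for x using s_pos[OF that] by simp
    show "bdd_above (sum s ` {F. F \<subseteq> E \<and> finite F})"
      by (rule bdd_aboveI[of _ C]) (use fin_bd in auto)
  qed
  then have "countable {x\<in>E. s x \<noteq> 0}" by (rule summable_countable_real)
  moreover have "{x\<in>E. s x \<noteq> 0} = E" using s_pos by fastforce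
  ultimately have cE: "countable E" by simp
  obtain I :: "nat set" and e where bij: "bij_betw e I E"
    using countable_nat_indexing[OF cE] by blast
  have eE: "e n \<in> E" if "n \<in> I" for n using bij that by (auto simp: bij_betw_def)
  have einj: "e m = e n \<longleftrightarrow> m = n" if "m \<in> I" "n \<in> I" for m n
    using bij that by (auto simp: bij_betw_def inj_on_def)
  have "orthonormal I e"
    unfolding orthonormal_def using eE ES einj E0 by (auto simp: ip_self E1)
  moreover have "nrm2 f = 0" if "f \<in> S" "\<And>n. n \<in> I \<Longrightarrow> ip f (e n) = 0" for f
  proof (rule total[OF that(1)])
    fix x assume "x \<in> E"
    then obtain n where "n \<in> I" "x = e n" using bij by (auto simp: bij_betw_def)
    then show "ip f x = 0" using that(2) by simp
  qed
  ultimately have "onb I e" by (simp add: onb_def)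
  then show ?thesis
    by (intro exI[of _ I] exI[of _ e] exI[of _ "\<lambda>n. s (e n)"] conjI ballI s_pos eig eE)
qed

end

section \<open>Absolute value of an injective nuclear operator\<close>

context semi_hilbert
begin

text \<open>\<open>P\<close> multiplies the n-th coefficient in the singular basis by
  \<open>s n\<close>; its properties follow from Parseval. Linearity is stated weakly because
  \<open>P\<close> is fixed only modulo null vectors. The existence of a basis is exported because
  it makes the trace unique.\<close>

theorem nuclear_absolute_value:
  assumes T: "nuclear T t" and inj: "\<And>x. x \<in> S \<Longrightarrow> nrm2 (T x) = 0 \<Longrightarrow> nrm2 x = 0"
  obtains P where "\<And>x. x \<in> S \<Longrightarrow> P x \<in> S"
    "\<And>x y. x \<in> S \<Longrightarrow> y \<in> S \<Longrightarrow> ip (P x) (P y) = ip (T x) (T y)"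
    "\<And>x. x \<in> S \<Longrightarrow> Im (ip (P x) x) = 0 \<and> 0 \<le> Re (ip (P x) x)"
    "\<And>a b x y z. x \<in> S \<Longrightarrow> y \<in> S \<Longrightarrow> z \<in> S \<Longrightarrow>
       ip (P (add (scl a x) (scl b y))) z = a * ip (P x) z + b * ip (P y) z"
    "\<And>I e. onb I e \<Longrightarrow> (\<lambda>n. ip (P (e n)) (e n)) summable_on I"
    "\<exists>I e. onb I e"
proof -
  obtain T' C where T': "adjoint_pair T T'" and ws: "weak_to_strong T" and C: "nuclear_bound T C"
    using T by (auto simp: nuclear_def)
  obtain I e s where e: "onb I e" and s': "\<forall>n\<in>I. s n > (0::real)"
    and eig': "\<forall>n\<in>I. \<forall>z\<in>S. ip (T (e n)) (T z) = of_real ((s n)\<^sup>2) * ip (e n) z"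
    using singular_basis[OF T' ws C] inj by auto
  note s = s'[rule_format] and eig = eig'[rule_format]
  have on: "orthonormal I e" using e by (simp add: onb_def)
  have eS: "e n \<in> S" if "n \<in> I" for n using on that by (simp add: orthonormal_def)
  have TS [simp]: "T x \<in> S" "T' x \<in> S" if "x \<in> S" for x using adjoint_pair_S[OF T' that] by auto
  have sum_s: "sum s F \<le> C" if F: "finite F" "F \<subseteq> I" for F
  proof -
    define f where "f n = scl (of_real (1 / s n)) (T (e n))" for n
    have Te: "ip (T (e m)) (T (e n)) = (if m = n then of_real ((s m)\<^sup>2) else 0)" if "m \<in> F" "n \<in> F" for m n
      using eig[of m "e n"] on that F(2) eS[of n] by (auto simp: orthonormal_def subset_iff)
    have "ip (f m) (f n) = (if m = n then 1 else 0)" if "m \<in> F" "n \<in> F" for m n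
    proof -
      have "ip (f m) (f n) = of_real (1 / s m) * (of_real (1 / s n) * ip (T (e m)) (T (e n)))"
        unfolding f_def using eS that F(2) by (simp add: subset_iff)
      then show ?thesis using Te[OF that] s[of m] s[of n] that F(2)
        by (cases "m = n") (auto simp: power2_eq_square subset_iff)
    qed
    then have "orthonormal F f"
      using eS F(2) by (simp add: orthonormal_def f_def subset_iff)
    then have "(\<Sum>n\<in>F. cmod (ip (T (e n)) (f n))) \<le> C"
      using C orthonormal_mono[OF on F(2)] F(1) unfolding nuclear_bound_def by blast
    moreover have "cmod (ip (T (e n)) (f n)) = s n" if "n \<in> F" for n
    proof -
      have "ip (T (e n)) (f n) = of_real (s n)"
        using Te[OF that that] that F(2) eS s[of n] by (auto simp: f_def power2_eq_square subset_iff)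
      then show ?thesis using s[of n] that F(2) by auto
    qed
    ultimately show ?thesis by simp
  qed
  have sC: "s n \<le> C" if "n \<in> I" for n using sum_s[of "{n}"] that by simp
  have "\<exists>y\<in>S. \<forall>n\<in>I. ip y (e n) = of_real (s n) * ip x (e n)" if x: "x \<in> S" for x
  proof -
    have "(\<Sum>n\<in>F. (cmod (of_real (s n) * ip x (e n)))\<^sup>2) \<le> C\<^sup>2 * nrm2 x" if F: "finite F" "F \<subseteq> I" for F
    proof -
      have "(\<Sum>n\<in>F. (cmod (of_real (s n) * ip x (e n)))\<^sup>2) \<le> (\<Sum>n\<in>F. C\<^sup>2 * (cmod (ip x (e n)))\<^sup>2)"
      proof (rule sum_mono)
        fix n assume "n \<in> F"
        then have "0 < s n" "s n \<le> C" using s sC F by auto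
        then have "(s n)\<^sup>2 \<le> C\<^sup>2" by (intro power_mono) auto
        then show "(cmod (of_real (s n) * ip x (e n)))\<^sup>2 \<le> C\<^sup>2 * (cmod (ip x (e n)))\<^sup>2"
          by (simp add: norm_mult power_mult_distrib mult_right_mono)
      qed
      also have "\<dots> = C\<^sup>2 * (\<Sum>n\<in>F. (cmod (ip x (e n)))\<^sup>2)" by (simp add: sum_distrib_left)
      also have "\<dots> \<le> C\<^sup>2 * nrm2 x"
        using bessel[OF orthonormal_mono[OF on F(2)] F(1) x] by (intro mult_left_mono) auto
      finally show ?thesis .
    qed
    from riesz_fischer[OF on this] show ?thesis by metis
  qed
  then obtain P where PS [simp]: "\<And>x. x \<in> S \<Longrightarrow> P x \<in> S"
    and P: "\<And>x n. x \<in> S \<Longrightarrow> n \<in> I \<Longrightarrow> ip (P x) (e n) = of_real (s n) * ip x (e n)"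
    by metis
  have P1: "ip (P x) (P y) = ip (T x) (T y)" if "x \<in> S" "y \<in> S" for x y
  proof (rule has_sum_unique)
    show "((\<lambda>n. ip (P x) (e n) * cnj (ip (P y) (e n))) has_sum ip (P x) (P y)) I"
      by (rule onb_expansion[OF e]) (use that in auto)
    have adj: "ip x (T' (T y)) = ip (T x) (T y)"
      using T' that unfolding adjoint_pair_def by simp
    have "((\<lambda>n. ip x (e n) * cnj (ip (T' (T y)) (e n))) has_sum ip (T x) (T y)) I"
      unfolding adj[symmetric] by (rule onb_expansion[OF e]) (use that in auto)
    moreover have "ip x (e n) * cnj (ip (T' (T y)) (e n)) = ip (P x) (e n) * cnj (ip (P y) (e n))" if n: "n \<in> I" for n
    proof -
      have "cnj (ip (T' (T y)) (e n)) = ip (e n) (T' (T y))"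
        by (rule ip_cnj[symmetric]) (use eS[OF n] \<open>y \<in> S\<close> in auto)
      also have "\<dots> = ip (T (e n)) (T y)"
        using T' eS[OF n] \<open>y \<in> S\<close> unfolding adjoint_pair_def by simp
      also have "\<dots> = of_real ((s n)\<^sup>2) * ip (e n) y" by (rule eig[OF n \<open>y \<in> S\<close>])
      also have "ip (e n) y = cnj (ip y (e n))" by (rule ip_cnj[OF \<open>y \<in> S\<close> eS[OF n]])
      finally show ?thesis
        using P[OF \<open>x \<in> S\<close> n] P[OF \<open>y \<in> S\<close> n] by (simp add: power2_eq_square)
    qed
    ultimately show "((\<lambda>n. ip (P x) (e n) * cnj (ip (P y) (e n))) has_sum ip (T x) (T y)) I"
      by (simp cong: has_sum_cong)
  qed
  have P_exp: "((\<lambda>n. of_real (s n * (cmod (ip x (e n)))\<^sup>2)) has_sum ip (P x) x) I" if x: "x \<in> S" for x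
  proof -
    have "((\<lambda>n. ip (P x) (e n) * cnj (ip x (e n))) has_sum ip (P x) x) I"
      by (rule onb_expansion[OF e]) (use x in auto)
    moreover have "ip (P x) (e n) * cnj (ip x (e n)) = of_real (s n * (cmod (ip x (e n)))\<^sup>2)" if "n \<in> I" for n
      using P[OF x that] complex_norm_square[of "ip x (e n)"] by (simp only: of_real_mult mult.assoc)
    ultimately show ?thesis by (simp cong: has_sum_cong)
  qed
  have P_real: "((\<lambda>n. s n * (cmod (ip x (e n)))\<^sup>2) has_sum Re (ip (P x) x)) I" "Im (ip (P x) x) = 0" if x: "x \<in> S" for x
    using has_sum_Re[OF P_exp[OF x]] has_sum_unique[OF has_sum_Im[OF P_exp[OF x]], of 0] by simp_all
  show ?thesis
  proof (rule that[of P])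
    show "Im (ip (P x) x) = 0 \<and> 0 \<le> Re (ip (P x) x)" if "x \<in> S" for x
      using P_real(2)[OF that] has_sum_nonneg[OF P_real(1)[OF that]] s by (simp add: less_imp_le)
    show "ip (P (add (scl a x) (scl b y))) z = a * ip (P x) z + b * ip (P y) z"
      if x: "x \<in> S" and y: "y \<in> S" and z: "z \<in> S" for a b x y z
    proof -
      let ?u = "P (add (scl a x) (scl b y))" and ?v = "add (scl a (P x)) (scl b (P y))"
      have "ip ?u z = ip ?v z"
      proof (rule has_sum_unique)
        show "((\<lambda>n. ip ?u (e n) * cnj (ip z (e n))) has_sum ip ?u z) I"
          by (rule onb_expansion[OF e]) (use x y z in auto)
        have "((\<lambda>n. ip ?v (e n) * cnj (ip z (e n))) has_sum ip ?v z) I"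
          by (rule onb_expansion[OF e]) (use x y z in auto)
        moreover have "ip ?u (e n) = ip ?v (e n)" if "n \<in> I" for n
          using P that x y eS by (simp add: algebra_simps)
        ultimately show "((\<lambda>n. ip ?u (e n) * cnj (ip z (e n))) has_sum ip ?v z) I"
          by (simp cong: has_sum_cong)
      qed
      then show ?thesis using x y z by simp
    qed
    show "(\<lambda>n. ip (P (b n)) (b n)) summable_on J" if b: "onb J b" for J b
    proof -
      have bo: "orthonormal J b" using b by (simp add: onb_def)
      have bS: "b n \<in> S" if "n \<in> J" for n using bo that by (simp add: orthonormal_def)
      \<comment> \<open>Expand every \<open>ip (P (b m)) (b m)\<close> in the singular basis and
        exchange the sums. By Bessel's inequality for \<open>b\<close>, each \<open>s n\<close>
        receives a weight of at most 1.\<close>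
      have bound: "(\<Sum>m\<in>F. Re (ip (P (b m)) (b m))) \<le> C" if F: "finite F" "F \<subseteq> J" for F
      proof (rule has_sum_le_finite_sums)
        show "((\<lambda>n. \<Sum>m\<in>F. s n * (cmod (ip (b m) (e n)))\<^sup>2) has_sum (\<Sum>m\<in>F. Re (ip (P (b m)) (b m)))) I"
          using F bS by (intro has_sum_finite_sum P_real(1)) auto
        fix G assume G: "finite G" "G \<subseteq> I"
        have "(\<Sum>m\<in>F. s n * (cmod (ip (b m) (e n)))\<^sup>2) \<le> s n" if n: "n \<in> I" for n
        proof -
          have "(\<Sum>m\<in>F. (cmod (ip (b m) (e n)))\<^sup>2) = (\<Sum>m\<in>F. (cmod (ip (e n) (b m)))\<^sup>2)"
          proof (rule sum.cong[OF refl])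
            fix m assume "m \<in> F"
            then have "ip (b m) (e n) = cnj (ip (e n) (b m))"
              using ip_cnj[OF eS[OF n] bS] F(2) by blast
            then show "(cmod (ip (b m) (e n)))\<^sup>2 = (cmod (ip (e n) (b m)))\<^sup>2" by simp
          qed
          also have "\<dots> \<le> nrm2 (e n)" using bessel[OF orthonormal_mono[OF bo F(2)] F(1) eS[OF n]] .
          also have "nrm2 (e n) = 1" using on n by (simp add: nrm2_def orthonormal_def)
          finally show ?thesis
            using mult_left_mono[of _ 1 "s n"] s[OF n] by (simp add: sum_distrib_left[symmetric])
        qed
        then have "(\<Sum>n\<in>G. \<Sum>m\<in>F. s n * (cmod (ip (b m) (e n)))\<^sup>2) \<le> sum s G"
          using G by (intro sum_mono) auto
        also have "\<dots> \<le> C" using sum_s[OF G] .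
        finally show "(\<Sum>n\<in>G. \<Sum>m\<in>F. s n * (cmod (ip (b m) (e n)))\<^sup>2) \<le> C" .
      qed
      have nonneg: "0 \<le> Re (ip (P (b m)) (b m))" if "m \<in> J" for m
        using has_sum_nonneg[OF P_real(1)[OF bS[OF that]]] s by (simp add: less_imp_le)
      have "(\<lambda>m. Re (ip (P (b m)) (b m))) summable_on J"
        by (rule nonneg_bdd_above_summable_on) (use nonneg bound in \<open>auto intro!: bdd_aboveI[of _ C]\<close>)
      then have "(\<lambda>m. complex_of_real (Re (ip (P (b m)) (b m)))) summable_on J"
        by (rule summable_on_of_real)
      moreover have "complex_of_real (Re (ip (P (b m)) (b m))) = ip (P (b m)) (b m)" if "m \<in> J" for m
        using P_real(2)[OF bS[OF that]] by (simp add: complex_eq_iff)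
      ultimately show ?thesis by (simp cong: summable_on_cong)
    qed
    show "\<exists>I e. onb I e" using e by blast
  qed (use P1 in auto)
qed

section \<open>Closure properties of nuclear operators\<close>

lemma nuclear_S: "nuclear T t \<Longrightarrow> x \<in> S \<Longrightarrow> T x \<in> S"
  by (auto simp: nuclear_def adjoint_pair_def)

lemma nuclear_add:
  assumes "nuclear T t" "nuclear U u"
  shows "nuclear (\<lambda>x. add (T x) (U x)) (t + u)"
proof -
  obtain T' C where T: "adjoint_pair T T'" "weak_to_strong T" "nuclear_bound T C"
    and Tt: "\<And>I e. onb I e \<Longrightarrow> ((\<lambda>n. ip (T (e n)) (e n)) has_sum t) I"
    using assms(1) by (auto simp: nuclear_def)
  obtain U' D where U: "adjoint_pair U U'" "weak_to_strong U" "nuclear_bound U D"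
    and Uu: "\<And>I e. onb I e \<Longrightarrow> ((\<lambda>n. ip (U (e n)) (e n)) has_sum u) I"
    using assms(2) by (auto simp: nuclear_def)
  have [simp]: "T x \<in> S" "U x \<in> S" "T' x \<in> S" "U' x \<in> S" if "x \<in> S" for x
    using that T(1) U(1) by (auto simp: adjoint_pair_def)
  have "adjoint_pair (\<lambda>x. add (T x) (U x)) (\<lambda>x. add (T' x) (U' x))"
    using T(1) U(1) unfolding adjoint_pair_def by simp
  moreover have "weak_to_strong (\<lambda>x. add (T x) (U x))"
    unfolding weak_to_strong_def
  proof (intro allI impI)
    fix X B assume X: "\<forall>n::nat. X n \<in> S \<and> nrm (X n) \<le> B" "\<forall>z\<in>S. convergent (\<lambda>n. ip (X n) z)"
    obtain y z where y: "y \<in> S" "lim_to (\<lambda>n. T (X n)) y" and z: "z \<in> S" "lim_to (\<lambda>n. U (X n)) z"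
      using T(2) U(2) X unfolding weak_to_strong_def by metis
    have "lim_to (\<lambda>n. add (T (X n)) (U (X n))) (add y z)"
      unfolding lim_to_def
    proof (rule tendsto_sandwich[of "\<lambda>_. 0" _ _ "\<lambda>n. 2 * nrm2 (sub (T (X n)) y) + 2 * nrm2 (sub (U (X n)) z)"])
      show "\<forall>\<^sub>F n in sequentially. nrm2 (sub (add (T (X n)) (U (X n))) (add y z))
          \<le> 2 * nrm2 (sub (T (X n)) y) + 2 * nrm2 (sub (U (X n)) z)"
      proof (intro always_eventually allI)
        fix n
        have "nrm2 (sub (add (T (X n)) (U (X n))) (add y z)) + nrm2 (sub (sub (T (X n)) y) (sub (U (X n)) z))
           = 2 * nrm2 (sub (T (X n)) y) + 2 * nrm2 (sub (U (X n)) z)"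
          using X y z by (simp add: nrm2_def)
        moreover have "0 \<le> nrm2 (sub (sub (T (X n)) y) (sub (U (X n)) z))"
          using X y z by (intro nrm2_nonneg) auto
        ultimately show "nrm2 (sub (add (T (X n)) (U (X n))) (add y z))
          \<le> 2 * nrm2 (sub (T (X n)) y) + 2 * nrm2 (sub (U (X n)) z)" by linarith
      qed
      have "(\<lambda>n. 2 * nrm2 (sub (T (X n)) y) + 2 * nrm2 (sub (U (X n)) z)) \<longlonglongrightarrow> 2 * 0 + 2 * 0"
        using y(2) z(2) unfolding lim_to_def by (intro tendsto_intros)
      then show "(\<lambda>n. 2 * nrm2 (sub (T (X n)) y) + 2 * nrm2 (sub (U (X n)) z)) \<longlonglongrightarrow> 0" by simp
    qed (use X y z in \<open>auto intro!: always_eventually nrm2_nonneg\<close>)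
    then show "\<exists>y\<in>S. lim_to (\<lambda>n. add (T (X n)) (U (X n))) y"
      using y(1) z(1) by (intro bexI[of _ "add y z"]) auto
  qed
  moreover have "nuclear_bound (\<lambda>x. add (T x) (U x)) (C + D)"
    unfolding nuclear_bound_def
  proof (intro allI impI)
    fix F e f assume F: "finite F" "orthonormal F e" "orthonormal F f"
    have "(\<Sum>n\<in>F. cmod (ip (add (T (e n)) (U (e n))) (f n))) 
      \<le> (\<Sum>n\<in>F. cmod (ip (T (e n)) (f n)) + cmod (ip (U (e n)) (f n)))"
      using F by (intro sum_mono) (auto simp: orthonormal_def norm_triangle_ineq)
    also have "\<dots> \<le> C + D"
      unfolding sum.distrib using T(3) U(3) F unfolding nuclear_bound_def by (intro add_mono) auto
    finally show "(\<Sum>n\<in>F. cmod (ip (add (T (e n)) (U (e n))) (f n))) \<le> C + D" .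
  qed
  moreover have "((\<lambda>n. ip (add (T (e n)) (U (e n))) (e n)) has_sum (t + u)) I" if e: "onb I e" for I e
  proof -
    have "((\<lambda>n. ip (T (e n)) (e n) + ip (U (e n)) (e n)) has_sum (t + u)) I"
      by (rule has_sum_add[OF Tt[OF e] Uu[OF e]])
    moreover have "ip (T (e n)) (e n) + ip (U (e n)) (e n) = ip (add (T (e n)) (U (e n))) (e n)" if "n \<in> I" for n
      using e that by (simp add: onb_def orthonormal_def)
    ultimately show ?thesis by (simp cong: has_sum_cong)
  qed
  ultimately show ?thesis unfolding nuclear_def by blast
qed

text \<open>An operator specified by a graph is determined only up to null vectors; this transfers
  nuclearity from an explicit representative.\<close>

lemma nuclear_cong:
  assumes T: "nuclear T t" and U: "\<And>x. x \<in> S \<Longrightarrow> U x \<in> S" "\<And>x z. x \<in> S \<Longrightarrow> z \<in> S \<Longrightarrow> ip (U x) z = ip (T x) z"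
  shows "nuclear U t"
proof -
  have TS: "T x \<in> S" if "x \<in> S" for x using nuclear_S[OF T that] .
  have "\<exists>T'. adjoint_pair U T'"
    using T U unfolding nuclear_def adjoint_pair_def by auto
  moreover have "nrm2 (sub (U x) y) = nrm2 (sub (T x) y)" if "x \<in> S" "y \<in> S" for x y
    using that TS U by (intro nrm2_cong) auto
  note same = this
  have "weak_to_strong U"
    unfolding weak_to_strong_def
  proof (intro allI impI)
    fix X B assume X: "\<forall>n::nat. X n \<in> S \<and> nrm (X n) \<le> B" "\<forall>z\<in>S. convergent (\<lambda>n. ip (X n) z)"
    then obtain y where "y \<in> S" "lim_to (\<lambda>n. T (X n)) y"
      using T unfolding nuclear_def weak_to_strong_def by metis
    then show "\<exists>y\<in>S. lim_to (\<lambda>n. U (X n)) y"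
      using same X(1) unfolding lim_to_def by (intro bexI[of _ y]) simp_all
  qed
  moreover have "nuclear_bound U C" if "nuclear_bound T C" for C
    using that U unfolding nuclear_bound_def by (simp add: orthonormal_def)
  moreover have "((\<lambda>n. ip (U (e n)) (e n)) has_sum t) I" if e: "onb I e" for I e
  proof -
    have "((\<lambda>n. ip (T (e n)) (e n)) has_sum t) I" using T e by (auto simp: nuclear_def)
    moreover have "ip (T (e n)) (e n) = ip (U (e n)) (e n)" if "n \<in> I" for n
      using e that U by (simp add: onb_def orthonormal_def)
    ultimately show ?thesis by (simp cong: has_sum_cong)
  qed
  ultimately show ?thesis using T unfolding nuclear_def by blast
qed

lemma nuclear_scl:
  assumes "nuclear T t"
  shows "nuclear (\<lambda>x. scl c (T x)) (c * t)"
proof -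
  obtain T' C where T: "adjoint_pair T T'" "weak_to_strong T" "nuclear_bound T C"
    and Tt: "\<And>I e. onb I e \<Longrightarrow> ((\<lambda>n. ip (T (e n)) (e n)) has_sum t) I"
    using assms(1) by (auto simp: nuclear_def)
  have [simp]: "T x \<in> S" "T' x \<in> S" if "x \<in> S" for x
    using that T(1) by (auto simp: adjoint_pair_def)
  have "adjoint_pair (\<lambda>x. scl c (T x)) (\<lambda>x. scl (cnj c) (T' x))"
    using T(1) unfolding adjoint_pair_def by simp
  moreover have "weak_to_strong (\<lambda>x. scl c (T x))"
    unfolding weak_to_strong_def
  proof (intro allI impI)
    fix X B assume X: "\<forall>n::nat. X n \<in> S \<and> nrm (X n) \<le> B" "\<forall>z\<in>S. convergent (\<lambda>n. ip (X n) z)"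
    obtain y where y: "y \<in> S" "lim_to (\<lambda>n. T (X n)) y"
      using T(2) X unfolding weak_to_strong_def by metis
    have "nrm2 (sub (scl c (T (X n))) (scl c y)) = (cmod c)\<^sup>2 * nrm2 (sub (T (X n)) y)" for n
    proof -
      have "nrm2 (sub (scl c (T (X n))) (scl c y)) = nrm2 (scl c (sub (T (X n)) y))"
        using X y by (intro nrm2_cong) (auto simp: algebra_simps)
      then show ?thesis using X y by simp
    qed
    then have "lim_to (\<lambda>n. scl c (T (X n))) (scl c y)"
      using y(2) tendsto_mult_left[of _ 0 _ "(cmod c)\<^sup>2"] unfolding lim_to_def by simp
    then show "\<exists>y\<in>S. lim_to (\<lambda>n. scl c (T (X n))) y"
      using y(1) by (intro bexI[of _ "scl c y"]) auto
  qed
  moreover have "nuclear_bound (\<lambda>x. scl c (T x)) (cmod c * C)"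
    unfolding nuclear_bound_def
  proof (intro allI impI)
    fix F e f assume F: "finite F" "orthonormal F e" "orthonormal F f"
    have "(\<Sum>n\<in>F. cmod (ip (scl c (T (e n))) (f n))) = cmod c * (\<Sum>n\<in>F. cmod (ip (T (e n)) (f n)))"
      using F by (simp add: orthonormal_def norm_mult sum_distrib_left)
    also have "\<dots> \<le> cmod c * C"
      using T(3) F unfolding nuclear_bound_def by (intro mult_left_mono) auto
    finally show "(\<Sum>n\<in>F. cmod (ip (scl c (T (e n))) (f n))) \<le> cmod c * C" .
  qed
  moreover have "((\<lambda>n. ip (scl c (T (e n))) (e n)) has_sum (c * t)) I" if e: "onb I e" for I e
  proof -
    have "((\<lambda>n. c * ip (T (e n)) (e n)) has_sum (c * t)) I"
      by (rule has_sum_cmult_right[OF Tt[OF e]])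
    moreover have "c * ip (T (e n)) (e n) = ip (scl c (T (e n))) (e n)" if "n \<in> I" for n
      using e that by (simp add: onb_def orthonormal_def)
    ultimately show ?thesis by (simp cong: has_sum_cong)
  qed
  ultimately show ?thesis unfolding nuclear_def by blast
qed

lemma nuclear_zero: "nuclear (\<lambda>x. zero) 0"
proof -
  have "adjoint_pair (\<lambda>x. zero) (\<lambda>x. zero)" by (auto simp: adjoint_pair_def)
  moreover have "weak_to_strong (\<lambda>x. zero)"
    unfolding weak_to_strong_def lim_to_def by (auto simp: nrm2_sub nrm2_def intro!: bexI[of _ zero])
  moreover have "nuclear_bound (\<lambda>x. zero) 0"
    by (auto simp: nuclear_bound_def orthonormal_def)
  moreover have "((\<lambda>n. ip zero (e n)) has_sum 0) I" if "onb I e" for I e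
    using that by (intro has_sum_0) (auto simp: onb_def orthonormal_def)
  ultimately show ?thesis unfolding nuclear_def by blast
qed

text \<open>Bessel's inequality bounds the trace norm by \<open>nrm b * nrm a\<close>, and Parseval
  in an arbitrary basis gives the trace.\<close>

lemma nuclear_rank_one:
  assumes a: "a \<in> S" and b: "b \<in> S"
  shows "nuclear (\<lambda>x. scl (ip x b) a) (ip a b)"
proof -
  have "adjoint_pair (\<lambda>x. scl (ip x b) a) (\<lambda>y. scl (ip y a) b)"
    unfolding adjoint_pair_def using a b by (auto simp flip: ip_cnj)
  moreover have "weak_to_strong (\<lambda>x. scl (ip x b) a)"
    unfolding weak_to_strong_def
  proof (intro allI impI)
    fix X B assume X: "\<forall>n::nat. X n \<in> S \<and> nrm (X n) \<le> B" "\<forall>z\<in>S. convergent (\<lambda>n. ip (X n) z)"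
    then obtain l where l: "(\<lambda>n. ip (X n) b) \<longlonglongrightarrow> l" using b by (auto simp: convergent_def)
    have "nrm2 (sub (scl (ip (X n) b) a) (scl l a)) = (cmod (ip (X n) b - l))\<^sup>2 * nrm2 a" for n
    proof -
      have "nrm2 (sub (scl (ip (X n) b) a) (scl l a)) = nrm2 (scl (ip (X n) b - l) a)"
        using a by (intro nrm2_cong) (auto simp: algebra_simps)
      then show ?thesis using a by simp
    qed
    moreover have "(\<lambda>n. (cmod (ip (X n) b - l))\<^sup>2 * nrm2 a) \<longlonglongrightarrow> (cmod (l - l))\<^sup>2 * nrm2 a"
      using l by (intro tendsto_intros)
    ultimately have "lim_to (\<lambda>n. scl (ip (X n) b) a) (scl l a)"
      by (simp add: lim_to_def)
    then show "\<exists>y\<in>S. lim_to (\<lambda>n. scl (ip (X n) b) a) y" using a by (intro bexI[of _ "scl l a"]) auto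
  qed
  moreover have "nuclear_bound (\<lambda>x. scl (ip x b) a) (nrm b * nrm a)"
    unfolding nuclear_bound_def
  proof (intro allI impI)
    fix F e f assume F: "finite F" "orthonormal F e" "orthonormal F f"
    have "(\<Sum>n\<in>F. cmod (ip (scl (ip (e n) b) a) (f n))) = (\<Sum>n\<in>F. cmod (ip b (e n)) * cmod (ip a (f n)))"
    proof (rule sum.cong[OF refl])
      fix n assume "n \<in> F"
      then have S: "e n \<in> S" "f n \<in> S" using F by (auto simp: orthonormal_def)
      have "cmod (ip (e n) b) = cmod (ip b (e n))"
        by (subst ip_cnj[OF b S(1)]) simp
      then show "cmod (ip (scl (ip (e n) b) a) (f n)) = cmod (ip b (e n)) * cmod (ip a (f n))"
        using S a by (simp add: norm_mult)
    qed
    also have "\<dots> \<le> nrm b * nrm a" by (rule bessel2[OF F(2,3,1) b a])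
    finally show "(\<Sum>n\<in>F. cmod (ip (scl (ip (e n) b) a) (f n))) \<le> nrm b * nrm a" .
  qed
  moreover have "((\<lambda>n. ip (scl (ip (e n) b) a) (e n)) has_sum ip a b) I" if e: "onb I e" for I e
  proof -
    have "((\<lambda>n. ip a (e n) * cnj (ip b (e n))) has_sum ip a b) I" by (rule onb_expansion[OF e a b])
    moreover have "ip a (e n) * cnj (ip b (e n)) = ip (scl (ip (e n) b) a) (e n)" if "n \<in> I" for n
    proof -
      have S: "e n \<in> S" using e that by (simp add: onb_def orthonormal_def)
      then show ?thesis using a b by (simp add: ip_cnj[OF b S])
    qed
    ultimately show ?thesis by (simp cong: has_sum_cong)
  qed
  ultimately show ?thesis unfolding nuclear_def by blast
qed

end

section \<open>The space of square-integrable functions\<close>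

lemma integrable_mult_L2:
  fixes f g :: "'a \<Rightarrow> complex"
  assumes [measurable]: "f \<in> borel_measurable M" "g \<in> borel_measurable M"
    and "integrable M (\<lambda>x. (cmod (f x))\<^sup>2)" "integrable M (\<lambda>x. (cmod (g x))\<^sup>2)"
  shows "integrable M (\<lambda>x. f x * g x)"
proof (rule Bochner_Integration.integrable_bound)
  show "integrable M (\<lambda>x. (cmod (f x))\<^sup>2 + (cmod (g x))\<^sup>2)"
    using assms by simp
  show "AE x in M. norm (f x * g x) \<le> norm ((cmod (f x))\<^sup>2 + (cmod (g x))\<^sup>2)"
  proof (intro AE_I2)
    fix x
    have "2 * (cmod (f x) * cmod (g x)) \<le> (cmod (f x))\<^sup>2 + (cmod (g x))\<^sup>2"
      using sum_squares_bound[of "cmod (f x)" "cmod (g x)"] by simp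
    moreover have "0 \<le> cmod (f x) * cmod (g x)" by simp
    ultimately have "cmod (f x) * cmod (g x) \<le> (cmod (f x))\<^sup>2 + (cmod (g x))\<^sup>2" by linarith
    then show "norm (f x * g x) \<le> norm ((cmod (f x))\<^sup>2 + (cmod (g x))\<^sup>2)"
      by (simp add: norm_mult)
  qed
qed measurable

lemma borel_measurable_cnj':
  fixes f :: "'a \<Rightarrow> complex"
  shows "f \<in> borel_measurable M \<Longrightarrow> (\<lambda>x. cnj (f x)) \<in> borel_measurable M"
  by (rule measurable_compose[OF _ borel_measurable_continuous_onI]) (auto intro: continuous_intros)

lemma integrable_L2_add:
  fixes f g :: "'a \<Rightarrow> complex"
  assumes [measurable]: "f \<in> borel_measurable M" "g \<in> borel_measurable M"
    and "integrable M (\<lambda>x. (cmod (f x))\<^sup>2)" "integrable M (\<lambda>x. (cmod (g x))\<^sup>2)"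
  shows "integrable M (\<lambda>x. (cmod (f x + g x))\<^sup>2)"
proof (rule Bochner_Integration.integrable_bound)
  show "integrable M (\<lambda>x. 2 * (cmod (f x))\<^sup>2 + 2 * (cmod (g x))\<^sup>2)"
    using assms by simp
  show "AE x in M. norm ((cmod (f x + g x))\<^sup>2) \<le> norm (2 * (cmod (f x))\<^sup>2 + 2 * (cmod (g x))\<^sup>2)"
  proof (intro AE_I2)
    fix x
    have "(cmod (f x + g x))\<^sup>2 \<le> (cmod (f x) + cmod (g x))\<^sup>2"
      by (intro power_mono norm_triangle_ineq) simp
    also have "\<dots> \<le> 2 * (cmod (f x))\<^sup>2 + 2 * (cmod (g x))\<^sup>2"
      using sum_squares_bound[of "cmod (f x)" "cmod (g x)"] by (simp add: power2_sum)
    finally show "norm ((cmod (f x + g x))\<^sup>2) \<le> norm (2 * (cmod (f x))\<^sup>2 + 2 * (cmod (g x))\<^sup>2)" by simp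
  qed
qed measurable

text \<open>A fast subsequence converges almost everywhere, and Fatou's lemma turns pointwise
  convergence into convergence in mean square.\<close>

lemma L2_functions_complete:
  fixes X :: "nat \<Rightarrow> 'a \<Rightarrow> complex"
  assumes "finite_measure M"
    and X [measurable]: "\<And>n. X n \<in> borel_measurable M"
    and int: "\<And>n. integrable M (\<lambda>x. (cmod (X n x))\<^sup>2)"
    and cauchy: "\<And>\<epsilon>. \<epsilon> > 0 \<Longrightarrow> \<exists>N. \<forall>m\<ge>N. \<forall>n\<ge>N. (LINT x|M. (cmod (X m x - X n x))\<^sup>2) < \<epsilon>"
  shows "\<exists>f \<in> borel_measurable M. integrable M (\<lambda>x. (cmod (f x))\<^sup>2) \<and>
    (\<lambda>n. LINT x|M. (cmod (X n x - f x))\<^sup>2) \<longlonglongrightarrow> 0"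
proof -
  interpret finite_measure M by fact
  have intd: "integrable M (\<lambda>x. (cmod (X m x - X n x))\<^sup>2)" for m n
    using integrable_L2_add[of "X m" M "\<lambda>x. - X n x"] int by simp
  have "\<forall>i. \<exists>N. \<forall>m\<ge>N. \<forall>n\<ge>N. (LINT x|M. (cmod (X m x - X n x))\<^sup>2) < (1/4)^i"
    using cauchy by simp
  then obtain N where N: "\<And>i m n. m \<ge> N i \<Longrightarrow> n \<ge> N i \<Longrightarrow> (LINT x|M. (cmod (X m x - X n x))\<^sup>2) < (1/4)^i"
    by metis
  \<comment> \<open>Partial sums of \<open>N\<close> provide a monotone index sequence with
    \<open>k i \<ge> N i\<close>.\<close>
  define k where "k i = (\<Sum>l\<le>i. N l)" for i
  have kN: "N i \<le> k j" if "i \<le> j" for i j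
    unfolding k_def using that by (intro member_le_sum) auto
  have ki: "k i \<le> k j" if "i \<le> j" for i j
    unfolding k_def using that by (intro sum_mono2) auto
  define D where "D i x = cmod (X (k (Suc i)) x - X (k i) x)" for i x
  have [measurable]: "D i \<in> borel_measurable M" for i unfolding D_def by measurable
  have D0 [simp]: "0 \<le> D i x" for i x by (simp add: D_def)
  have D2: "integrable M (\<lambda>x. (D i x)\<^sup>2)" "(LINT x|M. (D i x)\<^sup>2) < (1/4)^i" for i
    unfolding D_def using intd N[of i "k (Suc i)" "k i"] kN by auto
  \<comment> \<open>The inequality \<open>t \<le> \<epsilon> + t^2 / \<epsilon>\<close> with
    \<open>\<epsilon> = (1/2)^i\<close>. On a finite measure space it trades the bound
    \<open>(1/4)^i\<close> for the mean squares against a summable bound for the means.\<close>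
  have D_le: "D i x \<le> (1/2)^i + 2^i * (D i x)\<^sup>2" for i x
  proof -
    show ?thesis
    proof (cases "D i x \<le> (1/2)^i")
      case True
      moreover have "0 \<le> 2^i * (D i x)\<^sup>2" by simp
      ultimately show ?thesis by linarith
    next
      case False
      then have "D i x * (2^i * (1/2)^i) \<le> D i x * (2^i * D i x)"
        by (intro mult_left_mono) auto
      then have "D i x \<le> 2^i * (D i x)\<^sup>2"
        by (simp add: power2_eq_square power_divide algebra_simps)
      then show ?thesis by (simp add: add_increasing)
    qed
  qed
  have intD: "integrable M (D i)" for i
    by (rule Bochner_Integration.integrable_bound[OF _ _ AE_I2, of _ "\<lambda>x. (1/2)^i + 2^i * (D i x)\<^sup>2"])
      (use D2(1) D_le in auto)
  have intD_le: "(LINT x|M. D i x) \<le> (1/2)^i * (measure M (space M) + 1)" for i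
  proof -
    have "(LINT x|M. D i x) \<le> (LINT x|M. (1/2)^i + 2^i * (D i x)\<^sup>2)"
      using intD D2(1) D_le by (intro integral_mono) auto
    also have "\<dots> = (1/2)^i * measure M (space M) + 2^i * (LINT x|M. (D i x)\<^sup>2)"
      using D2(1) by simp
    also have "2^i * (LINT x|M. (D i x)\<^sup>2) \<le> 2^i * (1/4)^i"
      using D2(2)[of i] by (intro mult_left_mono) auto
    also have "(2::real)^i * (1/4)^i = (1/2)^i"
      by (simp flip: power_mult_distrib)
    finally show ?thesis by (simp add: algebra_simps)
  qed
  have "(\<integral>\<^sup>+x. (\<Sum>i. ennreal (D i x)) \<partial>M) = (\<Sum>i. \<integral>\<^sup>+x. ennreal (D i x) \<partial>M)"
    by (rule nn_integral_suminf) measurable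
  also have "\<dots> = (\<Sum>i. ennreal (LINT x|M. D i x))"
    using intD by (intro suminf_cong nn_integral_eq_integral) auto
  also have "\<dots> < \<infinity>"
  proof -
    have "summable (\<lambda>i. LINT x|M. D i x)"
    proof (rule summable_comparison_test')
      show "summable (\<lambda>i. (1/2::real)^i * (measure M (space M) + 1))"
        by (intro summable_mult2 summable_geometric) simp
      show "norm (LINT x|M. D n x) \<le> (1/2)^n * (measure M (space M) + 1)" if "n \<ge> 0" for n
        using intD_le[of n] by (simp add: integral_nonneg_AE)
    qed
    then show ?thesis
      by (subst suminf_ennreal2) (auto intro: integral_nonneg_AE)
  qed
  finally have "AE x in M. (\<Sum>i. ennreal (D i x)) \<noteq> \<infinity>"
    by (intro nn_integral_PInf_AE) auto
  then have conv: "AE x in M. convergent (\<lambda>i. X (k i) x)"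
  proof eventually_elim
    case (elim x)
    then have "summable (\<lambda>i. D i x)"
      by (intro summable_suminf_not_top) auto
    then have "summable (\<lambda>i. X (k (Suc i)) x - X (k i) x)"
      unfolding D_def by (rule summable_norm_cancel)
    then have "convergent (\<lambda>n. \<Sum>i<n. X (k (Suc i)) x - X (k i) x)"
      by (simp add: summable_iff_convergent)
    then have "convergent (\<lambda>n. X (k n) x - X (k 0) x)"
      by (simp only: sum_lessThan_telescope[of "\<lambda>i. X (k i) x"])
    from convergent_add[OF this convergent_const[of "X (k 0) x"]] show ?case by simp
  qed
  define f where "f x = lim (\<lambda>i. X (k i) x)" for x
  have f [measurable]: "f \<in> borel_measurable M" unfolding f_def by measurable
  have lim: "AE x in M. (\<lambda>i. X (k i) x) \<longlonglongrightarrow> f x"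
    using conv by eventually_elim (simp add: f_def convergent_LIMSEQ_iff)
  have fatou: "(\<integral>\<^sup>+x. ennreal ((cmod (X n x - f x))\<^sup>2) \<partial>M) \<le> ennreal ((1/4)^i)" if n: "n \<ge> N i" for n i
  proof -
    have "(\<integral>\<^sup>+x. ennreal ((cmod (X n x - f x))\<^sup>2) \<partial>M) = (\<integral>\<^sup>+x. liminf (\<lambda>j. ennreal ((cmod (X n x - X (k j) x))\<^sup>2)) \<partial>M)"
    proof (rule nn_integral_cong_AE)
      show "AE x in M. ennreal ((cmod (X n x - f x))\<^sup>2) = liminf (\<lambda>j. ennreal ((cmod (X n x - X (k j) x))\<^sup>2))"
        using lim
      proof eventually_elim
        case (elim x)
        have "(\<lambda>j. ennreal ((cmod (X n x - X (k j) x))\<^sup>2)) \<longlonglongrightarrow> ennreal ((cmod (X n x - f x))\<^sup>2)"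
          by (intro tendsto_ennrealI tendsto_intros elim)
        then show ?case by (intro lim_imp_Liminf[symmetric]) simp
      qed
    qed
    also have "\<dots> \<le> liminf (\<lambda>j. \<integral>\<^sup>+x. ennreal ((cmod (X n x - X (k j) x))\<^sup>2) \<partial>M)"
      by (rule nn_integral_liminf) measurable
    also have "\<dots> \<le> ennreal ((1/4)^i)"
    proof (rule Liminf_le)
      show "\<forall>\<^sub>F j in sequentially. (\<integral>\<^sup>+x. ennreal ((cmod (X n x - X (k j) x))\<^sup>2) \<partial>M) \<le> ennreal ((1/4)^i)"
        using eventually_ge_at_top[of i]
      proof eventually_elim
        case (elim j)
        have "(\<integral>\<^sup>+x. ennreal ((cmod (X n x - X (k j) x))\<^sup>2) \<partial>M) = ennreal (LINT x|M. (cmod (X n x - X (k j) x))\<^sup>2)"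
          by (rule nn_integral_eq_integral) (use intd in auto)
        also have "\<dots> \<le> ennreal ((1/4)^i)"
          using N[OF n, of "k j"] kN[OF elim] by (intro ennreal_leI) simp
        finally show ?case .
      qed
    qed simp
    finally show ?thesis .
  qed
  have intf: "integrable M (\<lambda>x. (cmod (X n x - f x))\<^sup>2)" "(LINT x|M. (cmod (X n x - f x))\<^sup>2) \<le> (1/4)^i" if "n \<ge> N i" for n i
  proof -
    show 1: "integrable M (\<lambda>x. (cmod (X n x - f x))\<^sup>2)"
      using fatou[OF that] by (intro integrableI_bounded) (auto intro: le_less_trans)
    have "ennreal (LINT x|M. (cmod (X n x - f x))\<^sup>2) \<le> ennreal ((1/4)^i)"
      using fatou[OF that] nn_integral_eq_integral[OF 1] by simp
    then show "(LINT x|M. (cmod (X n x - f x))\<^sup>2) \<le> (1/4)^i"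
      by (subst (asm) ennreal_le_iff) auto
  qed
  have "integrable M (\<lambda>x. (cmod (X (N 0) x + - (X (N 0) x - f x)))\<^sup>2)"
    by (rule integrable_L2_add) (use int intf(1)[of 0 "N 0"] in \<open>auto simp: norm_minus_commute\<close>)
  then have "integrable M (\<lambda>x. (cmod (f x))\<^sup>2)" by simp
  moreover have "(\<lambda>n. LINT x|M. (cmod (X n x - f x))\<^sup>2) \<longlonglongrightarrow> 0"
  proof (rule LIMSEQ_I)
    fix r :: real assume "r > 0"
    then obtain i where i: "(1/4::real)^i < r" using real_arch_pow_inv[of r "1/4"] by auto
    have "norm ((LINT x|M. (cmod (X n x - f x))\<^sup>2) - 0) < r" if "n \<ge> N i" for n
      using intf(2)[OF that] i by simp
    then show "\<exists>no. \<forall>n\<ge>no. norm ((LINT x|M. (cmod (X n x - f x))\<^sup>2) - 0) < r" by blast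
  qed
  ultimately show ?thesis using f by blast
qed

lemma finite_measure_Icc: "finite_measure (lebesgue_on {a..b::real})"
  using finite_measure_lebesgue_on[OF lmeasurable_cbox[of a b]] by (simp add: cbox_interval)

lemma L2_add: "f \<in> L2 q R \<Longrightarrow> g \<in> L2 q R \<Longrightarrow> (\<lambda>j r. f j r + g j r) \<in> L2 q R"
  unfolding L2_def by (auto intro!: integrable_L2_add borel_measurable_add)

lemma L2_scale: "f \<in> L2 q R \<Longrightarrow> (\<lambda>j r. c * f j r) \<in> L2 q R"
  unfolding L2_def by (auto simp: norm_mult power_mult_distrib)

lemma integrable_L2_inner:
  assumes "f \<in> L2 q R" "g \<in> L2 q R" "j < q"
  shows "integrable (lebesgue_on {0..R}) (\<lambda>r. f j r * cnj (g j r))"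
  using assms by (intro integrable_mult_L2 borel_measurable_cnj') (auto simp: L2_def)

lemma L2_inner_self_Re: "Re (L2_inner q R f f) = (\<Sum>j<q. LINT r|lebesgue_on {0..R}. (cmod (f j r))\<^sup>2)"
proof -
  have "L2_inner q R f f = of_real (\<Sum>j<q. LINT r|lebesgue_on {0..R}. (cmod (f j r))\<^sup>2)"
    unfolding L2_inner_def by (simp add: complex_norm_square[symmetric] del: of_real_power)
  then show ?thesis by simp
qed

interpretation L2_semi: semi_inner "L2 q R" "\<lambda>f g j r. f j r + g j r" "\<lambda>c f j r. c * f j r" "L2_inner q R"
  for q R
proof
  show "L2 q R \<noteq> {}" by (auto simp: L2_def intro!: exI[of _ "\<lambda>_ _. 0"])
  fix x y z :: vfun and c assume x: "x \<in> L2 q R" 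
  show "(\<lambda>j r. c * x j r) \<in> L2 q R" using x by (rule L2_scale)
  show "0 \<le> Re (L2_inner q R x x)" by (auto simp: L2_inner_self_Re intro!: sum_nonneg)
  assume y: "y \<in> L2 q R"
  show "(\<lambda>j r. x j r + y j r) \<in> L2 q R" using x y by (rule L2_add)
  show "L2_inner q R (\<lambda>j r. c * x j r) y = c * L2_inner q R x y"
    unfolding L2_inner_def by (simp add: sum_distrib_left mult.assoc)
  show "L2_inner q R y x = cnj (L2_inner q R x y)"
    unfolding L2_inner_def cnj_sum by (intro sum.cong refl) (subst Bochner_Integration.integral_cnj[symmetric], simp add: mult.commute)
  assume z: "z \<in> L2 q R"
  show "L2_inner q R (\<lambda>j r. x j r + y j r) z = L2_inner q R x z + L2_inner q R y z"
    using integrable_L2_inner[OF x z] integrable_L2_inner[OF y z]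
    unfolding L2_inner_def by (simp add: distrib_right sum.distrib)
qed

lemma L2_nrm2: "L2_semi.nrm2 q R f = (\<Sum>j<q. LINT r|lebesgue_on {0..R}. (cmod (f j r))\<^sup>2)"
  by (simp add: L2_semi.nrm2_def L2_inner_self_Re)

lemma L2_nrm: "L2_semi.nrm q R f = L2_norm q R f"
  by (simp add: L2_semi.nrm_def L2_nrm2 L2_norm_def)

interpretation L2: semi_hilbert "L2 q R" "\<lambda>f g j r. f j r + g j r" "\<lambda>c f j r. c * f j r" "L2_inner q R"
  for q R
proof
  fix X :: "nat \<Rightarrow> vfun"
  assume X: "\<And>n. X n \<in> L2 q R"
    and cauchy: "\<And>\<epsilon>. \<epsilon> > 0 \<Longrightarrow> \<exists>N. \<forall>m\<ge>N. \<forall>n\<ge>N. L2_semi.nrm2 q R (L2_semi.sub (X m) (X n)) < \<epsilon>"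
  have sub: "L2_semi.sub f g = (\<lambda>j r. f j r - g j r)" for f g by (simp add: L2_semi.sub_def)
  define Q where "Q j f \<longleftrightarrow> f \<in> borel_measurable (lebesgue_on {0..R}) \<and> integrable (lebesgue_on {0..R}) (\<lambda>x. (cmod (f x))\<^sup>2) \<and>
    (\<lambda>n. LINT x|lebesgue_on {0..R}. (cmod (X n j x - f x))\<^sup>2) \<longlonglongrightarrow> 0" for j f
  have "\<exists>f. Q j f" if j: "j < q" for j
    unfolding Q_def Bex_def[symmetric]
  proof (rule L2_functions_complete)
    show "X n j \<in> borel_measurable (lebesgue_on {0..R})" 
      "integrable (lebesgue_on {0..R}) (\<lambda>x. (cmod (X n j x))\<^sup>2)" for n
      using X[of n] j by (auto simp: L2_def)
    fix \<epsilon> :: real assume "\<epsilon> > 0"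
    then obtain N where N: "\<And>m n. m \<ge> N \<Longrightarrow> n \<ge> N \<Longrightarrow> L2_semi.nrm2 q R (L2_semi.sub (X m) (X n)) < \<epsilon>"
      using cauchy by meson
    have "(LINT x|lebesgue_on {0..R}. (cmod (X m j x - X n j x))\<^sup>2) \<le> L2_semi.nrm2 q R (L2_semi.sub (X m) (X n))" for m n
      unfolding L2_nrm2 sub using j by (intro member_le_sum) auto
    then show "\<exists>N. \<forall>m\<ge>N. \<forall>n\<ge>N. (LINT x|lebesgue_on {0..R}. (cmod (X m j x - X n j x))\<^sup>2) < \<epsilon>"
      using N by (meson le_less_trans)
  qed (rule finite_measure_Icc)
  then have "Q j (SOME f. Q j f)" if "j < q" for j
    using someI_ex[of "Q j"] that by simp
  moreover define y where "y j = (SOME f. Q j f)" for j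
  ultimately have y: "y j \<in> borel_measurable (lebesgue_on {0..R})"
    "integrable (lebesgue_on {0..R}) (\<lambda>x. (cmod (y j x))\<^sup>2)"
    "(\<lambda>n. LINT x|lebesgue_on {0..R}. (cmod (X n j x - y j x))\<^sup>2) \<longlonglongrightarrow> 0" if "j < q" for j
    using that by (simp_all add: Q_def)
  have "y \<in> L2 q R" using y by (simp add: L2_def)
  moreover have "(\<lambda>n. \<Sum>j<q. LINT r|lebesgue_on {0..R}. (cmod (X n j r - y j r))\<^sup>2) \<longlonglongrightarrow> 0"
    by (rule tendsto_null_sum) (use y in auto)
  then have "L2_semi.lim_to q R X y"
    unfolding L2_semi.lim_to_def L2_nrm2 sub .
  ultimately show "\<exists>y\<in>L2 q R. L2_semi.lim_to q R X y" by blast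
qed

text \<open>Bridge between equality almost everywhere and the weak equality of the abstract
  theory.\<close>

lemma L2_eq_iff_inner:
  assumes f: "f \<in> L2 q R" and g: "g \<in> L2 q R"
  shows "L2_eq q R f g \<longleftrightarrow> (\<forall>z\<in>L2 q R. L2_inner q R f z = L2_inner q R g z)"
proof -
  have fg: "(\<lambda>j r. f j r - g j r) \<in> L2 q R"
    using L2_semi.sub_S[OF f g] by (simp add: L2_semi.sub_def)
  have "(\<forall>z\<in>L2 q R. L2_inner q R f z = L2_inner q R g z) \<longleftrightarrow> L2_semi.nrm2 q R (\<lambda>j r. f j r - g j r) = 0"
    using L2_semi.nrm2_sub_eq_0_iff[OF f g] by (simp add: L2_semi.sub_def)
  also have "\<dots> \<longleftrightarrow> (\<forall>j<q. (LINT r|lebesgue_on {0..R}. (cmod (f j r - g j r))\<^sup>2) = 0)"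
    unfolding L2_nrm2 by (subst sum_nonneg_eq_0_iff) auto
  also have "\<dots> \<longleftrightarrow> (\<forall>j<q. AE r in lebesgue_on {0..R}. (cmod (f j r - g j r))\<^sup>2 = 0)"
    using fg by (intro all_cong integral_nonneg_eq_0_iff_AE) (auto simp: L2_def)
  finally show ?thesis by (simp add: L2_eq_def)
qed

section \<open>Hilbert-Schmidt kernels\<close>

definition sq_int :: "real \<Rightarrow> (real \<Rightarrow> complex) \<Rightarrow> bool" where
  "sq_int R u \<longleftrightarrow> u \<in> borel_measurable (lebesgue_on {0..R}) \<and> integrable (lebesgue_on {0..R}) (\<lambda>r. (cmod (u r))\<^sup>2)"

text \<open>Embeds the scalar theory of one component, so that scalar inequalities and scalar
  operators can be read in the vector-valued space.\<close>

definition emb :: "nat \<Rightarrow> (real \<Rightarrow> complex) \<Rightarrow> vfun" where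
  "emb j u = (\<lambda>i r. if i = j then u r else 0)"

text \<open>Square integrability is demanded of every section, not of almost every one: all sections
  are then vectors of the space, and integrals against them make sense at every point.\<close>

definition hs_kernel :: "real \<Rightarrow> (real \<Rightarrow> real \<Rightarrow> complex) \<Rightarrow> bool" where
  "hs_kernel R k \<longleftrightarrow> (\<lambda>p. k (fst p) (snd p)) \<in> borel_measurable (lebesgue_on {0..R} \<Otimes>\<^sub>M lebesgue_on {0..R}) \<and>
     (\<forall>r. sq_int R (k r)) \<and> (\<forall>s. sq_int R (\<lambda>r. k r s)) \<and>
     integrable (lebesgue_on {0..R} \<Otimes>\<^sub>M lebesgue_on {0..R}) (\<lambda>p. (cmod (k (fst p) (snd p)))\<^sup>2)"

definition kop :: "real \<Rightarrow> (real \<Rightarrow> real \<Rightarrow> complex) \<Rightarrow> (real \<Rightarrow> complex) \<Rightarrow> real \<Rightarrow> complex" where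
  "kop R k u r = (LINT s|lebesgue_on {0..R}. k r s * u s)"

lemma sq_intD: "sq_int R u \<Longrightarrow> u \<in> borel_measurable (lebesgue_on {0..R})"
  "sq_int R u \<Longrightarrow> integrable (lebesgue_on {0..R}) (\<lambda>r. (cmod (u r))\<^sup>2)"
  by (auto simp: sq_int_def)

lemma sq_int_component: "f \<in> L2 q R \<Longrightarrow> j < q \<Longrightarrow> sq_int R (f j)"
  by (auto simp: L2_def sq_int_def)

lemma L2_iff_sq_int: "f \<in> L2 q R \<longleftrightarrow> (\<forall>j<q. sq_int R (f j))"
  by (auto simp: L2_def sq_int_def)

lemma sq_int_cnj: "sq_int R u \<Longrightarrow> sq_int R (\<lambda>r. cnj (u r))"
  by (auto simp: sq_int_def borel_measurable_cnj')

lemma sq_int_add: "sq_int R u \<Longrightarrow> sq_int R v \<Longrightarrow> sq_int R (\<lambda>r. u r + v r)"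
  by (auto simp: sq_int_def intro!: integrable_L2_add borel_measurable_add)

lemma sq_int_scale: "sq_int R u \<Longrightarrow> sq_int R (\<lambda>r. c * u r)"
  by (auto simp: sq_int_def norm_mult power_mult_distrib)

lemma sq_int_diff: "sq_int R u \<Longrightarrow> sq_int R v \<Longrightarrow> sq_int R (\<lambda>r. u r - v r)"
  using sq_int_add[of R u "\<lambda>r. - 1 * v r"] sq_int_scale[of R v "-1"] by simp

lemma sq_int_0: "sq_int R (\<lambda>r. 0)"
  by (simp add: sq_int_def)

lemma emb_L2:
  assumes "sq_int R u" shows "emb j u \<in> L2 q R"
  unfolding L2_iff_sq_int
proof (intro allI impI)
  fix i show "sq_int R (emb j u i)"
    using assms sq_int_0 by (cases "i = j") (simp_all add: emb_def)
qed

lemma integrable_sq_int_mult: "sq_int R u \<Longrightarrow> sq_int R v \<Longrightarrow> integrable (lebesgue_on {0..R}) (\<lambda>r. u r * v r)"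
  by (intro integrable_mult_L2) (auto simp: sq_int_def)

lemma inner_emb_right: "j < q \<Longrightarrow> L2_inner q R x (emb j u) = (LINT r|lebesgue_on {0..R}. x j r * cnj (u r))"
proof -
  assume j: "j < q"
  have "L2_inner q R x (emb j u) = (\<Sum>i<q. if i = j then LINT r|lebesgue_on {0..R}. x j r * cnj (u r) else 0)"
    unfolding L2_inner_def emb_def by (intro sum.cong) auto
  then show ?thesis using j by simp
qed

lemma inner_emb_left: "j < q \<Longrightarrow> L2_inner q R (emb j u) y = (LINT r|lebesgue_on {0..R}. u r * cnj (y j r))"
proof -
  assume j: "j < q"
  have "L2_inner q R (emb j u) y = (\<Sum>i<q. if i = j then LINT r|lebesgue_on {0..R}. u r * cnj (y j r) else 0)"
    unfolding L2_inner_def emb_def by (intro sum.cong) auto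
  then show ?thesis using j by simp
qed

lemma nrm2_emb: "j < q \<Longrightarrow> L2_semi.nrm2 q R (emb j u) = (LINT r|lebesgue_on {0..R}. (cmod (u r))\<^sup>2)"
proof -
  assume j: "j < q"
  have "L2_semi.nrm2 q R (emb j u) = (\<Sum>i<q. if i = j then LINT r|lebesgue_on {0..R}. (cmod (u r))\<^sup>2 else 0)"
    unfolding L2_nrm2 emb_def by (intro sum.cong) auto
  then show ?thesis using j by simp
qed

text \<open>The abstract inequality, applied to the embedding with a single component.\<close>

lemma Cauchy_Schwarz_integral:
  assumes "sq_int R u" "sq_int R v"
  shows "(cmod (LINT r|lebesgue_on {0..R}. u r * v r))\<^sup>2
    \<le> (LINT r|lebesgue_on {0..R}. (cmod (u r))\<^sup>2) * (LINT r|lebesgue_on {0..R}. (cmod (v r))\<^sup>2)"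
  using L2_semi.Cauchy_Schwarz_sq[OF emb_L2[OF assms(1), of 0 1] emb_L2[OF sq_int_cnj[OF assms(2)], of 0 1]]
  by (simp add: inner_emb_right nrm2_emb) (simp add: emb_def)

context
  fixes R :: real
begin

interpretation N: finite_measure "lebesgue_on {0..R}" by (rule finite_measure_Icc)
interpretation NN: pair_sigma_finite "lebesgue_on {0..R}" "lebesgue_on {0..R}" ..

abbreviation (input) "NR \<equiv> lebesgue_on {0..R}"

lemma hs_kernelD:
  assumes "hs_kernel R k"
  shows "(\<lambda>p. k (fst p) (snd p)) \<in> borel_measurable (NR \<Otimes>\<^sub>M NR)" "sq_int R (k r)" "sq_int R (\<lambda>r. k r s)"
    "integrable (NR \<Otimes>\<^sub>M NR) (\<lambda>p. (cmod (k (fst p) (snd p)))\<^sup>2)"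
    "integrable NR (\<lambda>r. LINT s|NR. (cmod (k r s))\<^sup>2)" "integrable NR (\<lambda>s. LINT r|NR. (cmod (k r s))\<^sup>2)"
proof -
  show *: "integrable (NR \<Otimes>\<^sub>M NR) (\<lambda>p. (cmod (k (fst p) (snd p)))\<^sup>2)"
    using assms by (simp add: hs_kernel_def)
  show "integrable NR (\<lambda>r. LINT s|NR. (cmod (k r s))\<^sup>2)"
    using NN.integrable_fst'[OF *] by simp
  show "integrable NR (\<lambda>s. LINT r|NR. (cmod (k r s))\<^sup>2)"
    using NN.integrable_snd[of "\<lambda>r s. (cmod (k r s))\<^sup>2"] * by (simp add: case_prod_unfold)
qed (use assms in \<open>auto simp: hs_kernel_def\<close>)

lemma hs_kernel_adjoint:
  assumes "hs_kernel R k" shows "hs_kernel R (\<lambda>s r. cnj (k r s))"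
proof -
  have "(\<lambda>p. k (fst p) (snd p)) \<circ> (\<lambda>(x, y). (y, x)) \<in> borel_measurable (NR \<Otimes>\<^sub>M NR)"
    by (rule measurable_comp[OF measurable_pair_swap' hs_kernelD(1)[OF assms]])
  then have m: "(\<lambda>p. k (snd p) (fst p)) \<in> borel_measurable (NR \<Otimes>\<^sub>M NR)"
    by (simp add: o_def case_prod_unfold)
  have "integrable (NR \<Otimes>\<^sub>M NR) (\<lambda>(x, y). (\<lambda>p. (cmod (k (fst p) (snd p)))\<^sup>2) (y, x))"
    by (rule NN.integrable_product_swap[OF hs_kernelD(4)[OF assms]])
  then have "integrable (NR \<Otimes>\<^sub>M NR) (\<lambda>p. (cmod (k (snd p) (fst p)))\<^sup>2)"
    by (simp add: case_prod_unfold)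
  with m show ?thesis
    using assms unfolding hs_kernel_def by (auto intro: sq_int_cnj borel_measurable_cnj')
qed

lemma kop_measurable:
  assumes k: "(\<lambda>p. k (fst p) (snd p)) \<in> borel_measurable (NR \<Otimes>\<^sub>M NR)" and u: "u \<in> borel_measurable NR"
  shows "kop R k u \<in> borel_measurable NR"
proof -
  have "(\<lambda>p. k (fst p) (snd p) * u (snd p)) \<in> borel_measurable (NR \<Otimes>\<^sub>M NR)"
    by (intro borel_measurable_times k measurable_compose[OF measurable_snd u])
  then have "(\<lambda>r. LINT s|NR. k r s * u s) \<in> borel_measurable NR"
    by (intro N.borel_measurable_lebesgue_integral) (simp add: case_prod_unfold)
  then show ?thesis by (simp add: kop_def[abs_def])
qed

lemma kop_bound:
  assumes "sq_int R (k r)" "sq_int R u"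
  shows "(cmod (kop R k u r))\<^sup>2 \<le> (LINT s|NR. (cmod (k r s))\<^sup>2) * (LINT s|NR. (cmod (u s))\<^sup>2)"
  unfolding kop_def by (rule Cauchy_Schwarz_integral[OF assms])

lemma kop_sq_int:
  assumes k: "hs_kernel R k" and u: "sq_int R u"
  shows "sq_int R (kop R k u)"
    "(LINT r|NR. (cmod (kop R k u r))\<^sup>2) \<le> (LINT r|NR. LINT s|NR. (cmod (k r s))\<^sup>2) * (LINT s|NR. (cmod (u s))\<^sup>2)"
proof -
  have m: "kop R k u \<in> borel_measurable NR"
    by (rule kop_measurable[OF hs_kernelD(1)[OF k] sq_intD(1)[OF u]])
  have b: "(cmod (kop R k u r))\<^sup>2 \<le> (LINT s|NR. (cmod (k r s))\<^sup>2) * (LINT s|NR. (cmod (u s))\<^sup>2)" for r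
    by (rule kop_bound[of k, OF hs_kernelD(2)[OF k] u])
  have i: "integrable NR (\<lambda>r. (LINT s|NR. (cmod (k r s))\<^sup>2) * (LINT s|NR. (cmod (u s))\<^sup>2))"
    using hs_kernelD(5)[OF k] by simp
  have i2: "integrable NR (\<lambda>r. (cmod (kop R k u r))\<^sup>2)"
    by (rule Bochner_Integration.integrable_bound[OF i]) (use m b in \<open>auto simp: order_trans[OF b abs_ge_self]\<close>)
  then show "sq_int R (kop R k u)" using m by (simp add: sq_int_def)
  have "(LINT r|NR. (cmod (kop R k u r))\<^sup>2) \<le> (LINT r|NR. (LINT s|NR. (cmod (k r s))\<^sup>2) * (LINT s|NR. (cmod (u s))\<^sup>2))"
    using i i2 b by (intro integral_mono) auto
  then show "(LINT r|NR. (cmod (kop R k u r))\<^sup>2) \<le> (LINT r|NR. LINT s|NR. (cmod (k r s))\<^sup>2) * (LINT s|NR. (cmod (u s))\<^sup>2)"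
    by simp
qed

text \<open>\<open>v r * u s\<close> is square integrable on the square, so the triple product is a
  product of two square-integrable functions; this licenses Fubini in what follows.\<close>

lemma integrable_hs_product:
  assumes k: "hs_kernel R k" and u: "sq_int R u" and v: "sq_int R v"
  shows "integrable (NR \<Otimes>\<^sub>M NR) (\<lambda>p. k (fst p) (snd p) * u (snd p) * v (fst p))"
proof -
  have mu: "(\<lambda>p. u (snd p)) \<in> borel_measurable (NR \<Otimes>\<^sub>M NR)" and mv: "(\<lambda>p. v (fst p)) \<in> borel_measurable (NR \<Otimes>\<^sub>M NR)"
    using u v by (auto simp: sq_int_def intro: measurable_compose[OF measurable_snd] measurable_compose[OF measurable_fst])
  have "integrable (NR \<Otimes>\<^sub>M NR) (\<lambda>p. (cmod (v (fst p) * u (snd p)))\<^sup>2)"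
  proof (rule NN.Fubini_integrable)
    show "(\<lambda>p. (cmod (v (fst p) * u (snd p)))\<^sup>2) \<in> borel_measurable (NR \<Otimes>\<^sub>M NR)"
      using mu mv by measurable
    show "integrable NR (\<lambda>x. LINT y|NR. norm ((cmod (v (fst (x, y)) * u (snd (x, y))))\<^sup>2))"
      using v by (simp add: norm_mult power_mult_distrib sq_int_def)
    show "AE x in NR. integrable NR (\<lambda>y. (cmod (v (fst (x, y)) * u (snd (x, y))))\<^sup>2)"
      using u by (simp add: norm_mult power_mult_distrib sq_int_def)
  qed
  then have "integrable (NR \<Otimes>\<^sub>M NR) (\<lambda>p. k (fst p) (snd p) * (v (fst p) * u (snd p)))"
    using mu mv hs_kernelD(1,4)[OF k] by (intro integrable_mult_L2 borel_measurable_times) auto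
  then show ?thesis by (simp add: mult_ac)
qed

lemma kop_adjoint:
  assumes k: "hs_kernel R k" and u: "sq_int R u" and v: "sq_int R v"
  shows "(LINT r|NR. kop R k u r * cnj (v r)) = (LINT s|NR. u s * cnj (kop R (\<lambda>s r. cnj (k r s)) v s))"
proof -
  have i: "integrable (NR \<Otimes>\<^sub>M NR) (\<lambda>(r, s). k r s * u s * cnj (v r))"
    using integrable_hs_product[OF k u sq_int_cnj[OF v]] by (simp add: case_prod_unfold)
  have "(LINT r|NR. kop R k u r * cnj (v r)) = (LINT r|NR. LINT s|NR. k r s * u s * cnj (v r))"
    unfolding kop_def by (intro Bochner_Integration.integral_cong refl) simp
  also have "\<dots> = (LINT s|NR. LINT r|NR. k r s * u s * cnj (v r))"
    by (rule NN.Fubini_integral[symmetric, OF i])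
  also have "\<dots> = (LINT s|NR. u s * cnj (kop R (\<lambda>s r. cnj (k r s)) v s))"
  proof (intro Bochner_Integration.integral_cong refl)
    fix s
    have "cnj (kop R (\<lambda>s r. cnj (k r s)) v s) = (LINT r|NR. k r s * cnj (v r))"
      unfolding kop_def by (subst Bochner_Integration.integral_cnj[symmetric]) simp
    then show "(LINT r|NR. k r s * u s * cnj (v r)) = u s * cnj (kop R (\<lambda>s r. cnj (k r s)) v s)"
      by (simp add: mult_ac flip: Bochner_Integration.integral_mult_right_zero)
  qed
  finally show ?thesis .
qed

text \<open>The sesquilinear form of the product is an integral over \<open>s\<close> of rank-one
  forms built from sections of the two kernels. Bessel's inequality under the integral bounds the
  trace norm; Parseval under the integral, with dominated convergence, gives the trace. This
  replaces any appeal to a singular value decomposition.\<close>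

lemma nuclear_hs_product:
  assumes k: "hs_kernel R k" and l: "hs_kernel R l" and j: "j < q"
  shows "L2.nuclear q R (\<lambda>f. emb j (kop R k (kop R l (f j)))) (LINT s|NR. LINT r|NR. k r s * l s r)"
proof -
  let ?T = "\<lambda>f::vfun. emb j (kop R k (kop R l (f j)))"
  let ?k' = "\<lambda>s r. cnj (k r s)" and ?l' = "\<lambda>s r. cnj (l r s)"
  \<comment> \<open>Pairing a vector with \<open>\<Lambda> s\<close> evaluates the second factor at
    \<open>s\<close>; pairing with \<open>K s\<close> evaluates the adjoint of the first factor at
    \<open>s\<close>.\<close>
  define \<Lambda> where "\<Lambda> s = emb j (\<lambda>t. cnj (l s t))" for s
  define K where "K s = emb j (\<lambda>r. k r s)" for s
  have \<Lambda>L: "\<Lambda> s \<in> L2 q R" for s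
    unfolding \<Lambda>_def by (intro emb_L2 sq_int_cnj hs_kernelD(2)[OF l])
  have KL: "K s \<in> L2 q R" for s
    unfolding K_def by (intro emb_L2 hs_kernelD(3)[OF k])
  have \<Lambda>2: "L2_semi.nrm2 q R (\<Lambda> s) = (LINT t|NR. (cmod (l s t))\<^sup>2)" for s
    unfolding \<Lambda>_def nrm2_emb[OF j] by simp
  have K2: "L2_semi.nrm2 q R (K s) = (LINT r|NR. (cmod (k r s))\<^sup>2)" for s
    unfolding K_def nrm2_emb[OF j] by simp
  have ip\<Lambda>: "L2_inner q R x (\<Lambda> s) = kop R l (x j) s" for x s
    unfolding \<Lambda>_def inner_emb_right[OF j] kop_def by (simp add: mult.commute)
  have ipK: "L2_inner q R x (K s) = kop R ?k' (x j) s" for x s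
    unfolding K_def inner_emb_right[OF j] kop_def by (simp add: mult.commute)
  have ipT: "L2_inner q R (?T x) y = (LINT s|NR. L2_inner q R x (\<Lambda> s) * cnj (L2_inner q R y (K s)))"
    if "x \<in> L2 q R" "y \<in> L2 q R" for x y
    unfolding inner_emb_left[OF j] ip\<Lambda> ipK
    by (intro kop_adjoint k kop_sq_int l sq_int_component[OF _ j] that)
  have TL: "?T x \<in> L2 q R" if "x \<in> L2 q R" for x
    by (intro emb_L2 kop_sq_int k l sq_int_component[OF _ j] that)
  have adj: "L2.adjoint_pair q R ?T (\<lambda>y. emb j (kop R ?l' (kop R ?k' (y j))))"
    unfolding L2.adjoint_pair_def
  proof (intro conjI ballI)
    fix x assume x: "x \<in> L2 q R"
    show "?T x \<in> L2 q R" by (rule TL[OF x])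
    show "emb j (kop R ?l' (kop R ?k' (x j))) \<in> L2 q R"
      by (intro emb_L2 kop_sq_int hs_kernel_adjoint k l sq_int_component[OF _ j] x)
  next
    fix x y assume x: "x \<in> L2 q R" and y: "y \<in> L2 q R"
    have "L2_inner q R (?T x) y = (LINT s|NR. kop R l (x j) s * cnj (kop R ?k' (y j) s))"
      unfolding ipT[OF x y] ip\<Lambda> ipK ..
    also have "\<dots> = (LINT s|NR. x j s * cnj (kop R ?l' (kop R ?k' (y j)) s))"
      by (intro kop_adjoint l sq_int_component[OF _ j] kop_sq_int hs_kernel_adjoint k x y)
    finally show "L2_inner q R (?T x) y = L2_inner q R x (emb j (kop R ?l' (kop R ?k' (y j))))"
      by (simp add: inner_emb_right[OF j])
  qed
  \<comment> \<open>This one majorant serves both the trace norm bound and the dominated convergence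
    for the trace.\<close>
  have int2: "integrable NR (\<lambda>s. L2_semi.nrm2 q R (\<Lambda> s) + L2_semi.nrm2 q R (K s))"
    unfolding \<Lambda>2 K2 using hs_kernelD(5)[OF l] hs_kernelD(6)[OF k] by simp
  have meas: "(\<lambda>s. L2_inner q R x (\<Lambda> s) * cnj (L2_inner q R y (K s))) \<in> borel_measurable NR"
    if "x \<in> L2 q R" "y \<in> L2 q R" for x y
    unfolding ip\<Lambda> ipK
    by (intro borel_measurable_times borel_measurable_cnj' sq_intD kop_sq_int hs_kernel_adjoint k l sq_int_component[OF _ j] that)
  have bes: "(\<Sum>n\<in>F. cmod (L2_inner q R (e n) (\<Lambda> s) * cnj (L2_inner q R (f n) (K s))))
      \<le> L2_semi.nrm2 q R (\<Lambda> s) + L2_semi.nrm2 q R (K s)"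
    if F: "finite F" "L2_semi.orthonormal q R F e" "L2_semi.orthonormal q R F f" for F e f s
  proof -
    have "(\<Sum>n\<in>F. cmod (L2_inner q R (e n) (\<Lambda> s) * cnj (L2_inner q R (f n) (K s))))
      = (\<Sum>n\<in>F. cmod (L2_inner q R (\<Lambda> s) (e n)) * cmod (L2_inner q R (K s) (f n)))"
    proof (rule sum.cong[OF refl])
      fix n assume "n \<in> F"
      then have "e n \<in> L2 q R" "f n \<in> L2 q R" using F by (auto simp: L2_semi.orthonormal_def)
      then have "L2_inner q R (e n) (\<Lambda> s) = cnj (L2_inner q R (\<Lambda> s) (e n))"
          "L2_inner q R (f n) (K s) = cnj (L2_inner q R (K s) (f n))"
        using L2_semi.ip_cnj \<Lambda>L KL by blast+
      then show "cmod (L2_inner q R (e n) (\<Lambda> s) * cnj (L2_inner q R (f n) (K s)))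
        = cmod (L2_inner q R (\<Lambda> s) (e n)) * cmod (L2_inner q R (K s) (f n))"
        by (simp add: norm_mult)
    qed
    also have "\<dots> \<le> L2_semi.nrm q R (\<Lambda> s) * L2_semi.nrm q R (K s)"
      by (rule L2_semi.bessel2[OF F(2,3,1) \<Lambda>L KL])
    also have "\<dots> \<le> (L2_semi.nrm q R (\<Lambda> s))\<^sup>2 + (L2_semi.nrm q R (K s))\<^sup>2"
      using sum_squares_bound[of "L2_semi.nrm q R (\<Lambda> s)" "L2_semi.nrm q R (K s)"]
        mult_nonneg_nonneg[OF L2_semi.nrm_nonneg[OF \<Lambda>L[of s]] L2_semi.nrm_nonneg[OF KL[of s]]] by linarith
    also have "\<dots> = L2_semi.nrm2 q R (\<Lambda> s) + L2_semi.nrm2 q R (K s)"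
      using \<Lambda>L KL by (simp add: L2_semi.nrm_sq)
    finally show ?thesis .
  qed
  have inta: "integrable NR (\<lambda>s. L2_inner q R x (\<Lambda> s) * cnj (L2_inner q R y (K s)))"
    if x: "x \<in> L2 q R" and y: "y \<in> L2 q R" for x y
    unfolding ip\<Lambda> ipK
    by (intro integrable_sq_int_mult sq_int_cnj kop_sq_int hs_kernel_adjoint k l sq_int_component[OF _ j] that)
  define C where "C = (LINT s|NR. L2_semi.nrm2 q R (\<Lambda> s) + L2_semi.nrm2 q R (K s))"
  have bound: "L2.nuclear_bound q R ?T C"
    unfolding L2.nuclear_bound_def
  proof (intro allI impI)
    fix F e f assume F: "finite F" "L2_semi.orthonormal q R F e" "L2_semi.orthonormal q R F f"
    then have S: "e n \<in> L2 q R" "f n \<in> L2 q R" if "n \<in> F" for n using that by (auto simp: L2_semi.orthonormal_def)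
    have "(\<Sum>n\<in>F. cmod (L2_inner q R (?T (e n)) (f n)))
      \<le> (\<Sum>n\<in>F. LINT s|NR. cmod (L2_inner q R (e n) (\<Lambda> s) * cnj (L2_inner q R (f n) (K s))))"
      using S by (intro sum_mono) (simp add: ipT)
    also have "\<dots> = (LINT s|NR. (\<Sum>n\<in>F. cmod (L2_inner q R (e n) (\<Lambda> s) * cnj (L2_inner q R (f n) (K s)))))"
      using S inta by (intro Bochner_Integration.integral_sum[symmetric] integrable_norm) auto
    also have "\<dots> \<le> C"
      unfolding C_def using S inta bes[OF F] int2
      by (intro integral_mono Bochner_Integration.integrable_sum integrable_norm) auto
    finally show "(\<Sum>n\<in>F. cmod (L2_inner q R (?T (e n)) (f n))) \<le> C" .
  qed
  have trace: "((\<lambda>n. L2_inner q R (?T (e n)) (e n)) has_sum (LINT s|NR. LINT r|NR. k r s * l s r)) I"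
    if e: "L2_semi.onb q R I e" for I e
  proof (rule has_sum_of_partial_sums)
    have on: "L2_semi.orthonormal q R I e" using e by (simp add: L2_semi.onb_def)
    have S: "e n \<in> L2 q R" if "n \<in> I" for n using on that by (simp add: L2_semi.orthonormal_def)
    show "(\<Sum>n\<in>F. cmod (L2_inner q R (?T (e n)) (e n))) \<le> C" if "finite F" "F \<subseteq> I" for F
      using bound L2_semi.orthonormal_mono[OF on that(2)] that(1) unfolding L2.nuclear_bound_def by blast
    let ?a = "\<lambda>n s. L2_inner q R (e n) (\<Lambda> s) * cnj (L2_inner q R (e n) (K s))"
    have "(\<lambda>M. LINT s|NR. (\<Sum>n\<in>I \<inter> {..<M}. ?a n s)) \<longlonglongrightarrow> (LINT s|NR. LINT r|NR. k r s * l s r)"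
    proof (rule integral_dominated_convergence[OF _ _ int2])
      have eq1: "(\<Sum>n\<in>I \<inter> {..<M}. ?a n s) = (\<Sum>n\<in>I \<inter> {..<M}. L2_inner q R (K s) (e n) * cnj (L2_inner q R (\<Lambda> s) (e n)))" for M s
      proof (rule sum.cong[OF refl])
        fix n assume "n \<in> I \<inter> {..<M}"
        then have "e n \<in> L2 q R" using S by blast
        then have "L2_inner q R (e n) (\<Lambda> s) = cnj (L2_inner q R (\<Lambda> s) (e n))"
          "L2_inner q R (e n) (K s) = cnj (L2_inner q R (K s) (e n))"
          using L2_semi.ip_cnj \<Lambda>L KL by blast+
        then show "?a n s = L2_inner q R (K s) (e n) * cnj (L2_inner q R (\<Lambda> s) (e n))" by simp
      qed
      have eq2: "L2_inner q R (K s) (\<Lambda> s) = (LINT r|NR. k r s * l s r)" for s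
        unfolding \<Lambda>_def inner_emb_right[OF j] by (simp add: K_def emb_def)
      show "AE s in NR. (\<lambda>M. \<Sum>n\<in>I \<inter> {..<M}. ?a n s) \<longlonglongrightarrow> (LINT r|NR. k r s * l s r)"
        unfolding eq1 eq2[symmetric]
        by (intro AE_I2 has_sum_imp_partial_sums L2.onb_expansion e KL \<Lambda>L)
      show "AE s in NR. norm (\<Sum>n\<in>I \<inter> {..<M}. ?a n s) \<le> L2_semi.nrm2 q R (\<Lambda> s) + L2_semi.nrm2 q R (K s)" for M
      proof (intro AE_I2)
        fix s
        have "L2_semi.orthonormal q R (I \<inter> {..<M}) e" by (rule L2_semi.orthonormal_mono[OF on]) auto
        from order_trans[OF norm_sum bes[OF _ this this]]
        show "norm (\<Sum>n\<in>I \<inter> {..<M}. ?a n s) \<le> L2_semi.nrm2 q R (\<Lambda> s) + L2_semi.nrm2 q R (K s)" by simp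
      qed
      show "(\<lambda>s. \<Sum>n\<in>I \<inter> {..<M}. ?a n s) \<in> borel_measurable NR" for M
        using S meas by (intro borel_measurable_sum) auto
      have "(\<lambda>p. k (snd p) (fst p) * l (fst p) (snd p)) \<in> borel_measurable (NR \<Otimes>\<^sub>M NR)"
        using hs_kernelD(1)[OF hs_kernel_adjoint[OF k]] hs_kernelD(1)[OF l]
        by (intro borel_measurable_times) (auto dest: borel_measurable_cnj')
      then show "(\<lambda>s. LINT r|NR. k r s * l s r) \<in> borel_measurable NR"
        by (intro N.borel_measurable_lebesgue_integral) (simp add: case_prod_unfold)
    qed
    moreover have "(LINT s|NR. (\<Sum>n\<in>I \<inter> {..<M}. ?a n s)) = (\<Sum>n\<in>I \<inter> {..<M}. L2_inner q R (?T (e n)) (e n))" for M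
      using S inta by (subst Bochner_Integration.integral_sum) (auto simp: ipT)
    ultimately show "(\<lambda>M. \<Sum>n\<in>I \<inter> {..<M}. L2_inner q R (?T (e n)) (e n)) \<longlonglongrightarrow> (LINT s|NR. LINT r|NR. k r s * l s r)"
      by simp
  qed
  \<comment> \<open>Weak convergence makes \<open>\<phi> n\<close> converge at every point, with a
    square-integrable majorant given by the sections \<open>\<Lambda> s\<close>. Hence
    \<open>\<phi> n\<close> converges in mean square, and the remaining factor is bounded.\<close>
  have ws: "L2.weak_to_strong q R ?T"
    unfolding L2.weak_to_strong_def
  proof (intro allI impI)
    fix X B assume X: "\<forall>n::nat. X n \<in> L2 q R \<and> L2_semi.nrm q R (X n) \<le> B"
      and conv: "\<forall>z\<in>L2 q R. convergent (\<lambda>n. L2_inner q R (X n) z)"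
    define \<phi> where "\<phi> n = kop R l (X n j)" for n
    have \<phi>: "sq_int R (\<phi> n)" for n
      unfolding \<phi>_def using X j by (intro kop_sq_int l sq_int_component[of _ q]) auto
    define \<psi> where "\<psi> s = lim (\<lambda>n. \<phi> n s)" for s
    have lim: "(\<lambda>n. \<phi> n s) \<longlonglongrightarrow> \<psi> s" for s
    proof -
      have "convergent (\<lambda>n. \<phi> n s)" using conv \<Lambda>L[of s] unfolding \<phi>_def ip\<Lambda>[symmetric] by blast
      then show ?thesis by (simp add: \<psi>_def convergent_LIMSEQ_iff)
    qed
    have \<psi>m: "\<psi> \<in> borel_measurable NR"
      unfolding \<psi>_def using \<phi> by (intro borel_measurable_lim_metric) (simp add: sq_int_def)
    have bd: "(cmod (\<phi> n s))\<^sup>2 \<le> B\<^sup>2 * L2_semi.nrm2 q R (\<Lambda> s)" for n s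
    proof -
      have "(cmod (\<phi> n s))\<^sup>2 \<le> L2_semi.nrm2 q R (X n) * L2_semi.nrm2 q R (\<Lambda> s)"
        unfolding \<phi>_def ip\<Lambda>[symmetric] using X \<Lambda>L by (intro L2_semi.Cauchy_Schwarz_sq) auto
      also have "L2_semi.nrm2 q R (X n) \<le> B\<^sup>2"
      proof -
        have "(L2_semi.nrm q R (X n))\<^sup>2 \<le> B\<^sup>2" using X by (intro power_mono) auto
        then show ?thesis using X by (simp add: L2_semi.nrm_sq)
      qed
      finally show ?thesis using \<Lambda>L by (simp add: mult_right_mono)
    qed
    have \<psi>bd: "(cmod (\<psi> s))\<^sup>2 \<le> B\<^sup>2 * L2_semi.nrm2 q R (\<Lambda> s)" for s
      by (rule LIMSEQ_le_const2[of "\<lambda>n. (cmod (\<phi> n s))\<^sup>2"]) (use bd lim in \<open>auto intro!: tendsto_intros\<close>)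
    have i1: "integrable NR (\<lambda>s. B\<^sup>2 * L2_semi.nrm2 q R (\<Lambda> s))"
      unfolding \<Lambda>2 using hs_kernelD(5)[OF l] by simp
    have \<psi>: "sq_int R \<psi>"
      unfolding sq_int_def
      by (intro conjI \<psi>m Bochner_Integration.integrable_bound[OF i1]) (use \<psi>m \<psi>bd in \<open>auto intro: order_trans[OF _ abs_ge_self]\<close>)
    have "(\<lambda>n. LINT s|NR. (cmod (\<phi> n s - \<psi> s))\<^sup>2) \<longlonglongrightarrow> (LINT s|NR. 0)"
    proof (rule integral_dominated_convergence[where w = "\<lambda>s. 4 * (B\<^sup>2 * L2_semi.nrm2 q R (\<Lambda> s))"])
      show "integrable NR (\<lambda>s. 4 * (B\<^sup>2 * L2_semi.nrm2 q R (\<Lambda> s)))" using i1 by simp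
      show "(\<lambda>s. (cmod (\<phi> n s - \<psi> s))\<^sup>2) \<in> borel_measurable NR" for n
        using sq_intD(1)[OF \<phi>[of n]] \<psi>m by measurable
      have "(\<lambda>n. (cmod (\<phi> n s - \<psi> s))\<^sup>2) \<longlonglongrightarrow> (cmod (\<psi> s - \<psi> s))\<^sup>2" for s
        by (intro tendsto_intros lim)
      then show "AE s in NR. (\<lambda>n. (cmod (\<phi> n s - \<psi> s))\<^sup>2) \<longlonglongrightarrow> 0" by simp
      show "AE s in NR. norm ((cmod (\<phi> n s - \<psi> s))\<^sup>2) \<le> 4 * (B\<^sup>2 * L2_semi.nrm2 q R (\<Lambda> s))" for n
      proof (intro AE_I2)
        fix s
        have "(cmod (\<phi> n s - \<psi> s))\<^sup>2 \<le> (cmod (\<phi> n s) + cmod (\<psi> s))\<^sup>2"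
          by (intro power_mono norm_triangle_ineq4) simp
        also have "\<dots> \<le> 2 * (cmod (\<phi> n s))\<^sup>2 + 2 * (cmod (\<psi> s))\<^sup>2"
          using sum_squares_bound[of "cmod (\<phi> n s)" "cmod (\<psi> s)"] by (simp add: power2_sum)
        finally show "norm ((cmod (\<phi> n s - \<psi> s))\<^sup>2) \<le> 4 * (B\<^sup>2 * L2_semi.nrm2 q R (\<Lambda> s))"
          using bd[of n s] \<psi>bd[of s] by simp
      qed
    qed simp
    then have to0: "(\<lambda>n. LINT s|NR. (cmod (\<phi> n s - \<psi> s))\<^sup>2) \<longlonglongrightarrow> 0" by simp
    have "L2_semi.lim_to q R (\<lambda>n. ?T (X n)) (emb j (kop R k \<psi>))"
      unfolding L2_semi.lim_to_def
    proof (rule tendsto_sandwich[of "\<lambda>_. 0" _ _ "\<lambda>n. (LINT r|NR. LINT s|NR. (cmod (k r s))\<^sup>2) * (LINT s|NR. (cmod (\<phi> n s - \<psi> s))\<^sup>2)"])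
      show "\<forall>\<^sub>F n in sequentially. L2_semi.nrm2 q R (L2_semi.sub (?T (X n)) (emb j (kop R k \<psi>)))
        \<le> (LINT r|NR. LINT s|NR. (cmod (k r s))\<^sup>2) * (LINT s|NR. (cmod (\<phi> n s - \<psi> s))\<^sup>2)"
      proof (intro always_eventually allI)
        fix n
        have "kop R k (\<phi> n) r - kop R k \<psi> r = kop R k (\<lambda>s. \<phi> n s - \<psi> s) r" for r
          unfolding kop_def right_diff_distrib using hs_kernelD(2)[OF k, of r] \<phi> \<psi>
          by (intro Bochner_Integration.integral_diff[symmetric] integrable_sq_int_mult)
        then have "L2_semi.sub (?T (X n)) (emb j (kop R k \<psi>)) = emb j (kop R k (\<lambda>s. \<phi> n s - \<psi> s))"
          by (auto simp: L2_semi.sub_def emb_def \<phi>_def[symmetric] fun_eq_iff)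
        then show "L2_semi.nrm2 q R (L2_semi.sub (?T (X n)) (emb j (kop R k \<psi>)))
          \<le> (LINT r|NR. LINT s|NR. (cmod (k r s))\<^sup>2) * (LINT s|NR. (cmod (\<phi> n s - \<psi> s))\<^sup>2)"
          using kop_sq_int(2)[OF k sq_int_diff[OF \<phi> \<psi>]] by (simp add: nrm2_emb[OF j])
      qed
      show "(\<lambda>n. (LINT r|NR. LINT s|NR. (cmod (k r s))\<^sup>2) * (LINT s|NR. (cmod (\<phi> n s - \<psi> s))\<^sup>2)) \<longlonglongrightarrow> 0"
        using tendsto_mult_left[OF to0] by simp
      show "\<forall>\<^sub>F n in sequentially. 0 \<le> L2_semi.nrm2 q R (L2_semi.sub (?T (X n)) (emb j (kop R k \<psi>)))"
        by (intro always_eventually allI) (simp add: L2_nrm2 sum_nonneg)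
    qed simp
    then show "\<exists>y\<in>L2 q R. L2_semi.lim_to q R (\<lambda>n. ?T (X n)) y"
      using emb_L2[OF kop_sq_int(1)[OF k \<psi>]] by blast
  qed
  show ?thesis
    unfolding L2.nuclear_def using adj ws bound trace by blast
qed

end

section \<open>The Volterra resolvent\<close>

lemma borel_measurable_lebesgue_on_id: "(\<lambda>x::real. x) \<in> borel_measurable (lebesgue_on A)"
  by (intro measurable_restrict_space1) (simp add: borel_measurable_if_D measurable_completion)

lemma borel_imp_lebesgue_on: "f \<in> borel_measurable borel \<Longrightarrow> (f :: real \<Rightarrow> 'b::topological_space) \<in> borel_measurable (lebesgue_on A)"
  by (rule measurable_compose[OF borel_measurable_lebesgue_on_id])

lemma integrable_lebesgue_on_nonneg:
  fixes f :: "real \<Rightarrow> real"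
  assumes "(f has_integral I) A" "\<And>x. x \<in> A \<Longrightarrow> 0 \<le> f x" "A \<in> sets lebesgue"
  shows "integrable (lebesgue_on A) f" "(LINT x|lebesgue_on A. f x) = I"
proof -
  have "f absolutely_integrable_on A"
    using assms by (intro nonnegative_absolutely_integrable_1) auto
  then show *: "integrable (lebesgue_on A) f"
    using assms(3) by (simp add: absolutely_integrable_imp_integrable)
  show "(LINT x|lebesgue_on A. f x) = I"
    using lebesgue_integral_eq_integral[OF * assms(3)] assms(1) by (simp add: integral_unique)
qed

lemma integrable_subinterval_NR:
  fixes f :: "real \<Rightarrow> 'b::{banach, second_countable_topology}"
  assumes f: "integrable (lebesgue_on A) f" and B: "B \<in> sets lebesgue" "B \<subseteq> A" "A \<in> sets lebesgue"
  shows "integrable (lebesgue_on B) f" "(LINT x|lebesgue_on B. f x) = (LINT x|lebesgue_on A. indicat_real B x *\<^sub>R f x)"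
proof -
  have "set_integrable lebesgue A f"
    using f B by (simp add: integrable_restrict_space set_integrable_def)
  then have "set_integrable lebesgue B f"
    by (rule set_integrable_subset) (use B in auto)
  then show "integrable (lebesgue_on B) f"
    using B by (simp add: integrable_restrict_space set_integrable_def)
  have "(LINT x|lebesgue_on B. f x) = (LINT x|lebesgue. indicat_real B x *\<^sub>R f x)"
    using B by (simp add: integral_restrict_space set_lebesgue_integral_def)
  also have "\<dots> = (LINT x|lebesgue. indicat_real A x *\<^sub>R (indicat_real B x *\<^sub>R f x))"
    using B by (intro Bochner_Integration.integral_cong) (auto simp: indicator_def)
  also have "\<dots> = (LINT x|lebesgue_on A. indicat_real B x *\<^sub>R f x)"
    using B by (simp add: integral_restrict_space set_lebesgue_integral_def)
  finally show "(LINT x|lebesgue_on B. f x) = (LINT x|lebesgue_on A. indicat_real B x *\<^sub>R f x)" .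
qed

lemma powr_integral_0:
  fixes p R :: real
  assumes p: "p > -1" and r: "0 \<le> r"
  shows "integrable (lebesgue_on {0..r}) (\<lambda>s. s powr p)" "(LINT s|lebesgue_on {0..r}. s powr p) = r powr (p + 1) / (p + 1)"
proof -
  have "((\<lambda>s. s powr p) has_integral (r powr (p + 1) / (p + 1))) {0..r}"
    using has_integral_powr_from_0[OF p r] by simp
  from integrable_lebesgue_on_nonneg[OF this]
  show "integrable (lebesgue_on {0..r}) (\<lambda>s. s powr p)" "(LINT s|lebesgue_on {0..r}. s powr p) = r powr (p + 1) / (p + 1)"
    by auto
qed

text \<open>\<open>v\<close> is the order of the Bessel equation of one component: 0 for an entry
  -1/4 and \<open>nu\<close> otherwise.\<close>

locale volterra =
  fixes v R :: real
  assumes v0: "0 \<le> v" and v1: "v < 1" and R: "R > 0"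
begin

definition "a = 1/2 + v"
text \<open>Any exponent strictly between \<open>v\<close> and 1 would do. Being above
  \<open>v\<close> it absorbs the logarithm in \<open>Q\<close> at \<open>v = 0\<close>; being below
  1 it keeps \<open>\<beta>\<close> square integrable.\<close>

definition "\<theta> = (1 + v) / 2"
text \<open>A primitive of \<open>r powr (-1 - 2 * v)\<close>, the inverse square of the regular
  solution \<open>r powr a\<close>. Reduction of order gives the second solution
  \<open>r powr a * Q r\<close>.\<close>

definition Q :: "real \<Rightarrow> real" where "Q t = (if v = 0 then ln t else - (t powr (-2 * v)) / (2 * v))"
text \<open>Variation of constants: as a function of \<open>r\<close> this is the homogeneous
  solution that vanishes at \<open>r = s\<close> with slope -1. The cut-offs make it vanish outside
  the triangle for all real arguments.\<close>

definition ker :: "real \<Rightarrow> real \<Rightarrow> real" where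
  "ker r s = (if 0 < s \<and> s < r \<and> r \<le> R then - (r powr a * s powr a * (Q r - Q s)) else 0)"
text \<open>\<open>CC\<close>, \<open>\<alpha>\<close> and \<open>\<beta>\<close> form the separated
  kernel bound \<open>CC * \<alpha> r * \<beta> s\<close>. What matters is
  \<open>\<alpha> s * \<beta> s = s\<close>: where two kernels meet under an integral, the singular
  weights cancel.\<close>

definition "CC = 1 / (\<theta> - v)"
definition \<alpha> :: "real \<Rightarrow> real" where "\<alpha> r = r powr (1/2 + \<theta>)"
definition \<beta> :: "real \<Rightarrow> real" where "\<beta> s = s powr (1/2 - \<theta>)"

lemma \<theta>: "v < \<theta>" "\<theta> < 1" "1/2 \<le> \<theta>" using v0 v1 by (auto simp: \<theta>_def)

lemma CC_pos: "CC > 0" using \<theta> by (simp add: CC_def)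

lemma \<alpha>_nonneg [simp]: "0 \<le> \<alpha> r" and \<beta>_nonneg [simp]: "0 \<le> \<beta> r" by (auto simp: \<alpha>_def \<beta>_def)

lemma \<alpha>\<beta>: "0 \<le> s \<Longrightarrow> \<alpha> s * \<beta> s = s"
  by (cases "s = 0") (auto simp: \<alpha>_def \<beta>_def simp flip: powr_add)

lemma \<alpha>_mono: "0 \<le> r \<Longrightarrow> r \<le> s \<Longrightarrow> \<alpha> r \<le> \<alpha> s"
  using \<theta> by (auto simp: \<alpha>_def intro!: powr_mono2)

lemma Q_deriv: "t > 0 \<Longrightarrow> (Q has_real_derivative t powr (-1 - 2 * v)) (at t)"
proof (cases "v = 0")
  case True
  assume "t > 0"
  have "(ln has_real_derivative t powr (-1 - 2 * v)) (at t)"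
    using \<open>t > 0\<close> True by (auto simp: powr_minus_divide intro!: derivative_eq_intros)
  then show ?thesis unfolding Q_def[abs_def] using True by simp
next
  case False
  assume t: "t > 0"
  have "((\<lambda>t. - (t powr (-2 * v)) / (2 * v)) has_real_derivative - ((-2 * v) * t powr (-2 * v - 1)) / (2 * v)) (at t)"
    using t by (intro DERIV_cdivide DERIV_minus has_real_derivative_powr)
  moreover have "- ((-2 * v) * t powr (-2 * v - 1)) / (2 * v) = t powr (-2 * v - 1)"
    using False by simp
  moreover have "-2 * v - 1 = -1 - 2 * v" by simp
  ultimately have "((\<lambda>t. - (t powr (-2 * v)) / (2 * v)) has_real_derivative t powr (-1 - 2 * v)) (at t)"
    by (simp only:)
  then show ?thesis unfolding Q_def[abs_def] using False by simp
qed

lemma Q_mono: "0 < s \<Longrightarrow> s \<le> r \<Longrightarrow> Q s \<le> Q r"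
proof (rule DERIV_nonneg_imp_nondecreasing[of s r Q])
  fix x assume "0 < s" "s \<le> x"
  then show "\<exists>y. (Q has_real_derivative y) (at x) \<and> 0 \<le> y"
    by (intro exI[of _ "x powr (-1 - 2 * v)"] conjI Q_deriv) auto
qed

text \<open>Compare derivatives in the upper argument. For \<open>t \<ge> s\<close> the factor
  \<open>t powr (- \<theta> - v)\<close> of \<open>t powr (-1 - 2 * v)\<close> is at most its value
  at \<open>s\<close>, and the other factor integrates to a power with constant
  \<open>CC\<close>.\<close>

lemma Q_diff_bound:
  assumes s: "0 < s" and sr: "s \<le> r"
  shows "Q r - Q s \<le> CC * s powr (- \<theta> - v) * r powr (\<theta> - v)"
proof -
  let ?f = "\<lambda>t. CC * s powr (- \<theta> - v) * t powr (\<theta> - v) - Q t"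
  have "?f s \<le> ?f r"
  proof (rule DERIV_nonneg_imp_nondecreasing[OF sr])
    fix t assume t: "s \<le> t" "t \<le> r"
    have "(?f has_real_derivative CC * s powr (- \<theta> - v) * ((\<theta> - v) * t powr (\<theta> - v - 1)) - t powr (-1 - 2 * v)) (at t)"
      using s t by (intro DERIV_diff Q_deriv DERIV_cmult has_real_derivative_powr) auto
    moreover have "CC * s powr (- \<theta> - v) * ((\<theta> - v) * t powr (\<theta> - v - 1)) = s powr (- \<theta> - v) * t powr (\<theta> - v - 1)"
      using \<theta> by (simp add: CC_def)
    moreover have "t powr (-1 - 2 * v) = t powr (- \<theta> - v) * t powr (\<theta> - v - 1)"
    proof -
      have "-1 - 2 * v = (- \<theta> - v) + (\<theta> - v - 1)" by simp
      then show ?thesis by (simp only: powr_add)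
    qed
    moreover have "t powr (- \<theta> - v) \<le> s powr (- \<theta> - v)"
      using s t \<theta> v0 by (intro powr_mono2') auto
    ultimately show "\<exists>y. (?f has_real_derivative y) (at t) \<and> 0 \<le> y"
      by (intro exI[of _ "CC * s powr (- \<theta> - v) * ((\<theta> - v) * t powr (\<theta> - v - 1)) - t powr (-1 - 2 * v)"] conjI)
        (simp_all only: diff_ge_0_iff_ge, intro mult_right_mono, simp_all)
  qed
  moreover have "0 \<le> CC * s powr (- \<theta> - v) * s powr (\<theta> - v)" using CC_pos by simp
  ultimately show ?thesis by linarith
qed

lemma ker_support: "\<not> (0 < s \<and> s < r \<and> r \<le> R) \<Longrightarrow> ker r s = 0"
  by (auto simp: ker_def)

lemma ker_bound: "0 < s \<Longrightarrow> s < r \<Longrightarrow> \<bar>ker r s\<bar> \<le> CC * \<alpha> r * \<beta> s"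
proof -
  assume s: "0 < s" and sr: "s < r"
  have q: "0 \<le> Q r - Q s" using Q_mono[of s r] s sr by simp
  have "r powr a * s powr a * (Q r - Q s) \<le> r powr a * s powr a * (CC * s powr (- \<theta> - v) * r powr (\<theta> - v))"
    using Q_diff_bound[OF s less_imp_le[OF sr]] by (intro mult_left_mono) auto
  also have "\<dots> = CC * (r powr a * r powr (\<theta> - v)) * (s powr a * s powr (- \<theta> - v))"
    by (simp add: mult_ac)
  also have "\<dots> = CC * \<alpha> r * \<beta> s"
    by (simp add: \<alpha>_def \<beta>_def a_def flip: powr_add)
  finally have "\<bar>r powr a * s powr a * (Q r - Q s)\<bar> \<le> CC * \<alpha> r * \<beta> s"
    using q by (simp add: abs_mult)
  moreover have "0 \<le> CC * \<alpha> r * \<beta> s" using CC_pos by simp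
  ultimately show ?thesis by (auto simp: ker_def)
qed

interpretation N: finite_measure "NR R" by (rule finite_measure_Icc)
interpretation NN: pair_sigma_finite "NR R" "NR R" ..

lemma Q_measurable: "Q \<in> borel_measurable borel"
  unfolding Q_def[abs_def] by measurable

lemma ker_measurable: "(\<lambda>p. ker (fst p) (snd p)) \<in> borel_measurable ((NR R) \<Otimes>\<^sub>M (NR R))"
proof -
  have 1: "fst \<in> borel_measurable ((NR R) \<Otimes>\<^sub>M (NR R))" "snd \<in> borel_measurable ((NR R) \<Otimes>\<^sub>M (NR R))"
    using measurable_compose[OF measurable_fst[of "NR R" "NR R"] borel_measurable_lebesgue_on_id]
      measurable_compose[OF measurable_snd[of "NR R" "NR R"] borel_measurable_lebesgue_on_id] by simp_all
  note [measurable] = 1 Q_measurable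
  show ?thesis unfolding ker_def by measurable
qed

text \<open>\<open>vit n\<close> is the kernel of the (n+1)-st power of the Volterra operator.\<close>

primrec vit :: "nat \<Rightarrow> real \<Rightarrow> real \<Rightarrow> real" where
  "vit 0 = ker"
| "vit (Suc n) = (\<lambda>r s. LINT z|(NR R). ker r z * vit n z s)"

lemma vit_support: "\<not> (0 < s \<and> s < r \<and> r \<le> R) \<Longrightarrow> vit n r s = 0"
proof (induction n arbitrary: r)
  case (Suc n)
  have "ker r z * vit n z s = 0" for z
    using ker_support[of z r] Suc.IH[of z] Suc.prems by force
  then show ?case by (simp only: vit.simps) simp
qed (simp add: ker_support)

lemma vit_measurable: "(\<lambda>p. vit n (fst p) (snd p)) \<in> borel_measurable ((NR R) \<Otimes>\<^sub>M (NR R))"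
proof (induction n)
  case 0
  then show ?case using ker_measurable by simp
next
  case (Suc n)
  have "(\<lambda>x. (fst (fst x), snd x)) \<in> ((NR R) \<Otimes>\<^sub>M (NR R)) \<Otimes>\<^sub>M (NR R) \<rightarrow>\<^sub>M (NR R) \<Otimes>\<^sub>M (NR R)"
    "(\<lambda>x. (snd x, snd (fst x))) \<in> ((NR R) \<Otimes>\<^sub>M (NR R)) \<Otimes>\<^sub>M (NR R) \<rightarrow>\<^sub>M (NR R) \<Otimes>\<^sub>M (NR R)"
    by measurable
  from measurable_compose[OF this(1) ker_measurable] measurable_compose[OF this(2) Suc]
  have "(\<lambda>x. ker (fst (fst x)) (snd x) * vit n (snd x) (snd (fst x))) \<in> borel_measurable (((NR R) \<Otimes>\<^sub>M (NR R)) \<Otimes>\<^sub>M (NR R))"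
    by simp
  then show ?case
    unfolding vit.simps by (intro N.borel_measurable_lebesgue_integral) (simp add: case_prod_unfold)
qed

lemma measurable_section:
  assumes "(\<lambda>p. k (fst p) (snd p)) \<in> borel_measurable ((NR R) \<Otimes>\<^sub>M (NR R))"
    and "\<And>r s. \<not> (0 < s \<and> s < r \<and> r \<le> R) \<Longrightarrow> k r s = 0"
  shows "k r \<in> borel_measurable (NR R)" "(\<lambda>r. k r s) \<in> borel_measurable (NR R)"
proof -
  show "k r \<in> borel_measurable (NR R)"
  proof (cases "r \<in> {0..R}")
    case True
    then have "(\<lambda>s. (r, s)) \<in> (NR R) \<rightarrow>\<^sub>M (NR R) \<Otimes>\<^sub>M (NR R)" by simp
    from measurable_compose[OF this assms(1)] show ?thesis by simp
  next
    case False
    then have "k r = (\<lambda>_. 0)" using assms(2) by (auto simp: fun_eq_iff)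
    then show ?thesis by simp
  qed
  show "(\<lambda>r. k r s) \<in> borel_measurable (NR R)"
  proof (cases "s \<in> {0..R}")
    case True
    then have "(\<lambda>r. (r, s)) \<in> (NR R) \<rightarrow>\<^sub>M (NR R) \<Otimes>\<^sub>M (NR R)" by simp
    from measurable_compose[OF this assms(1)] show ?thesis by simp
  next
    case False
    then have "(\<lambda>r. k r s) = (\<lambda>_. 0)" using assms(2) by (auto simp: fun_eq_iff)
    then show ?thesis by simp
  qed
qed

lemma powr_section_integral:
  assumes p: "p > -1" and r: "0 \<le> r" "r \<le> R"
  shows "integrable (NR R) (\<lambda>s. if s < r then s powr p else 0)" "(LINT s|(NR R). (if s < r then s powr p else 0)) = r powr (p + 1) / (p + 1)"
proof -
  have i: "integrable (NR R) (\<lambda>s. s powr p)" using p R by (intro powr_integral_0) auto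
  have 1: "(LINT s|lebesgue_on {0..r}. s powr p) = (LINT s|(NR R). indicat_real {0..r} s *\<^sub>R s powr p)"
    by (rule integrable_subinterval_NR[OF i]) (use r in auto)
  have "AE s in (NR R). s \<noteq> r"
    using AE_completion[OF AE_lborel_singleton[of r]] by (subst AE_restrict_space_iff) auto
  then have ae: "AE s in (NR R). indicat_real {0..r} s *\<^sub>R s powr p = (if s < r then s powr p else 0)"
    using AE_space by eventually_elim (auto simp: indicator_def)
  have m: "(\<lambda>s. if s < r then s powr p else 0) \<in> borel_measurable (NR R)"
    by (intro borel_imp_lebesgue_on) measurable
  have m': "(\<lambda>s. indicat_real {0..r} s *\<^sub>R s powr p) \<in> borel_measurable (NR R)"
    by (intro borel_imp_lebesgue_on) measurable
  show "integrable (NR R) (\<lambda>s. if s < r then s powr p else 0)"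
    by (rule Bochner_Integration.integrable_bound[OF i m]) auto
  show "(LINT s|(NR R). (if s < r then s powr p else 0)) = r powr (p + 1) / (p + 1)"
    using integral_cong_AE[OF m' m ae] 1 powr_integral_0(2)[OF p r(1)] by simp
qed

text \<open>Each composition integrates \<open>\<alpha> z * \<beta> z = z\<close> against the
  previous power, which contributes \<open>r^2 / 2\<close> and the next factor of the factorial.
  This makes the Neumann series entire in the spectral parameter.\<close>

definition vit_bound :: "nat \<Rightarrow> real \<Rightarrow> real" where
  "vit_bound n r = CC ^ Suc n * \<alpha> r * ((r\<^sup>2 / 2) ^ n / fact n)"

lemma vit_bound_nonneg [simp]: "0 \<le> vit_bound n r"
  using CC_pos by (simp add: vit_bound_def)

lemma vit_bound_step:
  assumes r: "0 \<le> r" "r \<le> R"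
  shows "integrable (NR R) (\<lambda>z. if z < r then CC * \<alpha> r * \<beta> z * vit_bound n z else 0)"
    "(LINT z|(NR R). (if z < r then CC * \<alpha> r * \<beta> z * vit_bound n z else 0)) = vit_bound (Suc n) r"
proof -
  let ?c = "CC ^ Suc (Suc n) * \<alpha> r * (1 / (2 ^ n * fact n))"
  have eq: "(if z < r then CC * \<alpha> r * \<beta> z * vit_bound n z else 0) = ?c * (if z < r then z powr (2 * real n + 1) else 0)"
    if "z \<in> space (NR R)" for z
  proof (cases "z = 0")
    case True
    then show ?thesis using \<theta> by (simp add: \<beta>_def)
  next
    case False
    then have z: "z > 0" using that by simp
    have "z powr (2 * real n + 1) = z * (z\<^sup>2) ^ n"
    proof -
      have "z powr (2 * real n + 1) = z powr real (2 * n + 1)" by (simp add: add.commute)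
      also have "\<dots> = z ^ (2 * n + 1)" using z by (rule powr_realpow)
      finally show ?thesis by (simp add: power_mult)
    qed
    then show ?thesis
      using \<alpha>\<beta>[of z] z by (simp add: vit_bound_def power_divide mult_ac)
  qed
  have i: "integrable (NR R) (\<lambda>z. if z < r then z powr (2 * real n + 1) else 0)"
    "(LINT z|(NR R). (if z < r then z powr (2 * real n + 1) else 0)) = r powr (2 * real n + 1 + 1) / (2 * real n + 1 + 1)"
    by (rule powr_section_integral[OF _ r]; simp)+
  show "integrable (NR R) (\<lambda>z. if z < r then CC * \<alpha> r * \<beta> z * vit_bound n z else 0)"
    using i(1) by (subst Bochner_Integration.integrable_cong[OF refl eq]) auto
  have "(LINT z|(NR R). (if z < r then CC * \<alpha> r * \<beta> z * vit_bound n z else 0)) = ?c * (r powr (2 * real n + 1 + 1) / (2 * real n + 1 + 1))"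
    using i(2) by (subst Bochner_Integration.integral_cong[OF refl eq]) auto
  also have "r powr (2 * real n + 1 + 1) = (r\<^sup>2) ^ Suc n"
  proof (cases "r = 0")
    case False
    then have "r > 0" using r by simp
    then have "r powr (2 * real n + 1 + 1) = r powr real (2 * Suc n)" by (intro arg_cong2[where f = "(powr)"]) auto
    also have "\<dots> = r ^ (2 * Suc n)" using \<open>r > 0\<close> by (rule powr_realpow)
    finally show ?thesis by (simp only: power_mult)
  qed simp
  also have "?c * ((r\<^sup>2) ^ Suc n / (2 * real n + 1 + 1)) = vit_bound (Suc n) r"
    by (simp add: vit_bound_def power_divide field_simps)
  finally show "(LINT z|(NR R). (if z < r then CC * \<alpha> r * \<beta> z * vit_bound n z else 0)) = vit_bound (Suc n) r" .
qed

lemma vit_le: "0 < s \<Longrightarrow> s < r \<Longrightarrow> r \<le> R \<Longrightarrow> \<bar>vit n r s\<bar> \<le> vit_bound n r * \<beta> s"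
proof (induction n arbitrary: r)
  case 0
  then show ?case using ker_bound[of s r] by (simp add: vit_bound_def)
next
  case (Suc n)
  let ?g = "\<lambda>z. (if z < r then CC * \<alpha> r * \<beta> z * vit_bound n z else 0) * \<beta> s"
  have le: "norm (ker r z * vit n z s) \<le> ?g z" for z
  proof (cases "0 < s \<and> s < z \<and> z < r")
    case True
    then have "\<bar>ker r z\<bar> * \<bar>vit n z s\<bar> \<le> (CC * \<alpha> r * \<beta> z) * (vit_bound n z * \<beta> s)"
      using ker_bound[of z r] Suc.IH[of z] Suc.prems by (intro mult_mono) auto
    then show ?thesis using True by (simp add: abs_mult mult_ac)
  next
    case False
    then have "ker r z * vit n z s = 0"
      using ker_support[of z r] vit_support[of s z n] by auto
    moreover have "0 \<le> ?g z" using CC_pos by simp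
    ultimately show ?thesis by (simp only: norm_zero)
  qed
  have i: "integrable (NR R) ?g"
    using vit_bound_step(1)[of r n] Suc.prems by simp
  have m: "(\<lambda>z. ker r z * vit n z s) \<in> borel_measurable (NR R)"
    using measurable_section(1)[OF ker_measurable ker_support] measurable_section(2)[OF vit_measurable vit_support]
    by (intro borel_measurable_times) auto
  have "integrable (NR R) (\<lambda>z. ker r z * vit n z s)"
    by (rule Bochner_Integration.integrable_bound[OF i m])
      (intro AE_I2 order_trans[OF le], simp only: real_norm_def abs_ge_self)
  then have "norm (LINT z|(NR R). ker r z * vit n z s) \<le> (LINT z|(NR R). ?g z)"
    using i le by (intro Bochner_Integration.integral_norm_bound_integral) auto
  also have "\<dots> = vit_bound (Suc n) r * \<beta> s"
    using vit_bound_step(2)[of r n] Suc.prems by simp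
  finally show ?case by simp
qed

end

lemma complex_of_real_measurable:
  "f \<in> borel_measurable M \<Longrightarrow> (\<lambda>x. complex_of_real (f x)) \<in> borel_measurable M"
  by (rule measurable_compose[OF _ borel_measurable_continuous_onI]) (auto intro: continuous_intros)

text \<open>A separated majorant controls all sections and the double integral at once.\<close>

lemma hs_kernel_of_product_bound:
  fixes k :: "real \<Rightarrow> real \<Rightarrow> complex"
  assumes k: "(\<lambda>p. k (fst p) (snd p)) \<in> borel_measurable (NR R \<Otimes>\<^sub>M NR R)"
    and sections: "\<And>r. k r \<in> borel_measurable (NR R)" "\<And>s. (\<lambda>r. k r s) \<in> borel_measurable (NR R)"
    and bd: "\<And>r s. cmod (k r s) \<le> A r * B s"
    and A: "integrable (NR R) (\<lambda>r. (A r)\<^sup>2)" and B: "integrable (NR R) (\<lambda>s. (B s)\<^sup>2)"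
  shows "hs_kernel R k"
proof -
  interpret N: finite_measure "NR R" by (rule finite_measure_Icc)
  interpret NN: pair_sigma_finite "NR R" "NR R" ..
  have bd2: "(cmod (k r s))\<^sup>2 \<le> (A r)\<^sup>2 * (B s)\<^sup>2" for r s
    using power_mono[OF bd[of r s], of 2] by (simp add: power_mult_distrib)
  have 1: "sq_int R (k r)" for r
  proof -
    have "integrable (NR R) (\<lambda>s. (cmod (k r s))\<^sup>2)"
    proof (rule Bochner_Integration.integrable_bound)
      show "integrable (NR R) (\<lambda>s. (A r)\<^sup>2 * (B s)\<^sup>2)" using B by simp
      show "(\<lambda>s. (cmod (k r s))\<^sup>2) \<in> borel_measurable (NR R)" using sections(1)[of r] by measurable
    qed (simp add: bd2)
    then show ?thesis using sections(1)[of r] by (simp add: sq_int_def)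
  qed
  have 2: "sq_int R (\<lambda>r. k r s)" for s
  proof -
    have "integrable (NR R) (\<lambda>r. (cmod (k r s))\<^sup>2)"
    proof (rule Bochner_Integration.integrable_bound)
      show "integrable (NR R) (\<lambda>r. (A r)\<^sup>2 * (B s)\<^sup>2)" using A by simp
      show "(\<lambda>r. (cmod (k r s))\<^sup>2) \<in> borel_measurable (NR R)" using sections(2)[of s] by measurable
    qed (simp add: bd2)
    then show ?thesis using sections(2)[of s] by (simp add: sq_int_def)
  qed
  have "integrable (NR R \<Otimes>\<^sub>M NR R) (\<lambda>p. (cmod (k (fst p) (snd p)))\<^sup>2)"
  proof (rule NN.Fubini_integrable)
    show m: "(\<lambda>p. (cmod (k (fst p) (snd p)))\<^sup>2) \<in> borel_measurable (NR R \<Otimes>\<^sub>M NR R)"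
      using k by measurable
    show "integrable (NR R) (\<lambda>r. LINT s|NR R. norm ((cmod (k (fst (r, s)) (snd (r, s))))\<^sup>2))"
    proof (rule Bochner_Integration.integrable_bound)
      show "integrable (NR R) (\<lambda>r. (A r)\<^sup>2 * (LINT s|NR R. (B s)\<^sup>2))" using A by simp
      show "(\<lambda>r. LINT s|NR R. norm ((cmod (k (fst (r, s)) (snd (r, s))))\<^sup>2)) \<in> borel_measurable (NR R)"
        by (intro N.borel_measurable_lebesgue_integral) (use m in \<open>simp add: case_prod_unfold\<close>)
      show "AE r in NR R. norm (LINT s|NR R. norm ((cmod (k (fst (r, s)) (snd (r, s))))\<^sup>2))
          \<le> norm ((A r)\<^sup>2 * (LINT s|NR R. (B s)\<^sup>2))"
      proof (intro AE_I2)
        fix r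
        have "(LINT s|NR R. (cmod (k r s))\<^sup>2) \<le> (LINT s|NR R. (A r)\<^sup>2 * (B s)\<^sup>2)"
          using sq_intD(2)[OF 1[of r]] B bd2 by (intro integral_mono) auto
        then show "norm (LINT s|NR R. norm ((cmod (k (fst (r, s)) (snd (r, s))))\<^sup>2))
          \<le> norm ((A r)\<^sup>2 * (LINT s|NR R. (B s)\<^sup>2))"
          by (simp add: integral_nonneg_AE)
      qed
    qed
    show "AE r in NR R. integrable (NR R) (\<lambda>s. (cmod (k (fst (r, s)) (snd (r, s))))\<^sup>2)"
      using sq_intD(2)[OF 1] by simp
  qed
  then show ?thesis using k 1 2 by (simp add: hs_kernel_def)
qed

section \<open>The resolvent kernel as a Neumann series\<close>

context volterra
begin

interpretation N: finite_measure "NR R" by (rule finite_measure_Icc)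
interpretation NN: pair_sigma_finite "NR R" "NR R" ..

definition "rho = CC * R\<^sup>2 / 2"

lemma rho_nonneg [simp]: "0 \<le> rho" using CC_pos by (simp add: rho_def)

lemma vit_le_all: "\<bar>vit n r s\<bar> \<le> CC * \<alpha> r * \<beta> s * (rho ^ n / fact n)"
proof (cases "0 < s \<and> s < r \<and> r \<le> R")
  case True
  have "r\<^sup>2 \<le> R\<^sup>2" using True by (intro power_mono) auto
  then have "CC * r\<^sup>2 / 2 \<le> rho" using CC_pos by (simp add: rho_def)
  then have "(CC * r\<^sup>2 / 2) ^ n \<le> rho ^ n" using CC_pos by (intro power_mono) auto
  then have "CC * \<alpha> r * \<beta> s * ((CC * r\<^sup>2 / 2) ^ n / fact n) \<le> CC * \<alpha> r * \<beta> s * (rho ^ n / fact n)"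
    using CC_pos by (intro mult_left_mono divide_right_mono) auto
  moreover have "vit_bound n r * \<beta> s = CC * \<alpha> r * \<beta> s * ((CC * r\<^sup>2 / 2) ^ n / fact n)"
    by (simp add: vit_bound_def power_mult_distrib power_divide)
  ultimately show ?thesis using vit_le[of s r n] True by simp
next
  case False
  then have "vit n r s = 0" by (rule vit_support)
  then show ?thesis using CC_pos by simp
qed

text \<open>The kernel of \<open>(1 + w V)^-1 V\<close> for the Volterra operator \<open>V\<close>;
  there is no identity term, since \<open>vit 0\<close> is already the first power.\<close>

definition vw :: "complex \<Rightarrow> real \<Rightarrow> real \<Rightarrow> complex" where
  "vw w r s = (\<Sum>n. (- w) ^ n * of_real (vit n r s))"

definition Cw :: "complex \<Rightarrow> real" where "Cw w = CC * exp (cmod w * rho)"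

lemma Cw_nonneg [simp]: "0 \<le> Cw w" using CC_pos by (simp add: Cw_def)

lemma vw_term_bound:
  fixes w :: complex
  shows "cmod ((- w) ^ n * of_real (vit n r s)) \<le> CC * \<alpha> r * \<beta> s * ((cmod w * rho) ^ n / fact n)"
proof -
  have "cmod ((- w) ^ n * of_real (vit n r s)) = cmod w ^ n * \<bar>vit n r s\<bar>"
    by (simp add: norm_mult norm_power)
  also have "\<dots> \<le> cmod w ^ n * (CC * \<alpha> r * \<beta> s * (rho ^ n / fact n))"
    by (intro mult_left_mono vit_le_all) auto
  finally show ?thesis by (simp add: power_mult_distrib mult_ac)
qed

lemma exp_sums: "(\<lambda>n. c * (x ^ n / fact n)) sums (c * exp x)" for c x :: real
  using sums_mult[OF exp_converges[of x], of c] by (simp add: divide_inverse mult_ac)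

lemma vw_summable:
  fixes w :: complex
  shows "summable (\<lambda>n. norm ((- w) ^ n * of_real (vit n r s)))"
  by (rule summable_comparison_test'[OF sums_summable[OF exp_sums[of "CC * \<alpha> r * \<beta> s" "cmod w * rho"]], of 0])
    (use vw_term_bound in auto)

lemma vw_bound: "cmod (vw w r s) \<le> Cw w * \<alpha> r * \<beta> s"
proof -
  have "cmod (vw w r s) \<le> (\<Sum>n. norm ((- w) ^ n * of_real (vit n r s)))"
    unfolding vw_def by (rule summable_norm[OF vw_summable])
  also have "\<dots> \<le> CC * \<alpha> r * \<beta> s * exp (cmod w * rho)"
    using suminf_le[OF vw_term_bound vw_summable sums_summable[OF exp_sums]]
    by (simp only: sums_unique[OF exp_sums, symmetric])
  finally show ?thesis by (simp add: Cw_def mult_ac)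
qed

lemma vw_support: "\<not> (0 < s \<and> s < r \<and> r \<le> R) \<Longrightarrow> vw w r s = 0"
  unfolding vw_def using vit_support[of s r] by simp

lemma vw_measurable: "(\<lambda>p. vw w (fst p) (snd p)) \<in> borel_measurable (NR R \<Otimes>\<^sub>M NR R)"
  unfolding vw_def by (intro borel_measurable_suminf borel_measurable_times borel_measurable_const complex_of_real_measurable vit_measurable)

lemma vw_sections: "vw w r \<in> borel_measurable (NR R)" "(\<lambda>r. vw w r s) \<in> borel_measurable (NR R)"
  using measurable_section[OF vw_measurable vw_support] by auto

definition kerc :: "real \<Rightarrow> real \<Rightarrow> complex" where "kerc r s = of_real (ker r s)"

lemma vw_0: "vw 0 = kerc"
proof (intro ext)
  fix r s
  have "vw 0 r s = (\<Sum>n\<in>{0}. (- 0) ^ n * of_real (vit n r s))"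
    unfolding vw_def by (rule suminf_finite) auto
  then show "vw 0 r s = kerc r s" by (simp add: kerc_def)
qed

lemma kerc_bound: "cmod (kerc r s) \<le> CC * \<alpha> r * \<beta> s"
  using vw_bound[of 0 r s] by (simp add: vw_0 Cw_def)

lemma kerc_measurable: "(\<lambda>p. kerc (fst p) (snd p)) \<in> borel_measurable (NR R \<Otimes>\<^sub>M NR R)"
  using vw_measurable[of 0] by (simp add: vw_0)

lemma kerc_sections: "kerc r \<in> borel_measurable (NR R)" "(\<lambda>r. kerc r s) \<in> borel_measurable (NR R)"
  using vw_sections[of 0] by (simp_all add: vw_0)

lemma kerc_support: "\<not> (0 < s \<and> s < r \<and> r \<le> R) \<Longrightarrow> kerc r s = 0"
  by (simp add: kerc_def ker_support)

lemma \<beta>_sq_integrable: "integrable (NR R) (\<lambda>s. (\<beta> s)\<^sup>2)" 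
proof -
  have "integrable (NR R) (\<lambda>s. s powr (1 - 2 * \<theta>))"
    using \<theta> R by (intro powr_integral_0) auto
  moreover have "(\<beta> s)\<^sup>2 = s powr (1 - 2 * \<theta>)" for s
    by (simp add: \<beta>_def power2_eq_square flip: powr_add)
  ultimately show ?thesis by simp
qed

lemma \<beta>_integrable: "integrable (NR R) \<beta>"
  unfolding \<beta>_def[abs_def] using \<theta> R by (intro powr_integral_0) auto

lemma \<alpha>_sq_integrable: "integrable (NR R) (\<lambda>s. (\<alpha> s)\<^sup>2)" 
proof -
  have "integrable (NR R) (\<lambda>s. s powr (1 + 2 * \<theta>))"
    using \<theta> R by (intro powr_integral_0) auto
  moreover have "(\<alpha> s)\<^sup>2 = s powr (1 + 2 * \<theta>)" for s
    by (simp add: \<alpha>_def power2_eq_square flip: powr_add)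
  ultimately show ?thesis by simp
qed

lemma \<beta>_measurable: "\<beta> \<in> borel_measurable (NR R)"
  using \<beta>_integrable by (rule borel_measurable_integrable)

lemma hs_vw: "hs_kernel R (vw w)"
proof (rule hs_kernel_of_product_bound[where A = "\<lambda>r. Cw w * \<alpha> r" and B = \<beta>])
  show "integrable (NR R) (\<lambda>r. (Cw w * \<alpha> r)\<^sup>2)" using \<alpha>_sq_integrable by (simp add: power_mult_distrib)
qed (use vw_measurable vw_sections vw_bound \<beta>_sq_integrable in auto)

lemma hs_kerc: "hs_kernel R kerc"
  using hs_vw[of 0] by (simp add: vw_0)

text \<open>The term for \<open>n = 0\<close> is split off, and one factor \<open>kerc\<close> is
  pulled out on the left, the side on which the recursion of \<open>vit\<close> composes.\<close>

lemma resolvent_kernel: "vw w r s = kerc r s - w * (LINT z|NR R. kerc r z * vw w z s)"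
proof -
  let ?f = "\<lambda>n z. kerc r z * ((- w) ^ n * of_real (vit n z s))"
  define c where "c n = (cmod w * rho) ^ n / fact n" for n
  \<comment> \<open>\<open>K * c n\<close> dominates the n-th term uniformly in \<open>z\<close>:
    the weights meet at \<open>z\<close> and contribute only
    \<open>\<alpha> z * \<beta> z = z \<le> R\<close>.\<close>
  define K where "K = CC * \<alpha> r * (CC * \<beta> s) * R"
  have c0: "0 \<le> c n" for n by (simp add: c_def)
  have le: "norm (?f n z) \<le> K * c n" if "z \<in> space (NR R)" for n z
  proof -
    have z: "0 \<le> z" "z \<le> R" using that by auto
    have "norm (?f n z) \<le> (CC * \<alpha> r * \<beta> z) * (CC * \<alpha> z * \<beta> s * c n)"
      unfolding norm_mult[of "kerc r z"] c_def using CC_pos by (intro mult_mono kerc_bound vw_term_bound) auto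
    also have "\<dots> = CC * \<alpha> r * (CC * \<beta> s) * c n * (\<alpha> z * \<beta> z)" by (simp add: mult_ac)
    also have "\<dots> \<le> CC * \<alpha> r * (CC * \<beta> s) * c n * R"
      using z CC_pos c0 by (intro mult_left_mono) (auto simp: \<alpha>\<beta>)
    finally show ?thesis by (simp add: K_def mult_ac)
  qed
  have m: "?f n \<in> borel_measurable (NR R)" for n
    by (intro borel_measurable_times kerc_sections borel_measurable_const complex_of_real_measurable measurable_section(2)[OF vit_measurable vit_support])
  have int: "integrable (NR R) (?f n)" for n
    by (rule N.integrable_const_bound[of _ "K * c n"]) (use le m in auto)
  have sc: "summable c" unfolding c_def using exp_sums[of 1 "cmod w * rho"] by (simp add: sums_iff)
  have "(LINT z|NR R. (\<Sum>n. ?f n z)) = (\<Sum>n. LINT z|NR R. ?f n z)"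
  proof (rule integral_suminf[OF int])
    show "AE z in NR R. summable (\<lambda>n. norm (?f n z))"
    proof (intro AE_I2)
      fix z assume "z \<in> space (NR R)"
      from summable_comparison_test'[OF summable_mult[OF sc, of K], of 0 "\<lambda>n. norm (?f n z)"] le[OF this]
      show "summable (\<lambda>n. norm (?f n z))" by simp
    qed
    show "summable (\<lambda>n. LINT z|NR R. norm (?f n z))"
    proof (rule summable_comparison_test'[OF summable_mult[OF sc, of "K * measure (NR R) (space (NR R))"], of 0])
      fix n
      have "(LINT z|NR R. norm (?f n z)) \<le> (LINT z|NR R. K * c n)"
        using le int by (intro integral_mono) auto
      then show "norm (LINT z|NR R. norm (?f n z)) \<le> K * measure (NR R) (space (NR R)) * c n"
        by (simp add: integral_nonneg_AE mult_ac)
    qed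
  qed
  moreover have "(\<Sum>n. ?f n z) = kerc r z * vw w z s" for z
    unfolding vw_def by (rule suminf_mult[OF summable_norm_cancel[OF vw_summable]])
  moreover have "(LINT z|NR R. ?f n z) = (- w) ^ n * of_real (vit (Suc n) r s)" for n
  proof -
    have "(LINT z|NR R. ?f n z) = (LINT z|NR R. (- w) ^ n * of_real (ker r z * vit n z s))"
      by (intro Bochner_Integration.integral_cong refl) (simp add: kerc_def)
    also have "\<dots> = (- w) ^ n * of_real (vit (Suc n) r s)"
      unfolding integral_mult_right_zero by (simp only: integral_complex_of_real vit.simps)
    finally show ?thesis .
  qed
  ultimately have *: "(LINT z|NR R. kerc r z * vw w z s) = (\<Sum>n. (- w) ^ n * of_real (vit (Suc n) r s))" by simp
  have sm: "summable (\<lambda>n. (- w) ^ n * of_real (vit n r s))"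
    using vw_summable by (rule summable_norm_cancel)
  have sm': "summable (\<lambda>n. (- w) ^ n * of_real (vit (Suc n) r s) :: complex)"
  proof -
    have "summable (\<lambda>n. LINT z|NR R. ?f n z)"
    proof (rule summable_integral[OF int])
      show "AE z in NR R. summable (\<lambda>n. norm (?f n z))"
      proof (intro AE_I2)
        fix z assume "z \<in> space (NR R)"
        from summable_comparison_test'[OF summable_mult[OF sc, of K], of 0 "\<lambda>n. norm (?f n z)"] le[OF this]
        show "summable (\<lambda>n. norm (?f n z))" by simp
      qed
      show "summable (\<lambda>n. LINT z|NR R. norm (?f n z))"
      proof (rule summable_comparison_test'[OF summable_mult[OF sc, of "K * measure (NR R) (space (NR R))"], of 0])
        fix n
        have "(LINT z|NR R. norm (?f n z)) \<le> (LINT z|NR R. K * c n)"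
          using le int by (intro integral_mono) auto
        then show "norm (LINT z|NR R. norm (?f n z)) \<le> K * measure (NR R) (space (NR R)) * c n"
          by (simp add: integral_nonneg_AE mult_ac)
      qed
    qed
    then show ?thesis using \<open>\<And>n. (LINT z|NR R. ?f n z) = (- w) ^ n * of_real (vit (Suc n) r s)\<close> by simp
  qed
  have "vw w r s = (\<Sum>n. (- w) ^ Suc n * of_real (vit (Suc n) r s)) + of_real (vit 0 r s)"
    unfolding vw_def using suminf_split_head[OF sm] by simp
  also have "(\<Sum>n. (- w) ^ Suc n * of_real (vit (Suc n) r s)) = (\<Sum>n. - w * ((- w) ^ n * of_real (vit (Suc n) r s)))"
    by (simp add: mult_ac)
  also have "\<dots> = - w * (\<Sum>n. (- w) ^ n * of_real (vit (Suc n) r s))"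
    by (rule suminf_mult[OF sm'])
  finally show ?thesis using * by (simp add: kerc_def)
qed

text \<open>A class on which kernels bounded by \<open>\<alpha> r * \<beta> s\<close> act at every
  point. It contains the square-integrable functions, and the images are square integrable
  again.\<close>

definition Bint :: "(real \<Rightarrow> complex) \<Rightarrow> bool" where
  "Bint f \<longleftrightarrow> f \<in> borel_measurable (NR R) \<and> integrable (NR R) (\<lambda>s. \<beta> s * cmod (f s))"

definition Wn :: "(real \<Rightarrow> complex) \<Rightarrow> real" where "Wn f = (LINT s|NR R. \<beta> s * cmod (f s))"

lemma Wn_nonneg [simp]: "0 \<le> Wn f" unfolding Wn_def by (rule integral_nonneg_AE) simp

lemma Bint_sq_int: "sq_int R f \<Longrightarrow> Bint f"
proof -
  assume f: "sq_int R f"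
  have "integrable (NR R) (\<lambda>s. complex_of_real (\<beta> s) * f s)"
    using f \<beta>_sq_integrable \<beta>_measurable by (intro integrable_mult_L2) (auto simp: sq_int_def)
  from integrable_norm[OF this] show ?thesis
    using f by (simp add: Bint_def sq_int_def norm_mult)
qed

lemma Bint_add: "Bint f \<Longrightarrow> Bint g \<Longrightarrow> Bint (\<lambda>s. f s + g s)"
proof -
  assume f: "Bint f" and g: "Bint g"
  then have [measurable]: "f \<in> borel_measurable (NR R)" "g \<in> borel_measurable (NR R)" by (auto simp: Bint_def)
  note [measurable] = \<beta>_measurable
  have "integrable (NR R) (\<lambda>s. \<beta> s * cmod (f s + g s))"
  proof (rule Bochner_Integration.integrable_bound)
    show "integrable (NR R) (\<lambda>s. \<beta> s * cmod (f s) + \<beta> s * cmod (g s))"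
      using f g by (simp add: Bint_def)
    show "(\<lambda>s. \<beta> s * cmod (f s + g s)) \<in> borel_measurable (NR R)"
      by measurable
    show "AE s in NR R. norm (\<beta> s * cmod (f s + g s)) \<le> norm (\<beta> s * cmod (f s) + \<beta> s * cmod (g s))"
      by (intro AE_I2) (simp add: norm_triangle_ineq mult_left_mono flip: distrib_left)
  qed
  then show ?thesis using f g by (simp add: Bint_def borel_measurable_add)
qed

lemma Bint_scale: "Bint f \<Longrightarrow> Bint (\<lambda>s. c * f s)"
  by (auto simp: Bint_def norm_mult mult.left_commute)

lemma Bint_diff: "Bint f \<Longrightarrow> Bint g \<Longrightarrow> Bint (\<lambda>s. f s - g s)"
  using Bint_add[of f "\<lambda>s. - 1 * g s"] Bint_scale[of g "-1"] by simp

context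
  fixes k :: "real \<Rightarrow> real \<Rightarrow> complex" and c :: real
  assumes k_meas: "(\<lambda>p. k (fst p) (snd p)) \<in> borel_measurable (NR R \<Otimes>\<^sub>M NR R)"
    and k_sec: "\<And>r. k r \<in> borel_measurable (NR R)"
    and k_bd: "\<And>r s. cmod (k r s) \<le> c * \<alpha> r * \<beta> s"
begin

lemma kop_term_bound: "cmod (k r s * f s) \<le> c * \<alpha> r * (\<beta> s * cmod (f s))"
  using mult_right_mono[OF k_bd[of r s], of "cmod (f s)"] by (simp add: norm_mult mult_ac)

lemma kop_integrable: "Bint f \<Longrightarrow> integrable (NR R) (\<lambda>s. k r s * f s)"
  by (rule Bochner_Integration.integrable_bound[of _ "\<lambda>s. c * \<alpha> r * (\<beta> s * cmod (f s))"])
    (use k_sec kop_term_bound order_trans[OF kop_term_bound abs_ge_self] in \<open>auto simp: Bint_def\<close>)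

lemma kop_bound_Wn: "Bint f \<Longrightarrow> cmod (kop R k f r) \<le> c * \<alpha> r * Wn f"
proof -
  assume f: "Bint f"
  have "norm (LINT s|NR R. k r s * f s) \<le> (LINT s|NR R. c * \<alpha> r * (\<beta> s * cmod (f s)))"
    using kop_integrable[OF f] kop_term_bound f
    by (intro Bochner_Integration.integral_norm_bound_integral) (auto simp: Bint_def)
  also have "\<dots> = c * \<alpha> r * Wn f" by (simp add: Wn_def)
  finally show ?thesis by (simp add: kop_def)
qed

lemma kop_sq_int_B: "Bint f \<Longrightarrow> sq_int R (kop R k f)"
proof -
  assume f: "Bint f"
  have m: "kop R k f \<in> borel_measurable (NR R)"
    using f by (intro kop_measurable k_meas) (simp add: Bint_def)
  have "integrable (NR R) (\<lambda>r. (cmod (kop R k f r))\<^sup>2)"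
  proof (rule Bochner_Integration.integrable_bound)
    show "integrable (NR R) (\<lambda>r. (c * Wn f)\<^sup>2 * (\<alpha> r)\<^sup>2)" using \<alpha>_sq_integrable by simp
    show "(\<lambda>r. (cmod (kop R k f r))\<^sup>2) \<in> borel_measurable (NR R)" using m by measurable
    show "AE r in NR R. norm ((cmod (kop R k f r))\<^sup>2) \<le> norm ((c * Wn f)\<^sup>2 * (\<alpha> r)\<^sup>2)"
    proof (intro AE_I2)
      fix r
      show "norm ((cmod (kop R k f r))\<^sup>2) \<le> norm ((c * Wn f)\<^sup>2 * (\<alpha> r)\<^sup>2)"
        using power_mono[OF kop_bound_Wn[OF f, of r], of 2] by (simp add: power_mult_distrib mult_ac)
    qed
  qed
  then show ?thesis using m by (simp add: sq_int_def)
qed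

lemma kop_add: "Bint f \<Longrightarrow> Bint g \<Longrightarrow> kop R k (\<lambda>s. f s + g s) r = kop R k f r + kop R k g r"
  unfolding kop_def distrib_left by (rule Bochner_Integration.integral_add[OF kop_integrable kop_integrable])

lemma kop_diff: "Bint f \<Longrightarrow> Bint g \<Longrightarrow> kop R k (\<lambda>s. f s - g s) r = kop R k f r - kop R k g r"
  unfolding kop_def right_diff_distrib by (rule Bochner_Integration.integral_diff[OF kop_integrable kop_integrable])

end

lemma kop_scale: "kop R k (\<lambda>s. d * f s) r = d * kop R k f r"
  unfolding kop_def by (simp add: mult.left_commute)

lemma kop_cong: "(\<And>s. 0 < s \<Longrightarrow> s \<le> R \<Longrightarrow> f s = g s) \<Longrightarrow> (\<And>r s. s \<le> 0 \<Longrightarrow> k r s = 0) \<Longrightarrow> kop R k f r = kop R k g r"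
  unfolding kop_def by (intro Bochner_Integration.integral_cong refl) (metis atLeastAtMost_iff linorder_not_le mult_zero_left space_lebesgue_on)

definition V0 :: "(real \<Rightarrow> complex) \<Rightarrow> real \<Rightarrow> complex" where "V0 = kop R kerc"
definition Vw :: "complex \<Rightarrow> (real \<Rightarrow> complex) \<Rightarrow> real \<Rightarrow> complex" where "Vw w = kop R (vw w)"

lemmas V0_bound = kop_bound_Wn[OF kerc_measurable kerc_sections(1) kerc_bound, folded V0_def]
lemmas V0_sq_int = kop_sq_int_B[OF kerc_measurable kerc_sections(1) kerc_bound, folded V0_def]
lemmas V0_add = kop_add[OF kerc_measurable kerc_sections(1) kerc_bound, folded V0_def]
lemmas V0_diff = kop_diff[OF kerc_measurable kerc_sections(1) kerc_bound, folded V0_def]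
lemmas V0_scale = kop_scale[of kerc, folded V0_def]
lemmas V0_Bint = Bint_sq_int[OF V0_sq_int]
lemmas Vw_sq_int = kop_sq_int_B[OF vw_measurable vw_sections(1) vw_bound, folded Vw_def]
lemmas Vw_add = kop_add[OF vw_measurable vw_sections(1) vw_bound, folded Vw_def]
lemmas Vw_scale = kop_scale[of "vw w" for w, folded Vw_def]
lemmas Vw_Bint = Bint_sq_int[OF Vw_sq_int]

lemma V0_cong: "(\<And>s. 0 < s \<Longrightarrow> s \<le> R \<Longrightarrow> f s = g s) \<Longrightarrow> V0 f r = V0 g r"
  unfolding V0_def by (rule kop_cong) (auto intro: kerc_support)

text \<open>The kernel identity is integrated against \<open>f\<close>; Fubini applies because the
  weights at the intermediate point multiply to at most \<open>R\<close>.\<close>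

lemma resolvent_equation:
  assumes f: "Bint f"
  shows "Vw w f r = V0 f r - w * V0 (Vw w f) r"
proof -
  have fm: "f \<in> borel_measurable (NR R)" using f by (simp add: Bint_def)
  have bd: "norm (kerc r z * (vw w z s * f s)) \<le> CC * \<alpha> r * Cw w * R * (\<beta> s * cmod (f s))" if "z \<in> space (NR R)" for z s
  proof -
    have z: "0 \<le> z" "z \<le> R" using that by auto
    have "norm (kerc r z * (vw w z s * f s)) \<le> (CC * \<alpha> r * \<beta> z) * ((Cw w * \<alpha> z * \<beta> s) * cmod (f s))"
      unfolding norm_mult using CC_pos by (intro mult_mono kerc_bound vw_bound) auto
    also have "\<dots> = CC * \<alpha> r * Cw w * (\<beta> s * cmod (f s)) * (\<alpha> z * \<beta> z)" by (simp add: mult_ac)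
    also have "\<dots> \<le> CC * \<alpha> r * Cw w * (\<beta> s * cmod (f s)) * R"
      using z CC_pos by (intro mult_left_mono) (auto simp: \<alpha>\<beta>)
    finally show ?thesis by (simp add: mult_ac)
  qed
  have m: "(\<lambda>p. kerc r (fst p) * (vw w (fst p) (snd p) * f (snd p))) \<in> borel_measurable (NR R \<Otimes>\<^sub>M NR R)"
    by (intro borel_measurable_times vw_measurable measurable_compose[OF measurable_fst kerc_sections(1)]
        measurable_compose[OF measurable_snd fm])
  have sec: "integrable (NR R) (\<lambda>s. kerc r z * (vw w z s * f s))" for z
    using kop_integrable[OF vw_measurable vw_sections(1) vw_bound f, of w z] by simp
  have int: "integrable (NR R \<Otimes>\<^sub>M NR R) (\<lambda>p. kerc r (fst p) * (vw w (fst p) (snd p) * f (snd p)))"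
  proof (rule NN.Fubini_integrable[OF m])
    show "integrable (NR R) (\<lambda>z. LINT s|NR R. norm (kerc r (fst (z, s)) * (vw w (fst (z, s)) (snd (z, s)) * f (snd (z, s)))))"
    proof (rule N.integrable_const_bound[of _ "CC * \<alpha> r * Cw w * R * Wn f"])
      show "(\<lambda>z. LINT s|NR R. norm (kerc r (fst (z, s)) * (vw w (fst (z, s)) (snd (z, s)) * f (snd (z, s))))) \<in> borel_measurable (NR R)"
        by (intro N.borel_measurable_lebesgue_integral) (use m in \<open>simp add: case_prod_unfold\<close>)
      show "AE z in NR R. norm (LINT s|NR R. norm (kerc r (fst (z, s)) * (vw w (fst (z, s)) (snd (z, s)) * f (snd (z, s)))))
         \<le> CC * \<alpha> r * Cw w * R * Wn f"
      proof (intro AE_I2)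
        fix z assume z: "z \<in> space (NR R)"
        have "(LINT s|NR R. norm (kerc r z * (vw w z s * f s))) \<le> (LINT s|NR R. CC * \<alpha> r * Cw w * R * (\<beta> s * cmod (f s)))"
          using sec f bd[OF z] by (intro integral_mono integrable_norm) (auto simp: Bint_def)
        also have "\<dots> = CC * \<alpha> r * Cw w * R * Wn f" by (simp add: Wn_def)
        finally show "norm (LINT s|NR R. norm (kerc r (fst (z, s)) * (vw w (fst (z, s)) (snd (z, s)) * f (snd (z, s)))))
         \<le> CC * \<alpha> r * Cw w * R * Wn f"
          by (simp add: integral_nonneg_AE)
      qed
    qed
    show "AE z in NR R. integrable (NR R) (\<lambda>s. kerc r (fst (z, s)) * (vw w (fst (z, s)) (snd (z, s)) * f (snd (z, s))))"
      using sec by simp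
  qed
  have "V0 (Vw w f) r = (LINT z|NR R. LINT s|NR R. kerc r z * (vw w z s * f s))"
    unfolding V0_def Vw_def kop_def by simp
  also have "\<dots> = (LINT s|NR R. LINT z|NR R. kerc r z * (vw w z s * f s))"
    by (rule NN.Fubini_integral[symmetric]) (use int in \<open>simp add: case_prod_unfold\<close>)
  also have "\<dots> = (LINT s|NR R. (LINT z|NR R. kerc r z * vw w z s) * f s)"
    by (intro Bochner_Integration.integral_cong refl) (simp add: mult.assoc flip: Bochner_Integration.integral_mult_left_zero)
  finally have *: "V0 (Vw w f) r = (LINT s|NR R. (LINT z|NR R. kerc r z * vw w z s) * f s)" .
  have i1: "integrable (NR R) (\<lambda>s. (kerc r s - vw w r s) * f s)"
    unfolding left_diff_distrib
    using kop_integrable[OF vw_measurable vw_sections(1) vw_bound f, of w r] kop_integrable[OF kerc_measurable kerc_sections(1) kerc_bound f, of r]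
    by simp
  have "w * V0 (Vw w f) r = (LINT s|NR R. (kerc r s - vw w r s) * f s)"
    unfolding * integral_mult_right_zero[symmetric]
  proof (intro Bochner_Integration.integral_cong refl)
    fix s
    have "w * (LINT z|NR R. kerc r z * vw w z s) = kerc r s - vw w r s"
      using resolvent_kernel[of w r s] by simp
    then show "w * ((LINT z|NR R. kerc r z * vw w z s) * f s) = (kerc r s - vw w r s) * f s"
      by (simp only: mult.assoc[symmetric])
  qed
  also have "\<dots> = V0 f r - Vw w f r"
    unfolding left_diff_distrib V0_def Vw_def kop_def
    using kop_integrable[OF vw_measurable vw_sections(1) vw_bound f, of w r] kop_integrable[OF kerc_measurable kerc_sections(1) kerc_bound f, of r]
    by simp
  finally show ?thesis by simp
qed

text \<open>Iterating \<open>u = - w V u\<close> reproduces the bounds \<open>vit_bound\<close>,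
  which tend to 0 factorially.\<close>

lemma volterra_injective:
  assumes u: "Bint u" and eq: "\<And>r. 0 < r \<Longrightarrow> r \<le> R \<Longrightarrow> u r = - w * V0 u r" and r: "0 < r" "r \<le> R"
  shows "u r = 0"
proof -
  have bound: "cmod (u r) \<le> cmod w ^ Suc n * vit_bound n r * Wn u" if "0 < r" "r \<le> R" for n r
    using that
  proof (induction n arbitrary: r)
    case 0
    have "cmod (u r) = cmod w * cmod (V0 u r)" using eq[OF 0] by (simp add: norm_mult)
    also have "\<dots> \<le> cmod w * (CC * \<alpha> r * Wn u)" by (intro mult_left_mono V0_bound u) auto
    finally show ?case by (simp add: vit_bound_def mult_ac)
  next
    case (Suc n)
    have st: "integrable (NR R) (\<lambda>z. if z < r then CC * \<alpha> r * \<beta> z * vit_bound n z else 0)"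
      "(LINT z|NR R. (if z < r then CC * \<alpha> r * \<beta> z * vit_bound n z else 0)) = vit_bound (Suc n) r"
      using vit_bound_step[of r n] Suc.prems by auto
    have "norm (LINT z|NR R. kerc r z * u z) \<le> (LINT z|NR R. cmod w ^ Suc n * Wn u * (if z < r then CC * \<alpha> r * \<beta> z * vit_bound n z else 0))"
    proof (rule Bochner_Integration.integral_norm_bound_integral)
      show "integrable (NR R) (\<lambda>z. kerc r z * u z)"
        by (rule kop_integrable[OF kerc_measurable kerc_sections(1) kerc_bound u])
      show "integrable (NR R) (\<lambda>z. cmod w ^ Suc n * Wn u * (if z < r then CC * \<alpha> r * \<beta> z * vit_bound n z else 0))"
        using st(1) by (rule integrable_mult_right)
      fix z
      show "norm (kerc r z * u z) \<le> cmod w ^ Suc n * Wn u * (if z < r then CC * \<alpha> r * \<beta> z * vit_bound n z else 0)"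
      proof (cases "0 < z \<and> z < r")
        case True
        have "norm (kerc r z * u z) \<le> (CC * \<alpha> r * \<beta> z) * (cmod w ^ Suc n * vit_bound n z * Wn u)"
          unfolding norm_mult using True Suc.prems CC_pos by (intro mult_mono kerc_bound Suc.IH) auto
        then show ?thesis using True by (simp add: mult_ac)
      next
        case False
        then have "kerc r z = 0" by (intro kerc_support) auto
        then show ?thesis using CC_pos by simp
      qed
    qed
    also have "\<dots> = cmod w ^ Suc n * Wn u * vit_bound (Suc n) r"
      unfolding integral_mult_right_zero st(2) ..
    finally have "cmod (V0 u r) \<le> cmod w ^ Suc n * Wn u * vit_bound (Suc n) r"
      by (simp add: V0_def kop_def)
    then have "cmod w * cmod (V0 u r) \<le> cmod w * (cmod w ^ Suc n * Wn u * vit_bound (Suc n) r)"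
      by (intro mult_left_mono) auto
    then show ?case using eq[OF Suc.prems] by (simp add: norm_mult mult_ac)
  qed
  let ?x = "cmod w * (CC * r\<^sup>2 / 2)"
  have "(\<lambda>n. cmod w * CC * \<alpha> r * Wn u * (?x ^ n / fact n)) \<longlonglongrightarrow> 0"
    by (rule summable_LIMSEQ_zero[OF sums_summable[OF exp_sums]])
  moreover have "cmod w ^ Suc n * vit_bound n r * Wn u = cmod w * CC * \<alpha> r * Wn u * (?x ^ n / fact n)" for n
    by (simp add: vit_bound_def power_mult_distrib power_divide)
  ultimately have "(\<lambda>n. cmod w ^ Suc n * vit_bound n r * Wn u) \<longlonglongrightarrow> 0" by simp
  then have "cmod (u r) \<le> 0"
    by (rule LIMSEQ_le_const) (use bound[OF r] in auto)
  then show ?thesis by simp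
qed

text \<open>The candidate \<open>y\<close> solves the equation by \<open>resolvent_equation\<close>,
  and injectivity makes it the only solution. The equations are imposed on (0,R] alone, the only
  part that \<open>V0\<close> sees.\<close>

lemma volterra_solution_iff:
  assumes u: "Bint u" and F: "Bint F"
  shows "(\<forall>r. 0 < r \<longrightarrow> r \<le> R \<longrightarrow> u r + w * V0 u r = F r) \<longleftrightarrow> (\<forall>r. 0 < r \<longrightarrow> r \<le> R \<longrightarrow> u r = F r - w * Vw w F r)"
proof -
  define y where "y r = F r - w * Vw w F r" for r
  have By: "Bint y" unfolding y_def by (intro Bint_diff Bint_scale Vw_Bint F)
  have y: "y r + w * V0 y r = F r" for r
  proof -
    have "V0 y r = V0 F r - w * V0 (Vw w F) r"
      unfolding y_def by (simp add: V0_diff Bint_scale Vw_Bint F V0_scale)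
    also have "\<dots> = Vw w F r" using resolvent_equation[OF F, of w r] by simp
    finally show ?thesis by (simp add: y_def)
  qed
  show ?thesis
  proof
    assume L: "\<forall>r. 0 < r \<longrightarrow> r \<le> R \<longrightarrow> u r + w * V0 u r = F r"
    show "\<forall>r. 0 < r \<longrightarrow> r \<le> R \<longrightarrow> u r = F r - w * Vw w F r"
    proof (intro allI impI)
      fix r assume r: "0 < r" "r \<le> R"
      have "u r - y r = 0"
      proof (rule volterra_injective[where w = w and u = "\<lambda>r. u r - y r", OF _ _ r])
        show "Bint (\<lambda>r. u r - y r)" by (intro Bint_diff u By)
        fix r assume r: "0 < r" "r \<le> R"
        have "u r + w * V0 u r = y r + w * V0 y r" using L r y by simp
        then show "u r - y r = - w * V0 (\<lambda>r. u r - y r) r"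
          by (simp add: V0_diff u By algebra_simps)
      qed
      then show "u r = F r - w * Vw w F r" by (simp add: y_def)
    qed
  next
    assume "\<forall>r. 0 < r \<longrightarrow> r \<le> R \<longrightarrow> u r = F r - w * Vw w F r"
    then have uy: "u r = y r" if "0 < r" "r \<le> R" for r using that by (simp add: y_def)
    then have "V0 u r = V0 y r" for r by (intro V0_cong) auto
    then show "\<forall>r. 0 < r \<longrightarrow> r \<le> R \<longrightarrow> u r + w * V0 u r = F r" using uy y by simp
  qed
qed

text \<open>Composition in the opposite order. The series is not rearranged: \<open>Vw w f\<close>
  solves the Volterra equation with right-hand side \<open>V0 f\<close>, and the solution formula is
  applied to that equation.\<close>

lemma resolvent_equation':
  assumes f: "Bint f" and r: "0 < r" "r \<le> R"
  shows "Vw w f r = V0 f r - w * Vw w (V0 f) r"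
proof -
  have "\<forall>r. 0 < r \<longrightarrow> r \<le> R \<longrightarrow> Vw w f r + w * V0 (Vw w f) r = V0 f r"
    using resolvent_equation[OF f, of w] by (metis diff_add_cancel)
  then show ?thesis
    using volterra_solution_iff[OF Vw_Bint[OF f] V0_Bint[OF f], of w w] r by blast
qed

end

section \<open>The Volterra operator inverts the differential expression\<close>

lemma continuous_imp_measurable_Icc:
  fixes f :: "real \<Rightarrow> 'b::euclidean_space"
  shows "continuous_on {x..y} f \<Longrightarrow> f \<in> borel_measurable (lebesgue_on {x..y})"
  by (rule continuous_imp_measurable_on_sets_lebesgue) auto

lemma integral_continuous_Icc:
  fixes f :: "real \<Rightarrow> 'b::euclidean_space"
  assumes "continuous_on {x..y} f"
  shows "integrable (lebesgue_on {x..y}) f" "(LINT s|lebesgue_on {x..y}. f s) = integral {x..y} f"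
proof -
  show "integrable (lebesgue_on {x..y}) f" by (rule continuous_imp_integrable_real[OF assms])
  then show "(LINT s|lebesgue_on {x..y}. f s) = integral {x..y} f"
    by (rule lebesgue_integral_eq_integral) auto
qed

context volterra
begin

text \<open>Local absolute continuity in integral form, with \<open>h\<close> in the role of the
  derivative. The endpoint \<open>R\<close> is included and 0 is not, since the solutions are
  singular there.\<close>

definition AC :: "(real \<Rightarrow> complex) \<Rightarrow> (real \<Rightarrow> complex) \<Rightarrow> bool" where
  "AC u h \<longleftrightarrow> (\<forall>x y. 0 < x \<longrightarrow> x \<le> y \<longrightarrow> y \<le> R \<longrightarrow>
     integrable (lebesgue_on {x..y}) h \<and> u y - u x = (LINT s|lebesgue_on {x..y}. h s))"

lemma ACD:
  assumes "AC u h" "0 < x" "x \<le> y" "y \<le> R"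
  shows "integrable (lebesgue_on {x..y}) h" "u y - u x = (LINT s|lebesgue_on {x..y}. h s)"
  using assms by (auto simp: AC_def)

lemma AC_add: "AC u h \<Longrightarrow> AC u' h' \<Longrightarrow> AC (\<lambda>r. u r + u' r) (\<lambda>r. h r + h' r)"
proof -
  assume u: "AC u h" and u': "AC u' h'"
  show ?thesis unfolding AC_def
  proof (intro allI impI)
    fix x y assume xy: "0 < x" "x \<le> y" "y \<le> R"
    have "u y + u' y - (u x + u' x) = (u y - u x) + (u' y - u' x)" by simp
    then show "integrable (lebesgue_on {x..y}) (\<lambda>r. h r + h' r) \<and>
        u y + u' y - (u x + u' x) = (LINT s|lebesgue_on {x..y}. h s + h' s)"
      using ACD[OF u xy] ACD[OF u' xy] by simp
  qed
qed

lemma AC_cong: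
  assumes "AC u h" "\<And>r. 0 < r \<Longrightarrow> r \<le> R \<Longrightarrow> u' r = u r" "\<And>r. 0 < r \<Longrightarrow> r \<le> R \<Longrightarrow> h' r = h r"
  shows "AC u' h'"
  unfolding AC_def
proof (intro allI impI conjI)
  fix x y assume xy: "0 < x" "x \<le> y" "y \<le> R"
  have eq: "h' s = h s" if "s \<in> space (lebesgue_on {x..y})" for s using that xy assms(3) by simp
  show "integrable (lebesgue_on {x..y}) h'"
    by (subst Bochner_Integration.integrable_cong[OF refl eq]) (auto intro: ACD(1)[OF assms(1) xy])
  have "(LINT s|lebesgue_on {x..y}. h' s) = (LINT s|lebesgue_on {x..y}. h s)"
    by (rule Bochner_Integration.integral_cong[OF refl eq])
  then show "u' y - u' x = (LINT s|lebesgue_on {x..y}. h' s)"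
    using ACD(2)[OF assms(1) xy] xy assms(2) by simp
qed

lemma AC_continuous: 
  assumes "AC u h" "0 < x" "x \<le> y" "y \<le> R"
  shows "continuous_on {x..y} u"
proof -
  have i: "h integrable_on {x..y}"
    using integrable_on_lebesgue_on[OF ACD(1)[OF assms]] by auto
  have eq: "u x + integral {x..r} h = u r" if "r \<in> {x..y}" for r
  proof -
    have r: "x \<le> r" "r \<le> R" using that assms by auto
    have "u r - u x = integral {x..r} h"
      using ACD(2)[OF assms(1,2) r] lebesgue_integral_eq_integral[OF ACD(1)[OF assms(1,2) r]] by simp
    then show ?thesis by (simp add: algebra_simps)
  qed
  have "continuous_on {x..y} (\<lambda>r. u x + integral {x..r} h)"
    by (intro continuous_intros indefinite_integral_continuous_1 i)
  then show ?thesis by (rule continuous_on_eq) (rule eq)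
qed

lemma AC_has_derivative:
  assumes u: "AC u d" and d: "continuous_on {0<..R} d" and r: "0 < r" "r \<le> R"
  shows "(u has_vector_derivative d r) (at r within {0..R})"
proof -
  define x where "x = r / 2"
  have x: "0 < x" "x < r" using r by (auto simp: x_def)
  have cd: "continuous_on {x..R} d" by (rule continuous_on_subset[OF d]) (use x in auto)
  have D: "((\<lambda>t. u x + integral {x..t} d) has_vector_derivative 0 + d r) (at r within {x..R})"
    by (intro derivative_intros integral_has_vector_derivative[OF cd]) (use x r in auto)
  have "(u has_vector_derivative 0 + d r) (at r within {x..R})"
  proof (rule has_vector_derivative_transform[OF _ _ D])
    show "r \<in> {x..R}" using x r by simp
    fix t assume t: "t \<in> {x..R}"
    have "u t - u x = integral {x..t} d"
      using ACD[OF u x(1), of t] t lebesgue_integral_eq_integral[of "{x..t}" d] by auto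
    then show "u t = u x + integral {x..t} d" by (simp add: algebra_simps)
  qed
  moreover have "at r within {0..R} = at r within {x..R}"
    by (rule at_within_nhd[of r "{x<..}"]) (use x in auto)
  ultimately show ?thesis by (simp only: add_0)
qed

text \<open>As \<open>h\<close> is merely integrable, the product rule is obtained from Fubini on
  the triangle \<open>s \<le> r\<close>: both iterated integrals of \<open>c' r * h s\<close> are
  evaluated.\<close>

lemma AC_product:
  fixes c c' :: "real \<Rightarrow> real"
  assumes u: "AC u h" and c: "\<And>r. 0 < r \<Longrightarrow> (c has_real_derivative c' r) (at r)"
    and c': "continuous_on {0<..} c'"
  shows "AC (\<lambda>r. of_real (c r) * u r) (\<lambda>r. of_real (c' r) * u r + of_real (c r) * h r)"
  unfolding AC_def
proof (intro allI impI)
  fix x y assume xy: "0 < x" "x \<le> y" "y \<le> R"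
  let ?M = "lebesgue_on {x..y}"
  interpret M: finite_measure ?M by (rule finite_measure_Icc)
  interpret MM: pair_sigma_finite ?M ?M ..
  have h: "integrable ?M h" by (rule ACD[OF u xy])
  then have hm: "h \<in> borel_measurable ?M" by simp
  have cc': "continuous_on {x..y} c'" by (rule continuous_on_subset[OF c']) (use xy in auto)
  have cc: "continuous_on {x..y} c"
    by (intro continuous_at_imp_continuous_on ballI DERIV_isCont[OF c]) (use xy in auto)
  have cu: "continuous_on {x..y} u" by (rule AC_continuous[OF u xy])
  have c'm: "c' \<in> borel_measurable ?M" by (rule continuous_imp_measurable_Icc[OF cc'])
  have cm: "c \<in> borel_measurable ?M" by (rule continuous_imp_measurable_Icc[OF cc])
  obtain B where "\<forall>r\<in>{x..y}. \<bar>c r\<bar> \<le> B"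
    using compact_imp_bounded[OF compact_continuous_image[OF cc compact_Icc]] by (auto simp: bounded_iff)
  then have B: "\<bar>c r\<bar> \<le> B" if "r \<in> {x..y}" for r using that by blast
  obtain B' where "\<forall>r\<in>{x..y}. \<bar>c' r\<bar> \<le> B'"
    using compact_imp_bounded[OF compact_continuous_image[OF cc' compact_Icc]] by (auto simp: bounded_iff)
  then have B': "\<bar>c' r\<bar> \<le> B'" if "r \<in> {x..y}" for r using that by blast
  have ch: "integrable ?M (\<lambda>r. of_real (c r) * h r)"
  proof (rule Bochner_Integration.integrable_bound)
    show "integrable ?M (\<lambda>r. B * norm (h r))" using h by simp
    show "AE r in ?M. norm (of_real (c r) * h r) \<le> norm (B * norm (h r))"
      using B by (intro AE_I2) (auto simp: norm_mult abs_mult intro!: mult_right_mono order_trans[OF B abs_ge_self])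
  qed (use cm hm in measurable)
  have c'u: "integrable ?M (\<lambda>r. of_real (c' r) * u r)"
    by (intro integral_continuous_Icc continuous_intros cc' cu)
  let ?k = "\<lambda>r s. if s \<le> r then of_real (c' r) * h s else 0"
  have pm: "fst \<in> borel_measurable (?M \<Otimes>\<^sub>M ?M)" "snd \<in> borel_measurable (?M \<Otimes>\<^sub>M ?M)"
    using measurable_compose[OF measurable_fst[of ?M ?M] borel_measurable_lebesgue_on_id]
      measurable_compose[OF measurable_snd[of ?M ?M] borel_measurable_lebesgue_on_id] by simp_all
  have m1: "(\<lambda>p. of_real (c' (fst p)) * h (snd p)) \<in> borel_measurable (?M \<Otimes>\<^sub>M ?M)"
    by (intro borel_measurable_times complex_of_real_measurable measurable_compose[OF measurable_fst c'm] measurable_compose[OF measurable_snd hm])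
  have m: "(\<lambda>p. ?k (fst p) (snd p)) \<in> borel_measurable (?M \<Otimes>\<^sub>M ?M)"
    using m1 pm by measurable
  have int: "integrable (?M \<Otimes>\<^sub>M ?M) (\<lambda>p. ?k (fst p) (snd p))"
  proof (rule Bochner_Integration.integrable_bound[OF _ m])
    have "integrable (?M \<Otimes>\<^sub>M ?M) (\<lambda>p. norm (h (snd p)))"
    proof (rule MM.Fubini_integrable)
      show "(\<lambda>p. norm (h (snd p))) \<in> borel_measurable (?M \<Otimes>\<^sub>M ?M)"
        by (rule measurable_compose[OF measurable_snd]) (use hm in measurable)
    qed (use h in auto)
    then show "integrable (?M \<Otimes>\<^sub>M ?M) (\<lambda>p. B' * norm (h (snd p)))" by simp
    show "AE p in ?M \<Otimes>\<^sub>M ?M. norm (?k (fst p) (snd p)) \<le> norm (B' * norm (h (snd p)))"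
    proof (intro AE_I2)
      fix p assume "p \<in> space (?M \<Otimes>\<^sub>M ?M)"
      then have "fst p \<in> {x..y}" by (auto simp: space_pair_measure)
      from B'[OF this] show "norm (?k (fst p) (snd p)) \<le> norm (B' * norm (h (snd p)))"
        by (auto simp: norm_mult abs_mult intro!: mult_right_mono order_trans[OF _ abs_ge_self])
    qed
  qed
  have in1: "(LINT s|?M. ?k r s) = of_real (c' r) * (u r - u x)" if r: "r \<in> space ?M" for r
  proof -
    have r': "x \<le> r" "r \<le> R" "r \<le> y" using r xy by auto
    have "u r - u x = (LINT s|?M. indicat_real {x..r} s *\<^sub>R h s)"
      using ACD(2)[OF u xy(1) r'(1,2)] integrable_subinterval_NR(2)[OF h, of "{x..r}"] r' by auto
    also have "\<dots> = (LINT s|?M. (if s \<le> r then h s else 0))"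
      by (intro Bochner_Integration.integral_cong refl) (auto simp: indicator_def)
    finally have "of_real (c' r) * (u r - u x) = (LINT s|?M. of_real (c' r) * (if s \<le> r then h s else 0))"
      by simp
    also have "\<dots> = (LINT s|?M. ?k r s)"
      by (intro Bochner_Integration.integral_cong refl) auto
    finally show ?thesis by simp
  qed
  have in2: "(LINT r|?M. ?k r s) = of_real (c y - c s) * h s" if s: "s \<in> space ?M" for s
  proof -
    have s': "x \<le> s" "s \<le> y" using s by auto
    have cs: "continuous_on {s..y} c'" by (rule continuous_on_subset[OF cc']) (use s' in auto)
    have ic': "integrable ?M c'" by (rule integral_continuous_Icc[OF cc'])
    have "(c' has_integral (c y - c s)) {s..y}"
      using s' xy by (intro fundamental_theorem_of_calculus) 
        (auto simp: has_real_derivative_iff_has_vector_derivative[symmetric] intro!: has_field_derivative_at_within[OF c])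
    then have "c y - c s = (LINT r|lebesgue_on {s..y}. c' r)"
      using integral_continuous_Icc(2)[OF cs] by (simp add: integral_unique)
    also have "\<dots> = (LINT r|?M. indicat_real {s..y} r *\<^sub>R c' r)"
      by (rule integrable_subinterval_NR[OF ic']) (use s' in auto)
    also have "\<dots> = (LINT r|?M. (if s \<le> r then c' r else 0))"
      by (intro Bochner_Integration.integral_cong refl) (auto simp: indicator_def)
    finally have "of_real (c y - c s) * h s = of_real (LINT r|?M. (if s \<le> r then c' r else 0)) * h s" by simp
    also have "\<dots> = (LINT r|?M. of_real (if s \<le> r then c' r else 0) * h s)"
      by (simp flip: integral_complex_of_real)
    also have "\<dots> = (LINT r|?M. ?k r s)"
      by (intro Bochner_Integration.integral_cong refl) auto
    finally show ?thesis by simp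
  qed
  have "(LINT r|?M. of_real (c' r) * (u r - u x)) = (LINT r|?M. LINT s|?M. ?k r s)"
    by (intro Bochner_Integration.integral_cong refl in1[symmetric])
  also have "\<dots> = (LINT s|?M. LINT r|?M. ?k r s)"
    by (rule MM.Fubini_integral[symmetric]) (use int in \<open>simp add: case_prod_unfold\<close>)
  also have "\<dots> = (LINT s|?M. of_real (c y - c s) * h s)"
    by (intro Bochner_Integration.integral_cong refl in2)
  also have "\<dots> = of_real (c y) * (LINT s|?M. h s) - (LINT s|?M. of_real (c s) * h s)"
    using h ch by (simp add: left_diff_distrib)
  finally have 1: "(LINT r|?M. of_real (c' r) * (u r - u x)) = of_real (c y) * (u y - u x) - (LINT s|?M. of_real (c s) * h s)"
    using ACD(2)[OF u xy] by simp
  have ic'2: "integrable ?M c'" by (rule integral_continuous_Icc[OF cc'])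
  have "(c' has_integral (c y - c x)) {x..y}"
    using xy by (intro fundamental_theorem_of_calculus) 
      (auto simp: has_real_derivative_iff_has_vector_derivative[symmetric] intro!: has_field_derivative_at_within[OF c])
  then have 2: "(LINT r|?M. c' r) = c y - c x"
    using integral_continuous_Icc(2)[OF cc'] by (simp add: integral_unique)
  have "(LINT r|?M. of_real (c' r) * (u r - u x)) = (LINT r|?M. of_real (c' r) * u r) - of_real (c y - c x) * u x"
  proof -
    have i3: "integrable ?M (\<lambda>r. complex_of_real (c' r) * u x)" using ic'2 by simp
    have "(LINT r|?M. complex_of_real (c' r) * u x) = of_real (c y - c x) * u x"
      unfolding integral_mult_left_zero integral_complex_of_real 2 ..
    then show ?thesis
      by (simp only: right_diff_distrib Bochner_Integration.integral_diff[OF c'u i3])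
  qed
  moreover have "I3 + I2 = cy * uy - cx * ux" if "I1 = cy * (uy - ux) - I2" "I1 = I3 - (cy - cx) * ux"
    for I1 I2 I3 cy cx uy ux :: complex
    using that by (simp add: algebra_simps)
  ultimately have "(LINT r|?M. of_real (c' r) * u r) + (LINT s|?M. of_real (c s) * h s) = of_real (c y) * u y - of_real (c x) * u x"
    using 1 unfolding of_real_diff by blast
  then show "integrable ?M (\<lambda>r. of_real (c' r) * u r + of_real (c r) * h r) \<and>
     of_real (c y) * u y - of_real (c x) * u x = (LINT s|?M. of_real (c' s) * u s + of_real (c s) * h s)"
    using c'u ch by simp
qed

text \<open>The integrand is cut off at \<open>s < r\<close> instead of shrinking the domain of
  integration; this is the form in which the triangular kernel produces it.\<close>

lemma AC_indefinite:
  assumes f: "integrable (NR R) f"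
  shows "AC (\<lambda>r. LINT s|NR R. (if s < r then f s else 0)) f"
  unfolding AC_def
proof (intro allI impI conjI)
  fix x y assume xy: "0 < x" "x \<le> y" "y \<le> R"
  have sub: "{x..y} \<subseteq> {0..R}" using xy by auto
  show "integrable (lebesgue_on {x..y}) f"
    by (rule integrable_subinterval_NR(1)[OF f]) (use sub in auto)
  have fm: "f \<in> borel_measurable (NR R)" using f by simp
  have idm: "(\<lambda>x. x) \<in> borel_measurable (NR R)" by (rule borel_measurable_lebesgue_on_id)
  have m: "(\<lambda>s. if s < r then f s else 0) \<in> borel_measurable (NR R)" for r
    using fm idm by measurable
  have i: "integrable (NR R) (\<lambda>s. if s < r then f s else 0)" for r
    by (rule Bochner_Integration.integrable_bound[OF f m]) auto
  have "AE s in NR R. s \<noteq> y"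
    using AE_completion[OF AE_lborel_singleton[of y]] by (subst AE_restrict_space_iff) auto
  then have ae: "AE s in NR R. (if s < y then f s else 0) - (if s < x then f s else 0) = indicat_real {x..y} s *\<^sub>R f s"
    by eventually_elim (use xy in \<open>auto simp: indicator_def\<close>)
  have "(LINT s|NR R. (if s < y then f s else 0)) - (LINT s|NR R. (if s < x then f s else 0))
     = (LINT s|NR R. (if s < y then f s else 0) - (if s < x then f s else 0))"
    using i by simp
  also have "\<dots> = (LINT s|NR R. indicat_real {x..y} s *\<^sub>R f s)"
    by (rule integral_cong_AE[OF _ _ ae]) (use m fm idm in measurable)
  also have "\<dots> = (LINT s|lebesgue_on {x..y}. f s)"
    by (rule integrable_subinterval_NR(2)[symmetric, OF f]) (use sub in auto)
  finally show "(LINT s|NR R. (if s < y then f s else 0)) - (LINT s|NR R. (if s < x then f s else 0)) = (LINT s|lebesgue_on {x..y}. f s)" .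
qed

end

section \<open>Homogeneous solutions and variation of constants\<close>

context volterra
begin

definition "lam = v\<^sup>2 - 1/4"
definition pp :: "real \<Rightarrow> real" where "pp r = r powr a"
text \<open>Second homogeneous solution, by reduction of order from \<open>pp\<close>; the
  normalisation of \<open>Q\<close> makes the Wronskian 1.\<close>

definition nn :: "real \<Rightarrow> real" where "nn r = r powr a * Q r"
definition pp' :: "real \<Rightarrow> real" where "pp' r = a * r powr (a - 1)"
definition nn' :: "real \<Rightarrow> real" where "nn' r = a * r powr (a - 1) * Q r + r powr (- a)"

lemma a_props: "1/2 \<le> a" "a < 3/2" "lam = a * (a - 1)"
  using v0 v1 by (auto simp: a_def lam_def power2_eq_square algebra_simps)

lemma pp_deriv: "0 < r \<Longrightarrow> (pp has_real_derivative pp' r) (at r)"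
  unfolding pp_def[abs_def] pp'_def by (rule has_real_derivative_powr)

lemma nn_deriv: "0 < r \<Longrightarrow> (nn has_real_derivative nn' r) (at r)"
proof -
  assume r: "0 < r"
  have "(nn has_real_derivative (a * r powr (a - 1)) * Q r + r powr (-1 - 2 * v) * r powr a) (at r)"
    unfolding nn_def[abs_def] using r by (intro DERIV_mult has_real_derivative_powr Q_deriv)
  moreover have "r powr (-1 - 2 * v) * r powr a = r powr (- a)"
    by (simp add: a_def flip: powr_add)
  ultimately show ?thesis by (simp add: nn'_def)
qed

lemma pp'_deriv: "0 < r \<Longrightarrow> (pp' has_real_derivative lam / r\<^sup>2 * pp r) (at r)"
proof -
  assume r: "0 < r"
  have "(pp' has_real_derivative a * ((a - 1) * r powr (a - 1 - 1))) (at r)"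
    unfolding pp'_def[abs_def] using r by (intro DERIV_cmult has_real_derivative_powr)
  moreover have "r powr (a - 1 - 1) = pp r / r\<^sup>2"
  proof -
    have "r powr (a - 1 - 1) = r powr (a - 2)" by simp
    also have "\<dots> = r powr a / r powr 2" by (rule powr_diff)
    finally show ?thesis using r by (simp add: pp_def)
  qed
  ultimately show ?thesis by (simp add: a_props mult.assoc)
qed

lemma nn'_deriv: "0 < r \<Longrightarrow> (nn' has_real_derivative lam / r\<^sup>2 * nn r) (at r)"
proof -
  assume r: "0 < r"
  have "(nn' has_real_derivative (lam / r\<^sup>2 * pp r) * Q r + r powr (-1 - 2 * v) * pp' r + (- a) * r powr (- a - 1)) (at r)"
    unfolding nn'_def[abs_def] pp'_def[symmetric]
    using r by (intro DERIV_mult DERIV_add has_real_derivative_powr Q_deriv pp'_deriv)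
  moreover have "r powr (-1 - 2 * v) * pp' r = a * r powr (- a - 1)"
  proof -
    have "(-1 - 2 * v) + (a - 1) = - a - 1" by (simp add: a_def)
    then have "r powr (-1 - 2 * v) * r powr (a - 1) = r powr (- a - 1)"
      by (simp only: powr_add[symmetric])
    then show ?thesis by (simp add: pp'_def mult.left_commute)
  qed
  ultimately show ?thesis by (simp add: nn_def pp_def mult.assoc)
qed

lemma wronskian: "0 < r \<Longrightarrow> pp r * nn' r - pp' r * nn r = 1"
proof -
  assume r: "0 < r"
  have "r powr a * r powr (a - 1) = r powr (a - 1) * r powr a" by (rule mult.commute)
  moreover have "r powr a * r powr (- a) = 1" using r by (simp add: powr_minus)
  ultimately show ?thesis by (simp add: pp_def nn'_def pp'_def nn_def algebra_simps)
qed

lemma continuous_on_positive: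
  assumes "\<And>r. 0 < r \<Longrightarrow> (f has_real_derivative f' r) (at r)" shows "continuous_on {0<..} f"
  by (intro continuous_at_imp_continuous_on ballI DERIV_isCont[OF assms]) auto

text \<open>\<open>Q\<close> may be unbounded at 0, so \<open>Q r\<close> is compared with the fixed
  value \<open>Q R\<close> through \<open>Q_diff_bound\<close>.\<close>

lemma nn_bound: 
  assumes r: "0 < r" "r \<le> R"
  shows "\<bar>nn r\<bar> \<le> (\<bar>Q R\<bar> * R powr (v + \<theta>) + CC * R powr (\<theta> - v)) * \<beta> r"
proof -
  have "0 \<le> Q R - Q r" "Q R - Q r \<le> CC * r powr (- \<theta> - v) * R powr (\<theta> - v)"
    using Q_mono[OF r] Q_diff_bound[OF r] by auto
  then have "\<bar>Q r\<bar> \<le> \<bar>Q R\<bar> + CC * r powr (- \<theta> - v) * R powr (\<theta> - v)" by linarith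
  then have "r powr a * \<bar>Q r\<bar> \<le> r powr a * (\<bar>Q R\<bar> + CC * r powr (- \<theta> - v) * R powr (\<theta> - v))"
    by (intro mult_left_mono) auto
  also have "\<dots> = \<bar>Q R\<bar> * (r powr (v + \<theta>) * \<beta> r) + CC * R powr (\<theta> - v) * \<beta> r"
  proof -
    have "(v + \<theta>) + (1/2 - \<theta>) = a" "a + (- \<theta> - v) = 1/2 - \<theta>" by (simp_all add: a_def)
    then have e: "r powr (v + \<theta>) * \<beta> r = r powr a" "r powr a * r powr (- \<theta> - v) = \<beta> r"
      unfolding \<beta>_def by (simp_all only: powr_add[symmetric])
    have "r powr a * (\<bar>Q R\<bar> + CC * r powr (- \<theta> - v) * R powr (\<theta> - v))
      = \<bar>Q R\<bar> * r powr a + CC * R powr (\<theta> - v) * (r powr a * r powr (- \<theta> - v))"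
      by (simp add: algebra_simps)
    then show ?thesis unfolding e .
  qed
  also have "\<dots> \<le> \<bar>Q R\<bar> * (R powr (v + \<theta>) * \<beta> r) + CC * R powr (\<theta> - v) * \<beta> r"
    using r \<theta> v0 by (intro add_right_mono mult_left_mono mult_right_mono powr_mono2) auto
  finally show ?thesis by (simp add: nn_def abs_mult algebra_simps)
qed

lemma pp_sq_int: "sq_int R (\<lambda>r. complex_of_real (pp r))"
proof -
  have "integrable (NR R) (\<lambda>s. s powr (2 * a))" using a_props R by (intro powr_integral_0) auto
  moreover have "(pp s)\<^sup>2 = s powr (2 * a)" for s
    by (simp add: pp_def power2_eq_square flip: powr_add)
  moreover have "pp \<in> borel_measurable (NR R)"
    by (intro borel_imp_lebesgue_on) (simp add: pp_def[abs_def])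
  ultimately show ?thesis by (simp add: sq_int_def complex_of_real_measurable)
qed

lemma nn_sq_int: "sq_int R (\<lambda>r. complex_of_real (nn r))"
proof -
  have m: "nn \<in> borel_measurable (NR R)"
    using Q_measurable by (intro borel_imp_lebesgue_on) (simp add: nn_def[abs_def])
  let ?D = "\<bar>Q R\<bar> * R powr (v + \<theta>) + CC * R powr (\<theta> - v)"
  have "integrable (NR R) (\<lambda>r. (nn r)\<^sup>2)"
  proof (rule Bochner_Integration.integrable_bound)
    show "integrable (NR R) (\<lambda>r. ?D\<^sup>2 * (\<beta> r)\<^sup>2)" using \<beta>_sq_integrable by simp
    show "AE r in NR R. norm ((nn r)\<^sup>2) \<le> norm (?D\<^sup>2 * (\<beta> r)\<^sup>2)"
    proof (intro AE_I2)
      fix r assume "r \<in> space (NR R)"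
      then have "0 \<le> r" "r \<le> R" by auto
      then have "\<bar>nn r\<bar> \<le> ?D * \<beta> r" using nn_bound[of r] by (cases "r = 0") (auto simp: nn_def \<beta>_def)
      from power_mono[OF this, of 2] show "norm ((nn r)\<^sup>2) \<le> norm (?D\<^sup>2 * (\<beta> r)\<^sup>2)"
        by (simp add: power_mult_distrib)
    qed
  qed (use m in measurable)
  then show ?thesis using m by (simp add: sq_int_def complex_of_real_measurable)
qed

lemma continuous_on_half_open:
  fixes f :: "real \<Rightarrow> complex"
  assumes "\<And>x. 0 < x \<Longrightarrow> x \<le> R \<Longrightarrow> continuous_on {x..R} f"
  shows "continuous_on {0<..R} f"
  unfolding continuous_on_eq_continuous_within
proof
  fix r assume r: "r \<in> {0<..R}"
  have "continuous (at r within {r/2..R}) f"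
    using assms[of "r/2"] r by (simp add: continuous_on_eq_continuous_within)
  moreover have "at r within {0<..R} = at r within {r/2..R}"
    by (rule at_within_nhd[of r "{r/2<..}"]) (use r in auto)
  ultimately show "continuous (at r within {0<..R}) f" by simp
qed

definition Gi :: "(real \<Rightarrow> complex) \<Rightarrow> real \<Rightarrow> complex" where
  "Gi g r = (LINT s|NR R. (if s < r then of_real (pp s) * g s else 0))"
definition Ki :: "(real \<Rightarrow> complex) \<Rightarrow> real \<Rightarrow> complex" where
  "Ki g r = (LINT s|NR R. (if s < r then of_real (nn s) * g s else 0))"
text \<open>The derivative of \<open>V0 g = - nn * Gi g + pp * Ki g\<close>: the terms from
  differentiating \<open>Gi\<close> and \<open>Ki\<close>, namely \<open>- nn * pp * g\<close> and
  \<open>pp * nn * g\<close>, cancel.\<close>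

definition V0' :: "(real \<Rightarrow> complex) \<Rightarrow> real \<Rightarrow> complex" where
  "V0' g r = of_real (- nn' r) * Gi g r + of_real (pp' r) * Ki g r"

context
  fixes g :: "real \<Rightarrow> complex"
  assumes g: "sq_int R g"
begin

lemma pg_integrable: "integrable (NR R) (\<lambda>s. of_real (pp s) * g s)"
  by (rule integrable_sq_int_mult[OF pp_sq_int g])

lemma ng_integrable: "integrable (NR R) (\<lambda>s. of_real (nn s) * g s)"
  by (rule integrable_sq_int_mult[OF nn_sq_int g])

lemma integrable_cut: 
  assumes f: "integrable (NR R) f" shows "integrable (NR R) (\<lambda>s. if s < r then f s else (0::complex))"
proof (rule Bochner_Integration.integrable_bound[OF f])
  have "f \<in> borel_measurable (NR R)" "(\<lambda>x. x) \<in> borel_measurable (NR R)"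
    using f borel_measurable_lebesgue_on_id by auto
  then show "(\<lambda>s. if s < r then f s else 0) \<in> borel_measurable (NR R)" by measurable
qed auto

lemma V0_formula: 
  assumes r: "0 < r" "r \<le> R"
  shows "V0 g r = of_real (- nn r) * Gi g r + of_real (pp r) * Ki g r"
proof -
  have "V0 g r = (LINT s|NR R. of_real (- nn r) * (if s < r then of_real (pp s) * g s else 0)
     + of_real (pp r) * (if s < r then of_real (nn s) * g s else 0))"
    unfolding V0_def kop_def
  proof (intro Bochner_Integration.integral_cong refl)
    fix s assume "s \<in> space (NR R)"
    then have s: "0 \<le> s" "s \<le> R" by auto
    show "kerc r s * g s = of_real (- nn r) * (if s < r then of_real (pp s) * g s else 0)
     + of_real (pp r) * (if s < r then of_real (nn s) * g s else 0)"
    proof (cases "0 < s \<and> s < r")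
      case True
      then have "ker r s = - nn r * pp s + pp r * nn s"
        using r by (simp add: ker_def nn_def pp_def algebra_simps)
      then have e: "kerc r s = of_real (- nn r) * of_real (pp s) + of_real (pp r) * of_real (nn s)"
        unfolding kerc_def by simp
      show ?thesis unfolding e using True by (simp add: algebra_simps)
    next
      case False
      then have "s = 0 \<or> \<not> s < r" using s by auto
      then show ?thesis using kerc_support[of s r] by (auto simp: pp_def nn_def)
    qed
  qed
  also have "\<dots> = of_real (- nn r) * Gi g r + of_real (pp r) * Ki g r"
    unfolding Gi_def Ki_def using integrable_cut[OF pg_integrable] integrable_cut[OF ng_integrable] by simp
  finally show ?thesis .
qed

lemma AC_V0: "AC (V0 g) (V0' g)"
proof -
  have 1: "AC (\<lambda>r. of_real (- nn r) * Gi g r) (\<lambda>r. of_real (- nn' r) * Gi g r + of_real (- nn r) * (of_real (pp r) * g r))"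
    unfolding Gi_def[abs_def]
    by (rule AC_product[OF AC_indefinite[OF pg_integrable]])
      (auto intro!: DERIV_minus nn_deriv continuous_on_minus continuous_on_positive[OF nn'_deriv])
  have 2: "AC (\<lambda>r. of_real (pp r) * Ki g r) (\<lambda>r. of_real (pp' r) * Ki g r + of_real (pp r) * (of_real (nn r) * g r))"
    unfolding Ki_def[abs_def]
    by (rule AC_product[OF AC_indefinite[OF ng_integrable]])
      (auto intro!: pp_deriv continuous_on_positive[OF pp'_deriv])
  show ?thesis
    by (rule AC_cong[OF AC_add[OF 1 2]]) (auto simp: V0_formula V0'_def algebra_simps)
qed

text \<open>In the second derivative the terms from \<open>Gi\<close> and \<open>Ki\<close> combine
  to \<open>- g\<close> by the Wronskian identity, while the others reproduce the potential
  term.\<close>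

lemma AC_V0': "AC (V0' g) (\<lambda>r. of_real (lam / r\<^sup>2) * V0 g r - g r)"
proof -
  have c: "continuous_on {0<..} (\<lambda>r. lam / r\<^sup>2 * nn r)" "continuous_on {0<..} (\<lambda>r. lam / r\<^sup>2 * pp r)"
    using continuous_on_positive[OF nn_deriv] continuous_on_positive[OF pp_deriv]
    by (auto intro!: continuous_intros)
  have 1: "AC (\<lambda>r. of_real (- nn' r) * Gi g r) (\<lambda>r. of_real (- (lam / r\<^sup>2 * nn r)) * Gi g r + of_real (- nn' r) * (of_real (pp r) * g r))"
    unfolding Gi_def[abs_def]
    by (rule AC_product[OF AC_indefinite[OF pg_integrable]])
      (intro DERIV_minus nn'_deriv, assumption, intro continuous_on_minus c)
  have 2: "AC (\<lambda>r. of_real (pp' r) * Ki g r) (\<lambda>r. of_real (lam / r\<^sup>2 * pp r) * Ki g r + of_real (pp' r) * (of_real (nn r) * g r))"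
    unfolding Ki_def[abs_def]
    by (rule AC_product[OF AC_indefinite[OF ng_integrable] pp'_deriv c(2)])
  show ?thesis
  proof (rule AC_cong[OF AC_add[OF 1 2]])
    fix r assume r: "0 < r" "r \<le> R"
    have w: "complex_of_real (pp r) * of_real (nn' r) - of_real (pp' r) * of_real (nn r) = 1"
      using wronskian[OF r(1)] by (metis of_real_1 of_real_diff of_real_mult)
    have "of_real (- nn' r) * (of_real (pp r) * g r) + of_real (pp' r) * (of_real (nn r) * g r)
        = - (complex_of_real (pp r) * of_real (nn' r) - of_real (pp' r) * of_real (nn r)) * g r"
      by (simp add: algebra_simps)
    also have "\<dots> = - g r" unfolding w by simp
    finally have e: "of_real (- nn' r) * (of_real (pp r) * g r) + of_real (pp' r) * (of_real (nn r) * g r) = - g r" .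
    have "of_real (lam / r\<^sup>2) * V0 g r = of_real (- (lam / r\<^sup>2 * nn r)) * Gi g r + of_real (lam / r\<^sup>2 * pp r) * Ki g r"
      unfolding V0_formula[OF r] by (simp add: algebra_simps)
    moreover have "X - G = P1 + A + (P2 + B)" if "A + B = - G" "X = P1 + P2" for A B G X P1 P2 :: complex
    proof -
      have "X - G = X + (A + B)" using that(1) by simp
      then show ?thesis using that(2) by (simp add: add_ac)
    qed
    ultimately show "of_real (lam / r\<^sup>2) * V0 g r - g r =
       of_real (- (lam / r\<^sup>2 * nn r)) * Gi g r + of_real (- nn' r) * (of_real (pp r) * g r) +
         (of_real (lam / r\<^sup>2 * pp r) * Ki g r + of_real (pp' r) * (of_real (nn r) * g r))"
      using e by blast
  qed (simp add: V0'_def)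
qed

lemma V0'_continuous: "continuous_on {0<..R} (V0' g)"
  by (rule continuous_on_half_open) (rule AC_continuous[OF AC_V0'], auto)

lemma V0_has_derivative: "0 < r \<Longrightarrow> r \<le> R \<Longrightarrow> (V0 g has_vector_derivative V0' g r) (at r within {0..R})"
  by (rule AC_has_derivative[OF AC_V0 V0'_continuous])

text \<open>Cauchy-Schwarz against the section of the kernel. Its squared norm is at most a constant
  times \<open>(\<alpha> r)^2 * r powr (2 - 2 * \<theta>)\<close>, in which \<open>\<theta>\<close>
  cancels and \<open>r^3\<close> remains.\<close>

lemma V0_small: "\<exists>C. \<forall>r. 0 < r \<longrightarrow> r \<le> R \<longrightarrow> cmod (V0 g r) \<le> C * r powr (3/2)"
proof -
  let ?N = "LINT s|NR R. (cmod (g s))\<^sup>2"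
  define C where "C = sqrt (CC\<^sup>2 / (2 - 2 * \<theta>) * ?N)"
  have "cmod (V0 g r) \<le> C * r powr (3/2)" if r: "0 < r" "r \<le> R" for r
  proof -
    have sqi: "sq_int R (kerc r)" by (rule hs_kernelD(2)[OF hs_kerc])
    have st: "integrable (NR R) (\<lambda>s. if s < r then s powr (1 - 2 * \<theta>) else 0)"
      "(LINT s|NR R. (if s < r then s powr (1 - 2 * \<theta>) else 0)) = r powr (1 - 2 * \<theta> + 1) / (1 - 2 * \<theta> + 1)"
      by (rule powr_section_integral; use \<theta> r in auto)+
    have "(LINT s|NR R. (cmod (kerc r s))\<^sup>2) \<le> (LINT s|NR R. CC\<^sup>2 * (\<alpha> r)\<^sup>2 * (if s < r then s powr (1 - 2 * \<theta>) else 0))"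
    proof (rule integral_mono)
      show "integrable (NR R) (\<lambda>s. (cmod (kerc r s))\<^sup>2)" using sqi by (simp add: sq_int_def)
      show "integrable (NR R) (\<lambda>s. CC\<^sup>2 * (\<alpha> r)\<^sup>2 * (if s < r then s powr (1 - 2 * \<theta>) else 0))"
        by (intro integrable_mult_right st)
      fix s
      show "(cmod (kerc r s))\<^sup>2 \<le> CC\<^sup>2 * (\<alpha> r)\<^sup>2 * (if s < r then s powr (1 - 2 * \<theta>) else 0)"
      proof (cases "s < r")
        case True
        have "(\<beta> s)\<^sup>2 = s powr (1 - 2 * \<theta>)" by (simp add: \<beta>_def power2_eq_square flip: powr_add)
        then show ?thesis using power_mono[OF kerc_bound[of r s], of 2] True by (simp add: power_mult_distrib)
      next
        case False
        then show ?thesis using kerc_support[of s r] by simp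
      qed
    qed
    also have "\<dots> = CC\<^sup>2 * (\<alpha> r)\<^sup>2 * (r powr (1 - 2 * \<theta> + 1) / (1 - 2 * \<theta> + 1))"
      by (simp only: integral_mult_right_zero st(2))
    also have "\<dots> = CC\<^sup>2 / (2 - 2 * \<theta>) * ((\<alpha> r)\<^sup>2 * r powr (1 - 2 * \<theta> + 1))" by simp
    also have "(\<alpha> r)\<^sup>2 * r powr (1 - 2 * \<theta> + 1) = (r powr (3/2))\<^sup>2"
      by (simp add: \<alpha>_def power2_eq_square flip: powr_add)
    finally have k: "(LINT s|NR R. (cmod (kerc r s))\<^sup>2) \<le> CC\<^sup>2 / (2 - 2 * \<theta>) * (r powr (3/2))\<^sup>2" .
    have "(cmod (V0 g r))\<^sup>2 \<le> (LINT s|NR R. (cmod (kerc r s))\<^sup>2) * ?N"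
      unfolding V0_def by (rule kop_bound[where k = kerc and r = r, OF sqi g])
    also have "\<dots> \<le> CC\<^sup>2 / (2 - 2 * \<theta>) * (r powr (3/2))\<^sup>2 * ?N"
      by (intro mult_right_mono k) (simp add: integral_nonneg_AE)
    finally have "(cmod (V0 g r))\<^sup>2 \<le> CC\<^sup>2 / (2 - 2 * \<theta>) * ?N * (r powr (3/2))\<^sup>2" by (simp add: mult_ac)
    from real_sqrt_le_mono[OF this] show ?thesis
      by (simp only: C_def real_sqrt_mult real_sqrt_abs) simp
  qed
  then show ?thesis by blast
qed

text \<open>Writing \<open>V0' = (a / r) * V0 - r powr (- a) * Gi\<close> eliminates
  \<open>nn'\<close> and with it the logarithm. The two terms are controlled by
  \<open>V0_small\<close> and by Cauchy-Schwarz for \<open>Gi\<close>.\<close>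

lemma V0'_small: "\<exists>C. \<forall>r. 0 < r \<longrightarrow> r \<le> R \<longrightarrow> cmod (V0' g r) \<le> C * r powr (1/2)"
proof -
  let ?N = "LINT s|NR R. (cmod (g s))\<^sup>2"
  obtain C1 where C1: "\<And>r. 0 < r \<Longrightarrow> r \<le> R \<Longrightarrow> cmod (V0 g r) \<le> C1 * r powr (3/2)" using V0_small by blast
  define C2 where "C2 = sqrt (1 / (2 * a + 1) * ?N)"
  have "cmod (V0' g r) \<le> (a * C1 + C2) * r powr (1/2)" if r: "0 < r" "r \<le> R" for r
  proof -
    have st: "integrable (NR R) (\<lambda>s. if s < r then s powr (2 * a) else 0)"
      "(LINT s|NR R. (if s < r then s powr (2 * a) else 0)) = r powr (2 * a + 1) / (2 * a + 1)"
      by (rule powr_section_integral; use a_props r in auto)+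
    define u where "u s = (if s < r then complex_of_real (pp s) else 0)" for s
    have u2: "(cmod (u s))\<^sup>2 = (if s < r then s powr (2 * a) else 0)" for s
      by (simp add: u_def pp_def power2_eq_square flip: powr_add)
    have um: "u \<in> borel_measurable (NR R)"
      unfolding u_def[abs_def] using sq_intD(1)[OF pp_sq_int] borel_measurable_lebesgue_on_id[of "{0..R}"] by measurable
    have us: "sq_int R u" using um st(1) by (simp add: sq_int_def u2)
    have "Gi g r = (LINT s|NR R. u s * g s)"
      unfolding Gi_def u_def by (intro Bochner_Integration.integral_cong refl) auto
    then have "(cmod (Gi g r))\<^sup>2 \<le> (r powr (2 * a + 1) / (2 * a + 1)) * ?N"
      using Cauchy_Schwarz_integral[OF us g] by (simp add: u2 st(2))
    also have "r powr (2 * a + 1) = (r powr a * r powr (1/2))\<^sup>2"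
      by (simp add: power2_eq_square flip: powr_add)
    finally have "(cmod (Gi g r))\<^sup>2 \<le> 1 / (2 * a + 1) * ?N * (r powr a * r powr (1/2))\<^sup>2"
      by (simp add: mult_ac)
    from real_sqrt_le_mono[OF this] have G: "cmod (Gi g r) \<le> C2 * (r powr a * r powr (1/2))"
      by (simp only: C2_def real_sqrt_mult real_sqrt_abs) simp
    have "V0' g r = of_real (a / r) * V0 g r - of_real (r powr (- a)) * Gi g r"
    proof -
      have "r powr (a - 1) = r powr a / r" using r by (simp add: powr_diff)
      then have "nn' r = a / r * nn r + r powr (- a)" "pp' r = a / r * pp r"
        by (simp_all add: nn'_def nn_def pp'_def pp_def)
      then show ?thesis unfolding V0'_def V0_formula[OF r] by (simp add: algebra_simps)
    qed
    then have "cmod (V0' g r) \<le> cmod (of_real (a / r) * V0 g r) + cmod (of_real (r powr (- a)) * Gi g r)"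
      by (simp add: norm_triangle_ineq4)
    also have "\<dots> = a / r * cmod (V0 g r) + r powr (- a) * cmod (Gi g r)"
      using r a_props by (simp add: norm_mult norm_divide)
    also have "\<dots> \<le> a / r * (C1 * r powr (3/2)) + r powr (- a) * (C2 * (r powr a * r powr (1/2)))"
      using r a_props by (intro add_mono mult_left_mono C1 G) auto
    also have "\<dots> = (a * C1 + C2) * r powr (1/2)"
    proof -
      have "r powr (3/2) = r * r powr (1/2)"
      proof -
        have "r powr (3/2) = r powr (1 + 1/2)" by simp
        also have "\<dots> = r powr 1 * r powr (1/2)" by (rule powr_add)
        finally show ?thesis using r by simp
      qed
      moreover have "r powr (- a) * (C2 * (r powr a * r powr (1/2))) = C2 * r powr (1/2)"
        using r by (simp add: powr_minus)
      ultimately show ?thesis using r by (simp add: algebra_simps)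
    qed
    finally show ?thesis .
  qed
  then show ?thesis by blast
qed

end

section \<open>Remainder terms of the maximal domain\<close>

definition remainder :: "(real \<Rightarrow> complex) \<Rightarrow> (real \<Rightarrow> complex) \<Rightarrow> bool" where
  "remainder \<psi> d \<longleftrightarrow> (\<forall>r\<in>{0..R}. (\<psi> has_vector_derivative d r) (at r within {0..R})) \<and>
     continuous_on {0..R} d \<and> \<psi> \<in> O[at_right 0](\<lambda>r. complex_of_real (r powr (3/2))) \<and>
     d \<in> O[at_right 0](\<lambda>r. complex_of_real (r powr (1/2)))"

definition expr1 :: "(real \<Rightarrow> complex) \<Rightarrow> (real \<Rightarrow> complex) \<Rightarrow> bool" where
  "expr1 \<phi> g \<longleftrightarrow> (\<exists>h. has_second_derivative R \<phi> h \<and>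
     (AE r in lebesgue_on {0..R}. g r = - h r + complex_of_real (lam / r\<^sup>2) * \<phi> r))"

lemma powr_tendsto_0: "0 < p \<Longrightarrow> ((\<lambda>r::real. r powr p) \<longlongrightarrow> 0) (at 0 within {0..R})"
proof -
  assume p: "0 < p"
  have "continuous_on {0..R} (\<lambda>r::real. r powr p)"
    by (rule continuous_on_powr'[OF continuous_on_id continuous_on_const]) (use p in auto)
  from bspec[OF this[unfolded continuous_on_def], of 0] R show ?thesis by simp
qed

text \<open>The order 3/2 of \<open>\<psi>\<close> yields derivative 0 at the origin, and the order
  1/2 of \<open>d\<close> yields continuity there; hence the value 0 for
  \<open>r \<le> 0\<close>.\<close>

lemma remainderI:
  assumes D: "\<And>r. 0 < r \<Longrightarrow> r \<le> R \<Longrightarrow> (\<psi> has_vector_derivative d r) (at r within {0..R})"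
    and cont: "continuous_on {0<..R} d"
    and b1: "\<And>r. 0 < r \<Longrightarrow> r \<le> R \<Longrightarrow> cmod (\<psi> r) \<le> C1 * r powr (3/2)"
    and b2: "\<And>r. 0 < r \<Longrightarrow> r \<le> R \<Longrightarrow> cmod (d r) \<le> C2 * r powr (1/2)"
    and z: "\<psi> 0 = 0"
  shows "remainder \<psi> (\<lambda>r. if r \<le> 0 then 0 else d r)"
  unfolding remainder_def
proof (intro conjI ballI)
  let ?d = "\<lambda>r. if r \<le> 0 then 0 else d r"
  fix r assume r: "r \<in> {0..R}"
  show "(\<psi> has_vector_derivative ?d r) (at r within {0..R})"
  proof (cases "r = 0")
    case False
    then show ?thesis using D[of r] r by simp
  next
    case True
    have "((\<lambda>y. (\<psi> y - \<psi> 0 - (y - 0) *\<^sub>R 0) /\<^sub>R norm (y - 0)) \<longlongrightarrow> 0) (at 0 within {0..R})"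
    proof (rule Lim_null_comparison)
      have "((\<lambda>y. C1 * y powr (1/2)) \<longlongrightarrow> C1 * 0) (at 0 within {0..R})"
        by (intro tendsto_mult_left powr_tendsto_0) simp
      then show "((\<lambda>y. C1 * y powr (1/2)) \<longlongrightarrow> 0) (at 0 within {0..R})" by simp
      show "\<forall>\<^sub>F y in at 0 within {0..R}. norm ((\<psi> y - \<psi> 0 - (y - 0) *\<^sub>R 0) /\<^sub>R norm (y - 0)) \<le> C1 * y powr (1/2)"
        unfolding eventually_at_filter
      proof (intro always_eventually allI impI)
        fix y :: real assume y: "y \<noteq> 0" "y \<in> {0..R}"
        then have "cmod (\<psi> y) \<le> C1 * y powr (3/2)" by (intro b1) auto
        also have "y powr (3/2) = y * y powr (1/2)"
        proof -
          have "y powr (3/2) = y powr (1 + 1/2)" by simp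
          also have "\<dots> = y powr 1 * y powr (1/2)" by (rule powr_add)
          finally show ?thesis using y by simp
        qed
        finally show "norm ((\<psi> y - \<psi> 0 - (y - 0) *\<^sub>R 0) /\<^sub>R norm (y - 0)) \<le> C1 * y powr (1/2)"
          using y z by (simp add: field_simps)
      qed
    qed
    then have "(\<psi> has_vector_derivative 0) (at 0 within {0..R})"
      unfolding has_vector_derivative_def has_derivative_within by (simp add: bounded_linear_zero divide_inverse)
    then show ?thesis using True by simp
  qed
next
  let ?d = "\<lambda>r. if r \<le> 0 then 0 else d r"
  show "continuous_on {0..R} ?d"
    unfolding continuous_on_eq_continuous_within
  proof
    fix r assume r: "r \<in> {0..R}"
    show "continuous (at r within {0..R}) ?d"
    proof (cases "r = 0")
      case True
      have "(?d \<longlongrightarrow> 0) (at 0 within {0..R})"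
      proof (rule Lim_null_comparison)
        have "((\<lambda>y. C2 * y powr (1/2)) \<longlongrightarrow> C2 * 0) (at 0 within {0..R})"
          by (intro tendsto_mult_left powr_tendsto_0) simp
        then show "((\<lambda>y. C2 * y powr (1/2)) \<longlongrightarrow> 0) (at 0 within {0..R})" by simp
        show "\<forall>\<^sub>F y in at 0 within {0..R}. norm (?d y) \<le> C2 * y powr (1/2)"
          unfolding eventually_at_filter
          by (intro always_eventually allI impI) (use b2 in auto)
      qed
      then show ?thesis using True by (simp add: continuous_within)
    next
      case False
      then have "continuous (at r within {0<..R}) d"
        using cont r by (simp add: continuous_on_eq_continuous_within)
      then have "continuous (at r within {0<..R}) ?d"
        by (rule continuous_transform_within[where \<delta> = 1]) (use False r in auto)
      moreover have "at r within {0<..R} = at r within {0..R}"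
        by (rule at_within_nhd[of r "{0<..}"]) (use False r in auto)
      ultimately show ?thesis by simp
    qed
  qed
  show "\<psi> \<in> O[at_right 0](\<lambda>r. complex_of_real (r powr (3/2)))"
    by (rule bigoI[of _ C1]) (use R b1 in \<open>auto intro!: eventually_at_rightI[of 0 R]\<close>)
  show "?d \<in> O[at_right 0](\<lambda>r. complex_of_real (r powr (1/2)))"
    by (rule bigoI[of _ C2]) (use R b2 in \<open>auto intro!: eventually_at_rightI[of 0 R]\<close>)
qed

lemma V0_remainder:
  assumes g: "sq_int R g"
  shows "\<exists>d. remainder (V0 g) d"
proof -
  obtain C1 where "\<forall>r. 0 < r \<longrightarrow> r \<le> R \<longrightarrow> cmod (V0 g r) \<le> C1 * r powr (3/2)" using V0_small[OF g] by blast
  moreover obtain C2 where "\<forall>r. 0 < r \<longrightarrow> r \<le> R \<longrightarrow> cmod (V0' g r) \<le> C2 * r powr (1/2)" using V0'_small[OF g] by blast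
  moreover have "V0 g 0 = 0" by (simp add: V0_def kop_def kerc_support)
  ultimately show ?thesis
    using remainderI[of "V0 g" "V0' g" C1 C2] V0_has_derivative[OF g] V0'_continuous[OF g] by blast
qed

lemma V0_expr:
  assumes g: "sq_int R g"
  shows "expr1 (V0 g) g"
  unfolding expr1_def has_second_derivative_def
proof (intro exI conjI)
  show "\<forall>r\<in>{0<..<R}. (V0 g has_vector_derivative V0' g r) (at r)"
    using V0_has_derivative[OF g] at_within_Icc_at[of 0 _ R] by fastforce
  show "\<forall>x y. 0 < x \<and> x \<le> y \<and> y < R \<longrightarrow> integrable (lebesgue_on {x..y}) (\<lambda>r. of_real (lam / r\<^sup>2) * V0 g r - g r) \<and>
     V0' g y - V0' g x = (LINT s|lebesgue_on {x..y}. of_real (lam / s\<^sup>2) * V0 g s - g s)"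
    using ACD[OF AC_V0'[OF g]] by auto
qed auto

end

context volterra
begin

lemma AC_real:
  assumes "\<And>r. 0 < r \<Longrightarrow> (c has_real_derivative c' r) (at r)" "continuous_on {0<..} c'"
  shows "AC (\<lambda>r. of_real (c r)) (\<lambda>r. of_real (c' r))"
proof -
  have "AC (\<lambda>_. 1) (\<lambda>_. 0)" by (simp add: AC_def)
  from AC_product[OF this assms] show ?thesis by simp
qed

lemma of_real_has_vector_derivative:
  "(c has_real_derivative D) (at r) \<Longrightarrow> ((\<lambda>r. complex_of_real (c r)) has_vector_derivative of_real D) (at r)"
  using has_vector_derivative_of_real by blast

lemma expr1_add_homogeneous:
  assumes "expr1 \<psi> g" and \<phi>: "\<And>r. 0 < r \<Longrightarrow> r \<le> R \<Longrightarrow> \<phi> r = c * of_real (pp r) + c' * of_real (nn r) + \<psi> r"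
  shows "expr1 \<phi> g"
proof -
  obtain h where hs: "has_second_derivative R \<psi> h"
    and ae: "AE r in NR R. g r = - h r + complex_of_real (lam / r\<^sup>2) * \<psi> r"
    using assms(1) by (auto simp: expr1_def)
  obtain u' where u': "\<And>r. r \<in> {0<..<R} \<Longrightarrow> (\<psi> has_vector_derivative u' r) (at r)"
    and int: "\<And>x y. 0 < x \<Longrightarrow> x \<le> y \<Longrightarrow> y < R \<Longrightarrow> integrable (lebesgue_on {x..y}) h \<and> u' y - u' x = (LINT s|lebesgue_on {x..y}. h s)"
    using hs unfolding has_second_derivative_def by blast
  define w' where "w' r = c * of_real (pp' r) + c' * of_real (nn' r) + u' r" for r
  define k where "k r = c * of_real (lam / r\<^sup>2 * pp r) + c' * of_real (lam / r\<^sup>2 * nn r) + h r" for r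
  have cont: "continuous_on {0<..} (\<lambda>r. lam / r\<^sup>2 * nn r)" "continuous_on {0<..} (\<lambda>r. lam / r\<^sup>2 * pp r)"
    using continuous_on_positive[OF nn_deriv] continuous_on_positive[OF pp_deriv]
    by (auto intro!: continuous_intros)
  note ACp = AC_real[OF pp'_deriv cont(2)] and ACn = AC_real[OF nn'_deriv cont(1)]
  have "has_second_derivative R \<phi> k"
    unfolding has_second_derivative_def
  proof (intro exI[of _ w'] conjI ballI allI impI)
    fix r assume r: "r \<in> {0<..<R}"
    have "((\<lambda>r. c * of_real (pp r) + c' * of_real (nn r) + \<psi> r) has_vector_derivative w' r) (at r)"
      unfolding w'_def using r
      by (intro has_vector_derivative_add has_vector_derivative_mult_right of_real_has_vector_derivative pp_deriv nn_deriv u') auto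
    then show "(\<phi> has_vector_derivative w' r) (at r)"
      by (rule has_vector_derivative_transform_within_open[of _ _ _ "{0<..<R}"]) (use r \<phi> in auto)
  next
    fix x y assume xy: "0 < x \<and> x \<le> y \<and> y < R"
    then have i: "integrable (lebesgue_on {x..y}) h" "u' y - u' x = (LINT s|lebesgue_on {x..y}. h s)"
      using int by auto
    have p: "integrable (lebesgue_on {x..y}) (\<lambda>r. complex_of_real (lam / r\<^sup>2 * pp r))"
      "complex_of_real (pp' y) - of_real (pp' x) = (LINT s|lebesgue_on {x..y}. of_real (lam / s\<^sup>2 * pp s))"
      using ACD[OF ACp, of x y] xy by auto
    have n: "integrable (lebesgue_on {x..y}) (\<lambda>r. complex_of_real (lam / r\<^sup>2 * nn r))"
      "complex_of_real (nn' y) - of_real (nn' x) = (LINT s|lebesgue_on {x..y}. of_real (lam / s\<^sup>2 * nn s))"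
      using ACD[OF ACn, of x y] xy by auto
    show "integrable (lebesgue_on {x..y}) k"
      unfolding k_def by (intro Bochner_Integration.integrable_add integrable_mult_right p n i)
    have "(LINT s|lebesgue_on {x..y}. k s) = c * (complex_of_real (pp' y) - of_real (pp' x)) + c' * (complex_of_real (nn' y) - of_real (nn' x)) + (u' y - u' x)"
      unfolding k_def
      by (subst Bochner_Integration.integral_add, (intro Bochner_Integration.integrable_add integrable_mult_right p n i)+)+
        (simp only: integral_mult_right_zero p(2) n(2) i(2))
    then show "w' y - w' x = (LINT s|lebesgue_on {x..y}. k s)"
      by (simp add: w'_def algebra_simps)
  qed
  moreover have "AE r in NR R. r \<noteq> 0"
    using AE_completion[OF AE_lborel_singleton[of 0]] by (subst AE_restrict_space_iff) auto
  with ae have "AE r in NR R. g r = - k r + complex_of_real (lam / r\<^sup>2) * \<phi> r"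
    using AE_space
  proof eventually_elim
    case (elim r)
    then have "\<phi> r = c * of_real (pp r) + c' * of_real (nn r) + \<psi> r" by (intro \<phi>) auto
    with elim(1) show ?case by (simp add: k_def algebra_simps)
  qed
  ultimately show ?thesis by (auto simp: expr1_def)
qed

lemma zero_derivative_constant:
  fixes f :: "real \<Rightarrow> complex"
  assumes "\<And>s. s \<in> {0<..<R} \<Longrightarrow> (f has_vector_derivative 0) (at s)"
  shows "\<exists>c. \<forall>s\<in>{0<..<R}. f s = c"
proof (rule has_derivative_zero_constant)
  fix s assume "s \<in> {0<..<R}"
  then have "(f has_vector_derivative 0) (at s within {0<..<R})"
    using assms has_vector_derivative_at_within by blast
  then show "(f has_derivative (\<lambda>h. 0)) (at s within {0<..<R})"
    by (simp add: has_vector_derivative_def)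
qed simp

lemma constant_limit_zero:
  fixes z :: complex and p :: real
  assumes "0 < p" "\<forall>\<^sub>F r in at_right 0. cmod z \<le> C * r powr p"
  shows "z = 0"
proof -
  have "((\<lambda>r::real. r powr p) \<longlongrightarrow> 0) (at_right 0)"
    using powr_tendsto_0[OF assms(1)] at_within_Icc_at_right[OF R] by simp
  then have "((\<lambda>r. C * r powr p) \<longlongrightarrow> C * 0) (at_right 0)" by (intro tendsto_intros)
  then have "cmod z \<le> C * 0"
    by (rule tendsto_lowerbound[OF _ assms(2)]) simp
  then show ?thesis by simp
qed

text \<open>The difference \<open>\<delta>\<close> from \<open>V0 g\<close> solves the homogeneous
  equation. Its Wronskian with \<open>pp\<close> is constant and of order
  \<open>r powr (a + 1/2)\<close>, hence 0, so \<open>\<delta>\<close> is a multiple of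
  \<open>r powr a\<close>. As \<open>a < 3/2\<close>, the order \<open>r powr (3/2)\<close> forces
  the multiple to be 0.\<close>

lemma remainder_unique:
  assumes \<psi>: "remainder \<psi> d" "expr1 \<psi> g" and g: "sq_int R g" and r: "0 < r" "r \<le> R"
  shows "\<psi> r = V0 g r"
proof -
  obtain h where hs: "has_second_derivative R \<psi> h"
    and ae: "AE r in NR R. g r = - h r + complex_of_real (lam / r\<^sup>2) * \<psi> r"
    using \<psi>(2) by (auto simp: expr1_def)
  obtain u' where u': "\<And>r. r \<in> {0<..<R} \<Longrightarrow> (\<psi> has_vector_derivative u' r) (at r)"
    and int: "\<And>x y. 0 < x \<Longrightarrow> x \<le> y \<Longrightarrow> y < R \<Longrightarrow> integrable (lebesgue_on {x..y}) h \<and> u' y - u' x = (LINT s|lebesgue_on {x..y}. h s)"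
    using hs unfolding has_second_derivative_def by blast
  define \<delta> where "\<delta> s = \<psi> s - V0 g s" for s
  define e where "e s = u' s - V0' g s" for s
  define k where "k s = complex_of_real (lam / s\<^sup>2) * \<delta> s" for s
  have \<delta>': "(\<delta> has_vector_derivative e s) (at s)" if s: "s \<in> {0<..<R}" for s
  proof -
    have "at s within {0..R} = at s" using s by (intro at_within_Icc_at) auto
    then have "(V0 g has_vector_derivative V0' g s) (at s)"
      using V0_has_derivative[OF g, of s] s by auto
    then show ?thesis unfolding \<delta>_def[abs_def] e_def using u'[OF s] by (intro has_vector_derivative_diff)
  qed
  have \<delta>c: "continuous_on {0<..<R} \<delta>"
    by (intro continuous_at_imp_continuous_on ballI has_vector_derivative_continuous[OF \<delta>'])
  have kc: "continuous_on {0<..<R} k"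
    unfolding k_def[abs_def] using \<delta>c by (auto intro!: continuous_intros)
  \<comment> \<open>The inhomogeneities \<open>g\<close> cancel: the difference satisfies an
    equation with the continuous right-hand side \<open>k\<close>, so its derivative
    \<open>e\<close> is differentiable in the classical sense.\<close>
  have e_int: "e y - e x = integral {x..y} k" if xy: "0 < x" "x \<le> y" "y < R" for x y
  proof -
    have sub: "{x..y} \<subseteq> {0<..<R}" using xy by auto
    have kxy: "continuous_on {x..y} k" by (rule continuous_on_subset[OF kc sub])
    have i1: "integrable (lebesgue_on {x..y}) h" "u' y - u' x = (LINT s|lebesgue_on {x..y}. h s)"
      using int[OF xy] by auto
    have i2: "integrable (lebesgue_on {x..y}) (\<lambda>r. of_real (lam / r\<^sup>2) * V0 g r - g r)"
      "V0' g y - V0' g x = (LINT s|lebesgue_on {x..y}. of_real (lam / s\<^sup>2) * V0 g s - g s)"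
      using ACD[OF AC_V0'[OF g], of x y] xy by auto
    have "e y - e x = (LINT s|lebesgue_on {x..y}. h s - (of_real (lam / s\<^sup>2) * V0 g s - g s))"
      unfolding Bochner_Integration.integral_diff[OF i1(1) i2(1)] i1(2)[symmetric] i2(2)[symmetric]
      by (simp add: e_def)
    also have "\<dots> = (LINT s|lebesgue_on {x..y}. k s)"
    proof (rule integral_cong_AE)
      have "AE s in lebesgue. s \<in> {0..R} \<longrightarrow> g s = - h s + complex_of_real (lam / s\<^sup>2) * \<psi> s"
        using ae by (subst (asm) AE_restrict_space_iff) auto
      then have "AE s in lebesgue. s \<in> {x..y} \<longrightarrow> h s - (of_real (lam / s\<^sup>2) * V0 g s - g s) = k s"
      proof eventually_elim
        case (elim s)
        then show ?case using sub by (auto simp: k_def \<delta>_def algebra_simps diff_divide_distrib)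
      qed
      then show "AE s in lebesgue_on {x..y}. h s - (of_real (lam / s\<^sup>2) * V0 g s - g s) = k s"
        by (subst AE_restrict_space_iff) auto
      show "(\<lambda>s. h s - (of_real (lam / s\<^sup>2) * V0 g s - g s)) \<in> borel_measurable (lebesgue_on {x..y})"
        by (rule borel_measurable_integrable[OF Bochner_Integration.integrable_diff[OF i1(1) i2(1)]])
      show "k \<in> borel_measurable (lebesgue_on {x..y})" by (rule continuous_imp_measurable_Icc[OF kxy])
    qed
    also have "\<dots> = integral {x..y} k" by (rule integral_continuous_Icc(2)[OF kxy])
    finally show ?thesis .
  qed
  have e': "(e has_vector_derivative k s) (at s)" if s: "s \<in> {0<..<R}" for s
  proof -
    define x y where "x = s / 2" and "y = (s + R) / 2"
    have xy: "0 < x" "x < s" "s < y" "y < R" using s by (auto simp: x_def y_def)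
    have kxy: "continuous_on {x..y} k" by (rule continuous_on_subset[OF kc]) (use xy in auto)
    have D: "((\<lambda>t. e x + integral {x..t} k) has_vector_derivative 0 + k s) (at s within {x..y})"
      by (intro derivative_intros integral_has_vector_derivative[OF kxy]) (use xy in auto)
    have "(e has_vector_derivative 0 + k s) (at s within {x..y})"
    proof (rule has_vector_derivative_transform[OF _ _ D])
      show "s \<in> {x..y}" using xy by auto
      fix t assume "t \<in> {x..y}"
      then show "e t = e x + integral {x..t} k" using e_int[of x t] xy by (auto simp: algebra_simps)
    qed
    moreover have "at s within {x..y} = at s" using xy by (intro at_within_Icc_at) auto
    ultimately show ?thesis by (simp only: add_0)
  qed
  define Wr where "Wr s = of_real (pp s) * e s - of_real (pp' s) * \<delta> s" for s
  have Wr': "(Wr has_vector_derivative 0) (at s)" if s: "s \<in> {0<..<R}" for s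
  proof -
    have s0: "0 < s" using s by simp
    have "(Wr has_vector_derivative (of_real (pp s) * k s + of_real (pp' s) * e s)
      - (of_real (pp' s) * e s + of_real (lam / s\<^sup>2 * pp s) * \<delta> s)) (at s)"
      unfolding Wr_def[abs_def]
      by (intro has_vector_derivative_diff has_vector_derivative_mult of_real_has_vector_derivative pp_deriv[OF s0] pp'_deriv[OF s0] e'[OF s] \<delta>'[OF s])
    moreover have "(of_real (pp s) * k s + of_real (pp' s) * e s) - (of_real (pp' s) * e s + of_real (lam / s\<^sup>2 * pp s) * \<delta> s) = 0"
      by (simp add: k_def)
    ultimately show ?thesis by simp
  qed
  obtain c1 where c1': "\<forall>s\<in>{0<..<R}. Wr s = c1"
    using zero_derivative_constant[OF Wr'] by auto
  note c1 = c1'[rule_format]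
  obtain dV where dV: "remainder (V0 g) dV" using V0_remainder[OF g] by blast
  \<comment> \<open>The derivative supplied by \<open>has_second_derivative\<close> agrees in the
    interior with the one supplied by \<open>remainder\<close>, and only the latter comes with a
    bound near 0.\<close>
  have e_eq: "e s = d s - dV s" if s: "s \<in> {0<..<R}" for s
  proof -
    have w: "at s within {0..R} = at s" using s by (intro at_within_Icc_at) auto
    have r: "\<forall>r\<in>{0..R}. (\<psi> has_vector_derivative d r) (at r within {0..R})"
      "\<forall>r\<in>{0..R}. (V0 g has_vector_derivative dV r) (at r within {0..R})"
      using \<psi>(1) dV unfolding remainder_def by blast+
    have "s \<in> {0..R}" using s by simp
    with r have "(\<psi> has_vector_derivative d s) (at s)" "(V0 g has_vector_derivative dV s) (at s)"
      unfolding w[symmetric] by blast+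
    then have "(\<delta> has_vector_derivative d s - dV s) (at s)"
      unfolding \<delta>_def[abs_def] by (intro has_vector_derivative_diff)
    with \<delta>'[OF s] show ?thesis by (rule vector_derivative_unique_at)
  qed
  have "\<delta> \<in> O[at_right 0](\<lambda>r. complex_of_real (r powr (3/2)))"
    unfolding \<delta>_def[abs_def] using \<psi>(1) dV by (intro sum_in_bigo) (auto simp: remainder_def)
  then obtain C1 where C1: "\<forall>\<^sub>F r in at_right 0. norm (\<delta> r) \<le> C1 * norm (complex_of_real (r powr (3/2)))"
    by (auto elim: landau_o.bigE)
  have "(\<lambda>s. d s - dV s) \<in> O[at_right 0](\<lambda>r. complex_of_real (r powr (1/2)))"
    using \<psi>(1) dV by (intro sum_in_bigo) (auto simp: remainder_def)
  then obtain C2 where C2: "\<forall>\<^sub>F r in at_right 0. norm (d r - dV r) \<le> C2 * norm (complex_of_real (r powr (1/2)))"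
    by (auto elim: landau_o.bigE)
  have near: "\<forall>\<^sub>F r in at_right 0. r \<in> {0<..<R}"
    using R by (intro eventually_at_rightI[of 0 R]) auto
  have "c1 = 0"
  proof (rule constant_limit_zero[of "a + 1/2"])
    show "0 < a + 1/2" using a_props by simp
    show "\<forall>\<^sub>F r in at_right 0. cmod c1 \<le> (C2 + a * C1) * r powr (a + 1/2)"
      using near C1 C2
    proof eventually_elim
      case (elim s)
      have "cmod c1 = cmod (Wr s)" using c1[OF elim(1)] by simp
      also have "\<dots> \<le> cmod (of_real (pp s) * e s) + cmod (of_real (pp' s) * \<delta> s)"
        unfolding Wr_def by (rule norm_triangle_ineq4)
      also have "\<dots> = s powr a * cmod (d s - dV s) + a * s powr (a - 1) * cmod (\<delta> s)"
        using a_props by (simp add: norm_mult pp_def pp'_def e_eq[OF elim(1)])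
      also have "\<dots> \<le> s powr a * (C2 * s powr (1/2)) + a * s powr (a - 1) * (C1 * s powr (3/2))"
        using elim a_props by (intro add_mono mult_left_mono) auto
      also have "\<dots> = C2 * (s powr a * s powr (1/2)) + a * C1 * (s powr (a - 1) * s powr (3/2))" by simp
      also have "s powr (a - 1) * s powr (3/2) = s powr (a + 1/2)"
      proof -
        have "(a - 1) + 3/2 = a + 1/2" by simp
        then show ?thesis by (simp only: powr_add[symmetric])
      qed
      also have "C2 * (s powr a * s powr (1/2)) + a * C1 * s powr (a + 1/2) = (C2 + a * C1) * s powr (a + 1/2)"
        by (simp only: powr_add[symmetric] distrib_right)
      finally show ?case .
    qed
  qed
  then have Wr0: "Wr s = 0" if "s \<in> {0<..<R}" for s using c1[OF that] by simp
  \<comment> \<open>The derivative of this quotient by \<open>pp\<close> is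
    \<open>s powr (- 2 * a)\<close> times the Wronskian, hence 0.\<close>
  define z where "z s = of_real (s powr (- a)) * \<delta> s" for s
  have z': "(z has_vector_derivative 0) (at s)" if s: "s \<in> {0<..<R}" for s
  proof -
    have s0: "0 < s" using s by simp
    have "(z has_vector_derivative of_real (s powr (- a)) * e s + of_real (- a * s powr (- a - 1)) * \<delta> s) (at s)"
      unfolding z_def[abs_def]
      by (intro has_vector_derivative_mult of_real_has_vector_derivative has_real_derivative_powr s0 \<delta>'[OF s])
    moreover have "of_real (s powr (- a)) * e s + of_real (- a * s powr (- a - 1)) * \<delta> s = of_real (s powr (- 2 * a)) * Wr s"
    proof -
      have "-2 * a + a = - a" "-2 * a + (a - 1) = - a - 1" by simp_all
      then have "s powr (- 2 * a) * pp s = s powr (- a)" "s powr (- 2 * a) * pp' s = a * s powr (- a - 1)"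
        unfolding pp_def pp'_def by (simp_all only: powr_add[symmetric] mult.left_commute[of _ a])
      then have "complex_of_real (s powr (- a)) = of_real (s powr (- 2 * a)) * of_real (pp s)"
        "complex_of_real (- a * s powr (- a - 1)) = - (of_real (s powr (- 2 * a)) * of_real (pp' s))"
        by (simp_all flip: of_real_mult)
      then show ?thesis unfolding Wr_def by (simp only:) (simp add: algebra_simps)
    qed
    ultimately show ?thesis using Wr0[OF s] by simp
  qed
  obtain c2 where c2': "\<forall>s\<in>{0<..<R}. z s = c2"
    using zero_derivative_constant[OF z'] by auto
  note c2 = c2'[rule_format]
  have "c2 = 0"
  proof (rule constant_limit_zero[of "3/2 - a"])
    show "0 < 3/2 - a" using a_props by simp
    show "\<forall>\<^sub>F r in at_right 0. cmod c2 \<le> C1 * r powr (3/2 - a)"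
      using near C1
    proof eventually_elim
      case (elim s)
      have "cmod c2 = cmod (z s)" using c2[OF elim(1)] by simp
      also have "\<dots> = s powr (- a) * cmod (\<delta> s)" by (simp add: z_def norm_mult)
      also have "\<dots> \<le> s powr (- a) * (C1 * s powr (3/2))"
        using elim by (intro mult_left_mono) auto
      also have "\<dots> = C1 * (s powr (3/2) * s powr (- a))" by simp
      also have "\<dots> = C1 * s powr (3/2 - a)" by (simp flip: powr_add)
      finally show ?case .
    qed
  qed
  then have \<delta>0: "\<delta> s = 0" if "s \<in> {0<..<R}" for s
    using c2[OF that] that by (simp add: z_def)
  have "continuous_on {0..R} \<psi>" "continuous_on {0..R} (V0 g)"
    unfolding continuous_on_eq_continuous_within
    using \<psi>(1) dV by (auto simp: remainder_def intro!: has_vector_derivative_continuous)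
  then have "continuous_on (closure {0<..<R}) \<delta>"
    unfolding \<delta>_def[abs_def] using R by (simp add: continuous_on_diff)
  then have "\<delta> r = 0"
    by (rule continuous_constant_on_closure[OF _ \<delta>0]) (use r R in auto)
  then show ?thesis by (simp add: \<delta>_def)
qed

lemma decomposition:
  assumes g: "sq_int R g"
    and \<phi>: "\<And>r. 0 < r \<Longrightarrow> r \<le> R \<Longrightarrow> \<phi> r = c * of_real (pp r) + c' * of_real (nn r) + \<psi> r"
    and \<psi>: "remainder \<psi> d" and ex: "expr1 \<phi> g" and r: "0 < r" "r \<le> R"
  shows "\<phi> r = c * of_real (pp r) + c' * of_real (nn r) + V0 g r"
proof -
  have "expr1 \<psi> g"
    by (rule expr1_add_homogeneous[OF ex, of _ "- c" "- c'"]) (simp add: \<phi>)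
  from remainder_unique[OF \<psi> this g r] show ?thesis using \<phi>[OF r] by simp
qed

end

lemma lebesgue_on_subset_integral:
  fixes f :: "real \<Rightarrow> 'b::{banach, second_countable_topology}"
  assumes B: "B \<in> sets lebesgue" "B \<subseteq> A" "A \<in> sets lebesgue"
  shows "(LINT x|lebesgue_on B. f x) = (LINT x|lebesgue_on A. indicat_real B x *\<^sub>R f x)"
proof -
  have "(LINT x|lebesgue_on B. f x) = (LINT x|lebesgue. indicat_real B x *\<^sub>R f x)"
    using B by (simp add: integral_restrict_space set_lebesgue_integral_def)
  also have "\<dots> = (LINT x|lebesgue. indicat_real A x *\<^sub>R (indicat_real B x *\<^sub>R f x))"
    using B by (intro Bochner_Integration.integral_cong) (auto simp: indicator_def)
  also have "\<dots> = (LINT x|lebesgue_on A. indicat_real B x *\<^sub>R f x)"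
    using B by (simp add: integral_restrict_space set_lebesgue_integral_def)
  finally show ?thesis .
qed

section \<open>Hilbert-Schmidt factorization of the Volterra operator\<close>

context volterra
begin

interpretation N: finite_measure "NR R" by (rule finite_measure_Icc)
interpretation NN: pair_sigma_finite "NR R" "NR R" ..

text \<open>
  The Volterra operator is the product of two Hilbert-Schmidt operators; the weight \<open>s powr \<theta>\<close> is
  inserted because the natural first-order factor \<open>(r/s) powr a\<close> is not square integrable near 0.
\<close>

definition k1 :: "real \<Rightarrow> real \<Rightarrow> complex" where
  "k1 r s = (if 0 < s \<and> s < r \<and> r \<le> R then - of_real (r powr a * s powr (\<theta> - a)) else 0)"
definition k2 :: "real \<Rightarrow> real \<Rightarrow> complex" where
  "k2 s t = (if 0 < t \<and> t < s \<and> s \<le> R then of_real (s powr (- \<theta> - a) * t powr a) else 0)"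

lemma k_measurable: "(\<lambda>p. k1 (fst p) (snd p)) \<in> borel_measurable (NR R \<Otimes>\<^sub>M NR R)"
  "(\<lambda>p. k2 (fst p) (snd p)) \<in> borel_measurable (NR R \<Otimes>\<^sub>M NR R)"
proof -
  have [measurable]: "fst \<in> borel_measurable (NR R \<Otimes>\<^sub>M NR R)" "snd \<in> borel_measurable (NR R \<Otimes>\<^sub>M NR R)"
    using measurable_compose[OF measurable_fst[of "NR R" "NR R"] borel_measurable_lebesgue_on_id]
      measurable_compose[OF measurable_snd[of "NR R" "NR R"] borel_measurable_lebesgue_on_id] by simp_all
  show "(\<lambda>p. k1 (fst p) (snd p)) \<in> borel_measurable (NR R \<Otimes>\<^sub>M NR R)"
    unfolding k1_def by measurable
  show "(\<lambda>p. k2 (fst p) (snd p)) \<in> borel_measurable (NR R \<Otimes>\<^sub>M NR R)"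
    unfolding k2_def by measurable
qed

lemma measurable_section_complex:
  fixes k :: "real \<Rightarrow> real \<Rightarrow> complex"
  assumes "(\<lambda>p. k (fst p) (snd p)) \<in> borel_measurable (NR R \<Otimes>\<^sub>M NR R)"
    and "\<And>r s. \<not> (0 < s \<and> s < r \<and> r \<le> R) \<Longrightarrow> k r s = 0"
  shows "k r \<in> borel_measurable (NR R)" "(\<lambda>r. k r s) \<in> borel_measurable (NR R)"
  using measurable_section[OF assms] by auto

lemma k1_support: "\<not> (0 < s \<and> s < r \<and> r \<le> R) \<Longrightarrow> k1 r s = 0" by (auto simp: k1_def)
lemma k2_support: "\<not> (0 < t \<and> t < s \<and> s \<le> R) \<Longrightarrow> k2 s t = 0" by (auto simp: k2_def)

lemma powr_sq_integrable: "p > -1/2 \<Longrightarrow> integrable (NR R) (\<lambda>s. (s powr p)\<^sup>2)"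
proof -
  assume p: "p > -1/2"
  have "integrable (NR R) (\<lambda>s. s powr (2 * p))" using p R by (intro powr_integral_0) auto
  moreover have "(s powr p)\<^sup>2 = s powr (2 * p)" for s by (simp add: power2_eq_square flip: powr_add)
  ultimately show ?thesis by simp
qed

text \<open>The exponent \<open>\<theta> - a\<close> equals \<open>- v / 2\<close> and so exceeds
  -1/2.\<close>

lemma hs_k1: "hs_kernel R k1"
proof (rule hs_kernel_of_product_bound[where A = "\<lambda>r. r powr a" and B = "\<lambda>s. s powr (\<theta> - a)"])
  show "cmod (k1 r s) \<le> r powr a * s powr (\<theta> - a)" for r s by (simp add: k1_def norm_mult)
  show "integrable (NR R) (\<lambda>r. (r powr a)\<^sup>2)" using a_props by (intro powr_sq_integrable) auto
  show "integrable (NR R) (\<lambda>s. (s powr (\<theta> - a))\<^sup>2)"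
    using v1 by (intro powr_sq_integrable) (simp add: \<theta>_def a_def field_simps)
  show "k1 r \<in> borel_measurable (NR R)" "(\<lambda>r. k1 r s) \<in> borel_measurable (NR R)" for r s
    using measurable_section_complex[OF k_measurable(1) k1_support] by auto
qed (rule k_measurable(1))

text \<open>On the support \<open>t < s\<close>, so the positive power
  \<open>t powr (a + \<theta> / 2)\<close> may be replaced by the same power of \<open>s\<close>.
  The bound is then split evenly between the variables, with exponent
  \<open>- \<theta> / 2 > -1/2\<close>.\<close>

lemma hs_k2: "hs_kernel R k2"
proof (rule hs_kernel_of_product_bound[where A = "\<lambda>r. r powr (- \<theta> / 2)" and B = "\<lambda>s. s powr (- \<theta> / 2)"])
  show "cmod (k2 s t) \<le> s powr (- \<theta> / 2) * t powr (- \<theta> / 2)" for s t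
  proof (cases "0 < t \<and> t < s \<and> s \<le> R")
    case True
    have e: "(- \<theta> / 2) + (a + \<theta> / 2) = a" "(- \<theta> / 2) + (- \<theta> / 2 - a) = - \<theta> - a"
      "(a + \<theta> / 2) + (- \<theta> / 2 - a) = 0" by simp_all
    have "t powr a = t powr (- \<theta> / 2) * t powr (a + \<theta> / 2)" "s powr (- \<theta> - a) = s powr (- \<theta> / 2) * s powr (- \<theta> / 2 - a)"
      using e by (simp_all only: powr_add[symmetric])
    moreover have "t powr (a + \<theta> / 2) \<le> s powr (a + \<theta> / 2)"
      using True a_props \<theta> by (intro powr_mono2) auto
    moreover have "s powr (a + \<theta> / 2) * s powr (- \<theta> / 2 - a) = 1"
      using True e by (simp only: powr_add[symmetric]) simp
    ultimately have "s powr (- \<theta> - a) * t powr a \<le> s powr (- \<theta> / 2) * t powr (- \<theta> / 2)"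
    proof -
      assume t: "t powr a = t powr (- \<theta> / 2) * t powr (a + \<theta> / 2)" and s: "s powr (- \<theta> - a) = s powr (- \<theta> / 2) * s powr (- \<theta> / 2 - a)"
        and le: "t powr (a + \<theta> / 2) \<le> s powr (a + \<theta> / 2)" and one: "s powr (a + \<theta> / 2) * s powr (- \<theta> / 2 - a) = 1"
      have "s powr (- \<theta> - a) * t powr a = s powr (- \<theta> / 2) * t powr (- \<theta> / 2) * (t powr (a + \<theta> / 2) * s powr (- \<theta> / 2 - a))"
        unfolding t s by (simp only: mult_ac)
      also have "\<dots> \<le> s powr (- \<theta> / 2) * t powr (- \<theta> / 2) * (s powr (a + \<theta> / 2) * s powr (- \<theta> / 2 - a))"
        by (intro mult_left_mono mult_right_mono le) auto
      finally show ?thesis unfolding one by simp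
    qed
    then show ?thesis using True by (simp add: k2_def norm_mult)
  qed (auto simp: k2_def)
  show "integrable (NR R) (\<lambda>r. (r powr (- \<theta> / 2))\<^sup>2)" using \<theta> by (intro powr_sq_integrable) auto
  then show "integrable (NR R) (\<lambda>r. (r powr (- \<theta> / 2))\<^sup>2)" .
  show "k2 r \<in> borel_measurable (NR R)" "(\<lambda>r. k2 r s) \<in> borel_measurable (NR R)" for r s
    using measurable_section_complex[OF k_measurable(2) k2_support] by auto
qed (rule k_measurable(2))

text \<open>The powers of \<open>s\<close> combine to the derivative of \<open>Q\<close>, whose
  integral from \<open>t\<close> to \<open>r\<close> is \<open>Q r - Q t\<close>.\<close>

lemma k1_k2: "(LINT s|NR R. k1 r s * k2 s t) = kerc r t"
proof (cases "0 < t \<and> t < r \<and> r \<le> R")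
  case True
  have ne: "AE s in NR R. s \<noteq> c" for c
    using AE_completion[OF AE_lborel_singleton[of c]] by (subst AE_restrict_space_iff) auto
  note ne[of t] ne[of r]
  then have ae: "AE s in NR R. k1 r s * k2 s t = indicat_real {t..r} s *\<^sub>R (- of_real (r powr a * t powr a) * of_real (s powr (-1 - 2 * v)))"
  proof eventually_elim
    case (elim s)
    show ?case
    proof (cases "t < s \<and> s < r")
      case s: True
      have "(\<theta> - a) + (- \<theta> - a) = -1 - 2 * v" by (simp add: a_def)
      then have "s powr (\<theta> - a) * s powr (- \<theta> - a) = s powr (-1 - 2 * v)" by (simp only: powr_add[symmetric])
      then have "r powr a * s powr (\<theta> - a) * (s powr (- \<theta> - a) * t powr a) = r powr a * t powr a * s powr (-1 - 2 * v)"
        by (simp add: mult_ac)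
      then have "k1 r s * k2 s t = - of_real (r powr a * t powr a * s powr (-1 - 2 * v))"
        using True s by (simp add: k1_def k2_def flip: of_real_mult)
      then show ?thesis using s True by simp
    next
      case False
      then have "k1 r s * k2 s t = 0" using k1_support[of s r] k2_support[of t s] by auto
      then show ?thesis using False elim by (auto simp: indicator_def)
    qed
  qed
  have meas: "(\<lambda>s. k1 r s * k2 s t) \<in> borel_measurable (NR R)"
    by (intro borel_measurable_times measurable_section_complex(1)[OF k_measurable(1) k1_support] measurable_section_complex(2)[OF k_measurable(2) k2_support])
  have meas2: "(\<lambda>s. indicat_real {t..r} s *\<^sub>R (- of_real (r powr a * t powr a) * complex_of_real (s powr (-1 - 2 * v)))) \<in> borel_measurable (NR R)"
    by (intro borel_imp_lebesgue_on) measurable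
  have "(LINT s|NR R. k1 r s * k2 s t) = (LINT s|NR R. indicat_real {t..r} s *\<^sub>R (- of_real (r powr a * t powr a) * of_real (s powr (-1 - 2 * v))))"
    by (rule integral_cong_AE[OF meas meas2 ae])
  also have "\<dots> = (LINT s|lebesgue_on {t..r}. - of_real (r powr a * t powr a) * of_real (s powr (-1 - 2 * v)))"
    by (rule lebesgue_on_subset_integral[symmetric]) (use True in auto)
  also have "\<dots> = - of_real (r powr a * t powr a) * (LINT s|lebesgue_on {t..r}. of_real (s powr (-1 - 2 * v)))"
    by (rule integral_mult_right_zero)
  also have "(LINT s|lebesgue_on {t..r}. complex_of_real (s powr (-1 - 2 * v))) = of_real (Q r) - of_real (Q t)"
  proof -
    have c: "continuous_on {0<..} (\<lambda>s::real. s powr (-1 - 2 * v))"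
      by (intro continuous_intros) auto
    have "AC (\<lambda>r. of_real (Q r)) (\<lambda>r. of_real (r powr (-1 - 2 * v)))"
      by (rule AC_real[OF Q_deriv c])
    from ACD(2)[OF this, of t r] True show ?thesis by simp
  qed
  finally show ?thesis using True by (simp add: kerc_def ker_def)
next
  case False
  have z: "k1 r s * k2 s t = 0" for s
    using False k1_support[of s r] k2_support[of t s] by force
  have "kerc r t = 0" using False by (rule kerc_support)
  then show ?thesis unfolding z by simp
qed

lemma V0_factorization:
  assumes f: "sq_int R f" shows "kop R k1 (kop R k2 f) r = V0 f r"
proof -
  have i: "integrable (NR R \<Otimes>\<^sub>M NR R) (\<lambda>p. k2 (fst p) (snd p) * f (snd p) * k1 r (fst p))"
    by (rule integrable_hs_product[OF hs_k2 f hs_kernelD(2)[OF hs_k1]])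
  have "kop R k1 (kop R k2 f) r = (LINT s|NR R. LINT t|NR R. k2 s t * f t * k1 r s)"
    unfolding kop_def by (intro Bochner_Integration.integral_cong refl) (simp add: mult.commute)
  also have "\<dots> = (LINT t|NR R. LINT s|NR R. k2 s t * f t * k1 r s)"
    by (rule NN.Fubini_integral[symmetric]) (use i in \<open>simp add: case_prod_unfold\<close>)
  also have "\<dots> = (LINT t|NR R. kerc r t * f t)"
  proof (intro Bochner_Integration.integral_cong refl)
    fix t
    have "(LINT s|NR R. k2 s t * f t * k1 r s) = (LINT s|NR R. k1 r s * k2 s t * f t)"
      by (intro Bochner_Integration.integral_cong refl) (simp add: mult_ac)
    also have "\<dots> = kerc r t * f t" unfolding integral_mult_left_zero k1_k2 ..
    finally show "(LINT s|NR R. k2 s t * f t * k1 r s) = kerc r t * f t" .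
  qed
  finally show ?thesis by (simp add: V0_def kop_def)
qed

text \<open>Uniqueness of the remainder allows \<open>V0\<close> to be evaluated by exhibiting a
  solution of the right order at 0; this is applied to each Frobenius term.\<close>

lemma V0_of_real:
  fixes c c' c'' g :: "real \<Rightarrow> real"
  assumes c: "\<And>r. 0 < r \<Longrightarrow> (c has_real_derivative c' r) (at r)"
    and c': "\<And>r. 0 < r \<Longrightarrow> (c' has_real_derivative c'' r) (at r)"
    and c'': "continuous_on {0<..} c''"
    and b1: "\<And>r. 0 < r \<Longrightarrow> r \<le> R \<Longrightarrow> \<bar>c r\<bar> \<le> C1 * r powr (3/2)"
    and b2: "\<And>r. 0 < r \<Longrightarrow> r \<le> R \<Longrightarrow> \<bar>c' r\<bar> \<le> C2 * r powr (1/2)"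
    and c0: "c 0 = 0"
    and g: "sq_int R (\<lambda>r. of_real (g r))" and eq: "\<And>r. 0 < r \<Longrightarrow> r \<le> R \<Longrightarrow> g r = - c'' r + lam / r\<^sup>2 * c r"
    and r: "0 < r" "r \<le> R"
  shows "V0 (\<lambda>r. of_real (g r)) r = of_real (c r)"
proof -
  have "remainder (\<lambda>r. of_real (c r)) (\<lambda>r. if r \<le> 0 then 0 else of_real (c' r))"
  proof (rule remainderI)
    show "((\<lambda>r. complex_of_real (c r)) has_vector_derivative of_real (c' r)) (at r within {0..R})" if "0 < r" "r \<le> R" for r
      by (rule has_vector_derivative_at_within[OF of_real_has_vector_derivative[OF c[OF that(1)]]])
    show "continuous_on {0<..R} (\<lambda>r. complex_of_real (c' r))"
      by (intro continuous_intros continuous_on_subset[OF continuous_on_positive[OF c']]) auto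
    show "cmod (complex_of_real (c r)) \<le> C1 * r powr (3/2)" if "0 < r" "r \<le> R" for r
      using b1[OF that] by simp
    show "cmod (complex_of_real (c' r)) \<le> C2 * r powr (1/2)" if "0 < r" "r \<le> R" for r
      using b2[OF that] by simp
  qed (simp add: c0)
  moreover have "expr1 (\<lambda>r. of_real (c r)) (\<lambda>r. of_real (g r))"
    unfolding expr1_def
  proof (intro exI conjI)
    show "has_second_derivative R (\<lambda>r. of_real (c r)) (\<lambda>r. of_real (c'' r))"
      unfolding has_second_derivative_def
    proof (intro exI conjI ballI allI impI)
      show "((\<lambda>r. complex_of_real (c r)) has_vector_derivative of_real (c' r)) (at r)" if "r \<in> {0<..<R}" for r
        by (intro of_real_has_vector_derivative c) (use that in auto)
      fix x y assume "0 < x \<and> x \<le> y \<and> y < R"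
      then show "integrable (lebesgue_on {x..y}) (\<lambda>r. complex_of_real (c'' r))"
        "complex_of_real (c' y) - of_real (c' x) = (LINT s|lebesgue_on {x..y}. of_real (c'' s))"
        using ACD[OF AC_real[OF c' c''], of x y] by auto
    qed
    have "AE r in NR R. r \<noteq> 0"
      using AE_completion[OF AE_lborel_singleton[of 0]] by (subst AE_restrict_space_iff) auto
    then show "AE r in NR R. complex_of_real (g r) = - of_real (c'' r) + of_real (lam / r\<^sup>2) * of_real (c r)"
      using AE_space
    proof eventually_elim
      case (elim r)
      then have "g r = - c'' r + lam / r\<^sup>2 * c r" by (intro eq) auto
      then show ?case by simp
    qed
  qed
  ultimately show ?thesis using remainder_unique[OF _ _ g r, of "\<lambda>r. of_real (c r)" "\<lambda>r. if r \<le> 0 then 0 else of_real (c' r)"] by simp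
qed

end

section \<open>Frobenius solutions and Bessel functions\<close>

text \<open>
  Frobenius solutions of \<open>- u'' + (v\<^sup>2 - 1/4) u / r\<^sup>2 + w u = 0\<close>: the exponent is \<open>1/2 + \<sigma>\<close> with \<open>\<sigma> = v\<close> or \<open>- v\<close>;
  \<open>\<epsilon> = 1\<close> switches on the logarithm, and \<open>\<epsilon> = 0\<close>, \<open>h = -1\<close> gives the pure power series.
\<close>

definition frob_coeff :: "real \<Rightarrow> nat \<Rightarrow> real" where
  "frob_coeff \<sigma> k = 1 / (4 ^ k * fact k * pochhammer (1 + \<sigma>) k)"
definition frob :: "real \<Rightarrow> real \<Rightarrow> (nat \<Rightarrow> real) \<Rightarrow> nat \<Rightarrow> real \<Rightarrow> real" where
  "frob \<sigma> \<epsilon> h k s = frob_coeff \<sigma> k * (s powr (1/2 + \<sigma> + 2 * real k) * (\<epsilon> * ln s - h k))"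
definition sol :: "real \<Rightarrow> real \<Rightarrow> (nat \<Rightarrow> real) \<Rightarrow> complex \<Rightarrow> real \<Rightarrow> complex" where
  "sol \<sigma> \<epsilon> h w s = (\<Sum>k. of_real (frob \<sigma> \<epsilon> h k s) * w ^ k)"

lemma harm_le: "harm k \<le> (real k :: real)"
proof (induction k)
  case (Suc k)
  have "inverse (1 + real k) \<le> 1" by (simp add: field_simps)
  with Suc show ?case by (simp add: harm_Suc)
qed (simp add: harm_def)

text \<open>All factors after the first are at least 1, even for \<open>\<sigma>\<close> close to
  -1.\<close>

lemma pochhammer_lower_bound:
  assumes "-1 < (\<sigma>::real)" shows "min 1 (1 + \<sigma>) \<le> pochhammer (1 + \<sigma>) k"
proof (cases k)
  case (Suc n)
  have "1 \<le> pochhammer (1 + (1 + \<sigma>)) n"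
    unfolding pochhammer_prod by (rule prod_ge_1) (use assms in auto)
  then have "(1 + \<sigma>) * 1 \<le> (1 + \<sigma>) * pochhammer (1 + \<sigma> + 1) n"
    using assms by (intro mult_left_mono) (auto simp: add_ac)
  then show ?thesis unfolding Suc pochhammer_rec by simp
qed simp

lemma frob_coeff_Suc:
  assumes "-1 < \<sigma>"
  shows "frob_coeff \<sigma> (Suc k) * (4 * (real k + 1) * (real k + 1 + \<sigma>)) = frob_coeff \<sigma> k"
proof -
  have nz: "pochhammer (1 + \<sigma>) k \<noteq> 0" "real k + 1 + \<sigma> \<noteq> 0" "real k + 1 \<noteq> 0"
    using pochhammer_lower_bound[OF assms, of k] assms by auto
  have id: "1 / (4 * Z * (y * F) * (P * x)) * (4 * y * x) = 1 / (Z * F * P)"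
    if "x \<noteq> 0" "y \<noteq> 0" "P \<noteq> 0" for x y Z F P :: real using that by simp
  have e: "frob_coeff \<sigma> (Suc k) = 1 / (4 * 4 ^ k * ((real k + 1) * fact k) * (pochhammer (1 + \<sigma>) k * (real k + 1 + \<sigma>)))"
    by (simp add: frob_coeff_def pochhammer_Suc add_ac)
  show ?thesis unfolding e frob_coeff_def[of \<sigma> k] by (rule id) (use nz in auto)
qed

lemma sq_int_bound:
  assumes u: "u \<in> borel_measurable (NR R)" and d: "sq_int R d"
    and le: "\<And>s. 0 \<le> s \<Longrightarrow> s \<le> R \<Longrightarrow> cmod (u s) \<le> K * cmod (d s)"
  shows "sq_int R u"
proof -
  have "integrable (NR R) (\<lambda>s. (cmod (u s))\<^sup>2)"
  proof (rule Bochner_Integration.integrable_bound)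
    show "integrable (NR R) (\<lambda>s. K\<^sup>2 * (cmod (d s))\<^sup>2)" using sq_intD(2)[OF d] by simp
    show "(\<lambda>s. (cmod (u s))\<^sup>2) \<in> borel_measurable (NR R)" using u by simp
    show "AE s in NR R. norm ((cmod (u s))\<^sup>2) \<le> norm (K\<^sup>2 * (cmod (d s))\<^sup>2)"
    proof (rule AE_I2)
      fix s assume "s \<in> space (NR R)"
      then have "(cmod (u s))\<^sup>2 \<le> (K * cmod (d s))\<^sup>2" by (intro power_mono le) auto
      then show "norm ((cmod (u s))\<^sup>2) \<le> norm (K\<^sup>2 * (cmod (d s))\<^sup>2)" by (simp add: power_mult_distrib)
    qed
  qed
  with u show ?thesis by (simp add: sq_int_def)
qed

context volterra
begin

text \<open>The condition on \<open>h (Suc k) - h k\<close> is the recursion for the coefficients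
  beside the logarithm. It holds for constant \<open>h\<close> when \<open>\<epsilon> = 0\<close>,
  and for harmonic numbers when \<open>\<epsilon> = 1\<close> and \<open>\<sigma> = 0\<close>.
  \<open>D\<close> says that the leading behaviour at 0 is square integrable.\<close>

context
  fixes \<sigma> \<epsilon> :: real and h :: "nat \<Rightarrow> real"
  assumes \<sigma>: "-1 < \<sigma>" "\<sigma>\<^sup>2 = v\<^sup>2"
    and D: "sq_int R (\<lambda>s. of_real (s powr (1/2 + \<sigma>) * (1 + \<bar>\<epsilon> * ln s\<bar>)))"
    and h: "\<And>k. \<bar>h k\<bar> \<le> 1 + real k"
    and hS: "\<And>k. (real k + 1) * (real k + 1 + \<sigma>) * (h (Suc k) - h k) = \<epsilon> * (real k + 1 + \<sigma> / 2)"
begin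

abbreviation "fr \<equiv> frob \<sigma> \<epsilon> h"
abbreviation "DD s \<equiv> s powr (1/2 + \<sigma>) * (1 + \<bar>\<epsilon> * ln s\<bar>)"
abbreviation "MM k \<equiv> 2 / min 1 (1 + \<sigma>) * ((R\<^sup>2 / 2) ^ k / fact k)"

text \<open>The factor \<open>4 ^ k\<close> in the coefficient splits into two factors
  \<open>2 ^ k\<close>: one stays in \<open>(R^2 / 2) ^ k\<close>, the other absorbs the linear
  growth of \<open>h\<close> through \<open>2 + k \<le> 2 * 2 ^ k\<close>.\<close>

lemma frob_bound:
  assumes s: "0 \<le> s" "s \<le> R"
  shows "\<bar>fr k s\<bar> \<le> MM k * DD s"
proof (cases "s = 0")
  case False
  then have s0: "0 < s" using s by simp
  have m: "0 < min 1 (1 + \<sigma>)" using \<sigma> by simp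
  have c: "\<bar>frob_coeff \<sigma> k\<bar> \<le> 1 / (4 ^ k * fact k * min 1 (1 + \<sigma>))"
  proof -
    have p: "0 < pochhammer (1 + \<sigma>) k" using pochhammer_lower_bound[OF \<sigma>(1), of k] m by linarith
    then have "\<bar>frob_coeff \<sigma> k\<bar> = 1 / (4 ^ k * fact k * pochhammer (1 + \<sigma>) k)"
      by (simp add: frob_coeff_def)
    also have "\<dots> \<le> 1 / (4 ^ k * fact k * min 1 (1 + \<sigma>))"
      using pochhammer_lower_bound[OF \<sigma>(1), of k] m p
      by (intro divide_left_mono mult_left_mono mult_pos_pos) auto
    finally show ?thesis .
  qed
  have e: "s powr (1/2 + \<sigma> + 2 * real k) \<le> s powr (1/2 + \<sigma>) * (R\<^sup>2) ^ k"
  proof -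
    have "s powr (1/2 + \<sigma> + 2 * real k) = s powr (1/2 + \<sigma>) * s ^ (2 * k)"
      using powr_realpow[OF s0, of "2 * k"] by (simp add: powr_add)
    also have "\<dots> \<le> s powr (1/2 + \<sigma>) * R ^ (2 * k)"
      using s by (intro mult_left_mono power_mono) auto
    finally show ?thesis by (simp add: power_mult)
  qed
  have k2: "2 + real k \<le> 2 * 2 ^ k"
  proof (induction k)
    case (Suc k)
    then show ?case using one_le_power[of "2::real" k] by simp
  qed simp
  have l: "\<bar>\<epsilon> * ln s - h k\<bar> \<le> 2 * 2 ^ k * (1 + \<bar>\<epsilon> * ln s\<bar>)"
  proof -
    have "\<bar>\<epsilon> * ln s - h k\<bar> \<le> \<bar>\<epsilon> * ln s\<bar> + (1 + real k)" using h[of k] by linarith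
    also have "\<dots> \<le> (2 + real k) * (1 + \<bar>\<epsilon> * ln s\<bar>)" by (simp add: algebra_simps)
    also have "\<dots> \<le> 2 * 2 ^ k * (1 + \<bar>\<epsilon> * ln s\<bar>)" using k2 by (intro mult_right_mono) auto
    finally show ?thesis .
  qed
  have "\<bar>fr k s\<bar> = \<bar>frob_coeff \<sigma> k\<bar> * (s powr (1/2 + \<sigma> + 2 * real k) * \<bar>\<epsilon> * ln s - h k\<bar>)"
    by (simp add: frob_def abs_mult)
  also have "\<dots> \<le> 1 / (4 ^ k * fact k * min 1 (1 + \<sigma>)) * ((s powr (1/2 + \<sigma>) * (R\<^sup>2) ^ k) * (2 * 2 ^ k * (1 + \<bar>\<epsilon> * ln s\<bar>)))"
    using m by (intro mult_mono c e l) auto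
  also have "\<dots> = MM k * DD s"
  proof -
    have "(4::real) ^ k = 2 ^ k * 2 ^ k" by (simp flip: power_mult_distrib)
    moreover have id: "1 / (z * z * f * m) * (p * q * (2 * z * d)) = 2 / m * (q / z / f) * (p * d)"
      if "z \<noteq> 0" "m \<noteq> 0" "f \<noteq> 0" for z f m p q d :: real using that by (simp add: field_simps)
    ultimately show ?thesis using m by (simp only: power_divide) (rule id, auto)
  qed
  finally show ?thesis .
next
  case True
  then have "fr k s = 0" "DD s = 0" by (simp_all add: frob_def)
  then show ?thesis by (simp only: abs_zero mult_zero_right order_refl)
qed

lemma frob_measurable: "(\<lambda>s. complex_of_real (fr k s)) \<in> borel_measurable (NR R)"
  unfolding frob_def by (intro borel_imp_lebesgue_on) measurable

lemma frob_sq_int: "sq_int R (\<lambda>s. of_real (fr k s))"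
proof (rule sq_int_bound[OF frob_measurable D])
  fix s assume "0 \<le> s" "s \<le> R"
  moreover have "\<bar>DD s\<bar> = DD s" by simp
  ultimately show "cmod (of_real (fr k s)) \<le> MM k * cmod (of_real (DD s))"
    using frob_bound[of s k] by (simp only: norm_of_real)
qed

lemma MM_sums: "(\<lambda>k. MM k * x ^ k) sums (2 / min 1 (1 + \<sigma>) * exp (R\<^sup>2 / 2 * x))"
proof -
  have "2 / min 1 (1 + \<sigma>) * ((R\<^sup>2 / 2 * x) ^ k / fact k) = MM k * x ^ k" for k
    by (simp only: power_mult_distrib[of "R\<^sup>2 / 2" x]) simp
  with exp_sums[of "2 / min 1 (1 + \<sigma>)" "R\<^sup>2 / 2 * x"] show ?thesis by (simp only:)
qed

lemma frob_summable:
  assumes s: "0 \<le> s" "s \<le> R"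
  shows "summable (\<lambda>k. cmod (of_real (fr k s) * w ^ k))"
proof (rule summable_comparison_test')
  show "summable (\<lambda>k. DD s * (MM k * cmod w ^ k))"
    using sums_summable[OF MM_sums] by (rule summable_mult)
  fix k
  show "norm (cmod (of_real (fr k s) * w ^ k)) \<le> DD s * (MM k * cmod w ^ k)"
    using mult_right_mono[OF frob_bound[OF s, of k], of "cmod w ^ k"] by (simp add: norm_mult norm_power mult_ac)
qed

lemma sol_bound:
  assumes s: "0 \<le> s" "s \<le> R"
  shows "cmod (sol \<sigma> \<epsilon> h w s) \<le> 2 / min 1 (1 + \<sigma>) * exp (R\<^sup>2 / 2 * cmod w) * DD s"
proof -
  have "cmod (sol \<sigma> \<epsilon> h w s) \<le> (\<Sum>k. DD s * (MM k * cmod w ^ k))"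
    unfolding sol_def
  proof (rule norm_suminf_le)
    show "norm (complex_of_real (fr k s) * w ^ k) \<le> DD s * (MM k * cmod w ^ k)" for k
      using mult_right_mono[OF frob_bound[OF s, of k], of "cmod w ^ k"] by (simp add: norm_mult norm_power mult_ac)
    show "summable (\<lambda>k. DD s * (MM k * cmod w ^ k))"
      using sums_summable[OF MM_sums] by (rule summable_mult)
  qed
  also have "\<dots> = DD s * (2 / min 1 (1 + \<sigma>) * exp (R\<^sup>2 / 2 * cmod w))"
    by (intro sums_unique[symmetric] sums_mult MM_sums)
  finally show ?thesis by (simp only: mult_ac)
qed

lemma sol_measurable: "sol \<sigma> \<epsilon> h w \<in> borel_measurable (NR R)"
  unfolding sol_def[abs_def] by (intro borel_measurable_suminf borel_measurable_times frob_measurable borel_measurable_const)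

lemma sol_sq_int: "sq_int R (sol \<sigma> \<epsilon> h w)"
proof (rule sq_int_bound[OF sol_measurable D])
  fix s assume "0 \<le> s" "s \<le> R"
  then show "cmod (sol \<sigma> \<epsilon> h w s) \<le> 2 / min 1 (1 + \<sigma>) * exp (R\<^sup>2 / 2 * cmod w) * cmod (of_real (DD s))"
    using sol_bound[of s w] abs_of_nonneg[of "DD s"] by (simp only: norm_of_real) simp
qed

text \<open>Termwise integration against a square-integrable function. The resulting power series in
  \<open>w\<close> serves both the Volterra equation and the continuity in the spectral
  parameter.\<close>

lemma integral_sol:
  assumes \<kappa>: "sq_int R \<kappa>"
  shows "summable (\<lambda>k. (LINT s|NR R. \<kappa> s * of_real (fr k s)) * w ^ k)"
    "(LINT s|NR R. \<kappa> s * sol \<sigma> \<epsilon> h w s) = (\<Sum>k. (LINT s|NR R. \<kappa> s * of_real (fr k s)) * w ^ k)"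
proof -
  let ?f = "\<lambda>k s. \<kappa> s * of_real (fr k s) * w ^ k"
  define I where "I = (LINT s|NR R. cmod (\<kappa> s * of_real (DD s)))"
  have i0: "integrable (NR R) (\<lambda>s. \<kappa> s * of_real (fr k s))" for k
    by (rule integrable_sq_int_mult[OF \<kappa> frob_sq_int])
  then have i: "integrable (NR R) (?f k)" for k by (rule integrable_mult_left)
  have s1: "AE s in NR R. summable (\<lambda>k. norm (?f k s))"
  proof (rule AE_I2)
    fix s assume "s \<in> space (NR R)"
    then have "summable (\<lambda>k. cmod (\<kappa> s) * cmod (of_real (fr k s) * w ^ k))"
      by (intro summable_mult frob_summable) auto
    then show "summable (\<lambda>k. norm (?f k s))" by (simp add: norm_mult mult_ac)
  qed
  have s2: "summable (\<lambda>k. LINT s|NR R. norm (?f k s))"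
  proof (rule summable_comparison_test')
    show "summable (\<lambda>k. I * (MM k * cmod w ^ k))"
      using sums_summable[OF MM_sums] by (rule summable_mult)
    fix k
    have "(LINT s|NR R. norm (?f k s)) \<le> (LINT s|NR R. cmod (\<kappa> s * of_real (DD s)) * (MM k * cmod w ^ k))"
    proof (rule integral_mono)
      show "integrable (NR R) (\<lambda>s. norm (?f k s))" using i by (rule integrable_norm)
      show "integrable (NR R) (\<lambda>s. cmod (\<kappa> s * of_real (DD s)) * (MM k * cmod w ^ k))"
        using integrable_norm[OF integrable_sq_int_mult[OF \<kappa> D]] by (rule integrable_mult_left)
      fix s assume "s \<in> space (NR R)"
      then have "\<bar>fr k s\<bar> \<le> MM k * \<bar>DD s\<bar>" using frob_bound[of s k] by simp
      then have "cmod (\<kappa> s) * cmod w ^ k * \<bar>fr k s\<bar> \<le> cmod (\<kappa> s) * cmod w ^ k * (MM k * \<bar>DD s\<bar>)"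
        by (rule mult_left_mono) simp
      then show "norm (?f k s) \<le> cmod (\<kappa> s * of_real (DD s)) * (MM k * cmod w ^ k)"
        by (simp only: norm_mult norm_power norm_of_real mult_ac)
    qed
    also have "\<dots> = I * (MM k * cmod w ^ k)" unfolding I_def by (rule integral_mult_left_zero)
    finally show "norm (LINT s|NR R. norm (?f k s)) \<le> I * (MM k * cmod w ^ k)" by simp
  qed
  have e: "(LINT s|NR R. ?f k s) = (LINT s|NR R. \<kappa> s * of_real (fr k s)) * w ^ k" for k
    by (rule integral_mult_left_zero)
  show "summable (\<lambda>k. (LINT s|NR R. \<kappa> s * of_real (fr k s)) * w ^ k)"
    using summable_integral[OF i s1 s2] unfolding e .
  have "(LINT s|NR R. \<kappa> s * sol \<sigma> \<epsilon> h w s) = (LINT s|NR R. (\<Sum>k. ?f k s))"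
  proof (rule Bochner_Integration.integral_cong[OF refl])
    fix s assume "s \<in> space (NR R)"
    then have "summable (\<lambda>k. of_real (fr k s) * w ^ k)"
      by (intro summable_norm_cancel[OF frob_summable]) auto
    then show "\<kappa> s * sol \<sigma> \<epsilon> h w s = (\<Sum>k. ?f k s)"
      unfolding sol_def by (simp only: suminf_mult mult.assoc)
  qed
  also have "\<dots> = (\<Sum>k. LINT s|NR R. ?f k s)" by (rule integral_suminf[OF i s1 s2])
  finally show "(LINT s|NR R. \<kappa> s * sol \<sigma> \<epsilon> h w s) = (\<Sum>k. (LINT s|NR R. \<kappa> s * of_real (fr k s)) * w ^ k)"
    unfolding e .
qed

text \<open>Term \<open>k + 1\<close>, with opposite sign, solves the equation with right-hand side
  term \<open>k\<close>. The indicial polynomial \<open>(m + 1) * (m + 2) - lam\<close> equals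
  \<open>4 * (k + 1) * (k + 1 + \<sigma>)\<close>, the ratio in \<open>frob_coeff_Suc\<close>, and
  \<open>hS\<close> matches the terms without logarithm.\<close>

lemma V0_frob:
  assumes r: "0 < r" "r \<le> R"
  shows "V0 (\<lambda>s. of_real (fr k s)) r = - of_real (fr (Suc k) r)"
proof -
  define m where "m = 1/2 + \<sigma> + 2 * real k"
  define C where "C = frob_coeff \<sigma> (Suc k)"
  define l where "l = h (Suc k)"
  have m1: "-1/2 < m" using \<sigma> by (simp add: m_def)
  let ?c = "\<lambda>r. - C * (r powr (m + 2) * (\<epsilon> * ln r - l))"
  let ?c' = "\<lambda>r. - C * (r powr (m + 1) * ((m + 2) * (\<epsilon> * ln r - l) + \<epsilon>))"
  let ?c'' = "\<lambda>r. - C * (r powr m * ((m + 1) * ((m + 2) * (\<epsilon> * ln r - l) + \<epsilon>) + (m + 2) * \<epsilon>))"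
  have powr_m1: "s powr p / s = s powr (p - 1)" if "0 < s" for s p :: real using that by (simp add: powr_diff)
  \<comment> \<open>The surplus over the orders 3/2 and 1/2 that a remainder must have; being
    positive, it absorbs the logarithm in the bound \<open>B\<close>.\<close>
  define p where "p = m + 1/2"
  have p0: "0 < p" using m1 by (simp add: p_def)
  define B where "B = \<bar>\<epsilon>\<bar> * (R powr p * R + 1 / p) + R powr p * \<bar>l\<bar>"
  have B: "s powr p * \<bar>\<epsilon> * ln s - l\<bar> \<le> B" and pR: "s powr p \<le> R powr p" if s: "0 < s" "s \<le> R" for s
  proof -
    show pR: "s powr p \<le> R powr p" using s p0 by (intro powr_mono2) auto
    have "ln s \<le> R" using s ln_le_minus_one[of s] by linarith
    moreover have "p * (- ln s) \<le> s powr (- p)"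
      using s ln_le_minus_one[of "s powr (- p)"] by simp
    then have "- ln s \<le> s powr (- p) / p" using p0 by (simp add: field_simps)
    ultimately have "\<bar>ln s\<bar> \<le> R + s powr (- p) / p"
      using R p0 by (auto simp: abs_le_iff intro: add_increasing add_increasing2)
    then have "s powr p * \<bar>ln s\<bar> \<le> s powr p * (R + s powr (- p) / p)" by (rule mult_left_mono) simp
    also have "\<dots> = s powr p * R + 1 / p" using s by (simp add: distrib_left powr_minus field_simps)
    also have "\<dots> \<le> R powr p * R + 1 / p" using pR R by (intro add_right_mono mult_right_mono) auto
    finally have L: "s powr p * \<bar>ln s\<bar> \<le> R powr p * R + 1 / p" .
    have "s powr p * \<bar>\<epsilon> * ln s - l\<bar> \<le> s powr p * (\<bar>\<epsilon>\<bar> * \<bar>ln s\<bar> + \<bar>l\<bar>)"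
      using abs_triangle_ineq4[of "\<epsilon> * ln s" l] by (intro mult_left_mono) (auto simp: abs_mult)
    also have "\<dots> = \<bar>\<epsilon>\<bar> * (s powr p * \<bar>ln s\<bar>) + s powr p * \<bar>l\<bar>" by (simp add: algebra_simps)
    also have "\<dots> \<le> B" unfolding B_def by (intro add_mono mult_left_mono mult_right_mono L pR) auto
    finally show "s powr p * \<bar>\<epsilon> * ln s - l\<bar> \<le> B" .
  qed
  have e1: "s powr (m + 1) = s powr (1/2) * s powr p" "s powr (m + 2) = s powr (3/2) * s powr p" for s
  proof -
    have "1/2 + p = m + 1" "3/2 + p = m + 2" by (simp_all add: p_def)
    then show "s powr (m + 1) = s powr (1/2) * s powr p" "s powr (m + 2) = s powr (3/2) * s powr p"
      by (simp_all only: powr_add[symmetric])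
  qed
  have eq: "fr k s = - ?c'' s + lam / s\<^sup>2 * ?c s" if s: "0 < s" "s \<le> R" for s
  proof -
    define L where "L = \<epsilon> * ln s"
    have p2: "s powr (m + 2) = s\<^sup>2 * s powr m" using s by (simp add: powr_add)
    have q: "(m + 1) * (m + 2) - lam = 4 * ((real k + 1) * (real k + 1 + \<sigma>))"
    proof -
      have "lam = \<sigma>\<^sup>2 - 1/4" by (simp add: lam_def \<sigma>(2))
      then show ?thesis by (simp add: m_def power2_eq_square algebra_simps)
    qed
    have e2: "\<epsilon> * (2 * m + 3) = 4 * (\<epsilon> * (real k + 1 + \<sigma> / 2))" by (simp add: m_def algebra_simps)
    have "- ?c'' s + lam / s\<^sup>2 * ?c s
      = C * s powr m * (((m + 1) * (m + 2) - lam) * (L - l) + \<epsilon> * (2 * m + 3))"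
      unfolding p2 L_def[symmetric] using s by (simp add: field_simps power2_eq_square)
    also have "\<dots> = C * s powr m * (4 * ((real k + 1) * (real k + 1 + \<sigma>)) * (L - l)
        + 4 * ((real k + 1) * (real k + 1 + \<sigma>) * (l - h k)))"
      unfolding q e2 l_def hS ..
    also have "\<dots> = (C * (4 * (real k + 1) * (real k + 1 + \<sigma>))) * (s powr m * (L - h k))"
      by (simp only: algebra_simps)
    also have "\<dots> = fr k s" unfolding C_def frob_coeff_Suc[OF \<sigma>(1)] by (simp add: frob_def m_def L_def)
    finally show ?thesis ..
  qed
  have "V0 (\<lambda>s. of_real (fr k s)) r = of_real (?c r)"
  proof (rule V0_of_real[where c = ?c and c' = ?c' and c'' = ?c'', OF _ _ _ _ _ _ frob_sq_int eq r])
    show "(?c has_real_derivative ?c' s) (at s)" if s: "0 < s" for s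
    proof -
      have d: "(?c has_real_derivative - C * ((m + 2) * s powr (m + 2 - 1) * (\<epsilon> * ln s - l) + (\<epsilon> * (1 / s) - 0) * s powr (m + 2))) (at s)"
        using s by (intro DERIV_cmult DERIV_mult has_real_derivative_powr DERIV_diff DERIV_ln_divide DERIV_const)
      have e: "m + 2 - 1 = m + 1" "(\<epsilon> * (1 / s) - 0) * s powr (m + 2) = \<epsilon> * s powr (m + 1)"
        using powr_m1[OF s, of "m + 2"] by (simp_all add: add_ac flip: times_divide_eq_right)
      from d show ?thesis unfolding e by (rule DERIV_cong) (simp only: algebra_simps)
    qed
    show "(?c' has_real_derivative ?c'' s) (at s)" if s: "0 < s" for s
    proof -
      have d: "(?c' has_real_derivative - C * ((m + 1) * s powr (m + 1 - 1) * ((m + 2) * (\<epsilon> * ln s - l) + \<epsilon>)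
         + ((m + 2) * (\<epsilon> * (1 / s) - 0) + 0) * s powr (m + 1))) (at s)"
        using s by (intro DERIV_cmult DERIV_mult has_real_derivative_powr DERIV_diff DERIV_add DERIV_ln_divide DERIV_const)
      have e: "m + 1 - 1 = m" "((m + 2) * (\<epsilon> * (1 / s) - 0) + 0) * s powr (m + 1) = (m + 2) * \<epsilon> * s powr m"
        using powr_m1[OF s, of "m + 1"] by (simp_all flip: times_divide_eq_right)
      from d show ?thesis unfolding e by (rule DERIV_cong) (simp only: algebra_simps)
    qed
    show "continuous_on {0<..} ?c''" by (intro continuous_intros) auto
    show "?c 0 = 0" by simp
    show "\<bar>?c s\<bar> \<le> (\<bar>C\<bar> * B) * s powr (3/2)" if s: "0 < s" "s \<le> R" for s
    proof -
      have "\<bar>?c s\<bar> = \<bar>C\<bar> * s powr (3/2) * (s powr p * \<bar>\<epsilon> * ln s - l\<bar>)" by (simp add: e1 abs_mult)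
      also have "\<dots> \<le> \<bar>C\<bar> * s powr (3/2) * B" by (intro mult_left_mono B s) auto
      finally show ?thesis by (simp only: mult_ac)
    qed
    show "\<bar>?c' s\<bar> \<le> (\<bar>C\<bar> * (\<bar>m + 2\<bar> * B + R powr p * \<bar>\<epsilon>\<bar>)) * s powr (1/2)" if s: "0 < s" "s \<le> R" for s
    proof -
      have "\<bar>?c' s\<bar> = \<bar>C\<bar> * s powr (1/2) * (s powr p * \<bar>(m + 2) * (\<epsilon> * ln s - l) + \<epsilon>\<bar>)" by (simp add: e1 abs_mult)
      also have "\<dots> \<le> \<bar>C\<bar> * s powr (1/2) * (s powr p * (\<bar>m + 2\<bar> * \<bar>\<epsilon> * ln s - l\<bar> + \<bar>\<epsilon>\<bar>))"
        using abs_triangle_ineq[of "(m + 2) * (\<epsilon> * ln s - l)" \<epsilon>] by (intro mult_left_mono) (auto simp: abs_mult)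
      also have "\<dots> = \<bar>C\<bar> * s powr (1/2) * (\<bar>m + 2\<bar> * (s powr p * \<bar>\<epsilon> * ln s - l\<bar>) + s powr p * \<bar>\<epsilon>\<bar>)"
        by (simp only: algebra_simps)
      also have "\<dots> \<le> \<bar>C\<bar> * s powr (1/2) * (\<bar>m + 2\<bar> * B + R powr p * \<bar>\<epsilon>\<bar>)"
        by (intro mult_left_mono add_mono mult_right_mono B pR s) auto
      finally show ?thesis by (simp only: mult_ac)
    qed
  qed auto
  moreover have "?c r = - fr (Suc k) r"
    by (simp add: frob_def C_def m_def l_def algebra_simps)
  ultimately show ?thesis by (simp only: of_real_minus)
qed

text \<open>Summed over \<open>k\<close>, the identities \<open>V0_frob\<close> telescope and only
  term 0 survives.\<close>

lemma sol_equation: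
  assumes r: "0 < r" "r \<le> R"
  shows "sol \<sigma> \<epsilon> h w r + w * V0 (sol \<sigma> \<epsilon> h w) r = of_real (fr 0 r)"
proof -
  have k: "sq_int R (kerc r)" by (rule hs_kernelD(2)[OF hs_kerc])
  have t: "(LINT s|NR R. kerc r s * of_real (fr k s)) = - of_real (fr (Suc k) r)" for k
    using V0_frob[OF r, of k] by (simp add: V0_def kop_def)
  have s: "summable (\<lambda>k. of_real (fr (Suc k) r) * w ^ k)"
    using summable_minus[OF integral_sol(1)[OF k, of w]] unfolding t by simp
  have s0: "summable (\<lambda>k. of_real (fr k r) * w ^ k)"
    using r by (intro summable_norm_cancel[OF frob_summable]) auto
  have "V0 (sol \<sigma> \<epsilon> h w) r = - (\<Sum>k. of_real (fr (Suc k) r) * w ^ k)"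
    unfolding V0_def kop_def integral_sol(2)[OF k] t by (simp add: suminf_minus[OF s])
  then have "w * V0 (sol \<sigma> \<epsilon> h w) r = - (\<Sum>k. of_real (fr (Suc k) r) * w ^ Suc k)"
    using suminf_mult[OF s, of w] by (simp add: mult_ac)
  then show ?thesis
    using suminf_split_head[OF s0] by (simp add: sol_def)
qed

text \<open>The equation at \<open>z\<close> is read as the equation at \<open>w\<close> with the
  additional right-hand side \<open>(w - z) * V0 (sol z)\<close>, and solved by the resolvent at
  \<open>w\<close>.\<close>

lemma sol_shift:
  assumes r: "0 < r" "r \<le> R"
  shows "sol \<sigma> \<epsilon> h z r - sol \<sigma> \<epsilon> h w r = (w - z) * Vw w (sol \<sigma> \<epsilon> h z) r"
proof -
  let ?f = "\<lambda>s. complex_of_real (fr 0 s)" and ?y = "sol \<sigma> \<epsilon> h z"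
  have f: "Bint ?f" by (intro Bint_sq_int frob_sq_int)
  have y: "Bint (sol \<sigma> \<epsilon> h x)" for x by (intro Bint_sq_int sol_sq_int)
  have F: "Bint (\<lambda>s. ?f s + (w - z) * V0 ?y s)" by (intro Bint_add Bint_scale V0_Bint f y)
  have "?y r = (?f r + (w - z) * V0 ?y r) - w * Vw w (\<lambda>s. ?f s + (w - z) * V0 ?y s) r"
    using volterra_solution_iff[OF y[of z] F, of w] sol_equation[of _ z] r by (simp add: algebra_simps)
  also have "Vw w (\<lambda>s. ?f s + (w - z) * V0 ?y s) r = Vw w ?f r + (w - z) * Vw w (V0 ?y) r"
    by (subst Vw_add) (simp_all add: f V0_Bint y Bint_scale Vw_scale)
  finally have "?y r = ?f r - w * Vw w ?f r + (w - z) * (V0 ?y r - w * Vw w (V0 ?y) r)"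
    by (simp add: algebra_simps)
  moreover have "sol \<sigma> \<epsilon> h w r = ?f r - w * Vw w ?f r"
    using volterra_solution_iff[OF y[of w] f, of w] sol_equation[of _ w] r by simp
  ultimately show ?thesis using resolvent_equation'[OF y[of z] r, of w] by simp
qed

text \<open>By \<open>sol_shift\<close> the difference quotient is \<open>- Vw w (sol z) R\<close>
  with \<open>w\<close> fixed in the operator, a power series in \<open>z\<close> and therefore
  continuous.\<close>

lemma sol_has_derivative:
  "((\<lambda>w. sol \<sigma> \<epsilon> h w R) has_field_derivative - Vw w (sol \<sigma> \<epsilon> h w) R) (at w)"
proof -
  let ?c = "\<lambda>k. LINT s|NR R. vw w R s * of_real (fr k s)"
  have k: "sq_int R (vw w R)" by (rule hs_kernelD(2)[OF hs_vw])
  have e: "Vw w (sol \<sigma> \<epsilon> h z) R = (\<Sum>k. ?c k * z ^ k)" for z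
    unfolding Vw_def kop_def by (rule integral_sol(2)[OF k])
  have "isCont (\<lambda>z. \<Sum>k. ?c k * z ^ k) w"
    by (rule isCont_powser[where K = "of_real (cmod w + 1)"]) (use integral_sol(1)[OF k] in auto)
  then have "((\<lambda>z. - Vw w (sol \<sigma> \<epsilon> h z) R) \<longlongrightarrow> - Vw w (sol \<sigma> \<epsilon> h w) R) (at w)"
    unfolding e by (intro tendsto_minus) (simp add: isCont_def)
  moreover have "\<forall>\<^sub>F z in at w. - Vw w (sol \<sigma> \<epsilon> h z) R = (sol \<sigma> \<epsilon> h z R - sol \<sigma> \<epsilon> h w R) / (z - w)"
    unfolding eventually_at_filter
  proof (intro always_eventually allI impI)
    fix z assume "z \<noteq> w"
    then show "- Vw w (sol \<sigma> \<epsilon> h z) R = (sol \<sigma> \<epsilon> h z R - sol \<sigma> \<epsilon> h w R) / (z - w)"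
      unfolding sol_shift[OF R order_refl, of z w] by (simp add: field_simps)
  qed
  ultimately show ?thesis unfolding has_field_derivative_iff by (rule Lim_transform_eventually)
qed

end

section \<open>The regular and the singular solution\<close>

definition regular :: "complex \<Rightarrow> real \<Rightarrow> complex" where
  "regular = sol v 0 (\<lambda>_. -1)"
text \<open>At \<open>v = 0\<close> the two exponents coincide, and the second Frobenius solution is
  logarithmic, with harmonic numbers as in Neumann's series for \<open>Y_0\<close>.\<close>

definition singular :: "complex \<Rightarrow> real \<Rightarrow> complex" where
  "singular = (if v = 0 then sol 0 1 harm else sol (- v) 0 (\<lambda>_. -1))"
definition mm :: "real \<Rightarrow> real" where
  "mm r = (if v = 0 then r powr (1/2) * ln r else r powr (1/2 - v))"

text \<open>\<open>mm\<close> carries the normalisation of the maximal domain and \<open>nn\<close>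
  that of Wronskian 1; the factor \<open>- 2 * v\<close> undoes the denominator in the primitive
  \<open>Q\<close>.\<close>

lemma mm_nn: "0 < r \<Longrightarrow> mm r = (if v = 0 then 1 else - 2 * v) * nn r"
proof -
  assume r: "0 < r"
  have "(1/2 + v) + (-2 * v) = 1/2 - v" by simp
  then have "r powr (1/2 + v) * r powr (-2 * v) = r powr (1/2 - v)" by (simp only: powr_add[symmetric])
  then show ?thesis using r by (simp add: mm_def nn_def Q_def a_def)
qed

lemma regular_facts:
  "sq_int R (regular w)" "0 < r \<Longrightarrow> r \<le> R \<Longrightarrow> regular w r + w * V0 (regular w) r = of_real (pp r)"
  "((\<lambda>w. regular w R) has_field_derivative - Vw w (regular w) R) (at w)"
proof -
  have 1: "-1 < v" "v\<^sup>2 = v\<^sup>2" using v0 by auto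
  have 2: "sq_int R (\<lambda>s. of_real (s powr (1/2 + v) * (1 + \<bar>0 * ln s\<bar>)))"
    using pp_sq_int by (simp add: pp_def a_def)
  have 3: "\<bar>-1\<bar> \<le> 1 + real k" "(real k + 1) * (real k + 1 + v) * (-1 - -1) = 0 * (real k + 1 + v / 2)" for k by simp_all
  have 4: "frob v 0 (\<lambda>_. -1) 0 r = pp r" for r by (simp add: frob_def frob_coeff_def pp_def a_def)
  show "sq_int R (regular w)" unfolding regular_def by (rule sol_sq_int[OF 1 2 3])
  show "regular w r + w * V0 (regular w) r = of_real (pp r)" if "0 < r" "r \<le> R"
    unfolding regular_def 4[symmetric] by (rule sol_equation[OF 1 2 3 that])
  show "((\<lambda>w. regular w R) has_field_derivative - Vw w (regular w) R) (at w)"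
    unfolding regular_def by (rule sol_has_derivative[OF 1 2 3])
qed

lemma singular_facts:
  "sq_int R (singular w)" "0 < r \<Longrightarrow> r \<le> R \<Longrightarrow> singular w r + w * V0 (singular w) r = of_real (mm r)"
  "((\<lambda>w. singular w R) has_field_derivative - Vw w (singular w) R) (at w)"
proof -
  have "sq_int R (singular w) \<and> (0 < r \<longrightarrow> r \<le> R \<longrightarrow> singular w r + w * V0 (singular w) r = of_real (mm r))
    \<and> ((\<lambda>w. singular w R) has_field_derivative - Vw w (singular w) R) (at w)"
  proof (cases "v = 0")
    case True
    have s: "singular = sol 0 1 harm" unfolding singular_def using True by simp
    have 1: "-1 < (0::real)" "0\<^sup>2 = v\<^sup>2" using True by auto
    note [measurable] = Q_measurable
    have "(\<lambda>s. complex_of_real \<bar>nn s\<bar>) \<in> borel_measurable (NR R)"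
      unfolding nn_def by (intro borel_imp_lebesgue_on) measurable
    then have "sq_int R (\<lambda>s. complex_of_real \<bar>nn s\<bar>)"
      by (rule sq_int_bound[where K = 1, OF _ nn_sq_int]) simp
    from sq_int_add[OF pp_sq_int this] have 2: "sq_int R (\<lambda>s. of_real (s powr (1/2 + 0) * (1 + \<bar>1 * ln s\<bar>)))"
      unfolding pp_def nn_def a_def Q_def using True by (simp add: abs_mult distrib_left)
    have 3: "\<bar>harm k\<bar> \<le> 1 + real k"
       "(real k + 1) * (real k + 1 + 0) * (harm (Suc k) - harm k) = 1 * (real k + 1 + 0 / 2)" for k
    proof -
      show "\<bar>harm k\<bar> \<le> 1 + real k" using harm_le[of k] harm_nonneg[of k, where 'a = real] by linarith
      show "(real k + 1) * (real k + 1 + 0) * (harm (Suc k) - harm k) = 1 * (real k + 1 + 0 / 2)"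
        by (simp add: harm_Suc field_simps)
    qed
    have 4: "frob 0 1 harm 0 r = mm r" for r unfolding mm_def using True by (simp add: frob_def frob_coeff_def harm_def)
    show ?thesis unfolding s 4[symmetric]
      using sol_sq_int[OF 1 2 3] sol_equation[OF 1 2 3] sol_has_derivative[OF 1 2 3] by blast
  next
    case False
    have s: "singular = sol (- v) 0 (\<lambda>_. -1)" using False by (simp add: singular_def)
    have 1: "-1 < - v" "(- v)\<^sup>2 = v\<^sup>2" using v1 by auto
    have 2: "sq_int R (\<lambda>s. of_real (s powr (1/2 + - v) * (1 + \<bar>0 * ln s\<bar>)))"
      using powr_sq_integrable[of "1/2 - v"] v1
      by (simp add: sq_int_def borel_imp_lebesgue_on)
    have 3: "\<bar>-1\<bar> \<le> 1 + real k" "(real k + 1) * (real k + 1 + - v) * (-1 - -1) = 0 * (real k + 1 + - v / 2)" for k by simp_all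
    have 4: "frob (- v) 0 (\<lambda>_. -1) 0 r = mm r" for r using False by (simp add: frob_def frob_coeff_def mm_def)
    show ?thesis unfolding s 4[symmetric]
      using sol_sq_int[OF 1 2 3] sol_equation[OF 1 2 3] sol_has_derivative[OF 1 2 3] by blast
  qed
  then show "sq_int R (singular w)" "0 < r \<Longrightarrow> r \<le> R \<Longrightarrow> singular w r + w * V0 (singular w) r = of_real (mm r)"
    "((\<lambda>w. singular w R) has_field_derivative - Vw w (singular w) R) (at w)" by blast+
qed

end

section \<open>Comparison with Bessel functions\<close>

lemma frob_coeff_summable:
  assumes \<sigma>: "-1 < \<sigma>" and g: "\<And>k. \<bar>g k\<bar> \<le> 2 ^ k"
  shows "summable (\<lambda>k. complex_of_real (frob_coeff \<sigma> k * R ^ (2 * k) * g k) * w ^ k)"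
proof (rule summable_comparison_test')
  define m where "m = min 1 (1 + \<sigma>)"
  have m: "0 < m" using \<sigma> by (simp add: m_def)
  show "summable (\<lambda>k. 1 / m * ((R\<^sup>2 * cmod w / 2) ^ k / fact k))"
    using summable_mult[OF summable_exp[of "R\<^sup>2 * cmod w / 2"], of "1 / m"]
    unfolding divide_inverse[of _ "fact _"] mult.commute[of "inverse (fact _)"] .
  fix k
  have pm: "m \<le> pochhammer (1 + \<sigma>) k" unfolding m_def by (rule pochhammer_lower_bound[OF \<sigma>])
  have "cmod (of_real (frob_coeff \<sigma> k * R ^ (2 * k) * g k) * w ^ k)
    = 1 / (4 ^ k * fact k * pochhammer (1 + \<sigma>) k) * ((R\<^sup>2 * cmod w) ^ k * \<bar>g k\<bar>)"
    using pm m by (simp add: frob_coeff_def norm_mult norm_divide norm_power abs_mult power_mult power_mult_distrib power_abs)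
  also have "\<dots> \<le> 1 / (4 ^ k * fact k * m) * ((R\<^sup>2 * cmod w) ^ k * 2 ^ k)"
    using pm m g by (intro mult_mono divide_left_mono mult_left_mono mult_pos_pos) auto
  also have "\<dots> = 1 / m * ((R\<^sup>2 * cmod w / 2) ^ k / fact k)"
  proof -
    have e: "(4::real) ^ k = 2 ^ k * 2 ^ k" by (simp flip: power_mult_distrib)
    have id: "1 / (z * z * f * m) * (q * z) = 1 / m * (q / z / f)"
      if "z \<noteq> 0" "f \<noteq> 0" for z f q :: real using that m by (simp add: field_simps)
    show ?thesis unfolding e power_divide by (rule id) auto
  qed
  finally show "norm (of_real (frob_coeff \<sigma> k * R ^ (2 * k) * g k) * w ^ k) \<le> 1 / m * ((R\<^sup>2 * cmod w / 2) ^ k / fact k)" .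
qed

text \<open>The hypergeometric series \<open>0F1\<close> with parameter \<open>1 + \<sigma>\<close>
  at \<open>R^2 * w / 4\<close>; at \<open>w = - \<mu>^2\<close> it is the entire factor of the
  Bessel function of order \<open>\<sigma>\<close>.\<close>

definition bessel_series :: "real \<Rightarrow> real \<Rightarrow> complex \<Rightarrow> complex" where
  "bessel_series R \<sigma> w = (\<Sum>k. of_real (frob_coeff \<sigma> k * R ^ (2 * k)) * w ^ k)"

lemma bessel_series_sums:
  "-1 < \<sigma> \<Longrightarrow> (\<lambda>k. of_real (frob_coeff \<sigma> k * R ^ (2 * k)) * w ^ k) sums bessel_series R \<sigma> w"
  unfolding bessel_series_def using summable_sums[OF frob_coeff_summable[of \<sigma> "\<lambda>_. 1" R w]] by simp

lemma sol_bessel_series: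
  assumes "-1 < \<sigma>" "0 < R"
  shows "sol \<sigma> 0 (\<lambda>_. -1) w R = of_real (R powr (1/2 + \<sigma>)) * bessel_series R \<sigma> w"
proof -
  have "frob \<sigma> 0 (\<lambda>_. -1) k R = R powr (1/2 + \<sigma>) * (frob_coeff \<sigma> k * R ^ (2 * k))" for k
    using powr_realpow[OF assms(2), of "2 * k"] by (simp add: frob_def powr_add)
  then have "sol \<sigma> 0 (\<lambda>_. -1) w R = (\<Sum>k. of_real (R powr (1/2 + \<sigma>)) * (of_real (frob_coeff \<sigma> k * R ^ (2 * k)) * w ^ k))"
    by (simp add: sol_def mult_ac)
  also have "\<dots> = of_real (R powr (1/2 + \<sigma>)) * bessel_series R \<sigma> w"
    by (intro sums_unique[symmetric] sums_mult bessel_series_sums assms(1))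
  finally show ?thesis .
qed

text \<open>\<open>R / 2\<close> is positive, so the principal power of \<open>\<mu> * R / 2\<close>
  splits without a branch correction and the powers of \<open>\<mu>\<close> cancel. The Gamma
  factors reduce to the Pochhammer symbol.\<close>

lemma bessel_J_series:
  assumes \<sigma>: "-1 < \<sigma>" and R: "0 < R" and \<mu>: "\<mu> \<noteq> 0"
  shows "complex_of_real (2 powr \<sigma> * Gamma (1 + \<sigma>)) * \<mu> powr complex_of_real (- \<sigma>) * bessel_J \<sigma> (\<mu> * complex_of_real R)
    = of_real (R powr \<sigma>) * bessel_series R \<sigma> (- \<mu>\<^sup>2)"
proof -
  let ?z = "\<mu> * complex_of_real R / 2"
  have rG: "rGamma (1 + \<sigma>) \<noteq> 0"
    using \<sigma> by (auto simp: rGamma_eq_zero_iff elim!: nonpos_Ints_cases)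
  then have G0: "Gamma (1 + \<sigma>) \<noteq> 0" by (simp add: Gamma_def)
  have t: "(-1) ^ k / fact k * rGamma (complex_of_real (\<sigma> + real k + 1)) * ?z ^ (2 * k)
    = of_real (1 / Gamma (1 + \<sigma>)) * (of_real (frob_coeff \<sigma> k * R ^ (2 * k)) * (- \<mu>\<^sup>2) ^ k)" for k
  proof -
    have "rGamma (1 + \<sigma>) = pochhammer (1 + \<sigma>) k * rGamma (\<sigma> + real k + 1)"
      using pochhammer_rGamma[of "1 + \<sigma>" k] by (simp add: add_ac)
    moreover have "pochhammer (1 + \<sigma>) k \<noteq> 0" using pochhammer_lower_bound[OF \<sigma>, of k] \<sigma> by auto
    ultimately have "rGamma (\<sigma> + real k + 1) = 1 / Gamma (1 + \<sigma>) * (1 / pochhammer (1 + \<sigma>) k)"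
      by (simp add: Gamma_def field_simps)
    moreover have "?z ^ (2 * k) = of_real (R ^ (2 * k) / 4 ^ k) * (\<mu>\<^sup>2) ^ k"
      by (simp add: power_divide power_mult_distrib power_mult)
    moreover have "(- \<mu>\<^sup>2) ^ k = (-1) ^ k * (\<mu>\<^sup>2) ^ k" by (rule power_minus)
    ultimately show ?thesis
      by (simp only: rGamma_complex_of_real) (simp add: frob_coeff_def mult_ac)
  qed
  have S: "(\<Sum>k. (-1) ^ k / fact k * rGamma (complex_of_real (\<sigma> + real k + 1)) * ?z ^ (2 * k))
    = of_real (1 / Gamma (1 + \<sigma>)) * bessel_series R \<sigma> (- \<mu>\<^sup>2)"
    unfolding t by (intro sums_unique[symmetric] sums_mult bessel_series_sums \<sigma>)
  have P: "complex_of_real (2 powr \<sigma>) * \<mu> powr complex_of_real (- \<sigma>) * (if \<sigma> = 0 then 1 else ?z powr complex_of_real \<sigma>) = of_real (R powr \<sigma>)"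
  proof (cases "\<sigma> = 0")
    case False
    have "?z powr complex_of_real \<sigma> = (complex_of_real (R / 2) * \<mu>) powr complex_of_real \<sigma>" by (simp add: mult_ac)
    also have "\<dots> = complex_of_real (R / 2) powr complex_of_real \<sigma> * \<mu> powr complex_of_real \<sigma>"
      by (rule powr_times_real_left) (use R in auto)
    also have "complex_of_real (R / 2) powr complex_of_real \<sigma> = of_real ((R / 2) powr \<sigma>)"
      by (rule powr_of_real) (use R in auto)
    finally have "?z powr complex_of_real \<sigma> = of_real ((R / 2) powr \<sigma>) * \<mu> powr complex_of_real \<sigma>" .
    moreover have "\<mu> powr complex_of_real (- \<sigma>) * \<mu> powr complex_of_real \<sigma> = 1"
      using \<mu> by (simp add: powr_minus)
    moreover have "2 powr \<sigma> * (R / 2) powr \<sigma> = R powr \<sigma>" using R by (simp add: powr_divide)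
    ultimately show ?thesis using False by (simp add: mult_ac flip: of_real_mult)
  qed (use R \<mu> in simp)
  have "complex_of_real (2 powr \<sigma> * Gamma (1 + \<sigma>)) * \<mu> powr complex_of_real (- \<sigma>) * bessel_J \<sigma> (\<mu> * complex_of_real R)
    = (complex_of_real (2 powr \<sigma>) * \<mu> powr complex_of_real (- \<sigma>) * (if \<sigma> = 0 then 1 else ?z powr complex_of_real \<sigma>))
       * (of_real (Gamma (1 + \<sigma>) * (1 / Gamma (1 + \<sigma>))) * bessel_series R \<sigma> (- \<mu>\<^sup>2))"
    unfolding bessel_J_def S of_real_mult by (simp only: mult_ac)
  also have "\<dots> = of_real (R powr \<sigma>) * bessel_series R \<sigma> (- \<mu>\<^sup>2)" unfolding P using G0 by simp
  finally show ?thesis .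
qed

text \<open>At 0 the formulas evaluate \<open>powr\<close> and \<open>Ln\<close> at a default value;
  a continuous function that agrees with them elsewhere supplies the filled-in value.\<close>

lemma remove_sings_eq_continuous:
  assumes "\<And>\<mu>. \<mu> \<noteq> 0 \<Longrightarrow> f \<mu> = E \<mu>" "isCont E z"
  shows "remove_sings f z = E z"
proof (rule remove_sings_eqI)
  have "E \<midarrow>z\<rightarrow> E z" using assms(2) by (simp add: isCont_def)
  moreover have "\<forall>\<^sub>F \<mu> in at z. E \<mu> = f \<mu>"
  proof (cases "z = 0")
    case True
    then show ?thesis using assms(1) by (simp add: eventually_at_filter)
  next
    case False
    then have "\<forall>\<^sub>F \<mu> in at z. \<mu> \<noteq> 0" by (intro tendsto_imp_eventually_ne[OF tendsto_ident_at])
    then show ?thesis by eventually_elim (simp add: assms(1))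
  qed
  ultimately show "f \<midarrow>z\<rightarrow> E z" by (rule Lim_transform_eventually)
qed

lemma bessel_J_0_series: "\<mu> \<noteq> 0 \<Longrightarrow> 0 < R \<Longrightarrow> bessel_J 0 (\<mu> * complex_of_real R) = bessel_series R 0 (- \<mu>\<^sup>2)"
  using bessel_J_series[of 0 R \<mu>] by simp

text \<open>Neumann's expansion contributes \<open>Ln (\<mu> * R / 2)\<close>, and the definition
  subtracts \<open>Ln \<mu> - ln 2\<close>; the Euler constants cancel too. What remains is
  \<open>ln R\<close>, the logarithm of the singular solution at \<open>R\<close>.\<close>

lemma bessel_J0_tilde_series:
  assumes \<mu>: "\<mu> \<noteq> 0" and R: "0 < R"
  shows "bessel_J0_tilde R \<mu> = of_real (R powr (- 1/2)) * sol 0 1 harm (- \<mu>\<^sup>2) R"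
proof -
  let ?z = "\<mu> * complex_of_real R / 2"
  define H where "H = (\<Sum>k. complex_of_real (frob_coeff 0 k * R ^ (2 * k) * harm k) * (- \<mu>\<^sup>2) ^ k)"
  have H: "(\<lambda>k. complex_of_real (frob_coeff 0 k * R ^ (2 * k) * harm k) * (- \<mu>\<^sup>2) ^ k) sums H"
    unfolding H_def
  proof (intro summable_sums frob_coeff_summable)
    fix k have "harm k \<le> (2::real) ^ k"
      using harm_le[of k] of_nat_less_two_power[of k, where 'a = real] by linarith
    then show "\<bar>harm k\<bar> \<le> (2::real) ^ k" using harm_nonneg[of k, where 'a = real] by simp
  qed simp
  have t: "(-1) ^ k * harm k / (fact k)\<^sup>2 * ?z ^ (2 * k) = complex_of_real (frob_coeff 0 k * R ^ (2 * k) * harm k) * (- \<mu>\<^sup>2) ^ k" for k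
  proof -
    have "?z ^ (2 * k) = of_real (R ^ (2 * k) / 4 ^ k) * (\<mu>\<^sup>2) ^ k"
      by (simp add: power_divide power_mult_distrib power_mult)
    moreover have "(- \<mu>\<^sup>2) ^ k = (-1) ^ k * (\<mu>\<^sup>2) ^ k" by (rule power_minus)
    moreover have "harm k = complex_of_real (harm k)" by (simp add: harm_def)
    ultimately show ?thesis by (simp add: frob_coeff_def pochhammer_fact[symmetric] power2_eq_square mult_ac)
  qed
  have "Ln ?z = Ln (complex_of_real (R / 2) * \<mu>)" by (simp add: mult_ac)
  also have "\<dots> = of_real (ln (R / 2)) + Ln \<mu>" using R \<mu> Ln_times_of_real[of "R / 2" \<mu>] Ln_of_real[of "R / 2"] by simp
  finally have L: "Ln ?z = of_real (ln R) - of_real (ln 2) + Ln \<mu>" using R by (simp add: ln_div)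
  have pi: "complex_of_real (pi / 2) * complex_of_real (2 / pi) = 1" by (simp flip: of_real_mult)
  have "bessel_J0_tilde R \<mu> = (complex_of_real (pi / 2) * complex_of_real (2 / pi)) * ((Ln ?z + euler_mascheroni) * bessel_series R 0 (- \<mu>\<^sup>2) - H)
     - (Ln \<mu> - complex_of_real (ln 2) + euler_mascheroni) * bessel_series R 0 (- \<mu>\<^sup>2)"
    unfolding bessel_J0_tilde_def bessel_Y0_def bessel_J_0_series[OF \<mu> R] t H_def by (simp only: mult.assoc)
  also have "\<dots> = of_real (ln R) * bessel_series R 0 (- \<mu>\<^sup>2) - H" unfolding pi L by (simp add: algebra_simps)
  finally have 1: "bessel_J0_tilde R \<mu> = of_real (ln R) * bessel_series R 0 (- \<mu>\<^sup>2) - H" .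
  have f: "of_real (R powr (1/2)) * (of_real (ln R) * (of_real (frob_coeff 0 k * R ^ (2 * k)) * (- \<mu>\<^sup>2) ^ k)
    - complex_of_real (frob_coeff 0 k * R ^ (2 * k) * harm k) * (- \<mu>\<^sup>2) ^ k) = of_real (frob 0 1 harm k R) * (- \<mu>\<^sup>2) ^ k" for k
    using powr_realpow[OF R, of "2 * k"] by (simp add: frob_def powr_add algebra_simps)
  have "(\<lambda>k. of_real (R powr (1/2)) * (of_real (ln R) * (of_real (frob_coeff 0 k * R ^ (2 * k)) * (- \<mu>\<^sup>2) ^ k)
    - complex_of_real (frob_coeff 0 k * R ^ (2 * k) * harm k) * (- \<mu>\<^sup>2) ^ k)) sums
    (of_real (R powr (1/2)) * (of_real (ln R) * bessel_series R 0 (- \<mu>\<^sup>2) - H))"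
    by (intro sums_mult sums_diff H bessel_series_sums) simp
  then have "sol 0 1 harm (- \<mu>\<^sup>2) R = of_real (R powr (1/2)) * bessel_J0_tilde R \<mu>"
    unfolding f 1 sol_def by (rule sums_unique[symmetric])
  moreover have "complex_of_real (R powr (- 1/2)) * of_real (R powr (1/2)) = 1"
    using R by (simp flip: of_real_mult powr_add)
  ultimately show ?thesis by (simp flip: mult.assoc)
qed

context volterra
begin

lemma entry_isCont:
  assumes "\<And>w. (F has_field_derivative F' w) (at w)"
  shows "isCont (\<lambda>\<mu>. c * F (- \<mu>\<^sup>2)) (z::complex)"
proof -
  have "isCont (\<lambda>\<mu>. F (- \<mu>\<^sup>2)) z"
    by (rule isCont_o2[OF _ DERIV_isCont[OF assms]]) (intro continuous_intros)
  then show ?thesis by (intro continuous_intros)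
qed

text \<open>The equation without first-order term is solved by \<open>sqrt r\<close> times Bessel
  functions of the radius; the factor \<open>R powr (- 1/2)\<close> removes this square root at
  \<open>R\<close>.\<close>

lemma J_entries:
  assumes v: "v = (if j < q0 then 0 else nu lm j)" and pos: "\<not> j < q0 \<Longrightarrow> 0 < nu lm j"
  shows "J_plus_entry q0 lm R j \<mu> = of_real (R powr (- 1/2)) * regular (- \<mu>\<^sup>2) R"
    "J_minus_entry q0 lm R j \<mu> = of_real (R powr (- 1/2)) * singular (- \<mu>\<^sup>2) R"
proof -
  have p: "complex_of_real (R powr (- 1/2)) * (of_real (R powr (1/2 + \<sigma>)) * b) = of_real (R powr \<sigma>) * b" for \<sigma> b
    using R by (simp flip: mult.assoc of_real_mult powr_add)
  have v': "-1 < v" "-1 < - v" using v0 v1 by auto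
  show "J_plus_entry q0 lm R j \<mu> = of_real (R powr (- 1/2)) * regular (- \<mu>\<^sup>2) R"
    unfolding J_plus_entry_def
  proof (rule remove_sings_eq_continuous)
    fix \<mu> :: complex assume "\<mu> \<noteq> 0"
    note b = bessel_J_series[OF v'(1) R this] bessel_J_0_series[OF this R]
    show "(if j < q0 then bessel_J 0 (\<mu> * complex_of_real R)
     else complex_of_real (2 powr nu lm j * Gamma (1 + nu lm j)) * \<mu> powr complex_of_real (- nu lm j) * bessel_J (nu lm j) (\<mu> * complex_of_real R))
      = of_real (R powr (- 1/2)) * regular (- \<mu>\<^sup>2) R"
      unfolding regular_def sol_bessel_series[OF v'(1) R] p using b v R by (auto split: if_splits)
  qed (rule entry_isCont[OF regular_facts(3)])
  show "J_minus_entry q0 lm R j \<mu> = of_real (R powr (- 1/2)) * singular (- \<mu>\<^sup>2) R"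
    unfolding J_minus_entry_def
  proof (rule remove_sings_eq_continuous)
    fix \<mu> :: complex assume \<mu>: "\<mu> \<noteq> 0"
    show "(if j < q0 then bessel_J0_tilde R \<mu>
     else complex_of_real (2 powr (- nu lm j) * Gamma (1 - nu lm j)) * \<mu> powr complex_of_real (nu lm j) * bessel_J (- nu lm j) (\<mu> * complex_of_real R))
      = of_real (R powr (- 1/2)) * singular (- \<mu>\<^sup>2) R"
    proof (cases "j < q0")
      case True
      then have "singular = sol 0 1 harm" unfolding singular_def using v by simp
      then show ?thesis using True bessel_J0_tilde_series[OF \<mu> R] by simp
    next
      case False
      then have "singular = sol (- v) 0 (\<lambda>_. -1)" and vj: "nu lm j = v" unfolding singular_def using v pos by auto
      then show ?thesis
        using False bessel_J_series[OF v'(2) R \<mu>] by (simp only: sol_bessel_series[OF v'(2) R] p) simp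
    qed
  qed (rule entry_isCont[OF singular_facts(3)])
qed

section \<open>Solutions of the scalar resolvent equation\<close>

lemma resolvent_form:
  assumes f: "sq_int R f"
  defines "\<chi> \<equiv> \<lambda>c c' w r. c * regular w r + c' * singular w r + Vw w f r"
  shows resolvent_form_sq_int: "sq_int R (\<chi> c c' w)"
    and resolvent_form_equation: "0 < r \<Longrightarrow> r \<le> R \<Longrightarrow> \<chi> c c' w r + w * V0 (\<chi> c c' w) r = c * of_real (pp r) + c' * of_real (mm r) + V0 f r"
proof -
  note s = regular_facts(1)[of w] singular_facts(1)[of w] Vw_sq_int[OF Bint_sq_int[OF f], of w]
  note b = this[THEN Bint_sq_int]
  show "sq_int R (\<chi> c c' w)" unfolding \<chi>_def by (intro sq_int_add sq_int_scale s)
  have "V0 (\<chi> c c' w) r = c * V0 (regular w) r + c' * V0 (singular w) r + V0 (Vw w f) r" for r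
    unfolding \<chi>_def by (simp add: V0_add V0_scale Bint_add Bint_scale b)
  moreover assume "0 < r" "r \<le> R"
  ultimately show "\<chi> c c' w r + w * V0 (\<chi> c c' w) r = c * of_real (pp r) + c' * of_real (mm r) + V0 f r"
    using resolvent_equation[OF Bint_sq_int[OF f], of w r]
    by (simp add: \<chi>_def regular_facts(2)[of _ w, symmetric] singular_facts(2)[of _ w, symmetric] algebra_simps)
qed

text \<open>\<open>u\<close> and \<open>\<phi>\<close> agree only almost everywhere, so the Volterra
  equation is set up for \<open>\<Phi>\<close>, which depends on \<open>u\<close> only through an
  integral. \<open>\<chi>\<close> solves the same equation, and uniqueness gives equality at every
  point of (0,R].\<close>

lemma domain_imp_resolvent_form:
  assumes f: "sq_int R f" and u: "sq_int R u"
    and \<phi>: "\<And>r. 0 < r \<Longrightarrow> r \<le> R \<Longrightarrow> \<phi> r = c * of_real (pp r) + c' * of_real (mm r) + \<psi> r"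
    and \<psi>: "remainder \<psi> d" and ex: "expr1 \<phi> (\<lambda>r. f r - w * u r)" and ae: "AE r in NR R. u r = \<phi> r"
    and r: "0 < r" "r \<le> R"
  shows "\<phi> r = c * regular w r + c' * singular w r + Vw w f r"
proof -
  define \<chi> where "\<chi> = (\<lambda>r. c * regular w r + c' * singular w r + Vw w f r)"
  define F where "F r = \<chi> r + w * V0 \<chi> r" for r
  define \<Phi> where "\<Phi> r = F r - w * V0 u r" for r
  have s\<chi>: "sq_int R \<chi>" unfolding \<chi>_def by (rule resolvent_form_sq_int[OF f])
  have sF: "sq_int R F" unfolding F_def[abs_def] by (intro sq_int_add sq_int_scale s\<chi> V0_sq_int Bint_sq_int)
  have s\<Phi>: "sq_int R \<Phi>" unfolding \<Phi>_def[abs_def] by (intro sq_int_diff sq_int_scale sF V0_sq_int Bint_sq_int u)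
  have \<phi>\<Phi>: "\<phi> r = \<Phi> r" if r: "0 < r" "r \<le> R" for r
  proof -
    let ?\<tau> = "if v = 0 then 1 else - 2 * v"
    have "\<phi> r = c * of_real (pp r) + (c' * of_real ?\<tau>) * of_real (nn r) + V0 (\<lambda>r. f r - w * u r) r"
      by (rule decomposition[OF _ _ \<psi> ex r])
        (auto intro!: sq_int_diff sq_int_scale f u simp: \<phi> mm_nn)
    also have "V0 (\<lambda>r. f r - w * u r) r = V0 f r - w * V0 u r"
      by (simp add: V0_diff V0_scale Bint_sq_int Bint_scale f u)
    finally have "\<phi> r = (c * of_real (pp r) + c' * of_real (mm r) + V0 f r) - w * V0 u r"
      using r by (simp add: mm_nn)
    also have "\<dots> = \<Phi> r" unfolding \<Phi>_def F_def \<chi>_def resolvent_form_equation[OF f r] ..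
    finally show ?thesis .
  qed
  have "AE r in NR R. r \<noteq> 0"
    using AE_completion[OF AE_lborel_singleton[of 0]] by (subst AE_restrict_space_iff) auto
  then have ae': "AE r in NR R. u r = \<Phi> r"
    using ae AE_space by eventually_elim (simp add: \<phi>\<Phi>)
  have V: "V0 u r = V0 \<Phi> r" for r
    unfolding V0_def kop_def
  proof (rule integral_cong_AE)
    show "(\<lambda>s. kerc r s * u s) \<in> borel_measurable (NR R)" "(\<lambda>s. kerc r s * \<Phi> s) \<in> borel_measurable (NR R)"
      by (intro borel_measurable_times kerc_sections(1) sq_intD(1) u s\<Phi>)+
    show "AE s in NR R. kerc r s * u s = kerc r s * \<Phi> s" using ae' by eventually_elim simp
  qed
  have "\<forall>r. 0 < r \<longrightarrow> r \<le> R \<longrightarrow> \<Phi> r + w * V0 \<Phi> r = F r" by (simp add: \<Phi>_def V)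
  then have "\<Phi> r = F r - w * Vw w F r"
    using volterra_solution_iff[OF Bint_sq_int[OF s\<Phi>] Bint_sq_int[OF sF], of w] r by blast
  moreover have "\<forall>r. 0 < r \<longrightarrow> r \<le> R \<longrightarrow> \<chi> r + w * V0 \<chi> r = F r" by (simp add: F_def)
  then have "\<chi> r = F r - w * Vw w F r"
    using volterra_solution_iff[OF Bint_sq_int[OF s\<chi>] Bint_sq_int[OF sF], of w] r by blast
  ultimately show ?thesis using \<phi>\<Phi>[OF r] by (simp add: \<chi>_def)
qed

text \<open>By the Volterra equation for \<open>\<chi>\<close>, subtracting the leading terms leaves
  \<open>V0 (f - w * \<chi>)\<close>, and every value of \<open>V0\<close> on a square-integrable
  function is an admissible remainder.\<close>

lemma resolvent_form_in_domain:
  assumes f: "sq_int R f"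
    and \<phi>: "\<And>r. 0 < r \<Longrightarrow> r \<le> R \<Longrightarrow> \<phi> r = c * regular w r + c' * singular w r + Vw w f r"
    and u: "sq_int R u" and ae: "AE r in NR R. u r = \<phi> r"
  shows "\<exists>\<psi> d. remainder \<psi> d \<and> (\<exists>g. sq_int R g \<and> expr1 \<psi> g) \<and> expr1 \<phi> (\<lambda>r. f r - w * u r) \<and>
    (\<forall>r. 0 < r \<longrightarrow> r \<le> R \<longrightarrow> \<phi> r = c * of_real (pp r) + c' * of_real (mm r) + \<psi> r)"
proof -
  define \<chi> where "\<chi> = (\<lambda>r. c * regular w r + c' * singular w r + Vw w f r)"
  define g where "g = (\<lambda>r. f r - w * \<chi> r)"
  have s\<chi>: "sq_int R \<chi>" unfolding \<chi>_def by (rule resolvent_form_sq_int[OF f])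
  have g: "sq_int R g" unfolding g_def by (intro sq_int_diff sq_int_scale f s\<chi>)
  have e: "\<phi> r = c * of_real (pp r) + c' * of_real (mm r) + V0 g r" if r: "0 < r" "r \<le> R" for r
  proof -
    have "V0 g r = V0 f r - w * V0 \<chi> r"
      unfolding g_def by (simp add: V0_diff V0_scale Bint_sq_int Bint_scale f s\<chi>)
    then have V: "V0 f r = V0 g r + w * V0 \<chi> r" by simp
    have "\<chi> r + w * V0 \<chi> r = c * of_real (pp r) + c' * of_real (mm r) + V0 f r"
      unfolding \<chi>_def by (rule resolvent_form_equation[OF f r])
    then have "\<chi> r = c * of_real (pp r) + c' * of_real (mm r) + V0 g r"
      unfolding V add.assoc[symmetric] by (rule add_right_imp_eq)
    moreover have "\<phi> r = \<chi> r" using \<phi>[OF r] by (simp add: \<chi>_def)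
    ultimately show ?thesis by simp
  qed
  obtain d where d: "remainder (V0 g) d" using V0_remainder[OF g] by blast
  have "expr1 \<phi> g"
    by (rule expr1_add_homogeneous[OF V0_expr[OF g], of _ c "c' * of_real (if v = 0 then 1 else - 2 * v)"])
      (simp add: e mm_nn)
  then obtain h where h: "has_second_derivative R \<phi> h" "AE r in NR R. g r = - h r + complex_of_real (lam / r\<^sup>2) * \<phi> r"
    by (auto simp: expr1_def)
  have "AE r in NR R. r \<noteq> 0"
    using AE_completion[OF AE_lborel_singleton[of 0]] by (subst AE_restrict_space_iff) auto
  then have "AE r in NR R. f r - w * u r = - h r + complex_of_real (lam / r\<^sup>2) * \<phi> r"
    using h(2) ae AE_space
  proof eventually_elim
    case (elim r)
    then have "\<phi> r = \<chi> r" unfolding \<chi>_def by (intro \<phi>) auto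
    with elim show ?case by (simp add: g_def)
  qed
  with h(1) have ex: "expr1 \<phi> (\<lambda>r. f r - w * u r)" unfolding expr1_def by (intro exI[of _ h] conjI)
  show ?thesis
    by (intro exI[of _ "V0 g"] exI[of _ d] conjI d exI[of _ g] g V0_expr ex allI impI e)
qed

end

section \<open>Trace of the scalar resolvent\<close>

lemma AE_ex_point:
  assumes "AE r in NR R. P r" "R > 0" shows "\<exists>r\<in>{0..R}. P r"
proof (rule ccontr)
  assume "\<not> (\<exists>r\<in>{0..R}. P r)"
  then have "AE r in NR R. r \<notin> space (NR R)" using assms(1) by (auto elim!: AE_mp)
  then obtain N where N: "{r \<in> space (NR R). \<not> r \<notin> space (NR R)} \<subseteq> N" "emeasure (NR R) N = 0" "N \<in> sets (NR R)"
    by (rule AE_E)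
  then have "emeasure (NR R) (space (NR R)) \<le> emeasure (NR R) N" by (intro emeasure_mono) auto
  moreover have "emeasure (NR R) (space (NR R)) = ennreal R"
    using assms(2) by (simp add: emeasure_restrict_space)
  ultimately show False using assms(2) N(2) by simp
qed

lemma AE_lebesgue_on_neq: fixes a b c :: real shows "AE r in lebesgue_on {a..b}. r \<noteq> c"
  using AE_completion[OF AE_lborel_singleton[of c]] by (subst AE_restrict_space_iff) auto

text \<open>Intervals generate the Borel sets, so the integral vanishes over every Borel set, and
  then over every Lebesgue set, which differs from a Borel set by a null set.\<close>

lemma zero_integrals_imp_AE_zero:
  fixes h :: "real \<Rightarrow> complex"
  assumes h: "integrable (lebesgue_on {x..y}) h"
    and z: "\<And>a b. x \<le> a \<Longrightarrow> a \<le> b \<Longrightarrow> b \<le> y \<Longrightarrow> (LINT s|lebesgue_on {a..b}. h s) = 0"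
  shows "AE s in lebesgue_on {x..y}. h s = 0"
proof (cases "x \<le> y")
  case True
  interpret F: finite_measure "lebesgue_on {x..y}" by (rule finite_measure_Icc)
  define k where "k s = indicat_real {x..y} s *\<^sub>R h s" for s
  have k: "integrable lebesgue k"
    using h unfolding k_def[abs_def] by (simp add: integrable_restrict_space set_integrable_def)
  have restr: "(LINT s|lebesgue. indicat_real B s *\<^sub>R k s) = (LINT s|lebesgue_on {x..y}. indicat_real B s *\<^sub>R h s)" for B
    unfolding k_def by (subst integral_restrict_space) (simp_all add: set_lebesgue_integral_def mult_ac)
  have ik: "set_integrable lebesgue B k" if "B \<in> sets lebesgue" for B
    using integrable_mult_indicator[OF that k] by (simp add: set_integrable_def)
  have borel: "(LINT s:B|lebesgue. k s) = 0" if "B \<in> sets borel" for B :: "real set"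
    using that
  proof (induction rule: borel_set_induct)
    case empty
    then show ?case by (simp add: set_lebesgue_integral_def)
  next
    case (interval a b)
    show ?case
    proof (cases "max a x \<le> min b y")
      case True
      have "(LINT s:{a..b}|lebesgue. k s) = (LINT s|lebesgue_on {x..y}. indicat_real {max a x..min b y} s *\<^sub>R h s)"
        unfolding set_lebesgue_integral_def restr
        by (intro Bochner_Integration.integral_cong) (auto simp: indicator_def)
      also have "\<dots> = (LINT s|lebesgue_on {max a x..min b y}. h s)"
        by (rule lebesgue_on_subset_integral[symmetric]) auto
      also have "\<dots> = 0" using True by (intro z) auto
      finally show ?thesis .
    next
      case False
      then have "indicat_real {a..b} s *\<^sub>R k s = 0" for s by (auto simp: indicator_def k_def)
      then show ?thesis by (simp only: set_lebesgue_integral_def Bochner_Integration.integral_zero)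
    qed
  next
    case (compl B)
    have "(LINT s:-B|lebesgue. k s) = (LINT s|lebesgue. k s - indicat_real B s *\<^sub>R k s)"
      unfolding set_lebesgue_integral_def by (intro Bochner_Integration.integral_cong) (auto simp: indicator_def)
    also have "\<dots> = (LINT s|lebesgue. k s) - (LINT s:B|lebesgue. k s)"
      unfolding set_lebesgue_integral_def
      by (rule Bochner_Integration.integral_diff) (use k ik[of B] compl in \<open>auto simp: set_integrable_def\<close>)
    also have "(LINT s|lebesgue. k s) = (LINT s|lebesgue_on {x..y}. h s)"
      using restr[of UNIV] by simp
    also have "\<dots> = 0" using True by (intro z) auto
    finally show ?case using compl by simp
  next
    case (union f)
    have "(LINT s:(\<Union>i. f i)|lebesgue. k s) = (\<Sum>i. LINT s:f i|lebesgue. k s)"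
    proof (rule lebesgue_integral_countable_add)
      show "f i \<in> sets lebesgue" for i using union by simp
      show "i \<noteq> j \<Longrightarrow> f i \<inter> f j = {}" for i j using union(1) by (auto simp: disjoint_family_on_def)
      have "(\<Union>i. f i) \<in> sets lebesgue" using union by (intro sets.countable_UN) auto
      then show "set_integrable lebesgue (\<Union>i. f i) k" by (rule ik)
    qed
    then show ?case using union by simp
  qed
  show ?thesis
  proof (rule F.density_zero[OF h])
    fix S assume S: "S \<in> sets (lebesgue_on {x..y})"
    then have S': "S \<in> sets lebesgue" "S \<subseteq> {x..y}" by (auto simp: sets_restrict_space)
    obtain B N where BN: "B \<in> sets borel" "negligible N" "B \<union> N = S"
      using sets_lebesgue_almost_borel[OF S'(1)] by blast
    have N: "AE s in lebesgue. s \<notin> N"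
      using BN(2) by (auto simp: negligible_iff_null_sets intro: AE_not_in)
    have "(LINT s:S|lebesgue_on {x..y}. h s) = (LINT s:S|lebesgue. k s)"
      by (simp add: set_lebesgue_integral_def restr)
    also have "\<dots> = (LINT s:B|lebesgue. k s)"
      unfolding set_lebesgue_integral_def
    proof (rule integral_cong_AE)
      show "(\<lambda>s. indicat_real S s *\<^sub>R k s) \<in> borel_measurable lebesgue"
        using ik[OF S'(1)] by (simp add: set_integrable_def)
      show "(\<lambda>s. indicat_real B s *\<^sub>R k s) \<in> borel_measurable lebesgue"
        using ik[of B] BN(1) by (simp add: set_integrable_def)
      show "AE s in lebesgue. indicat_real S s *\<^sub>R k s = indicat_real B s *\<^sub>R k s"
        using N by eventually_elim (use BN(3) in \<open>auto simp: indicator_def\<close>)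
    qed
    also have "\<dots> = 0" by (rule borel[OF BN(1)])
    finally show "(LINT s:S|lebesgue_on {x..y}. h s) = 0" .
  qed
next
  case False
  then show ?thesis by (intro AE_I2) simp
qed

text \<open>A differentiable function that is 0 almost everywhere is 0 throughout the open interval,
  and so is its derivative; hence the second derivative has integral 0 over every compact
  subinterval. This leads to injectivity of the resolvent.\<close>

lemma second_derivative_zero:
  assumes h: "has_second_derivative R \<phi> h" and z: "AE r in NR R. \<phi> r = 0" and R: "R > 0"
  shows "AE r in NR R. h r = 0"
proof -
  obtain u' where u'': "\<forall>r\<in>{0<..<R}. (\<phi> has_vector_derivative u' r) (at r)"
    "\<forall>x y. 0 < x \<and> x \<le> y \<and> y < R \<longrightarrow> integrable (lebesgue_on {x..y}) h \<and> u' y - u' x = (LINT s|lebesgue_on {x..y}. h s)"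
    using h unfolding has_second_derivative_def by (elim exE conjE)
  note u' = u''(1)[rule_format]
  have int: "integrable (lebesgue_on {x..y}) h" "u' y - u' x = (LINT s|lebesgue_on {x..y}. h s)"
    if "0 < x" "x \<le> y" "y < R" for x y using u''(2) that by simp_all
  have \<phi>0: "\<phi> r = 0" if r: "r \<in> {0<..<R}" for r
  proof (rule ccontr)
    assume ne: "\<phi> r \<noteq> 0"
    have "isCont \<phi> r" using u'[OF r] by (rule has_vector_derivative_continuous)
    then have "\<forall>\<^sub>F s in nhds r. \<phi> s \<noteq> 0"
      using ne tendsto_imp_eventually_ne[of \<phi> "\<phi> r" "nhds r" 0] by (simp add: isCont_def tendsto_at_iff_tendsto_nhds)
    moreover have "\<forall>\<^sub>F s in nhds r. s \<in> {0<..<R}" using r by (intro eventually_nhds_in_open) auto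
    ultimately have "\<forall>\<^sub>F s in nhds r. \<phi> s \<noteq> 0 \<and> s \<in> {0<..<R}" by (rule eventually_conj)
    then obtain e where e: "0 < e" "\<And>s. dist s r < e \<Longrightarrow> \<phi> s \<noteq> 0 \<and> s \<in> {0<..<R}"
      unfolding eventually_nhds_metric by blast
    have "AE s in lebesgue. s \<in> {0..R} \<longrightarrow> \<phi> s = 0"
      using z by (subst (asm) AE_restrict_space_iff) auto
    then have "AE s in lebesgue. s \<notin> ball r e"
      by eventually_elim (use e(2) in \<open>force simp: dist_commute\<close>)
    then have "emeasure lebesgue (ball r e) = 0"
      by (subst (asm) AE_iff_measurable[where N = "ball r e"]) auto
    then have "negligible (ball r e)"
      by (simp add: negligible_iff_null_sets null_sets_def)
    then show False using e(1) open_not_negligible[of "ball r e"] by simp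
  qed
  have u'0: "u' r = 0" if r: "r \<in> {0<..<R}" for r
  proof (rule vector_derivative_unique_at[OF u'[OF r]])
    have "((\<lambda>_. 0) has_vector_derivative 0) (at r)" by simp
    then show "(\<phi> has_vector_derivative 0) (at r)"
      by (rule has_vector_derivative_transform_within_open[OF _ open_greaterThanLessThan r]) (simp add: \<phi>0)
  qed
  \<comment> \<open>These intervals exhaust (0,R) as \<open>n\<close> grows; the offset 3 keeps
    their endpoints in order from \<open>n = 0\<close> on.\<close>
  have "AE s in lebesgue. s \<in> {R / real (n + 3)..R - R / real (n + 3)} \<longrightarrow> h s = 0" for n
  proof -
    let ?x = "R / real (n + 3)" and ?y = "R - R / real (n + 3)"
    have xy: "0 < ?x" "?x \<le> ?y" "?y < R" using R by (auto simp: field_simps)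
    have "AE s in lebesgue_on {?x..?y}. h s = 0"
    proof (rule zero_integrals_imp_AE_zero)
      show "integrable (lebesgue_on {?x..?y}) h" by (rule int(1)[OF xy])
      fix a b assume ab: "?x \<le> a" "a \<le> b" "b \<le> ?y"
      then have "u' b - u' a = (LINT s|lebesgue_on {a..b}. h s)" by (intro int(2)) (use xy in auto)
      then show "(LINT s|lebesgue_on {a..b}. h s) = 0" using ab xy u'0[of a] u'0[of b] by auto
    qed
    then show ?thesis by (subst (asm) AE_restrict_space_iff) auto
  qed
  then have "AE s in lebesgue. \<forall>n. s \<in> {R / real (n + 3)..R - R / real (n + 3)} \<longrightarrow> h s = 0"
    by (subst AE_all_countable) (rule allI)
  then have "AE s in NR R. \<forall>n. s \<in> {R / real (n + 3)..R - R / real (n + 3)} \<longrightarrow> h s = 0"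
    by (subst AE_restrict_space_iff) auto
  then show ?thesis using AE_lebesgue_on_neq[where c = 0] AE_lebesgue_on_neq[where c = R] AE_space
  proof eventually_elim
    case (elim s)
    then have s: "0 < s" "s < R" by auto
    define m where "m = min s (R - s)"
    have m: "0 < m" using s by (simp add: m_def)
    obtain n where "R / m < real n" using reals_Archimedean2 by blast
    then have "R < real n * m" using m by (simp add: pos_divide_less_eq)
    also have "\<dots> < m * real (n + 3)" using m by (simp add: algebra_simps)
    finally have "R / real (n + 3) < m" by (simp add: field_simps)
    then have "s \<in> {R / real (n + 3)..R - R / real (n + 3)}" by (auto simp: m_def)
    then show ?case using elim(1) by blast
  qed
qed

context volterra
begin

lemma expr1_zero:
  assumes "expr1 \<phi> f" "AE r in NR R. \<phi> r = 0"
  shows "AE r in NR R. f r = 0"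
proof -
  obtain h where h: "has_second_derivative R \<phi> h" "AE r in NR R. f r = - h r + complex_of_real (lam / r\<^sup>2) * \<phi> r"
    using assms(1) by (auto simp: expr1_def)
  show ?thesis using h(2) assms(2) second_derivative_zero[OF h(1) assms(2) R] by eventually_elim simp
qed

text \<open>Applying \<open>1 + w * V0\<close> returns to the leading terms \<open>pp\<close> and
  \<open>mm\<close>, whose independence amounts to \<open>Q\<close> taking different values at two
  points.\<close>

lemma homogeneous_independent:
  assumes ae: "AE r in NR R. c * regular w r + c' * singular w r = 0"
  shows "c = 0" "c' = 0"
proof -
  define u where "u = (\<lambda>r. c * regular w r + c' * singular w r)"
  have su: "sq_int R u" unfolding u_def by (intro sq_int_add sq_int_scale regular_facts singular_facts)
  have V: "V0 u r = c * V0 (regular w) r + c' * V0 (singular w) r" for r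
    unfolding u_def by (simp add: V0_add V0_scale Bint_scale Bint_sq_int regular_facts singular_facts)
  have "V0 u r = (LINT s|NR R. 0)" for r
    unfolding V0_def kop_def
  proof (rule integral_cong_AE)
    show "(\<lambda>s. kerc r s * u s) \<in> borel_measurable (NR R)"
      by (intro borel_measurable_times kerc_sections(1) sq_intD(1) su)
    show "AE s in NR R. kerc r s * u s = 0" using ae by eventually_elim (simp add: u_def)
  qed simp
  then have V0: "V0 u r = 0" for r by simp
  let ?\<tau> = "complex_of_real (if v = 0 then 1 else - 2 * v)"
  have good: "AE r in NR R. 0 < r \<and> c + c' * ?\<tau> * of_real (Q r) = 0"
    using ae AE_lebesgue_on_neq[where c = 0] AE_space
  proof eventually_elim
    case (elim r)
    then have r: "0 < r" "r \<le> R" by auto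
    have "c * of_real (pp r) + c' * of_real (mm r) = u r + w * V0 u r"
      unfolding V regular_facts(2)[OF r, of w, symmetric] singular_facts(2)[OF r, of w, symmetric]
      by (simp only: u_def algebra_simps)
    also have "\<dots> = 0" using elim(1) V0 by (simp add: u_def)
    also have "c * of_real (pp r) + c' * of_real (mm r) = of_real (r powr a) * (c + c' * ?\<tau> * of_real (Q r))"
      by (simp only: mm_nn[OF r(1)] pp_def nn_def of_real_mult) (simp only: algebra_simps)
    finally show ?case using r(1) by (simp only: mult_eq_0_iff of_real_eq_0_iff powr_eq_0_iff) simp
  qed
  obtain r where r: "0 < r" "c + c' * ?\<tau> * of_real (Q r) = 0" using AE_ex_point[OF good R] by blast
  have "AE s in NR R. s \<noteq> r \<and> 0 < s \<and> c + c' * ?\<tau> * of_real (Q s) = 0"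
    using good AE_lebesgue_on_neq[where c = r] by eventually_elim simp
  then obtain s where s: "s \<noteq> r" "0 < s" "c + c' * ?\<tau> * of_real (Q s) = 0" using AE_ex_point R by blast
  have strict: "Q x < Q y" if "0 < x" "x < y" for x y
  proof (rule DERIV_pos_imp_increasing[OF that(2)])
    fix z assume "x \<le> z" "z \<le> y"
    then have z: "0 < z" using that by simp
    then show "\<exists>d. (Q has_real_derivative d) (at z) \<and> 0 < d"
      using Q_deriv[OF z] by (intro exI[of _ "z powr (-1 - 2 * v)"]) simp
  qed
  have "Q r \<noteq> Q s" using strict[of r s] strict[of s r] r(1) s(1,2) by (cases "r < s") auto
  moreover have "c' * ?\<tau> * (of_real (Q r) - of_real (Q s)) = 0"
    unfolding right_diff_distrib right_minus_eq by (rule add_left_imp_eq[of c]) (simp only: r(2) s(3))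
  ultimately show "c' = 0" by (auto split: if_splits)
  then show "c = 0" using r(2) by simp
qed

text \<open>In \<open>Vw = V0 - w * Vw V0\<close> both summands are products of Hilbert-Schmidt
  operators: \<open>k1\<close> with \<open>k2\<close>, and \<open>vw\<close> with
  \<open>kerc\<close>. Each trace integrates a product of kernels living on opposite strict
  triangles, which is identically 0.\<close>

lemma nuclear_Vw:
  assumes j: "j < q"
  shows "L2.nuclear q R (\<lambda>f. emb j (Vw w (f j))) 0"
proof -
  have t1: "(LINT s|NR R. LINT r|NR R. k1 r s * k2 s r) = 0"
  proof -
    have z: "k1 r s * k2 s r = 0" for r s using k1_support[of s r] k2_support[of r s] by force
    show ?thesis unfolding z by simp
  qed
  have t2: "(LINT s|NR R. LINT r|NR R. vw w r s * kerc s r) = 0"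
  proof -
    have z: "vw w r s * kerc s r = 0" for r s using vw_support[of s r w] kerc_support[of r s] by force
    show ?thesis unfolding z by simp
  qed
  have n1: "L2.nuclear q R (\<lambda>f. emb j (kop R k1 (kop R k2 (f j)))) 0"
    using nuclear_hs_product[OF hs_k1 hs_k2 j] unfolding t1 .
  have n2: "L2.nuclear q R (\<lambda>f. emb j (kop R (vw w) (kop R kerc (f j)))) 0"
    using nuclear_hs_product[OF hs_vw[of w] hs_kerc j] unfolding t2 .
  have eq: "emb j (Vw w (f j)) = (\<lambda>i r. emb j (kop R k1 (kop R k2 (f j))) i r + (- w) * emb j (kop R (vw w) (kop R kerc (f j))) i r)"
    if f: "f \<in> L2 q R" for f
  proof (intro ext)
    fix i r
    have fj: "sq_int R (f j)" using f j by (rule sq_int_component)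
    have "Vw w (f j) r = V0 (f j) r - w * Vw w (V0 (f j)) r"
    proof (cases "0 < r \<and> r \<le> R")
      case False
      then have "vw w r s = 0" "kerc r s = 0" for s using vw_support[of s r w] kerc_support[of s r] by auto
      then show ?thesis by (simp add: Vw_def V0_def kop_def)
    qed (auto intro: resolvent_equation' Bint_sq_int fj)
    then show "emb j (Vw w (f j)) i r = emb j (kop R k1 (kop R k2 (f j))) i r + (- w) * emb j (kop R (vw w) (kop R kerc (f j))) i r"
      by (simp add: emb_def V0_factorization[OF fj]) (simp add: V0_def Vw_def)
  qed
  from L2.nuclear_add[OF n1 L2.nuclear_scl[OF n2, of "- w"]]
  have n3: "L2.nuclear q R (\<lambda>f i r. emb j (kop R k1 (kop R k2 (f j))) i r + (- w) * emb j (kop R (vw w) (kop R kerc (f j))) i r) 0"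
    by simp
  show ?thesis
  proof (rule L2.nuclear_cong[OF n3])
    fix f z :: vfun assume f: "f \<in> L2 q R"
    show "emb j (Vw w (f j)) \<in> L2 q R"
      by (intro emb_L2 Vw_sq_int Bint_sq_int sq_int_component[OF f j])
    show "L2_inner q R (emb j (Vw w (f j))) z = L2_inner q R (\<lambda>i r. emb j (kop R k1 (kop R k2 (f j))) i r + (- w) * emb j (kop R (vw w) (kop R kerc (f j))) i r) z"
      unfolding eq[OF f] ..
  qed
qed

end

text \<open>Jacobi's formula. The product rule in the Leibniz expansion differentiates one row at a
  time, and Laplace expansion along that row yields its cofactors.\<close>

lemma det_has_derivative:
  fixes M :: "complex \<Rightarrow> complex mat"
  assumes car: "\<And>w. M w \<in> carrier_mat n n"
    and D: "\<And>i j. i < n \<Longrightarrow> j < n \<Longrightarrow> ((\<lambda>w. M w $$ (i, j)) has_field_derivative M' i j) (at w)"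
  shows "((\<lambda>w. det (M w)) has_field_derivative (\<Sum>i<n. \<Sum>j<n. M' i j * cofactor (M w) i j)) (at w)"
proof -
  let ?P = "{p. p permutes {0..<n}}"
  define X where "X i = Matrix.mat n n (\<lambda>(l, j). if l = i then M' i j else M w $$ (l, j))" for i
  have X: "X i \<in> carrier_mat n n" for i by (simp add: X_def)
  have lt: "p i < n" if "p \<in> ?P" "i < n" for p i
    using that permutes_in_image[of p "{0..<n}" i] by auto
  have "((\<lambda>w. \<Sum>p\<in>?P. signof p * (\<Prod>i = 0..<n. M w $$ (i, p i))) has_field_derivative
      (\<Sum>p\<in>?P. signof p * (\<Sum>i\<in>{0..<n}. M' i (p i) * (\<Prod>l\<in>{0..<n} - {i}. M w $$ (l, p l))))) (at w)"
    by (intro DERIV_sum DERIV_cmult has_field_derivative_prod D) (use lt in auto)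
  moreover have "(\<Sum>p\<in>?P. signof p * (\<Sum>i\<in>{0..<n}. M' i (p i) * (\<Prod>l\<in>{0..<n} - {i}. M w $$ (l, p l))))
    = (\<Sum>i<n. det (X i))"
  proof -
    have "(\<Sum>p\<in>?P. signof p * (\<Sum>i\<in>{0..<n}. M' i (p i) * (\<Prod>l\<in>{0..<n} - {i}. M w $$ (l, p l))))
      = (\<Sum>i\<in>{0..<n}. \<Sum>p\<in>?P. signof p * (M' i (p i) * (\<Prod>l\<in>{0..<n} - {i}. M w $$ (l, p l))))"
      unfolding sum_distrib_left by (rule sum.swap)
    also have "\<dots> = (\<Sum>i\<in>{0..<n}. det (X i))"
    proof (rule sum.cong[OF refl])
      fix i assume i: "i \<in> {0..<n}"
      have "M' i (p i) * (\<Prod>l\<in>{0..<n} - {i}. M w $$ (l, p l)) = (\<Prod>l = 0..<n. X i $$ (l, p l))" if p: "p \<in> ?P" for p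
      proof -
        have "(\<Prod>l = 0..<n. X i $$ (l, p l)) = X i $$ (i, p i) * (\<Prod>l\<in>{0..<n} - {i}. X i $$ (l, p l))"
          using i by (intro prod.remove) auto
        also have "X i $$ (i, p i) = M' i (p i)" using i lt[OF p] by (simp add: X_def)
        also have "(\<Prod>l\<in>{0..<n} - {i}. X i $$ (l, p l)) = (\<Prod>l\<in>{0..<n} - {i}. M w $$ (l, p l))"
          by (rule prod.cong) (use lt[OF p] in \<open>auto simp: X_def\<close>)
        finally show ?thesis ..
      qed
      then show "(\<Sum>p\<in>?P. signof p * (M' i (p i) * (\<Prod>l\<in>{0..<n} - {i}. M w $$ (l, p l)))) = det (X i)"
        unfolding det_def'[OF X] by (intro sum.cong) auto
    qed
    finally show ?thesis by (simp only: atLeast0LessThan)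
  qed
  moreover have "det (X i) = (\<Sum>j<n. M' i j * cofactor (M w) i j)" if i: "i < n" for i
    unfolding laplace_expansion_row[OF X i]
  proof (rule sum.cong[OF refl])
    fix j assume j: "j \<in> {..<n}"
    have "mat_delete (X i) i j = mat_delete (M w) i j"
      unfolding mat_delete_def using car[of w] i j by (intro eq_matI) (auto simp: X_def)
    then show "X i $$ (i, j) * cofactor (X i) i j = M' i j * cofactor (M w) i j"
      using i j by (simp add: cofactor_def X_def)
  qed
  ultimately show ?thesis unfolding det_def'[OF car] by simp
qed

lemma nuclear_sum:
  fixes n :: nat
  assumes "\<And>k. k < n \<Longrightarrow> L2.nuclear q R (T k) (t k)"
  shows "L2.nuclear q R (\<lambda>f j r. (\<Sum>k<n. T k f j r)) (\<Sum>k<n. t k)"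
  using assms
proof (induction n)
  case 0
  have "L2_semi.zero q R = (\<lambda>j r. 0)" by (simp add: L2_semi.zero_def)
  then show ?case using L2.nuclear_zero[of q R] by simp
next
  case (Suc n)
  then show ?case using L2.nuclear_add[OF Suc.IH Suc.prems[of n]] by simp
qed

section \<open>From nuclear sums to trace class and trace\<close>

lemma L2_null_iff: 
  assumes f: "f \<in> L2 q R"
  shows "L2_eq q R f (\<lambda>_ _. 0) \<longleftrightarrow> L2_semi.nrm2 q R f = 0"
proof -
  have z: "(\<lambda>_ _. 0) \<in> L2 q R" by (simp add: L2_def)
  have "L2_semi.sub f (\<lambda>_ _. 0) = f" by (simp add: L2_semi.sub_def)
  then show ?thesis using L2_semi.nrm2_sub_eq_0_iff[OF f z] L2_eq_iff_inner[OF f z] by simp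
qed

lemma orthonormal_basis_iff: "orthonormal_basis q R I e \<longleftrightarrow> L2_semi.onb q R I e"
  unfolding orthonormal_basis_def L2_semi.onb_def L2_semi.orthonormal_def by (simp add: conj_assoc L2_null_iff)

lemma L2_eq_linear:
  assumes "x \<in> L2 q R" "f \<in> L2 q R" "g \<in> L2 q R"
    and "\<And>z. z \<in> L2 q R \<Longrightarrow> L2_inner q R x z = a * L2_inner q R f z + b * L2_inner q R g z"
  shows "L2_eq q R x (\<lambda>j r. a * f j r + b * g j r)"
proof -
  have S: "(\<lambda>j r. a * f j r) \<in> L2 q R" "(\<lambda>j r. b * g j r) \<in> L2 q R" using assms by (intro L2_scale; simp)+
  have "L2_inner q R (\<lambda>j r. a * f j r + b * g j r) z = a * L2_inner q R f z + b * L2_inner q R g z"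
    if z: "z \<in> L2 q R" for z
    using L2_semi.ip_add_left[OF S z] L2_semi.ip_scl_left[OF assms(2) z] L2_semi.ip_scl_left[OF assms(3) z] by simp
  then show ?thesis using assms L2_add[OF S] by (subst L2_eq_iff_inner) auto
qed

lemma nuclear_bounded_op:
  assumes "L2.nuclear q R T t"
  shows "bounded_op q R T"
proof -
  obtain T' C where T: "L2.adjoint_pair q R T T'" and C: "L2.nuclear_bound q R T C"
    using assms unfolding L2.nuclear_def by blast
  have TS: "T f \<in> L2 q R" if "f \<in> L2 q R" for f using L2.adjoint_pair_S(1)[OF T that] .
  show ?thesis
    unfolding bounded_op_def
  proof (intro conjI ballI allI TS)
    fix f g a b assume f: "f \<in> L2 q R" and g: "g \<in> L2 q R"
    have fg: "(\<lambda>j r. a * f j r + b * g j r) \<in> L2 q R" by (intro L2_add L2_scale f g)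
    show "L2_eq q R (T (\<lambda>j r. a * f j r + b * g j r)) (\<lambda>j r. a * T f j r + b * T g j r)"
    proof (rule L2_eq_linear[OF TS[OF fg] TS[OF f] TS[OF g]])
      fix z assume z: "z \<in> L2 q R"
      have adj: "L2_inner q R (T x) z = L2_inner q R x (T' z)" if "x \<in> L2 q R" for x
        using T that z unfolding L2.adjoint_pair_def by blast
      have z': "T' z \<in> L2 q R" using L2.adjoint_pair_S(2)[OF T z] .
      show "L2_inner q R (T (\<lambda>j r. a * f j r + b * g j r)) z = a * L2_inner q R (T f) z + b * L2_inner q R (T g) z"
        unfolding adj[OF f] adj[OF g] adj[OF fg]
        using L2_semi.ip_add_left[OF L2_scale[OF f] L2_scale[OF g] z', of a b]
          L2_semi.ip_scl_left[OF f z'] L2_semi.ip_scl_left[OF g z'] by simp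
    qed
  next
    show "\<exists>C. \<forall>f\<in>L2 q R. L2_norm q R (T f) \<le> C * L2_norm q R f"
    proof (intro exI ballI)
      fix f assume f: "f \<in> L2 q R"
      have "sqrt (L2_semi.nrm2 q R (T f)) \<le> sqrt (C\<^sup>2 * L2_semi.nrm2 q R f)"
        using L2.nuclear_bound_bounded[OF T C f] by simp
      then show "L2_norm q R (T f) \<le> \<bar>C\<bar> * L2_norm q R f"
        by (simp add: real_sqrt_mult L2_nrm[symmetric] L2_semi.nrm_def)
    qed
  qed
qed

text \<open>Injectivity turns the singular vectors into a basis. It supplies the absolute value, and
  it makes the number sought in \<open>op_trace\<close> unique.\<close>

lemma nuclear_trace_class:
  assumes T: "L2.nuclear q R T t"
    and inj: "\<And>f. f \<in> L2 q R \<Longrightarrow> L2_eq q R (T f) (\<lambda>_ _. 0) \<Longrightarrow> L2_eq q R f (\<lambda>_ _. 0)"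
  shows "trace_class q R T" "op_trace q R T = t"
proof -
  have bT: "bounded_op q R T" by (rule nuclear_bounded_op[OF T])
  have inj': "L2_semi.nrm2 q R f = 0" if "f \<in> L2 q R" "L2_semi.nrm2 q R (T f) = 0" for f
    using inj[OF that(1)] that L2_null_iff[OF that(1)] L2_null_iff[OF L2.nuclear_S[OF T that(1)]] by simp
  have "trace_class q R T \<and> op_trace q R T = t"
  proof (rule L2.nuclear_absolute_value[OF T inj'])
  fix P assume P: "\<And>x. x \<in> L2 q R \<Longrightarrow> P x \<in> L2 q R"
    "\<And>x y. x \<in> L2 q R \<Longrightarrow> y \<in> L2 q R \<Longrightarrow> L2_inner q R (P x) (P y) = L2_inner q R (T x) (T y)"
    "\<And>x. x \<in> L2 q R \<Longrightarrow> Im (L2_inner q R (P x) x) = 0 \<and> 0 \<le> Re (L2_inner q R (P x) x)"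
    "\<And>a b x y z. x \<in> L2 q R \<Longrightarrow> y \<in> L2 q R \<Longrightarrow> z \<in> L2 q R \<Longrightarrow>
       L2_inner q R (P (\<lambda>j r. a * x j r + b * y j r)) z = a * L2_inner q R (P x) z + b * L2_inner q R (P y) z"
    "\<And>I e. L2_semi.onb q R I e \<Longrightarrow> (\<lambda>n. L2_inner q R (P (e n)) (e n)) summable_on I"
  assume ex: "\<exists>I e. L2_semi.onb q R I e"
  have nP: "L2_norm q R (P f) = L2_norm q R (T f)" if "f \<in> L2 q R" for f
    using P(2)[OF that that] by (simp add: L2_nrm[symmetric] L2_semi.nrm_def L2_semi.nrm2_def)
  have bP: "bounded_op q R P"
    unfolding bounded_op_def
  proof (intro conjI ballI allI P(1))
    fix f g a b assume f: "f \<in> L2 q R" and g: "g \<in> L2 q R"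
    show "L2_eq q R (P (\<lambda>j r. a * f j r + b * g j r)) (\<lambda>j r. a * P f j r + b * P g j r)"
      by (intro L2_eq_linear P f g L2_add L2_scale)
  next
    obtain C where "\<forall>f\<in>L2 q R. L2_norm q R (T f) \<le> C * L2_norm q R f" using bT by (auto simp: bounded_op_def)
    then show "\<exists>C. \<forall>f\<in>L2 q R. L2_norm q R (P f) \<le> C * L2_norm q R f" using nP by auto
  qed
  have "is_abs_op q R T P"
    unfolding is_abs_op_def using bP P(2,3) by (auto simp: complex_nonneg_Reals_iff)
  then have 1: "trace_class q R T"
    unfolding trace_class_def using bT P(5) by (auto simp: orthonormal_basis_iff)
  have hs: "((\<lambda>n. L2_inner q R (T (e n)) (e n)) has_sum t) I" if "L2_semi.onb q R I e" for I e
    using T that unfolding L2.nuclear_def by simp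
  have 2: "op_trace q R T = t"
    unfolding op_trace_def orthonormal_basis_iff
  proof (rule the_equality)
    show "\<forall>I e. L2_semi.onb q R I e \<longrightarrow> ((\<lambda>n. L2_inner q R (T (e n)) (e n)) has_sum t) I" using hs by blast
    fix s assume s: "\<forall>I e. L2_semi.onb q R I e \<longrightarrow> ((\<lambda>n. L2_inner q R (T (e n)) (e n)) has_sum s) I"
    obtain I e where e: "L2_semi.onb q R I e" using ex by blast
    show "s = t" using has_sum_unique[OF s[rule_format, OF e] hs[OF e]] .
  qed
  from 1 2 show "trace_class q R T \<and> op_trace q R T = t" ..
  qed
  then show "trace_class q R T" "op_trace q R T = t" by auto
qed

section \<open>The model operator\<close>

lemma sum_lessThan_add: "(\<Sum>i<m + n. h i) = (\<Sum>i<m. h i) + (\<Sum>i<n::nat. h (m + i) :: 'a::comm_monoid_add)"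
  by (induction n) (simp_all add: add.assoc)

locale model =
  fixes q0 q1 :: nat and lm :: "nat \<Rightarrow> real" and R :: real and A B :: "complex mat"
  assumes lm: "\<And>j. q0 \<le> j \<Longrightarrow> j < q0 + q1 \<Longrightarrow> - 1/4 < lm j \<and> lm j < 3/4"
    and R: "R > 0"
    and A: "A \<in> carrier_mat (q0 + q1) (q0 + q1)" and B: "B \<in> carrier_mat (q0 + q1) (q0 + q1)"
begin

abbreviation "q \<equiv> q0 + q1"
definition "vv j = (if j < q0 then 0 else nu lm j)"
text \<open>The normalising factor that the maximal domain puts in front of both leading terms of a
  component.\<close>

definition kap :: "nat \<Rightarrow> complex" where
  "kap j = (if j < q0 then 1 else of_real (1 / sqrt (2 * nu lm j)))"
abbreviation "Rm \<equiv> complex_of_real (R powr (- 1/2))"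
abbreviation "reg w j \<equiv> volterra.regular (vv j) w"
abbreviation "sg w j \<equiv> volterra.singular (vv j) w"
abbreviation "V w j \<equiv> volterra.Vw (vv j) R w"

lemma nu_bounds: "j < q \<Longrightarrow> \<not> j < q0 \<Longrightarrow> 0 < nu lm j \<and> nu lm j < 1"
  using lm[of j] by (simp add: nu_def)

lemma vol: "j < q \<Longrightarrow> volterra (vv j) R"
  using nu_bounds[of j] R by unfold_locales (auto simp: vv_def)

lemma kap_nz: "j < q \<Longrightarrow> kap j \<noteq> 0"
  using nu_bounds[of j] by (auto simp: kap_def)

lemma Rm_nz: "Rm \<noteq> 0" using R by simp

text \<open>The matrix of the determinant in the variable \<open>w = - \<mu>^2\<close>; at
  \<open>\<mu> = \<i> * z\<close> this is \<open>w = z^2\<close>.\<close>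

definition Nm :: "complex \<Rightarrow> complex mat" where
  "Nm w = four_block_mat A B (mat_diag q (\<lambda>j. Rm * reg w j R)) (mat_diag q (\<lambda>j. Rm * sg w j R))"

lemma Nm_carrier: "Nm w \<in> carrier_mat (q + q) (q + q)"
  unfolding Nm_def using A B by (intro four_block_carrier_mat) auto

lemma F_det_eq: "F_det q0 q1 lm R A B (\<i> * z) = det (Nm (z\<^sup>2))"
proof -
  have "J_plus_entry q0 lm R j (\<i> * z) = Rm * reg (z\<^sup>2) j R" "J_minus_entry q0 lm R j (\<i> * z) = Rm * sg (z\<^sup>2) j R"
    if j: "j < q" for j
    using volterra.J_entries[OF vol[OF j], of j q0 lm "\<i> * z"] nu_bounds[OF j]
    by (auto simp: vv_def power_mult_distrib)
  then have "mat_diag q (\<lambda>j. J_plus_entry q0 lm R j (\<i> * z)) = mat_diag q (\<lambda>j. Rm * reg (z\<^sup>2) j R)"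
    "mat_diag q (\<lambda>j. J_minus_entry q0 lm R j (\<i> * z)) = mat_diag q (\<lambda>j. Rm * sg (z\<^sup>2) j R)"
    by (intro eq_matI; simp add: mat_diag_def)+
  then show ?thesis by (simp add: F_det_def Nm_def)
qed

lemma Nm_upper: "i < q \<Longrightarrow> j < q + q \<Longrightarrow> Nm w $$ (i, j) = beside q A B $$ (i, j)"
  using A B by (auto simp: Nm_def beside_def mat_diag_def)

lemma Nm_lower: "k < q \<Longrightarrow> j < q + q \<Longrightarrow>
   Nm w $$ (q + k, j) = (if j = k then Rm * reg w k R else 0) + (if j = q + k then Rm * sg w k R else 0)"
  using A B by (auto simp: Nm_def mat_diag_def)

text \<open>Right-hand side of the boundary system: 0 in the rows of the Lagrangian condition,
  \<open>y\<close> in the rows of the Dirichlet condition.\<close>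

definition "Jvec y = vec (q + q) (\<lambda>i. if i < q then 0 else y (i - q) :: complex)"

lemma Nm_mult:
  assumes c: "c \<in> carrier_vec (q + q)"
  shows "Nm w *\<^sub>v c = Jvec y \<longleftrightarrow>
    beside q A B *\<^sub>v c = 0\<^sub>v q \<and> (\<forall>k<q. Rm * reg w k R * c $ k + Rm * sg w k R * c $ (q + k) = y k)"
proof -
  have car: "Nm w \<in> carrier_mat (q + q) (q + q)" by (rule Nm_carrier)
  have up: "(Nm w *\<^sub>v c) $ i = (beside q A B *\<^sub>v c) $ i" if i: "i < q" for i
    using i car c Nm_upper[OF i] by (auto simp: scalar_prod_def beside_def intro!: sum.cong)
  have low: "(Nm w *\<^sub>v c) $ (q + k) = Rm * reg w k R * c $ k + Rm * sg w k R * c $ (q + k)" if k: "k < q" for k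
  proof -
    have "(Nm w *\<^sub>v c) $ (q + k) = (\<Sum>j<q + q. Nm w $$ (q + k, j) * c $ j)"
      using k car c by (auto simp: scalar_prod_def atLeast0LessThan)
    also have "\<dots> = (\<Sum>j<q + q. (if j = k then Rm * reg w k R * c $ k else 0) + (if j = q + k then Rm * sg w k R * c $ (q + k) else 0))"
      using k by (intro sum.cong) (auto simp: Nm_lower)
    also have "\<dots> = Rm * reg w k R * c $ k + Rm * sg w k R * c $ (q + k)"
      using k by (simp add: sum.distrib)
    finally show ?thesis .
  qed
  have "Nm w *\<^sub>v c = Jvec y \<longleftrightarrow> (\<forall>i<q + q. (Nm w *\<^sub>v c) $ i = Jvec y $ i)"
    using car by (auto simp: vec_eq_iff Jvec_def)
  also have "\<dots> \<longleftrightarrow> (\<forall>i<q. (Nm w *\<^sub>v c) $ i = 0) \<and> (\<forall>k<q. (Nm w *\<^sub>v c) $ (q + k) = y k)"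
  proof -
    have "(\<forall>i<q + q. P i) \<longleftrightarrow> (\<forall>i<q. P i) \<and> (\<forall>k<q. P (q + k))" for P :: "nat \<Rightarrow> bool"
    proof (safe)
      fix i assume "\<forall>i<q. P i" "\<forall>k<q. P (q + k)" "i < q + q"
      then show "P i" by (cases "i < q") (auto dest: spec[of _ "i - q"])
    qed auto
    then show ?thesis by (auto simp: Jvec_def)
  qed
  also have "(\<forall>i<q. (Nm w *\<^sub>v c) $ i = 0) \<longleftrightarrow> beside q A B *\<^sub>v c = 0\<^sub>v q"
    using up by (auto simp: vec_eq_iff beside_def)
  also have "(\<forall>k<q. (Nm w *\<^sub>v c) $ (q + k) = y k) \<longleftrightarrow> (\<forall>k<q. Rm * reg w k R * c $ k + Rm * sg w k R * c $ (q + k) = y k)"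
    using low by auto
  finally show ?thesis .
qed

definition lead :: "complex vec \<Rightarrow> nat \<Rightarrow> real \<Rightarrow> complex" where
  "lead c j r = kap j * (c $ j * of_real (volterra.pp (vv j) r) + c $ (q + j) * of_real (volterra.mm (vv j) r))"

lemma lead_low: "j < q0 \<Longrightarrow> lead c j r = c $ j * complex_of_real (r powr (1/2)) + c $ (q + j) * complex_of_real (r powr (1/2) * ln r)"
  using vol[of j] by (simp add: lead_def kap_def vv_def volterra.pp_def volterra.mm_def volterra.a_def)

lemma lead_high: "q0 \<le> j \<Longrightarrow> j < q \<Longrightarrow> lead c j r = complex_of_real (1 / sqrt (2 * nu lm j)) *
    (c $ j * complex_of_real (r powr (nu lm j + 1/2)) + c $ (q + j) * complex_of_real (r powr (- nu lm j + 1/2)))"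
  using vol[of j] nu_bounds[of j]
  by (simp add: lead_def kap_def vv_def volterra.pp_def volterra.mm_def volterra.a_def add.commute)

lemma model_expr_iff: "model_expr q0 q1 lm R \<phi> g \<longleftrightarrow> (\<forall>j<q. volterra.expr1 (vv j) R (\<phi> j) (g j))"
proof -
  have "diag_entry q0 lm j = volterra.lam (vv j)" if j: "j < q" for j
    using lm[of j] j volterra.lam_def[OF vol[OF j]] by (cases "j < q0") (simp_all add: diag_entry_def vv_def nu_def)
  then show ?thesis
    using volterra.expr1_def[OF vol] by (auto simp: model_expr_def)
qed

lemma max_domain_coeffs_iff:
  "max_domain_coeffs q0 q1 lm R \<phi> c \<longleftrightarrow> c \<in> carrier_vec (q + q) \<and> (\<forall>j<q. \<phi> j R = 0) \<and>
    (\<exists>\<psi> d. (\<forall>j<q. \<forall>r\<in>{0<..R}. \<phi> j r = lead c j r + \<psi> j r) \<and> (\<forall>j<q. volterra.remainder R (\<psi> j) (d j)) \<and>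
      (\<exists>g\<in>L2 q R. \<forall>j<q. volterra.expr1 (vv j) R (\<psi> j) (g j)))"
proof -
  have "(\<forall>j<q. \<forall>r\<in>{0<..R}. \<phi> j r = lead c j r + \<psi> j r) \<longleftrightarrow>
    (\<forall>j<q0. \<forall>r\<in>{0<..R}. \<phi> j r = c $ j * complex_of_real (r powr (1/2))
                 + c $ (q0 + q1 + j) * complex_of_real (r powr (1/2) * ln r) + \<psi> j r) \<and>
    (\<forall>j\<in>{q0..<q0+q1}. \<forall>r\<in>{0<..R}. \<phi> j r = complex_of_real (1 / sqrt (2 * nu lm j)) *
                    (c $ j * complex_of_real (r powr (nu lm j + 1/2))
                     + c $ (q0 + q1 + j) * complex_of_real (r powr (- nu lm j + 1/2))) + \<psi> j r)" for \<psi>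
  proof -
    have split: "(\<forall>j<q. P j) \<longleftrightarrow> (\<forall>j<q0. P j) \<and> (\<forall>j\<in>{q0..<q0+q1}. P j)" for P :: "nat \<Rightarrow> bool"
      using not_le by auto
    show ?thesis unfolding split by (simp add: lead_low lead_high)
  qed
  moreover have "(\<forall>j<q. volterra.remainder R (\<psi> j) (d j)) \<longleftrightarrow> (\<forall>j<q.
           (\<forall>r\<in>{0..R}. (\<psi> j has_vector_derivative d j r) (at r within {0..R})) \<and>
           continuous_on {0..R} (d j) \<and>
           \<psi> j \<in> O[at_right 0](\<lambda>r. complex_of_real (r powr (3/2))) \<and>
           d j \<in> O[at_right 0](\<lambda>r. complex_of_real (r powr (1/2))))" for \<psi> d
    using volterra.remainder_def[OF vol] by auto
  ultimately show ?thesis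
    unfolding max_domain_coeffs_def model_expr_iff mult_2 by (simp only: conj_assoc)
qed

section \<open>The resolvent equation as a boundary system\<close>

definition solf :: "complex \<Rightarrow> vfun \<Rightarrow> complex vec \<Rightarrow> vfun" where
  "solf w f c j r = kap j * (c $ j * reg w j r + c $ (q + j) * sg w j r) + V w j (f j) r"
text \<open>The Dirichlet condition for \<open>solf\<close>, solved for its homogeneous part and
  scaled to match the lower rows of \<open>Nm\<close>.\<close>

definition "yv w f k = - (Rm / kap k) * V w k (f k) R"

lemma boundary_iff:
  assumes j: "j < q"
  shows "solf w f c j R = 0 \<longleftrightarrow> Rm * reg w j R * c $ j + Rm * sg w j R * c $ (q + j) = yv w f j"
proof -
  let ?s = "c $ j * reg w j R + c $ (q + j) * sg w j R"
  have "Rm * reg w j R * c $ j + Rm * sg w j R * c $ (q + j) = Rm * ?s" by (simp add: algebra_simps)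
  moreover have "yv w f j = Rm * (- V w j (f j) R / kap j)" by (simp add: yv_def)
  moreover have "k * s + X = 0 \<longleftrightarrow> s = - X / k" if "k \<noteq> 0" for k s X :: complex
    unfolding nonzero_eq_divide_eq[OF that] eq_neg_iff_add_eq_0 by (simp only: mult.commute)
  then have "solf w f c j R = 0 \<longleftrightarrow> ?s = - V w j (f j) R / kap j"
    unfolding solf_def using kap_nz[OF j] by blast
  ultimately show ?thesis by (simp only: mult_left_cancel[OF Rm_nz])
qed

text \<open>The problem becomes finite-dimensional: each component is forced into the form
  \<open>solf\<close> by the scalar results, and only the boundary conditions on the coefficient
  vector remain.\<close>

lemma graph_iff:
  assumes f: "f \<in> L2 q R" and u: "u \<in> L2 q R"
  shows "(u, \<lambda>j r. f j r - w * u j r) \<in> model_graph q0 q1 lm R A B \<longleftrightarrow>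
    (\<exists>c\<in>carrier_vec (q + q). Nm w *\<^sub>v c = Jvec (yv w f) \<and> L2_eq q R u (solf w f c))" (is "?L \<longleftrightarrow> ?R")
proof
  assume ?L
  then obtain \<phi> c where mdc: "max_domain_coeffs q0 q1 lm R \<phi> c" and Bc: "beside q A B *\<^sub>v c = 0\<^sub>v q"
    and u\<phi>: "L2_eq q R u \<phi>" and ex: "model_expr q0 q1 lm R \<phi> (\<lambda>j r. f j r - w * u j r)"
    by (auto simp: model_graph_def)
  from mdc obtain \<psi> d where c: "c \<in> carrier_vec (q + q)" and \<phi>R: "\<forall>j<q. \<phi> j R = 0"
    and \<phi>: "\<forall>j<q. \<forall>r\<in>{0<..R}. \<phi> j r = lead c j r + \<psi> j r" and rem: "\<forall>j<q. volterra.remainder R (\<psi> j) (d j)"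
    unfolding max_domain_coeffs_iff by (elim conjE exE)
  have sol: "\<phi> j r = solf w f c j r" if j: "j < q" and r: "0 < r" "r \<le> R" for j r
  proof -
    have "\<phi> j r = kap j * c $ j * reg w j r + kap j * c $ (q + j) * sg w j r + V w j (f j) r"
    proof (rule volterra.domain_imp_resolvent_form[OF vol[OF j], where \<psi> = "\<psi> j" and d = "d j" and u = "u j"])
      show "sq_int R (f j)" "sq_int R (u j)" using f u j by (auto intro: sq_int_component)
      show "\<phi> j r = kap j * c $ j * of_real (volterra.pp (vv j) r) + kap j * c $ (q + j) * of_real (volterra.mm (vv j) r) + \<psi> j r"
        if "0 < r" "r \<le> R" for r
        using \<phi>[rule_format, OF j, of r] that by (simp add: lead_def distrib_left mult.assoc)
      show "volterra.remainder R (\<psi> j) (d j)" using rem j by blast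
      show "volterra.expr1 (vv j) R (\<phi> j) (\<lambda>r. f j r - w * u j r)" using ex j by (simp add: model_expr_iff)
      show "AE r in NR R. u j r = \<phi> j r" using u\<phi> j by (simp add: L2_eq_def)
    qed (use r in auto)
    then show ?thesis by (simp add: solf_def distrib_left mult.assoc)
  qed
  have "Rm * reg w k R * c $ k + Rm * sg w k R * c $ (q + k) = yv w f k" if k: "k < q" for k
    using boundary_iff[OF k, of w f c] sol[OF k R] \<phi>R k by simp
  then have "Nm w *\<^sub>v c = Jvec (yv w f)" using Nm_mult[OF c] Bc by blast
  moreover have "L2_eq q R u (solf w f c)"
    unfolding L2_eq_def
  proof (intro allI impI)
    fix j assume j: "j < q"
    have "AE r in NR R. u j r = \<phi> j r" using u\<phi> j by (simp add: L2_eq_def)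
    then show "AE r in NR R. u j r = solf w f c j r"
      using AE_lebesgue_on_neq[where c = 0] AE_space by eventually_elim (simp add: sol[OF j])
  qed
  ultimately show ?R using c by blast
next
  assume ?R
  then obtain c where c: "c \<in> carrier_vec (q + q)" and N: "Nm w *\<^sub>v c = Jvec (yv w f)"
    and us: "L2_eq q R u (solf w f c)" by blast
  define \<phi> where "\<phi> = solf w f c"
  have ae: "AE r in NR R. u j r = \<phi> j r" if "j < q" for j using us that by (simp add: L2_eq_def \<phi>_def)
  define P where "P j \<psi> d g \<longleftrightarrow> volterra.remainder R \<psi> d \<and> sq_int R g \<and> volterra.expr1 (vv j) R \<psi> g \<and>
      volterra.expr1 (vv j) R (\<phi> j) (\<lambda>r. f j r - w * u j r) \<and> (\<forall>r\<in>{0<..R}. \<phi> j r = lead c j r + \<psi> r)" for j \<psi> d g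
  have "\<exists>\<psi> d g. P j \<psi> d g" if j: "j < q" for j
  proof -
    have fu: "sq_int R (f j)" "sq_int R (u j)" using f u j by (auto intro: sq_int_component)
    have "\<phi> j r = kap j * c $ j * reg w j r + kap j * c $ (q + j) * sg w j r + V w j (f j) r" for r
      by (simp add: \<phi>_def solf_def distrib_left mult.assoc)
    from volterra.resolvent_form_in_domain[OF vol[OF j] fu(1) this fu(2) ae[OF j]]
    obtain \<psi> d g where *: "volterra.remainder R \<psi> d" "sq_int R g" "volterra.expr1 (vv j) R \<psi> g"
      "volterra.expr1 (vv j) R (\<phi> j) (\<lambda>r. f j r - w * u j r)"
      "\<forall>r. 0 < r \<longrightarrow> r \<le> R \<longrightarrow> \<phi> j r = kap j * c $ j * of_real (volterra.pp (vv j) r) + kap j * c $ (q + j) * of_real (volterra.mm (vv j) r) + \<psi> r"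
      by (elim exE conjE)
    have "\<forall>r\<in>{0<..R}. \<phi> j r = lead c j r + \<psi> r" using *(5) by (simp add: lead_def distrib_left mult.assoc)
    with *(1-4) have "P j \<psi> d g" unfolding P_def by (intro conjI)
    then show ?thesis by (intro exI)
  qed
  then have "\<forall>j. \<exists>\<psi> d g. j < q \<longrightarrow> P j \<psi> d g" by blast
  then obtain \<psi> d g where P: "\<forall>j. j < q \<longrightarrow> P j (\<psi> j) (d j) (g j)" by metis
  have *: "volterra.remainder R (\<psi> j) (d j)" "sq_int R (g j)" "volterra.expr1 (vv j) R (\<psi> j) (g j)"
      "volterra.expr1 (vv j) R (\<phi> j) (\<lambda>r. f j r - w * u j r)" "\<forall>r\<in>{0<..R}. \<phi> j r = lead c j r + \<psi> j r" if "j < q" for j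
    using P that by (simp_all add: P_def)
  have N': "beside q A B *\<^sub>v c = 0\<^sub>v q" "\<forall>k<q. Rm * reg w k R * c $ k + Rm * sg w k R * c $ (q + k) = yv w f k"
    using Nm_mult[OF c] N by blast+
  have 1: "\<forall>j<q. \<phi> j R = 0" using N'(2) boundary_iff by (simp add: \<phi>_def)
  have g: "g \<in> L2 q R" using * by (simp add: L2_iff_sq_int)
  have 2: "(\<forall>j<q. \<forall>r\<in>{0<..R}. \<phi> j r = lead c j r + \<psi> j r) \<and> (\<forall>j<q. volterra.remainder R (\<psi> j) (d j)) \<and>
      (\<exists>g\<in>L2 q R. \<forall>j<q. volterra.expr1 (vv j) R (\<psi> j) (g j))"
    using * by (intro conjI bexI[OF _ g] allI impI) blast+
  have "max_domain_coeffs q0 q1 lm R \<phi> c"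
    unfolding max_domain_coeffs_iff
    by (intro conjI c 1, rule exI[of _ \<psi>], rule exI[of _ d], rule 2)
  moreover have "model_expr q0 q1 lm R \<phi> (\<lambda>j r. f j r - w * u j r)" using * by (simp add: model_expr_iff)
  moreover have "(\<lambda>j r. f j r - w * u j r) \<in> L2 q R"
    using f u by (simp add: L2_iff_sq_int sq_int_diff sq_int_scale)
  ultimately show ?L unfolding model_graph_def using u N'(1) us by (auto simp: \<phi>_def)
qed

text \<open>A kernel vector of \<open>Nm w\<close> gives a solution with right-hand side 0, which a
  linear inverse must represent by a null function. Independence of the two homogeneous solutions
  then makes the vector 0.\<close>

lemma shifted_inverse_imp_det:
  assumes T: "is_shifted_inverse q R (model_graph q0 q1 lm R A B) w T"
  shows "det (Nm w) \<noteq> 0"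
proof
  assume "det (Nm w) = 0"
  then obtain c where c: "c \<in> carrier_vec (q + q)" "c \<noteq> 0\<^sub>v (q + q)" "Nm w *\<^sub>v c = 0\<^sub>v (q + q)"
    using det_0_iff_vec_prod_zero_field[OF Nm_carrier] by blast
  define z where "z = (\<lambda>(j::nat) (r::real). 0::complex)"
  have z: "z \<in> L2 q R" by (simp add: z_def L2_def)
  have V0: "V w j (z j) r = 0" if "j < q" for j r
    by (simp add: volterra.Vw_def[OF vol[OF that]] kop_def z_def)
  have sz: "solf w z c j r = kap j * (c $ j * reg w j r + c $ (q + j) * sg w j r)" if "j < q" for j r
    by (simp add: solf_def V0[OF that])
  have u: "solf w z c \<in> L2 q R"
    unfolding L2_iff_sq_int
  proof (intro allI impI)
    fix j assume j: "j < q"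
    have "sq_int R (\<lambda>r. kap j * (c $ j * reg w j r + c $ (q + j) * sg w j r))"
      by (intro sq_int_scale sq_int_add volterra.regular_facts(1) volterra.singular_facts(1) vol j)
    moreover have "solf w z c j = (\<lambda>r. kap j * (c $ j * reg w j r + c $ (q + j) * sg w j r))" using sz[OF j] by blast
    ultimately show "sq_int R (solf w z c j)" by simp
  qed
  have "Jvec (yv w z) = 0\<^sub>v (q + q)" by (intro eq_vecI) (auto simp: Jvec_def yv_def V0)
  then have "(solf w z c, \<lambda>j r. z j r - w * solf w z c j r) \<in> model_graph q0 q1 lm R A B"
    using c by (subst graph_iff[OF z u]) (auto simp: L2_eq_def)
  then have "L2_eq q R (solf w z c) (T z)" using T z u by (simp add: is_shifted_inverse_def)
  moreover have "L2_eq q R (T (\<lambda>j r. 0 * z j r + 0 * z j r)) (\<lambda>j r. 0 * T z j r + 0 * T z j r)"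
    using T z unfolding is_shifted_inverse_def bounded_op_def by blast
  then have "L2_eq q R (T z) (\<lambda>_ _. 0)" by (simp add: z_def)
  ultimately have ae: "AE r in NR R. c $ j * reg w j r + c $ (q + j) * sg w j r = 0" if j: "j < q" for j
  proof -
    assume "L2_eq q R (solf w z c) (T z)" "L2_eq q R (T z) (\<lambda>_ _. 0)"
    then have "AE r in NR R. solf w z c j r = T z j r" "AE r in NR R. T z j r = 0" using j by (auto simp: L2_eq_def)
    then show ?thesis by eventually_elim (use kap_nz[OF j] in \<open>simp add: sz[OF j]\<close>)
  qed
  have "c $ i = 0" if i: "i < q + q" for i
  proof (cases "i < q")
    case True
    then show ?thesis using volterra.homogeneous_independent(1)[OF vol ae] by blast
  next
    case False
    then have "i - q < q" "q + (i - q) = i" using i by auto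
    then show ?thesis using volterra.homogeneous_independent(2)[OF vol ae] by metis
  qed
  then have "c = 0\<^sub>v (q + q)" using c(1) by (intro eq_vecI) auto
  then show False using c(2) by simp
qed

text \<open>If the solution is null, then so is the differential expression applied to it, by
  \<open>expr1_zero\<close>.\<close>

lemma shifted_inverse_injective:
  assumes T: "is_shifted_inverse q R (model_graph q0 q1 lm R A B) w T"
    and f: "f \<in> L2 q R" and Tf: "L2_eq q R (T f) (\<lambda>_ _. 0)"
  shows "L2_eq q R f (\<lambda>_ _. 0)"
proof -
  define z where "z = (\<lambda>(j::nat) (r::real). 0::complex)"
  have z: "z \<in> L2 q R" by (simp add: z_def L2_def)
  have "L2_eq q R z (T f)" using Tf by (auto simp: L2_eq_def z_def elim!: eventually_mono)
  then have "(z, \<lambda>j r. f j r - w * z j r) \<in> model_graph q0 q1 lm R A B"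
    using T f z by (simp add: is_shifted_inverse_def)
  then obtain \<phi> where "L2_eq q R z \<phi>" "model_expr q0 q1 lm R \<phi> (\<lambda>j r. f j r - w * z j r)"
    by (auto simp: model_graph_def)
  then have "AE r in NR R. f j r = 0" if j: "j < q" for j
  proof -
    assume "L2_eq q R z \<phi>" "model_expr q0 q1 lm R \<phi> (\<lambda>j r. f j r - w * z j r)"
    then have "volterra.expr1 (vv j) R (\<phi> j) (f j)" "AE r in NR R. \<phi> j r = 0"
      using j by (auto simp: L2_eq_def z_def model_expr_iff elim!: eventually_mono)
    then show ?thesis by (rule volterra.expr1_zero[OF vol[OF j]])
  qed
  then show ?thesis by (simp add: L2_eq_def)
qed

text \<open>Jacobi's formula for \<open>Nm\<close>: only the entries of the two lower diagonal
  blocks depend on \<open>w\<close>, and their derivatives are given by \<open>regular_facts\<close>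
  and \<open>singular_facts\<close>.\<close>

definition "detD w = (\<Sum>k<q. - Rm * V w k (reg w k) R * cofactor (Nm w) (q + k) k
   + - Rm * V w k (sg w k) R * cofactor (Nm w) (q + k) (q + k))"

lemma det_Nm_derivative: "((\<lambda>w. det (Nm w)) has_field_derivative detD w) (at w)"
proof -
  define N' where "N' i j = (if i < q then 0 else (if j = i - q then - Rm * V w (i - q) (reg w (i - q)) R else 0)
     + (if j = i then - Rm * V w (i - q) (sg w (i - q)) R else 0))" for i j
  have "((\<lambda>w. det (Nm w)) has_field_derivative (\<Sum>i<q + q. \<Sum>j<q + q. N' i j * cofactor (Nm w) i j)) (at w)"
  proof (rule det_has_derivative[OF Nm_carrier])
    fix i j assume i: "i < q + q" and j: "j < q + q"
    show "((\<lambda>w. Nm w $$ (i, j)) has_field_derivative N' i j) (at w)"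
    proof (cases "i < q")
      case True
      then show ?thesis using j by (simp add: Nm_upper N'_def)
    next
      case False
      define k where "k = i - q"
      have k: "k < q" "i = q + k" using False i by (auto simp: k_def)
      have "((\<lambda>w. Rm * reg w k R) has_field_derivative Rm * - V w k (reg w k) R) (at w)"
        "((\<lambda>w. Rm * sg w k R) has_field_derivative Rm * - V w k (sg w k) R) (at w)"
        by (intro DERIV_cmult volterra.regular_facts(3) volterra.singular_facts(3) vol k)+
      then show ?thesis unfolding k(2) Nm_lower[OF k(1) j] using k(1) by (auto simp: N'_def)
    qed
  qed
  also have "(\<Sum>i<q + q. \<Sum>j<q + q. N' i j * cofactor (Nm w) i j) = detD w"
  proof -
    have "(\<Sum>j<q + q. N' (q + k) j * cofactor (Nm w) (q + k) j) = - Rm * V w k (reg w k) R * cofactor (Nm w) (q + k) k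
        + - Rm * V w k (sg w k) R * cofactor (Nm w) (q + k) (q + k)" if k: "k < q" for k
    proof -
      have "(\<Sum>j<q + q. N' (q + k) j * cofactor (Nm w) (q + k) j)
        = (\<Sum>j<q + q. (if j = k then - Rm * V w k (reg w k) R * cofactor (Nm w) (q + k) k else 0)
           + (if j = q + k then - Rm * V w k (sg w k) R * cofactor (Nm w) (q + k) (q + k) else 0))"
        using k by (intro sum.cong) (auto simp: N'_def)
      then show ?thesis using k by (simp add: sum.distrib)
    qed
    then show ?thesis unfolding sum_lessThan_add[of _ q q] detD_def by (simp add: N'_def)
  qed
  finally show ?thesis .
qed

section \<open>The resolvent where the determinant is nonzero\<close>

context
  fixes w :: complex
  assumes det: "det (Nm w) \<noteq> 0"
begin

text \<open>Cramer's rule for the columns of the inverse matrix that belong to the Dirichlet rows;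
  the other columns meet the zero part of \<open>Jvec\<close>.\<close>

definition "Ninv i k = cofactor (Nm w) (q + k) i / det (Nm w)"
definition "coef f = vec (q + q) (\<lambda>i. \<Sum>k<q. Ninv i k * yv w f k)"

lemma coef_iff:
  assumes c: "c \<in> carrier_vec (q + q)"
  shows "Nm w *\<^sub>v c = Jvec (yv w f) \<longleftrightarrow> c = coef f"
proof -
  let ?N = "Nm w" and ?a = "adj_mat (Nm w)" and ?b = "Jvec (yv w f)"
  note N = Nm_carrier[of w]
  have b: "?b \<in> carrier_vec (q + q)" by (simp add: Jvec_def)
  note a = adj_mat[OF N]
  have coef: "coef f = (1 / det ?N) \<cdot>\<^sub>v (?a *\<^sub>v ?b)"
  proof (intro eq_vecI)
    fix i assume "i < dim_vec ((1 / det ?N) \<cdot>\<^sub>v (?a *\<^sub>v ?b))"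
    then have i: "i < q + q" using a(1) by simp
    have "(?a *\<^sub>v ?b) $ i = (\<Sum>l<q + q. cofactor ?N l i * ?b $ l)"
      using i N a(1) by (simp add: scalar_prod_def adj_mat_def Jvec_def atLeast0LessThan)
    also have "\<dots> = (\<Sum>k<q. cofactor ?N (q + k) i * yv w f k)"
      unfolding sum_lessThan_add by (simp add: Jvec_def)
    finally show "coef f $ i = ((1 / det ?N) \<cdot>\<^sub>v (?a *\<^sub>v ?b)) $ i"
      using i a(1) by (simp add: coef_def Ninv_def sum_distrib_left)
  qed (use a(1) in \<open>simp add: coef_def\<close>)
  have s: "(1 / det ?N) \<cdot>\<^sub>v (det ?N \<cdot>\<^sub>m 1\<^sub>m (q + q) *\<^sub>v x) = x" if x: "x \<in> carrier_vec (q + q)" for x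
  proof (intro eq_vecI)
    fix i assume "i < dim_vec x"
    then have i: "i < q + q" using x by simp
    have "(det ?N \<cdot>\<^sub>m 1\<^sub>m (q + q) *\<^sub>v x) $ i = (\<Sum>j<q + q. det ?N * (if j = i then 1 else 0) * x $ j)"
      using i x by (auto simp: scalar_prod_def atLeast0LessThan intro!: sum.cong)
    also have "\<dots> = (\<Sum>j<q + q. (if j = i then det ?N * x $ j else 0))" by (intro sum.cong) auto
    also have "\<dots> = det ?N * x $ i" using i by simp
    finally show "((1 / det ?N) \<cdot>\<^sub>v (det ?N \<cdot>\<^sub>m 1\<^sub>m (q + q) *\<^sub>v x)) $ i = x $ i"
      using i det by simp
  qed (use x in simp)
  have ab: "?a *\<^sub>v ?b \<in> carrier_vec (q + q)" using a(1) b by (rule mult_mat_vec_carrier)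
  show ?thesis
  proof
    assume "?N *\<^sub>v c = ?b"
    then have "coef f = (1 / det ?N) \<cdot>\<^sub>v ((?a * ?N) *\<^sub>v c)"
      unfolding coef using assoc_mult_mat_vec[OF a(1) N c] by simp
    then show "c = coef f" unfolding a(3) s[OF c] by simp
  next
    assume "c = coef f"
    then have "?N *\<^sub>v c = (1 / det ?N) \<cdot>\<^sub>v ((?N * ?a) *\<^sub>v ?b)"
      unfolding coef using mult_mat_vec[OF N ab, of "1 / det ?N"] assoc_mult_mat_vec[OF N a(1) b] by simp
    then show "?N *\<^sub>v c = ?b" unfolding a(2) s[OF b] .
  qed
qed

lemma resolvent_graph:
  assumes "f \<in> L2 q R" "u \<in> L2 q R"
  shows "(u, \<lambda>j r. f j r - w * u j r) \<in> model_graph q0 q1 lm R A B \<longleftrightarrow> L2_eq q R u (solf w f (coef f))"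
proof -
  have "coef f \<in> carrier_vec (q + q)" by (simp add: coef_def)
  note c = this coef_iff[OF this]
  show ?thesis
    unfolding graph_iff[OF assms]
  proof (intro iffI)
    assume "\<exists>c\<in>carrier_vec (q + q). Nm w *\<^sub>v c = Jvec (yv w f) \<and> L2_eq q R u (solf w f c)"
    then obtain d where "d \<in> carrier_vec (q + q)" "Nm w *\<^sub>v d = Jvec (yv w f)" "L2_eq q R u (solf w f d)"
      by (elim bexE conjE)
    then show "L2_eq q R u (solf w f (coef f))" using coef_iff[of d f] by simp
  next
    assume "L2_eq q R u (solf w f (coef f))"
    then show "\<exists>c\<in>carrier_vec (q + q). Nm w *\<^sub>v c = Jvec (yv w f) \<and> L2_eq q R u (solf w f c)"
      using c by (intro bexI[of _ "coef f"] conjI) simp_all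
  qed
qed

text \<open>The finite-rank part of the resolvent. \<open>bv k\<close> represents the functional
  \<open>f \<mapsto> V w k (f k) R\<close>, and \<open>av k\<close> is the homogeneous solution that
  compensates a unit value of it.\<close>

definition "av k = (\<lambda>j r. - (Rm / kap k) * (kap j * (Ninv j k * reg w j r + Ninv (q + j) k * sg w j r)))"
definition "bv k = emb k (\<lambda>s. cnj (volterra.vw (vv k) R w R s))"

lemma solf_coef:
  assumes j: "j < q"
  shows "solf w f (coef f) j r = (\<Sum>k<q. emb k (V w k (f k)) j r) + (\<Sum>k<q. V w k (f k) R * av k j r)"
proof -
  have "(\<Sum>k<q. emb k (V w k (f k)) j r) = (\<Sum>k<q. if k = j then V w j (f j) r else 0)"
    by (intro sum.cong) (auto simp: emb_def)
  then have 1: "(\<Sum>k<q. emb k (V w k (f k)) j r) = V w j (f j) r" using j by simp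
  have "(\<Sum>k<q. V w k (f k) R * av k j r) = (\<Sum>k<q. kap j * (Ninv j k * yv w f k * reg w j r + Ninv (q + j) k * yv w f k * sg w j r))"
    by (intro sum.cong refl) (simp add: av_def yv_def algebra_simps)
  also have "\<dots> = kap j * ((\<Sum>k<q. Ninv j k * yv w f k) * reg w j r + (\<Sum>k<q. Ninv (q + j) k * yv w f k) * sg w j r)"
    by (simp only: sum_distrib_left[symmetric] sum.distrib sum_distrib_right)
  finally show ?thesis using j 1 by (simp add: solf_def coef_def)
qed

lemma inner_bv: "k < q \<Longrightarrow> L2_inner q R f (bv k) = V w k (f k) R"
  unfolding bv_def by (subst inner_emb_right) (simp_all add: volterra.Vw_def[OF vol] kop_def mult.commute)

text \<open>The Volterra part has trace 0. Each rank-one term contributes the value at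
  \<open>R\<close> of \<open>V w k\<close> applied to component \<open>k\<close> of
  \<open>av k\<close>. Since \<open>- Rm * V w k (reg w k) R\<close> is the derivative of a matrix
  entry, and likewise for \<open>sg\<close>, the sum is the logarithmic derivative of the
  determinant.\<close>

lemma nuclear_resolvent:
  assumes T: "\<And>f. f \<in> L2 q R \<Longrightarrow> T f \<in> L2 q R \<and> L2_eq q R (T f) (solf w f (coef f))"
  shows "L2.nuclear q R T (detD w / det (Nm w))"
proof -
  have av: "av k \<in> L2 q R" for k
    unfolding L2_iff_sq_int av_def
    by (intro allI impI sq_int_scale sq_int_add volterra.regular_facts(1) volterra.singular_facts(1) vol)
  have bv: "bv k \<in> L2 q R" if k: "k < q" for k
    unfolding bv_def by (intro emb_L2 sq_int_cnj hs_kernelD(2)[OF volterra.hs_vw[OF vol[OF k]]])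
  let ?U = "\<lambda>f j r. (\<Sum>k<q. emb k (V w k (f k)) j r) + (\<Sum>k<q. L2_inner q R f (bv k) * av k j r)"
  have "L2.nuclear q R (\<lambda>f j r. \<Sum>k<q. emb k (V w k (f k)) j r) (\<Sum>k<q. 0)"
    by (intro nuclear_sum volterra.nuclear_Vw vol) auto
  moreover have "L2.nuclear q R (\<lambda>f j r. \<Sum>k<q. L2_inner q R f (bv k) * av k j r) (\<Sum>k<q. L2_inner q R (av k) (bv k))"
    by (intro nuclear_sum L2.nuclear_rank_one av bv)
  ultimately have U: "L2.nuclear q R ?U ((\<Sum>k<q. 0) + (\<Sum>k<q. L2_inner q R (av k) (bv k)))"
    by (rule L2.nuclear_add)
  have t: "L2_inner q R (av k) (bv k) = (- Rm * V w k (reg w k) R * cofactor (Nm w) (q + k) k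
      + - Rm * V w k (sg w k) R * cofactor (Nm w) (q + k) (q + k)) / det (Nm w)" if k: "k < q" for k
  proof -
    note b = volterra.Bint_sq_int[OF vol[OF k] volterra.regular_facts(1)[OF vol[OF k], of w]]
      volterra.Bint_sq_int[OF vol[OF k] volterra.singular_facts(1)[OF vol[OF k], of w]]
    have "L2_inner q R (av k) (bv k) = V w k (\<lambda>r. - (Rm / kap k) * (kap k * (Ninv k k * reg w k r + Ninv (q + k) k * sg w k r))) R"
      unfolding inner_bv[OF k] by (simp only: av_def)
    also have "\<dots> = - (Rm / kap k) * (kap k * (Ninv k k * V w k (reg w k) R + Ninv (q + k) k * V w k (sg w k) R))"
      by (simp only: volterra.Vw_scale[OF vol[OF k]] volterra.Vw_add[OF vol[OF k] volterra.Bint_scale[OF vol[OF k] b(1)] volterra.Bint_scale[OF vol[OF k] b(2)]])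
    also have "\<dots> = - Rm * (Ninv k k * V w k (reg w k) R + Ninv (q + k) k * V w k (sg w k) R)"
      using kap_nz[OF k] by simp
    finally show ?thesis using det by (simp add: Ninv_def field_simps)
  qed
  have tr: "(\<Sum>k<q. 0) + (\<Sum>k<q. L2_inner q R (av k) (bv k)) = detD w / det (Nm w)"
    unfolding detD_def sum_divide_distrib using t by simp
  show ?thesis
  proof (rule L2.nuclear_cong[OF U[unfolded tr]])
    fix f z assume f: "f \<in> L2 q R" and z: "z \<in> L2 q R"
    show "T f \<in> L2 q R" using T[OF f] by blast
    have "solf w f (coef f) j r = ?U f j r" if "j < q" for j r
      using solf_coef[OF that] inner_bv by simp
    then have "L2_eq q R (T f) (?U f)" using T[OF f] by (simp add: L2_eq_def)
    then show "L2_inner q R (T f) z = L2_inner q R (?U f) z"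
      using L2_eq_iff_inner[of "T f" q R "?U f"] T[OF f] L2.nuclear_S[OF U f] z by blast
  qed
qed

lemma shifted_inverse_trace:
  assumes T: "is_shifted_inverse q R (model_graph q0 q1 lm R A B) w T"
  shows "trace_class q R T" "op_trace q R T = detD w / det (Nm w)"
proof -
  have "T f \<in> L2 q R \<and> L2_eq q R (T f) (solf w f (coef f))" if f: "f \<in> L2 q R" for f
  proof -
    have Tf: "T f \<in> L2 q R" using T f by (simp add: is_shifted_inverse_def bounded_op_def)
    have "L2_eq q R (T f) (T f)" by (simp add: L2_eq_def)
    then have "(T f, \<lambda>j r. f j r - w * T f j r) \<in> model_graph q0 q1 lm R A B"
      using T f Tf by (simp add: is_shifted_inverse_def)
    then show ?thesis using resolvent_graph[OF f Tf] Tf by blast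
  qed
  from nuclear_trace_class[OF nuclear_resolvent[OF this] shifted_inverse_injective[OF T]]
  show "trace_class q R T" "op_trace q R T = detD w / det (Nm w)" by blast+
qed

text \<open>Boundedness is inherited from nuclearity of the explicit operator.\<close>

lemma shifted_inverse_exists:
  "is_shifted_inverse q R (model_graph q0 q1 lm R A B) w (\<lambda>f. solf w f (coef f))"
proof -
  have S: "solf w f (coef f) \<in> L2 q R" if f: "f \<in> L2 q R" for f
    unfolding L2_iff_sq_int solf_def
    by (intro allI impI sq_int_scale sq_int_add volterra.regular_facts(1) volterra.singular_facts(1)
        volterra.Vw_sq_int volterra.Bint_sq_int vol sq_int_component[OF f])
  have "bounded_op q R (\<lambda>f. solf w f (coef f))"
    by (rule nuclear_bounded_op[OF nuclear_resolvent]) (auto simp: S L2_eq_def)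
  then show ?thesis using resolvent_graph by (simp add: is_shifted_inverse_def)
qed

end

end

text \<open>A holomorphic function without zeros on a disc has a holomorphic logarithm there,
  because discs are contractible; the chain rule for the exponential identifies its
  derivative.\<close>

lemma holomorphic_imp_log_derivative:
  assumes f: "\<And>z. (f has_field_derivative f' z) (at z)" and x: "f x \<noteq> 0"
  shows "has_log_derivative f (f' x / f x) x"
proof -
  have "\<forall>\<^sub>F z in nhds x. f z \<noteq> 0"
    using DERIV_isCont[OF f[of x]] x
    by (intro tendsto_imp_eventually_ne[of f "f x"]) (auto simp: isCont_def tendsto_at_iff_tendsto_nhds)
  then obtain e where e: "0 < e" "\<And>z. dist z x < e \<Longrightarrow> f z \<noteq> 0" unfolding eventually_nhds_metric by blast
  have h: "f holomorphic_on ball x e" using f by (auto simp: holomorphic_on_def field_differentiable_def intro: has_field_derivative_at_within)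
  have nz: "f z \<noteq> 0" if "z \<in> ball x e" for z using e(2)[of z] that by (simp add: dist_commute)
  obtain l where l: "l holomorphic_on ball x e" "\<And>z. z \<in> ball x e \<Longrightarrow> f z = exp (l z)"
    using contractible_imp_holomorphic_log[OF h convex_imp_contractible[OF convex_ball] nz] by blast
  have xb: "x \<in> ball x e" using e(1) by simp
  have dl: "(l has_field_derivative deriv l x) (at x)" by (rule holomorphic_derivI[OF l(1) open_ball xb])
  have "((\<lambda>z. exp (l z)) has_field_derivative exp (l x) * deriv l x) (at x)" using dl by (rule DERIV_fun_exp)
  then have "(f has_field_derivative exp (l x) * deriv l x) (at x)"
    by (rule has_field_derivative_transform_within_open[OF _ open_ball xb]) (simp add: l(2))
  then have "exp (l x) * deriv l x = f' x" by (rule DERIV_unique) (rule f)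
  then have "deriv l x = f' x / f x" using l(2)[OF xb] x by (simp add: field_simps)
  then show ?thesis unfolding has_log_derivative_def
    using l xb dl by (intro exI[of _ "ball x e"] exI[of _ l]) auto
qed

theorem theorem6p1:
  fixes q0 q1 q :: nat and lam :: "nat \<Rightarrow> real" and R :: real
    and A B :: "complex mat" and x :: complex
  assumes "q = q0 + q1"
    and "\<And>i j. q0 \<le> i \<Longrightarrow> i \<le> j \<Longrightarrow> j < q \<Longrightarrow> lam i \<le> lam j"
    and "\<And>j. q0 \<le> j \<Longrightarrow> j < q \<Longrightarrow> - 1/4 < lam j \<and> lam j < 3/4"
    and "R > 0"
    and "A \<in> carrier_mat q q" and "B \<in> carrier_mat q q"
    and "vec_space.rank q (beside q A B) = q"
    and "mat_adjoint (negate_first_cols q0 A * mat_adjoint B) = negate_first_cols q0 A * mat_adjoint B"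
  shows "((\<exists>T. is_shifted_inverse q R (model_graph q0 q1 lam R A B) (x\<^sup>2) T \<and> trace_class q R T) \<longleftrightarrow>
            (\<exists>D. has_log_derivative (\<lambda>z. F_det q0 q1 lam R A B (\<i> * z)) D x)) \<and>
         (\<forall>T. is_shifted_inverse q R (model_graph q0 q1 lam R A B) (x\<^sup>2) T \<and> trace_class q R T \<longrightarrow>
            has_log_derivative (\<lambda>z. F_det q0 q1 lam R A B (\<i> * z)) (2 * x * op_trace q R T) x)"
proof -
  interpret M: model q0 q1 lam R A B
    using assms by unfold_locales auto
  let ?G = "model_graph q0 q1 lam R A B"
  have F: "(\<lambda>z. F_det q0 q1 lam R A B (\<i> * z)) = (\<lambda>z. det (M.Nm (z\<^sup>2)))" by (simp add: M.F_det_eq)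
  \<comment> \<open>The chain rule for \<open>w = z^2\<close> is the source of the factor
    \<open>2 * x\<close>.\<close>
  have der: "((\<lambda>z. det (M.Nm (z\<^sup>2))) has_field_derivative M.detD (z\<^sup>2) * (2 * z)) (at z)" for z
    by (rule DERIV_chain2[OF M.det_Nm_derivative]) (auto intro!: derivative_eq_intros)
  have log: "has_log_derivative (\<lambda>z. det (M.Nm (z\<^sup>2))) (2 * x * op_trace q R T) x"
    if "is_shifted_inverse q R ?G (x\<^sup>2) T" for T
  proof -
    have T: "is_shifted_inverse (q0 + q1) R ?G (x\<^sup>2) T" using that assms(1) by simp
    have d: "det (M.Nm (x\<^sup>2)) \<noteq> 0" by (rule M.shifted_inverse_imp_det[OF T])
    have "M.detD (x\<^sup>2) * (2 * x) / det (M.Nm (x\<^sup>2)) = 2 * x * op_trace q R T"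
      using M.shifted_inverse_trace(2)[OF d T] assms(1) by simp
    with holomorphic_imp_log_derivative[of "\<lambda>z. det (M.Nm (z\<^sup>2))", OF der d] show ?thesis by simp
  qed
  have ex: "\<exists>T. is_shifted_inverse q R ?G (x\<^sup>2) T \<and> trace_class q R T"
    if hl: "has_log_derivative (\<lambda>z. det (M.Nm (z\<^sup>2))) D x" for D
  proof -
    \<comment> \<open>A local logarithm exhibits the determinant at \<open>x\<close> as a value of
      the exponential function.\<close>
    have d: "det (M.Nm (x\<^sup>2)) \<noteq> 0"
    proof -
      obtain U l where "x \<in> U" "\<forall>z\<in>U. exp (l z) = det (M.Nm (z\<^sup>2))"
        using hl unfolding has_log_derivative_def by (elim exE conjE)
      then have "exp (l x) = det (M.Nm (x\<^sup>2))" by blast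
      then show ?thesis using exp_not_eq_zero[of "l x"] by simp
    qed
    note T = M.shifted_inverse_exists[OF d]
    show ?thesis unfolding assms(1)
      by (rule exI, rule conjI, rule T, rule M.shifted_inverse_trace(1)[OF d T])
  qed
  show ?thesis
    unfolding F
  proof (intro conjI iffI allI impI)
    assume "\<exists>T. is_shifted_inverse q R ?G (x\<^sup>2) T \<and> trace_class q R T"
    then obtain T where "is_shifted_inverse q R ?G (x\<^sup>2) T" by (elim exE conjE)
    then show "\<exists>D. has_log_derivative (\<lambda>z. det (M.Nm (z\<^sup>2))) D x" by (intro exI) (rule log)
  next
    assume "\<exists>D. has_log_derivative (\<lambda>z. det (M.Nm (z\<^sup>2))) D x"
    then show "\<exists>T. is_shifted_inverse q R ?G (x\<^sup>2) T \<and> trace_class q R T" by (elim exE) (rule ex)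
  next
    fix T assume "is_shifted_inverse q R ?G (x\<^sup>2) T \<and> trace_class q R T"
    then show "has_log_derivative (\<lambda>z. det (M.Nm (z\<^sup>2))) (2 * x * op_trace q R T) x" by (elim conjE) (rule log)
  qed
qed

end
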